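(* Let $\nu$ be a finite diffuse measure on $\Gamma=\mathbb{R}$ with positive density function $\nu(x)$ with respect to Lebesgue measure, let $\mathbb{P}_\nu$ be the pure jump Lévy process on $I=[0,1]$ with Lévy measure $\nu$, and let $(\mathbb{P}_\nu^{x,y})_{x,y\in\Gamma}$ be the family of its bridges between time $0$ and time $1$. For a probability $Q$ on $\Omega=\mathbb{D}(I;\Gamma)$ consider the identity $$E_Q[\mathfrak{A}\Phi]=E_Q\bigg[\sum_{\substack{s_1\neq s_2:\ \Delta Z_{s_1}\neq0,\\ \Delta Z_{s_2}\neq0}}\int_I\Phi\big((t,\Delta Z_{s_1}+\Delta Z_{s_2}),(s_1,\Delta Z_{s_1}),(s_2,\Delta Z_{s_2}),Z\big)\,dt\ \chi_\nu(\Delta Z_{s_1},\Delta Z_{s_2})\bigg]\qquad(\dagger)$$ for all non-negative test functionals $\Phi$ on $(I\times\Gamma)^3\times\Omega$. (a) The identity $(\dagger)$ is valid for $Q$ equal to any bridge $\mathbb{P}_\nu^{x,y}$ of $\mathbb{P}_\nu$. (b) Reciprocally, let $Q$ be a pure jump process pinned at times $0$ and $1$ to two values $x\neq y$, that is, $Q(Z_0=x)=Q(Z_1=y)=1$. If $Q$ satisfies $(\dagger)$, then $Q$ coincides with the bridge $\mathbb{P}_\nu^{x,y}$. (c) If the pure jump process $Q$ is pinned at times $0$ and $1$ to the same value $x$ (that is, it carries only loops which start and end in $x$) and satisfies $(\dagger)$, then $$Q(\,\cdot\,|\,\#\{t:\Delta Z_t\neq0\}\ge1)=\mathbb{P}_\nu^{x,x}(\,\cdot\,|\,\#\{t:\Delta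 Z_t\neq0\}\ge1).$$ In other words, $Q$ and the bridge $\mathbb{P}_\nu^{x,x}$ coincide on the set of non-constant paths.
   Context: $\Omega=\mathbb{D}(I;\Gamma)$ is the space of càdlàg paths on $I=[0,1]$ with values in $\Gamma=\mathbb{R}$, $Z$ is the canonical process and $\Delta Z_t=Z_t-Z_{t-}$ its jump at time $t$. Put $\tilde\Gamma=I\times\Gamma$. To a path $Z$ one associates its jump point measure $\mu_Z=\sum_{t:\Delta Z_t\neq0}\delta_{(t,\Delta Z_t)}$ on $\tilde\Gamma$. Since $\nu$ is finite, $\mathbb{P}_\nu$ is a compound Poisson process. A pure jump process is (the law on $\Omega$ of) a process whose paths evolve only by jumps, i.e. $Z_t-Z_0$ is the sum of the jumps up to time $t$. Bridges: $(\mathbb{P}_\nu^{x,y})_{x,y\in\Gamma}$ is a regular version of the family of conditional laws $\mathbb{P}_\nu(\cdot\,|\,Z_0=x,Z_1=y)$. Jump splitting: for an atom $\gamma=(t,\Delta Z_t)$ of $\mu_Z$ and $\gamma_1=(s_1,x_1),\gamma_2=(s_2,x_2)\in\tilde\Gamma$, $$\Theta_{\gamma,\gamma_1,\gamma_2}Z=Z-\Delta Z_t\mathbf{1}_{[t,1]}+x_1\mathbf{1}_{[s_1,1]}+x_2\mathbf{1}_{[s_2,1]}.$$ For non-negative $F$ on $\tilde\Gamma^3\times\Omega$, $$\mathfrak{A}F(Z)=\sum_{t:\Delta Z_t\neq0}\int_{\tilde\Gamma^2}F\big((t,\Delta Z_t),\gamma_1,\gamma_2,\Theta_{(t,\Delta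 Z_t),\gamma_1,\gamma_2}Z\big)\,dx_1\,\delta_{\Delta Z_t-x_1}(dx_2)\,ds_1\,ds_2,$$ with $\gamma_1=(s_1,x_1)$, $\gamma_2=(s_2,x_2)$. $\chi_\nu(x_1,x_2)=\dfrac{\nu(x_1+x_2)}{\nu(x_1)\nu(x_2)}$. The sum in $(\dagger)$ runs over ordered pairs $(s_1,s_2)$ of distinct jump times. *)

theory Defs
  imports "HOL-Probability.Probability"
begin

section \<open>Cadlag paths on the unit interval and their jumps\<close>

definition cadlag :: "(real \<Rightarrow> real) \<Rightarrow> bool" where
  "cadlag \<omega> \<longleftrightarrow>
     (\<forall>t\<in>{0..<1}. (\<omega> \<longlongrightarrow> \<omega> t) (at_right t)) \<and>
     (\<forall>t\<in>{0<..1}. \<exists>l. (\<omega> \<longlongrightarrow> l) (at_left t))"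

text \<open>
  A path is a function that is extensional on [0,1] (value \<open>undefined\<close> outside). The
  sigma-algebra is the one generated by the canonical process, which is also the Borel
  sigma-algebra of the Skorokhod topology.
\<close>

definition path_space :: "(real \<Rightarrow> real) measure" where
  "path_space = restrict_space (\<Pi>\<^sub>M t\<in>{0..1::real}. (borel :: real measure)) {\<omega>. cadlag \<omega>}"

text \<open>There is no jump at time 0: the convention is that the left limit at 0 is the initial value.\<close>

definition jump :: "(real \<Rightarrow> real) \<Rightarrow> real \<Rightarrow> real" where
  "jump \<omega> t = (if 0 < t \<and> t \<le> 1 then \<omega> t - Lim (at_left t) \<omega> else 0)"

definition jump_times :: "(real \<Rightarrow> real) \<Rightarrow> real set" where
  "jump_times \<omega> = {t\<in>{0..1}. jump \<omega> t \<noteq> 0}"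

text \<open>
  The number of jumps may be infinite; \<open>has_sum\<close> is unordered summation, so the jumps
  of almost every path are absolutely summable.
\<close>

definition pure_jump :: "(real \<Rightarrow> real) measure \<Rightarrow> bool" where
  "pure_jump Q \<longleftrightarrow>
     (AE \<omega> in Q. \<forall>t\<in>{0..1}. (jump \<omega> has_sum (\<omega> t - \<omega> 0)) {s\<in>jump_times \<omega>. s \<le> t})"

section \<open>Levy processes with finite Levy measure and their bridges\<close>

text \<open>
  \<open>levy_law \<nu> P\<close>: under \<open>P\<close> the canonical process has independent stationary increments
  (also independent of the initial value) with Levy-Khintchine exponent
  \<open>\<integral> (exp (i u x) - 1) \<nu>(dx)\<close>, that is, no drift and no Gaussian part; for finite \<open>\<nu>\<close> no
  compensation of small jumps is needed. The law of the initial value is arbitrary.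
\<close>

definition levy_law :: "real measure \<Rightarrow> (real \<Rightarrow> real) measure \<Rightarrow> bool" where
  "levy_law \<nu> P \<longleftrightarrow>
     P \<in> space (prob_algebra path_space) \<and>
     (\<forall>s t. 0 \<le> s \<and> s \<le> t \<and> t \<le> 1 \<longrightarrow>
        prob_space.indep_set P
          (sets (vimage_algebra (space P) (\<lambda>\<omega>. restrict \<omega> {0..s}) (\<Pi>\<^sub>M r\<in>{0..s}. (borel :: real measure))))
          (sets (vimage_algebra (space P) (\<lambda>\<omega>. \<omega> t - \<omega> s) borel)) \<and>
        (\<forall>u. char (distr P borel (\<lambda>\<omega>. \<omega> t - \<omega> s)) u
             = exp (of_real (t - s) * (CLINT x|\<nu>. iexp (u * x) - 1))))"

text \<open>
  \<open>bridge_family \<nu> \<kappa>\<close>: the probability kernel \<open>\<kappa>\<close> is a regular version of the conditional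
  laws given the two endpoints. Since the increments do not depend on the initial value,
  one kernel serves all initial laws; asking this for every initial law is what
  determines \<open>\<kappa> (x, y)\<close> for every \<open>x\<close> and almost every \<open>y\<close>.
\<close>

definition bridge_family :: "real measure \<Rightarrow> (real \<times> real \<Rightarrow> (real \<Rightarrow> real) measure) \<Rightarrow> bool" where
  "bridge_family \<nu> \<kappa> \<longleftrightarrow>
     \<kappa> \<in> borel \<Otimes>\<^sub>M borel \<rightarrow>\<^sub>M prob_algebra path_space \<and>
     (\<forall>P. levy_law \<nu> P \<longrightarrow>
        (\<forall>A\<in>sets path_space. \<forall>B\<in>sets (borel \<Otimes>\<^sub>M borel).
           emeasure P {\<omega>\<in>A. (\<omega> 0, \<omega> 1) \<in> B}
           = (\<integral>\<^sup>+p\<in>B. emeasure (\<kappa> p) A \<partial>distr P (borel \<Otimes>\<^sub>M borel) (\<lambda>\<omega>. (\<omega> 0, \<omega> 1)))))"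

section \<open>Jump splitting\<close>

type_synonym mark = "real \<times> real"

definition mark_space :: "mark measure" where
  "mark_space = restrict_space borel {0..1} \<Otimes>\<^sub>M borel"

definition unit_lebesgue :: "real measure" where
  "unit_lebesgue = restrict_space lborel {0..1}"

definition split_path :: "mark \<Rightarrow> mark \<Rightarrow> mark \<Rightarrow> (real \<Rightarrow> real) \<Rightarrow> real \<Rightarrow> real" where
  "split_path \<gamma> \<gamma>1 \<gamma>2 \<omega> =
     (\<lambda>u\<in>{0..1}. \<omega> u - snd \<gamma> * indicator {fst \<gamma>..1} u
                     + snd \<gamma>1 * indicator {fst \<gamma>1..1} u
                     + snd \<gamma>2 * indicator {fst \<gamma>2..1} u)"

definition split_op ::
  "(mark \<times> mark \<times> mark \<times> (real \<Rightarrow> real) \<Rightarrow> ennreal) \<Rightarrow> (real \<Rightarrow> real) \<Rightarrow> ennreal" where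
  "split_op F \<omega> =
     (\<integral>\<^sup>+t.
        (\<integral>\<^sup>+x1. (\<integral>\<^sup>+x2. (\<integral>\<^sup>+s1. (\<integral>\<^sup>+s2.
             F ((t, jump \<omega> t), (s1, x1), (s2, x2),
                split_path (t, jump \<omega> t) (s1, x1) (s2, x2) \<omega>)
           \<partial>unit_lebesgue) \<partial>unit_lebesgue) \<partial>return borel (jump \<omega> t - x1)) \<partial>lborel)
      \<partial>count_space (jump_times \<omega>))"

definition chi :: "(real \<Rightarrow> real) \<Rightarrow> real \<Rightarrow> real \<Rightarrow> real" where
  "chi f x1 x2 = f (x1 + x2) / (f x1 * f x2)"

definition splitting_identity :: "(real \<Rightarrow> real) \<Rightarrow> (real \<Rightarrow> real) measure \<Rightarrow> bool" where
  "splitting_identity f Q \<longleftrightarrow>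
     (\<forall>\<Phi> \<in> borel_measurable (mark_space \<Otimes>\<^sub>M mark_space \<Otimes>\<^sub>M mark_space \<Otimes>\<^sub>M path_space).
        (\<integral>\<^sup>+\<omega>. split_op \<Phi> \<omega> \<partial>Q)
        = (\<integral>\<^sup>+\<omega>. (\<integral>\<^sup>+(s1, s2).
              (\<integral>\<^sup>+t. \<Phi> ((t, jump \<omega> s1 + jump \<omega> s2), (s1, jump \<omega> s1), (s2, jump \<omega> s2), \<omega>)
                \<partial>unit_lebesgue)
              * ennreal (chi f (jump \<omega> s1) (jump \<omega> s2))
            \<partial>count_space {(s1, s2). s1 \<in> jump_times \<omega> \<and> s2 \<in> jump_times \<omega> \<and> s1 \<noteq> s2}) \<partial>Q))"

section \<open>Pinned pure jump processes\<close>

definition pinned_pure_jump :: "(real \<Rightarrow> real) measure \<Rightarrow> real \<Rightarrow> real \<Rightarrow> bool" where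
  "pinned_pure_jump Q x y \<longleftrightarrow>
     Q \<in> space (prob_algebra path_space) \<and> pure_jump Q \<and>
     \<P>(\<omega> in Q. \<omega> 0 = x) = 1 \<and> \<P>(\<omega> in Q. \<omega> 1 = y) = 1"

definition jumping_paths :: "(real \<Rightarrow> real) set" where
  "jumping_paths = {\<omega>\<in>space path_space. jump_times \<omega> \<noteq> {}}"

end

(*
  A path with finitely many jumps is a constant path into which marks (time, size) have been inserted.
  The bridge from x to y is the normalised sum over n of 1/n! times the integral over n marks with
  uniform times and sizes weighted by f, pinned to total size y - x. By Campbell's formula, splitting
  one of n marks and merging two of n + 1 marks give the same integral up to these factorials, so the
  n-jump part of the left side of the identity equals the (n+1)-jump part of the right side.

  Conversely, a law satisfying the identity is determined on n + 1 jumps by its restriction to n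
  jumps, and testing with a functional of the time of the split mark shows that a single jump occurs at
  a uniform time; a loop never has exactly one jump, so its recursion starts from zero. Infinitely many
  jumps are excluded as follows. For a suitable compact set U of sizes away from zero, almost surely only finitely
  many pairs of jump sizes a, b have both b and a + b in U. If there were infinitely many jumps, their
  sizes x_i would tend to zero, and the sizes u in U with u + x_i in U for infinitely many i would have
  positive measure; splitting off a jump of such a size u contradicts the finiteness.

  The Levy process is identified with the compound Poisson law by the characteristic functions of its
  finite-dimensional distributions, which exhibits its conditional laws as the bridges above.
*)
theory Submission
  imports Defs
begin

section \<open>Cadlag paths and insertion of jumps\<close>

text \<open>Pinning the endpoint conditions on a null event, so the bridge is built through a
  density: one mark size stays unintegrated and is forced to be the remainder of
  \<open>y - x\<close>. The price is a normalising mass that is finite only for almost every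
  endpoint. At the exceptional endpoints with \<open>x \<noteq> y\<close> no pinned pure jump law
  satisfies the identity, since total mass one would force the normalising mass to be finite; a
  constant path can therefore stand in there. For \<open>x = y\<close> the constant path is the true
  conditional law: jumpless paths have positive probability, whereas jumps whose sizes have a
  density sum to zero with probability zero. Hence both sides of (c) vanish on jumping paths.

  Two obstacles shape the rest. The sigma-algebra knows only evaluations at fixed times, so jumps at
  random times must first be enumerated measurably. And \<open>f\<close> is merely positive and
  measurable, so it is bounded above and away from zero only on suitable sets of sizes; weighting
  the test functional by the density of the first part is what keeps the split side finite.\<close>

lemma cadlag_right: "cadlag \<omega> \<Longrightarrow> 0 \<le> t \<Longrightarrow> t < 1 \<Longrightarrow> (\<omega> \<longlongrightarrow> \<omega> t) (at_right t)"
  by (auto simp: cadlag_def)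

lemma cadlag_left:
  assumes "cadlag \<omega>" "0 < t" "t \<le> 1"
  shows "(\<omega> \<longlongrightarrow> \<omega> t - jump \<omega> t) (at_left t)"
proof -
  have "\<exists>l. (\<omega> \<longlongrightarrow> l) (at_left t)"
    using assms unfolding cadlag_def by simp
  then obtain l where l: "(\<omega> \<longlongrightarrow> l) (at_left t)" by blast
  have "Lim (at_left t) \<omega> = l"
    using l by (intro tendsto_Lim) auto
  then show ?thesis using l assms by (simp add: jump_def)
qed

lemma jumpI:
  assumes "0 < t" "t \<le> 1" "(\<omega> \<longlongrightarrow> l) (at_left t)"
  shows "jump \<omega> t = \<omega> t - l"
  using assms tendsto_Lim[OF _ assms(3)] by (simp add: jump_def)

lemma jump_outside: "\<not> (0 < t \<and> t \<le> 1) \<Longrightarrow> jump \<omega> t = 0"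
  by (auto simp: jump_def)

lemma jump_times_iff: "t \<in> jump_times \<omega> \<longleftrightarrow> jump \<omega> t \<noteq> 0"
  by (auto simp: jump_times_def jump_def)

lemma jump_times_subset: "jump_times \<omega> \<subseteq> {0<..1}"
  by (auto simp: jump_times_def jump_def split: if_splits)

lemma space_path_space: "space path_space = {\<omega> \<in> extensional {0..1}. cadlag \<omega>}"
  by (auto simp: path_space_def space_restrict_space space_PiM PiE_def)

text \<open>On either side of \<open>t\<close> the path stays close to a single number, its
  one-sided limit there, so value and left limit at a nearby time are both close to that number. The
  jump at \<open>t\<close> itself is not constrained.\<close>

lemma cadlag_small_jumps_near:
  assumes "cadlag \<omega>" "0 \<le> t" "t \<le> 1" "0 < e"
  shows "\<forall>\<^sub>F s in at t. \<bar>jump \<omega> s\<bar> < e"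
proof -
  \<comment> \<open>The value at \<open>s\<close> and its left limit each lie within e/3 of
    \<open>l\<close>; the remaining third keeps the bound strict after passing to the limit.\<close>
  have close: "\<bar>jump \<omega> s\<bar> < e"
    if "s \<in> {a<..<b}" "s \<le> 1" "0 \<le> a" and ab: "\<forall>r\<in>{a<..<b}. r \<le> 1 \<longrightarrow> \<bar>\<omega> r - l\<bar> < e/3" for s a b l
  proof -
    have s: "0 < s" using that by auto
    have "\<forall>\<^sub>F r in at_left s. r \<in> {a<..<s}"
      using that by (intro eventually_at_leftI[of a]) auto
    then have ev: "\<forall>\<^sub>F r in at_left s. \<bar>\<omega> r - l\<bar> \<le> e/3"
      by (rule eventually_mono) (use ab that(1,2) in \<open>auto intro: less_imp_le\<close>)
    have "\<bar>(\<omega> s - jump \<omega> s) - l\<bar> \<le> e/3"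
      by (rule tendsto_upperbound[OF _ ev])
         (auto intro!: tendsto_intros cadlag_left assms s that)
    moreover have "\<bar>\<omega> s - l\<bar> < e/3" using ab that by auto
    ultimately show ?thesis using \<open>0 < e\<close> by linarith
  qed
  have "\<forall>\<^sub>F s in at_right t. \<bar>jump \<omega> s\<bar> < e"
  proof (cases "t < 1")
    case True
    then have "\<forall>\<^sub>F r in at_right t. \<bar>\<omega> r - \<omega> t\<bar> < e/3"
      using tendstoD[OF cadlag_right[OF assms(1,2) True], of "e/3"] \<open>0<e\<close> by (auto simp: dist_real_def)
    then obtain b where b: "b > t" "\<forall>r>t. r < b \<longrightarrow> \<bar>\<omega> r - \<omega> t\<bar> < e/3"
      by (auto simp: eventually_at_right_field)
    show ?thesis
      unfolding eventually_at_right_field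
    proof (intro exI[of _ "min b 1"] conjI allI impI)
      fix s assume "t < s" "s < min b 1"
      then show "\<bar>jump \<omega> s\<bar> < e"
        by (intro close[where a=t and b=b]) (use b assms in auto)
    qed (use b True in auto)
  next
    case False
    then show ?thesis using assms
      by (auto simp: eventually_at_right_field jump_outside intro!: exI[of _ 2])
  qed
  moreover have "\<forall>\<^sub>F s in at_left t. \<bar>jump \<omega> s\<bar> < e"
  proof (cases "0 < t")
    case True
    define l where "l = \<omega> t - jump \<omega> t"
    have "\<forall>\<^sub>F r in at_left t. \<bar>\<omega> r - l\<bar> < e/3"
      using tendstoD[OF cadlag_left[OF assms(1) True assms(3)], of "e/3"] \<open>0<e\<close>
      by (auto simp: dist_real_def l_def)
    then obtain b where b: "b < t" "\<forall>r>b. r < t \<longrightarrow> \<bar>\<omega> r - l\<bar> < e/3"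
      by (auto simp: eventually_at_left_field)
    show ?thesis
      unfolding eventually_at_left_field
    proof (intro exI[of _ "max b 0"] conjI allI impI)
      fix s assume "max b 0 < s" "s < t"
      then show "\<bar>jump \<omega> s\<bar> < e"
        by (intro close[where a="max b 0" and b=t]) (use b assms in auto)
    qed (use b True in auto)
  next
    case False
    then show ?thesis using assms
      by (auto simp: eventually_at_left_field jump_outside intro!: exI[of _ "-1"])
  qed
  ultimately show ?thesis by (simp add: eventually_at_split)
qed

text \<open>Infinitely many such times would accumulate in the unit interval by Bolzano-Weierstrass,
  but near any point all other jumps are small.\<close>

lemma finite_big_jumps:
  assumes "cadlag \<omega>" "0 < e"
  shows "finite {t. e \<le> \<bar>jump \<omega> t\<bar>}" (is "finite ?A")
proof (rule ccontr)
  assume inf: "infinite ?A"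
  have "?A \<subseteq> {0..1}" using assms by (auto simp: jump_def split: if_splits)
  then obtain t where t: "t \<in> {0..1}" "t islimpt ?A"
    using Heine_Borel_imp_Bolzano_Weierstrass[OF compact_Icc inf] by blast
  have "\<forall>\<^sub>F s in at t. s \<notin> ?A"
    using cadlag_small_jumps_near[OF assms(1) _ _ assms(2), of t] t
    by (auto elim!: eventually_mono)
  then show False using t by (simp add: islimpt_iff_eventually)
qed

lemma countable_jump_times:
  assumes "cadlag \<omega>" shows "countable (jump_times \<omega>)"
proof -
  have "jump_times \<omega> \<subseteq> (\<Union>n. {t. 1 / real (Suc n) \<le> \<bar>jump \<omega> t\<bar>})"
  proof
    fix t assume "t \<in> jump_times \<omega>"
    then have "0 < \<bar>jump \<omega> t\<bar>" by (simp add: jump_times_iff)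
    then obtain n where "1 / real (Suc n) < \<bar>jump \<omega> t\<bar>"
      using nat_approx_posE by blast
    then show "t \<in> (\<Union>n. {t. 1 / real (Suc n) \<le> \<bar>jump \<omega> t\<bar>})" by (auto intro!: exI[of _ n])
  qed
  then show ?thesis
    by (rule countable_subset) (intro countable_UN countableI_type countable_finite finite_big_jumps assms, simp)
qed

text \<open>A mark at time 0 is ignored, so that inserting a mark never changes the initial value.\<close>

definition insert_jump :: "mark \<Rightarrow> (real \<Rightarrow> real) \<Rightarrow> real \<Rightarrow> real" where
  "insert_jump \<gamma> \<omega> = (\<lambda>u\<in>{0..1}. \<omega> u + snd \<gamma> * indicator {t. 0 < t \<and> t \<le> u} (fst \<gamma>))"

lemma insert_jump_commute: "insert_jump \<gamma> (insert_jump \<gamma>' \<omega>) = insert_jump \<gamma>' (insert_jump \<gamma> \<omega>)"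
  by (auto simp: insert_jump_def fun_eq_iff restrict_def)

text \<open>Treats left and right limits at once: along \<open>F\<close> the indicator is eventually
  the constant \<open>c\<close>, so the insertion only shifts the limit.\<close>

lemma insert_jump_tendsto:
  assumes t: "0 \<le> t" "t \<le> 1" and F: "F = at_left t \<and> 0 < t \<or> F = at_right t \<and> t < 1"
    and ind: "\<forall>\<^sub>F u in F. indicator {t. 0 < t \<and> t \<le> u} (fst \<gamma>) = (c::real)" and l: "(\<omega> \<longlongrightarrow> l) F"
  shows "(insert_jump \<gamma> \<omega> \<longlongrightarrow> l + snd \<gamma> * c) F"
proof -
  have "\<forall>\<^sub>F u in F. u \<in> {0..1}"
    using F t by (auto intro!: eventually_at_leftI[of 0] eventually_at_rightI[of _ 1])
  with ind have "\<forall>\<^sub>F u in F. \<omega> u + snd \<gamma> * c = insert_jump \<gamma> \<omega> u"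
    by eventually_elim (auto simp: insert_jump_def)
  then show ?thesis
    by (rule Lim_transform_eventually[rotated]) (intro tendsto_intros l)
qed

lemma ind_at_right: "\<forall>\<^sub>F u in at_right t. indicator {t. 0 < t \<and> t \<le> u} s = (indicator {t. 0 < t \<and> t \<le> t'} s::real)"
  if "t' = t" for s t :: real
proof (cases "s \<le> t")
  case True
  then show ?thesis using that
    by (auto intro!: eventually_at_rightI[of _ "t+1"] simp: indicator_def)
next
  case False
  then show ?thesis using that
    by (auto intro!: eventually_at_rightI[of _ s] simp: indicator_def)
qed

lemma ind_at_left: "\<forall>\<^sub>F u in at_left t. indicator {t. 0 < t \<and> t \<le> u} s = (indicator {r. 0 < r \<and> r < t} s::real)"
  for s t :: real
proof (cases "s < t")
  case True
  then show ?thesis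
    by (auto intro!: eventually_at_leftI[of s] simp: indicator_def)
next
  case False
  then show ?thesis
    by (auto intro!: eventually_at_leftI[of "t-1"] simp: indicator_def)
qed

lemma insert_jump_apply: "u \<in> {0..1} \<Longrightarrow> insert_jump \<gamma> \<omega> u = \<omega> u + snd \<gamma> * indicator {t. 0 < t \<and> t \<le> u} (fst \<gamma>)"
  by (simp add: insert_jump_def)

lemma insert_jump_0 [simp]: "insert_jump \<gamma> \<omega> 0 = \<omega> 0"
  by (simp add: insert_jump_def)

lemma insert_jump_1: "0 < fst \<gamma> \<Longrightarrow> fst \<gamma> \<le> 1 \<Longrightarrow> insert_jump \<gamma> \<omega> 1 = \<omega> 1 + snd \<gamma>"
  by (simp add: insert_jump_def)

lemma cadlag_insert_jump:
  assumes "cadlag \<omega>" shows "cadlag (insert_jump \<gamma> \<omega>)"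
  unfolding cadlag_def
proof (intro conjI ballI)
  fix t :: real assume t: "t \<in> {0..<1}"
  show "(insert_jump \<gamma> \<omega> \<longlongrightarrow> insert_jump \<gamma> \<omega> t) (at_right t)"
    using insert_jump_tendsto[where t=t and \<gamma>=\<gamma>, OF _ _ _ ind_at_right[where t=t and t'=t and s="fst \<gamma>", OF refl] cadlag_right[OF assms]] t
    by (simp add: insert_jump_apply)
next
  fix t :: real assume t: "t \<in> {0<..1}"
  show "\<exists>l. (insert_jump \<gamma> \<omega> \<longlongrightarrow> l) (at_left t)"
    using insert_jump_tendsto[where t=t and \<gamma>=\<gamma>, OF _ _ _ ind_at_left[where t=t and s="fst \<gamma>"] cadlag_left[OF assms]] t by auto
qed

lemma jump_insert_jump:
  assumes "cadlag \<omega>"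
  shows "jump (insert_jump \<gamma> \<omega>) t = jump \<omega> t + (if t = fst \<gamma> \<and> 0 < t \<and> t \<le> 1 then snd \<gamma> else 0)"
proof (cases "0 < t \<and> t \<le> 1")
  case True
  have "jump (insert_jump \<gamma> \<omega>) t = insert_jump \<gamma> \<omega> t - (\<omega> t - jump \<omega> t + snd \<gamma> * indicator {r. 0 < r \<and> r < t} (fst \<gamma>))"
    using True by (intro jumpI insert_jump_tendsto[where t=t] ind_at_left cadlag_left assms) auto
  then show ?thesis using True
    by (auto simp: insert_jump_apply indicator_def)
qed (auto simp: jump_outside)

lemma insert_jump_in_space [simp]:
  "\<omega> \<in> space path_space \<Longrightarrow> insert_jump \<gamma> \<omega> \<in> space path_space"
  by (auto simp: space_path_space cadlag_insert_jump) (simp add: insert_jump_def)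

lemma jump_times_insert_jump:
  assumes "cadlag \<omega>" "0 < fst \<gamma>" "fst \<gamma> \<le> 1" "fst \<gamma> \<notin> jump_times \<omega>" "snd \<gamma> \<noteq> 0"
  shows "jump_times (insert_jump \<gamma> \<omega>) = insert (fst \<gamma>) (jump_times \<omega>)"
  using assms by (auto simp: jump_times_iff jump_insert_jump split: if_splits)

definition const_path :: "real \<Rightarrow> real \<Rightarrow> real" where
  "const_path x = (\<lambda>u\<in>{0..1}. x)"

lemma const_path_tendsto:
  assumes "F = at_left t \<and> 0 < t \<and> t \<le> 1 \<or> F = at_right t \<and> 0 \<le> t \<and> t < 1"
  shows "(const_path x \<longlongrightarrow> x) F"
proof -
  have "\<forall>\<^sub>F u in F. u \<in> {0..1}"
    using assms by (auto intro!: eventually_at_leftI[of 0] eventually_at_rightI[of _ 1])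
  then have "\<forall>\<^sub>F u in F. x = const_path x u"
    by eventually_elim (auto simp: const_path_def)
  then show ?thesis
    by (rule Lim_transform_eventually[rotated]) (intro tendsto_intros)
qed

lemma const_path_apply [simp]: "0 \<le> u \<Longrightarrow> u \<le> 1 \<Longrightarrow> const_path x u = x"
  by (simp add: const_path_def)

lemma cadlag_const_path: "cadlag (const_path x)"
  unfolding cadlag_def
proof (intro conjI ballI)
  fix t :: real assume t: "t \<in> {0..<1}"
  then show "(const_path x \<longlongrightarrow> const_path x t) (at_right t)"
    using const_path_tendsto[of "at_right t" t x] by simp
next
  fix t :: real assume t: "t \<in> {0<..1}"
  then show "\<exists>l. (const_path x \<longlongrightarrow> l) (at_left t)"
    using const_path_tendsto[of "at_left t" t x] by auto
qed

lemma const_path_in_space [simp]: "const_path x \<in> space path_space"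
  by (auto simp: space_path_space cadlag_const_path) (simp add: const_path_def)

lemma jump_const_path [simp]: "jump (const_path x) t = 0"
proof (cases "0 < t \<and> t \<le> 1")
  case True
  then have "jump (const_path x) t = const_path x t - x"
    by (intro jumpI const_path_tendsto) auto
  with True show ?thesis by simp
qed (simp add: jump_outside)

lemma jump_times_const_path [simp]: "jump_times (const_path x) = {}"
  by (auto simp: jump_times_iff)

section \<open>Measurability of functionals of the jumps\<close>

lemma measurable_path_eval:
  assumes "f \<in> M \<rightarrow>\<^sub>M path_space" "u \<in> {0..1}"
  shows "(\<lambda>x. f x u) \<in> borel_measurable M"
proof -
  have "(\<lambda>\<omega>. \<omega> u) \<in> borel_measurable path_space"
    unfolding path_space_def
    by (intro measurable_restrict_space1 measurable_component_singleton assms)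
  from measurable_compose[OF assms(1) this] show ?thesis .
qed

text \<open>Evaluations generate the sigma-algebra, so measurability of a path-valued map can be
  checked time by time.\<close>

lemma measurable_path_spaceI:
  assumes "\<And>x. x \<in> space M \<Longrightarrow> f x \<in> space path_space"
    and "\<And>u. u \<in> {0..1} \<Longrightarrow> (\<lambda>x. f x u) \<in> borel_measurable M"
  shows "f \<in> M \<rightarrow>\<^sub>M path_space"
  unfolding path_space_def
proof (rule measurable_restrict_space2)
  show "f \<in> space M \<rightarrow> {\<omega>. cadlag \<omega>}"
    using assms(1) by (auto simp: space_path_space)
  show "f \<in> M \<rightarrow>\<^sub>M (\<Pi>\<^sub>M t\<in>{0..1}. borel)"
    by (rule measurable_PiM_single')
       (use assms in \<open>auto simp: space_path_space PiE_def\<close>)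
qed

abbreviation marks :: "mark measure" where
  "marks \<equiv> restrict_space borel {0..1} \<Otimes>\<^sub>M borel"

lemma space_marks: "space marks = {0..1} \<times> UNIV"
  by (simp add: space_pair_measure space_restrict_space)

lemma measurable_unit_id:
  "f \<in> M \<rightarrow>\<^sub>M restrict_space borel {0..1} \<Longrightarrow> f \<in> borel_measurable M"
  by (simp add: measurable_restrict_space2_iff)

lemma measurable_mark_time:
  assumes "f \<in> M \<rightarrow>\<^sub>M marks"
  shows "(\<lambda>x. fst (f x)) \<in> borel_measurable M"
  by (rule measurable_unit_id) (rule measurable_compose[OF assms measurable_fst])

lemma sets_unit_lebesgue [measurable_cong]: "sets unit_lebesgue = sets (restrict_space borel {0..1})"
  by (simp add: unit_lebesgue_def sets_restrict_space)

lemma space_unit_lebesgue: "space unit_lebesgue = {0..1}"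
  by (simp add: unit_lebesgue_def space_restrict_space)

lemma prob_space_unit_lebesgue: "prob_space unit_lebesgue"
  by standard (simp add: unit_lebesgue_def space_restrict_space emeasure_restrict_space)

lemma emeasure_unit_lebesgue: "emeasure unit_lebesgue {0..1} = 1"
  using prob_space.emeasure_space_1[OF prob_space_unit_lebesgue] by (simp add: space_unit_lebesgue)

definition mark_lebesgue :: "mark measure" where
  "mark_lebesgue = unit_lebesgue \<Otimes>\<^sub>M lborel"

lemma sets_mark_lebesgue [measurable_cong]: "sets mark_lebesgue = sets marks"
  unfolding mark_lebesgue_def
  by (intro sets_pair_measure_cong sets_unit_lebesgue sets_lborel)

lemma space_mark_lebesgue: "space mark_lebesgue = {0..1} \<times> UNIV"
  using sets_eq_imp_space_eq[OF sets_mark_lebesgue] by (simp add: space_marks)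

lemma sigma_finite_unit_lebesgue: "sigma_finite_measure unit_lebesgue"
  using prob_space_unit_lebesgue prob_space_imp_sigma_finite by blast

lemma sigma_finite_mark_lebesgue: "sigma_finite_measure mark_lebesgue"
proof -
  interpret u: sigma_finite_measure unit_lebesgue by (rule sigma_finite_unit_lebesgue)
  interpret pair_sigma_finite unit_lebesgue "lborel :: real measure" ..
  show ?thesis unfolding mark_lebesgue_def by (rule sigma_finite_measure_axioms)
qed

lemma measurable_insert_jump [measurable (raw)]:
  assumes [measurable]: "f \<in> M \<rightarrow>\<^sub>M marks" "g \<in> M \<rightarrow>\<^sub>M path_space"
  shows "(\<lambda>x. insert_jump (f x) (g x)) \<in> M \<rightarrow>\<^sub>M path_space"
proof (rule measurable_path_spaceI)
  fix x assume "x \<in> space M"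
  then show "insert_jump (f x) (g x) \<in> space path_space"
    using measurable_space[OF assms(2)] by simp
next
  fix u :: real assume u: "u \<in> {0..1}"
  note [measurable] = measurable_path_eval[OF assms(2) u] measurable_mark_time[OF assms(1)]
  show "(\<lambda>x. insert_jump (f x) (g x) u) \<in> borel_measurable M"
    using u by (simp add: insert_jump_apply)
qed

lemma measurable_const_path [measurable]: "const_path \<in> borel \<rightarrow>\<^sub>M path_space"
  by (rule measurable_path_spaceI) simp_all

text \<open>Reduced to \<open>insert_jump\<close>, for which the cadlag property is known, up to an
  additive constant.\<close>

lemma split_path_in_space:
  assumes "\<gamma> \<in> space marks" "\<gamma>1 \<in> space marks" "\<gamma>2 \<in> space marks" "\<omega> \<in> space path_space"
  shows "split_path \<gamma> \<gamma>1 \<gamma>2 \<omega> \<in> space path_space"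
proof -
  define \<omega>' where "\<omega>' = insert_jump \<gamma>2 (insert_jump \<gamma>1 (insert_jump (fst \<gamma>, - snd \<gamma>) \<omega>))"
  \<comment> \<open>A mark at time 0 moves the whole path under \<open>split_path\<close> but is
    ignored by \<open>insert_jump\<close>; \<open>c\<close> is the total effect of such
    marks.\<close>
  define c where "c = split_path \<gamma> \<gamma>1 \<gamma>2 \<omega> 0 - \<omega> 0"
  have c: "cadlag \<omega>'" using assms unfolding \<omega>'_def by (auto intro!: cadlag_insert_jump simp: space_path_space)
  have eq: "split_path \<gamma> \<gamma>1 \<gamma>2 \<omega> u = \<omega>' u + c" if "u \<in> {0..1}" for u
    using that assms unfolding c_def split_path_def \<omega>'_def
    by (auto simp: insert_jump_apply space_marks indicator_def)
  have tr: "(split_path \<gamma> \<gamma>1 \<gamma>2 \<omega> \<longlongrightarrow> l + c) F"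
    if F: "F = at_left t \<and> 0 < t \<and> t \<le> 1 \<or> F = at_right t \<and> 0 \<le> t \<and> t < 1" and l: "(\<omega>' \<longlongrightarrow> l) F" for l F t
  proof -
    have "\<forall>\<^sub>F u in F. u \<in> {0..1}"
      using F by (auto intro!: eventually_at_leftI[of 0] eventually_at_rightI[of _ 1])
    then have "\<forall>\<^sub>F u in F. \<omega>' u + c = split_path \<gamma> \<gamma>1 \<gamma>2 \<omega> u"
      by eventually_elim (simp add: eq)
    then show ?thesis
      by (rule Lim_transform_eventually[rotated]) (intro tendsto_intros l)
  qed
  have "cadlag (split_path \<gamma> \<gamma>1 \<gamma>2 \<omega>)"
    unfolding cadlag_def
  proof (intro conjI ballI)
    fix t :: real assume t: "t \<in> {0..<1}"
    then show "(split_path \<gamma> \<gamma>1 \<gamma>2 \<omega> \<longlongrightarrow> split_path \<gamma> \<gamma>1 \<gamma>2 \<omega> t) (at_right t)"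
      using tr[of "at_right t" t, OF _ cadlag_right[OF c]] by (simp add: eq)
  next
    fix t :: real assume t: "t \<in> {0<..1}"
    then show "\<exists>l. (split_path \<gamma> \<gamma>1 \<gamma>2 \<omega> \<longlongrightarrow> l) (at_left t)"
      using tr[of "at_left t" t, OF _ cadlag_left[OF c]] by auto
  qed
  then show ?thesis by (auto simp: space_path_space split_path_def)
qed

lemma measurable_split_path [measurable (raw)]:
  assumes [measurable]: "f \<in> M \<rightarrow>\<^sub>M marks" "f1 \<in> M \<rightarrow>\<^sub>M marks" "f2 \<in> M \<rightarrow>\<^sub>M marks" "g \<in> M \<rightarrow>\<^sub>M path_space"
  shows "(\<lambda>x. split_path (f x) (f1 x) (f2 x) (g x)) \<in> M \<rightarrow>\<^sub>M path_space"
proof (rule measurable_path_spaceI)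
  fix x assume "x \<in> space M"
  then show "split_path (f x) (f1 x) (f2 x) (g x) \<in> space path_space"
    using assms[THEN measurable_space] by (intro split_path_in_space) auto
next
  fix u :: real assume u: "u \<in> {0..1}"
  note [measurable] = measurable_path_eval[OF assms(4) u] assms(1-3)[THEN measurable_mark_time]
  have "indicator {s..1} u = (if s \<le> u then 1 else (0::real))" for s :: real
    using u by auto
  then show "(\<lambda>x. split_path (f x) (f1 x) (f2 x) (g x) u) \<in> borel_measurable M"
    using u by (simp add: split_path_def)
qed

text \<open>Deleting the inserted mark undoes its insertion. Positive times are required because the
  two operations treat a mark at time 0 differently; that time is null in all later
  integrals.\<close>

lemma split_path_insert_jump:
  assumes "0 < fst \<gamma>" "0 < fst \<gamma>1" "0 < fst \<gamma>2"
  shows "split_path \<gamma> \<gamma>1 \<gamma>2 (insert_jump \<gamma> \<omega>) = insert_jump \<gamma>2 (insert_jump \<gamma>1 \<omega>)"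
  using assms by (auto simp: split_path_def insert_jump_def fun_eq_iff restrict_def indicator_def)

section \<open>Joint measurability of the jump in time and path\<close>

lemma filterlim_grid_right: "filterlim (\<lambda>n. (of_int \<lfloor>t * real (Suc n)\<rfloor> + 1) / real (Suc n)) (at_right t) sequentially"
  for t :: real
  unfolding filterlim_at
proof
  have l: "t < (of_int \<lfloor>t * real (Suc n)\<rfloor> + 1) / real (Suc n)" for n
    using floor_correct[of "t * real (Suc n)"] by (simp add: field_simps)
  have u: "(of_int \<lfloor>t * real (Suc n)\<rfloor> + 1) / real (Suc n) \<le> t + 1 / real (Suc n)" for n
  proof -
    have "t + 1 / real (Suc n) = (t * real (Suc n) + 1) / real (Suc n)"
      by (simp add: add_divide_distrib del: of_nat_Suc)
    then show ?thesis
      using floor_correct[of "t * real (Suc n)"] by (auto intro!: divide_right_mono simp del: of_nat_Suc)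
  qed
  show "(\<lambda>n. (of_int \<lfloor>t * real (Suc n)\<rfloor> + 1) / real (Suc n)) \<longlonglongrightarrow> t"
  proof (rule tendsto_sandwich)
    show "(\<lambda>n. t) \<longlonglongrightarrow> t" by simp
    show "(\<lambda>n. t + 1 / real (Suc n)) \<longlonglongrightarrow> t"
      using tendsto_add[OF tendsto_const LIMSEQ_inverse_real_of_nat, of t] by (simp add: inverse_eq_divide)
  qed (use l u in \<open>auto intro!: always_eventually simp: less_imp_le simp del: of_nat_Suc\<close>)
  show "\<forall>\<^sub>F n in sequentially. (of_int \<lfloor>t * real (Suc n)\<rfloor> + 1) / real (Suc n) \<in> {t<..}
    \<and> (of_int \<lfloor>t * real (Suc n)\<rfloor> + 1) / real (Suc n) \<noteq> t"
    using l by (intro always_eventually) (auto simp del: of_nat_Suc dest: less_imp_neq[symmetric])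
qed

lemma filterlim_grid_left: "filterlim (\<lambda>n. (of_int \<lceil>t * real (Suc n)\<rceil> - 1) / real (Suc n)) (at_left t) sequentially"
  for t :: real
  unfolding filterlim_at
proof
  have l: "(of_int \<lceil>t * real (Suc n)\<rceil> - 1) / real (Suc n) < t" for n
    using ceiling_correct[of "t * real (Suc n)"] by (simp add: field_simps)
  have u: "t + - (1 / real (Suc n)) \<le> (of_int \<lceil>t * real (Suc n)\<rceil> - 1) / real (Suc n)" for n
  proof -
    have "t + - (1 / real (Suc n)) = (t * real (Suc n) - 1) / real (Suc n)"
      by (simp add: diff_divide_distrib del: of_nat_Suc)
    then show ?thesis
      using ceiling_correct[of "t * real (Suc n)"] by (auto intro!: divide_right_mono simp del: of_nat_Suc)
  qed
  show "(\<lambda>n. (of_int \<lceil>t * real (Suc n)\<rceil> - 1) / real (Suc n)) \<longlonglongrightarrow> t"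
  proof (rule tendsto_sandwich)
    show "(\<lambda>n. t + - (1 / real (Suc n))) \<longlonglongrightarrow> t"
      using tendsto_add[OF tendsto_const tendsto_minus[OF LIMSEQ_inverse_real_of_nat], of t] by (simp add: inverse_eq_divide)
    show "(\<lambda>n. t) \<longlonglongrightarrow> t" by simp
  qed (use l u in \<open>auto intro!: always_eventually simp: less_imp_le simp del: of_nat_Suc\<close>)
  show "\<forall>\<^sub>F n in sequentially. (of_int \<lceil>t * real (Suc n)\<rceil> - 1) / real (Suc n) \<in> {..<t}
    \<and> (of_int \<lceil>t * real (Suc n)\<rceil> - 1) / real (Suc n) \<noteq> t"
    using l by (intro always_eventually) (auto simp del: of_nat_Suc dest: less_imp_neq)
qed

text \<open>At each grid size the path is evaluated just right and just left of \<open>t\<close> at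
  grid points, of which there are countably many, so each approximation is a countable case
  distinction. The difference converges to the jump by right continuity and existence of left
  limits.\<close>

lemma measurable_jump_aux: "(\<lambda>(t, \<omega>). jump \<omega> t) \<in> borel_measurable (borel \<Otimes>\<^sub>M path_space)"
proof -
  \<comment> \<open>Evaluation is measurable only at times of the unit interval, so grid points are
    clamped to it.\<close>
  define cl where "cl r = max 0 (min 1 r)" for r :: real
  have cl: "cl r \<in> {0..1}" for r by (auto simp: cl_def)
  define A where "A n i \<omega> = \<omega> (cl ((of_int i + 1) / real (Suc n)))" for n and i :: int and \<omega> :: "real \<Rightarrow> real"
  define B where "B n i \<omega> = \<omega> (cl ((of_int i - 1) / real (Suc n)))" for n and i :: int and \<omega> :: "real \<Rightarrow> real"
  have [measurable]: "(\<lambda>x. A n i (snd x)) \<in> borel_measurable (borel \<Otimes>\<^sub>M path_space)"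
     "(\<lambda>x. B n i (snd x)) \<in> borel_measurable (borel \<Otimes>\<^sub>M path_space)" for n i
    unfolding A_def B_def by (auto intro!: measurable_path_eval cl)
  have [measurable]: "(\<lambda>x. A n \<lfloor>fst x * real (Suc n)\<rfloor> (snd x)) \<in> borel_measurable (borel \<Otimes>\<^sub>M path_space)"
     "(\<lambda>x. B n \<lceil>fst x * real (Suc n)\<rceil> (snd x)) \<in> borel_measurable (borel \<Otimes>\<^sub>M path_space)" for n
    by (rule measurable_compose_countable[where f="\<lambda>i x. A n i (snd x)"]; measurable)
       (rule measurable_compose_countable[where f="\<lambda>i x. B n i (snd x)"]; measurable)
  have eq: "jump \<omega> t = (if 0 < t \<and> t \<le> 1 then
      lim (\<lambda>n. A n \<lfloor>t * real (Suc n)\<rfloor> \<omega> - B n \<lceil>t * real (Suc n)\<rceil> \<omega>) else 0)"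
    if "\<omega> \<in> space path_space" for t \<omega>
  proof (cases "0 < t \<and> t \<le> 1")
    case True
    have c: "cadlag \<omega>" using that by (simp add: space_path_space)
    have "(\<lambda>n. A n \<lfloor>t * real (Suc n)\<rfloor> \<omega>) \<longlonglongrightarrow> \<omega> t"
    proof (cases "t = 1")
      case t1: True
      \<comment> \<open>There is no right limit at 1, but the clamped grid point equals 1
        exactly.\<close>
      have "cl ((of_int \<lfloor>t * real (Suc n)\<rfloor> + 1) / real (Suc n)) = 1" for n
        by (auto simp: t1 cl_def field_simps)
      then show ?thesis by (simp add: A_def t1)
    next
      case False
      with True have t: "0 < t" "t < 1" by auto
      have "\<forall>\<^sub>F r in at_right t. \<omega> r = \<omega> (cl r)"
        using t by (intro eventually_at_rightI[of _ 1]) (auto simp: cl_def)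
      with cadlag_right[OF c, of t] t have "((\<lambda>r. \<omega> (cl r)) \<longlongrightarrow> \<omega> t) (at_right t)"
        by (auto intro: Lim_transform_eventually)
      from filterlim_compose[OF this filterlim_grid_right] show ?thesis
        by (simp add: A_def)
    qed
    moreover have "(\<lambda>n. B n \<lceil>t * real (Suc n)\<rceil> \<omega>) \<longlonglongrightarrow> \<omega> t - jump \<omega> t"
    proof -
      have "\<forall>\<^sub>F r in at_left t. \<omega> r = \<omega> (cl r)"
        using True by (intro eventually_at_leftI[of 0]) (auto simp: cl_def)
      with cadlag_left[OF c, of t] True have "((\<lambda>r. \<omega> (cl r)) \<longlongrightarrow> \<omega> t - jump \<omega> t) (at_left t)"
        by (auto intro: Lim_transform_eventually)
      from filterlim_compose[OF this filterlim_grid_left] show ?thesis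
        by (simp add: B_def)
    qed
    ultimately have "(\<lambda>n. A n \<lfloor>t * real (Suc n)\<rfloor> \<omega> - B n \<lceil>t * real (Suc n)\<rceil> \<omega>) \<longlonglongrightarrow> \<omega> t - (\<omega> t - jump \<omega> t)"
      by (rule tendsto_diff)
    then show ?thesis using True by (auto dest: limI)
  qed (auto simp: jump_outside)
  have "(\<lambda>x. if 0 < fst x \<and> fst x \<le> 1 then
      lim (\<lambda>n. A n \<lfloor>fst x * real (Suc n)\<rfloor> (snd x) - B n \<lceil>fst x * real (Suc n)\<rceil> (snd x)) else 0)
    \<in> borel_measurable (borel \<Otimes>\<^sub>M path_space)" (is "?f \<in> _")
    by measurable
  also have "?this \<longleftrightarrow> ?thesis"
    by (rule measurable_cong) (auto simp: space_pair_measure eq)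
  finally show ?thesis .
qed

lemma measurable_jump [measurable (raw)]:
  assumes [measurable]: "f \<in> borel_measurable M" "g \<in> M \<rightarrow>\<^sub>M path_space"
  shows "(\<lambda>x. jump (g x) (f x)) \<in> borel_measurable M"
  using measurable_compose[OF _ measurable_jump_aux, of "\<lambda>x. (f x, g x)" M] by simp

text \<open>Replaces an uncountable search over jump times by countable operations. A jump above
  \<open>a\<close> shows as a difference of values at arbitrarily close points of the countable set
  \<open>D\<close>; conversely such close pairs accumulate at a jump. The surplus 1/(k+1) makes the
  strict bound survive the limit.\<close>

lemma jump_exceeds_iff:
  assumes c: "cadlag \<omega>" and "0 \<le> p" "p < q" "q \<le> 1" "0 < a"
  defines "D \<equiv> (\<rat> \<inter> {p..q}) \<union> {q}"
  shows "(\<exists>t\<in>{p<..q}. a < \<bar>jump \<omega> t\<bar>) \<longleftrightarrow>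
    (\<exists>k::nat. \<forall>n::nat. \<exists>u\<in>D. \<exists>v\<in>D. u < v \<and> v - u < 1 / real (Suc n) \<and> a + 1 / real (Suc k) < \<bar>\<omega> v - \<omega> u\<bar>)"
    (is "?L \<longleftrightarrow> (\<exists>k. ?R k)")
proof
  assume ?L
  then obtain t where t: "p < t" "t \<le> q" "a < \<bar>jump \<omega> t\<bar>" by auto
  from t(3) have "0 < \<bar>jump \<omega> t\<bar> - a" by simp
  then obtain k where k: "1 / real (Suc k) < \<bar>jump \<omega> t\<bar> - a" by (rule nat_approx_posE)
  define e where "e = \<bar>jump \<omega> t\<bar> - a - 1 / real (Suc k)"
  have e: "0 < e" using k by (simp add: e_def)
  have "?R k"
  proof
    fix n :: nat
    define d where "d = 1 / real (Suc n)"
    have d: "0 < d" by (simp add: d_def)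
    have "\<forall>\<^sub>F u in at_left t. \<bar>\<omega> u - (\<omega> t - jump \<omega> t)\<bar> < e/2"
      using tendstoD[OF cadlag_left[OF c], of t "e/2"] t assms e by (auto simp: dist_real_def)
    then obtain b where b: "b < t" "\<forall>u>b. u < t \<longrightarrow> \<bar>\<omega> u - (\<omega> t - jump \<omega> t)\<bar> < e/2"
      by (auto simp: eventually_at_left_field)
    obtain u where u: "u \<in> \<rat>" "max b (max p (t - d/2)) < u" "u < t"
      using Rats_dense_in_real[of "max b (max p (t - d/2))" t] b t d by auto
    have "\<exists>v\<in>D. t \<le> v \<and> v < t + d/2 \<and> \<bar>\<omega> v - \<omega> t\<bar> < e/2"
    proof (cases "t = q")
      \<comment> \<open>At the right end there is no room inside the interval to approach
        \<open>t\<close> from the right, which is why \<open>q\<close> itself belongs to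
        \<open>D\<close>.\<close>
      case True then show ?thesis using d e by (auto simp: D_def)
    next
      case False
      then have tq: "t < q" using t by simp
      have "\<forall>\<^sub>F r in at_right t. \<bar>\<omega> r - \<omega> t\<bar> < e/2"
        using tendstoD[OF cadlag_right[OF c], of t "e/2"] tq t assms e by (auto simp: dist_real_def)
      then obtain b' where b': "t < b'" "\<forall>r>t. r < b' \<longrightarrow> \<bar>\<omega> r - \<omega> t\<bar> < e/2"
        by (auto simp: eventually_at_right_field)
      obtain v where v: "v \<in> \<rat>" "t < v" "v < min b' (min q (t + d/2))"
        using Rats_dense_in_real[of t "min b' (min q (t + d/2))"] b' tq d by auto
      then show ?thesis using b' t by (auto simp: D_def intro!: bexI[of _ v])
    qed
    then obtain v where v: "v \<in> D" "t \<le> v" "v < t + d/2" "\<bar>\<omega> v - \<omega> t\<bar> < e/2" by blast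
    have "\<bar>\<omega> u - (\<omega> t - jump \<omega> t)\<bar> < e/2" using b u by auto
    with v(4) have "\<bar>jump \<omega> t\<bar> < \<bar>\<omega> v - \<omega> u\<bar> + e" by linarith
    then have "a + 1 / real (Suc k) < \<bar>\<omega> v - \<omega> u\<bar>" by (simp add: e_def)
    moreover have "u \<in> D" using u t by (auto simp: D_def)
    moreover have "u < v" "v - u < d" using u v by auto
    ultimately show "\<exists>u\<in>D. \<exists>v\<in>D. u < v \<and> v - u < 1 / real (Suc n) \<and> a + 1 / real (Suc k) < \<bar>\<omega> v - \<omega> u\<bar>"
      using v(1) unfolding d_def by blast
  qed
  then show "\<exists>k. ?R k" ..
next
  assume "\<exists>k. ?R k"
  then obtain k where "?R k" ..
  then obtain u v where uv: "\<And>n::nat. u n \<in> D" "\<And>n. v n \<in> D" "\<And>n. u n < v n"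
    "\<And>n. v n - u n < 1 / real (Suc n)" "\<And>n. a + 1 / real (Suc k) < \<bar>\<omega> (v n) - \<omega> (u n)\<bar>"
    by metis
  have D: "D \<subseteq> {p..q}" using assms by (auto simp: D_def)
  obtain t r where t: "t \<in> {p..q}" and r: "strict_mono r" and ur: "(u \<circ> r) \<longlonglongrightarrow> t"
    using compact_Icc[of p q, unfolded compact_def, rule_format, of u] uv(1) D by blast
  have "(\<lambda>n. (v \<circ> r) n - (u \<circ> r) n) \<longlonglongrightarrow> 0"
  proof (rule tendsto_sandwich[OF _ _ tendsto_const])
    show "(\<lambda>n. 1 / real (Suc n)) \<longlonglongrightarrow> 0"
      using LIMSEQ_inverse_real_of_nat by (simp add: inverse_eq_divide)
    show "\<forall>\<^sub>F n in sequentially. (v \<circ> r) n - (u \<circ> r) n \<le> 1 / real (Suc n)"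
    proof (intro always_eventually allI)
      fix n
      have "1 / real (Suc (r n)) \<le> 1 / real (Suc n)"
        using seq_suble[OF r, of n] by (auto intro!: divide_left_mono)
      then show "(v \<circ> r) n - (u \<circ> r) n \<le> 1 / real (Suc n)"
        using uv(4)[of "r n"] by simp
    qed
  qed (use uv(3) in \<open>auto simp: less_imp_le\<close>)
  from tendsto_add[OF this ur] have vr: "(v \<circ> r) \<longlonglongrightarrow> t" by (simp add: comp_def)
  \<comment> \<open>Two errors of size \<open>e\<close>, one for each of the two points, use up
    exactly the surplus 1/(k+1).\<close>
  define e where "e = 1 / real (Suc k) / 2"
  have e: "0 < e" by (simp add: e_def)
  have t01: "0 \<le> t" "t \<le> 1" using t assms by auto
  obtain b' where b': "t < b'" "\<forall>r\<ge>t. r < b' \<longrightarrow> r \<le> 1 \<longrightarrow> \<bar>\<omega> r - \<omega> t\<bar> < e"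
  proof (cases "t < 1")
    case True
    have "\<forall>\<^sub>F r in at_right t. \<bar>\<omega> r - \<omega> t\<bar> < e"
      using tendstoD[OF cadlag_right[OF c], of t e] True t01 e by (auto simp: dist_real_def)
    then obtain b' where "t < b'" "\<forall>r>t. r < b' \<longrightarrow> \<bar>\<omega> r - \<omega> t\<bar> < e"
      by (auto simp: eventually_at_right_field)
    then show ?thesis using e by (intro that[of b']) (auto simp: le_less)
  next
    case False
    then have "t = 1" using t01 by simp
    then show ?thesis using e by (intro that[of 2]) auto
  qed
  obtain b where b: "b < t" "\<forall>r\<ge>0. b < r \<longrightarrow> r < t \<longrightarrow> \<bar>\<omega> r - (\<omega> t - jump \<omega> t)\<bar> < e"
  proof (cases "0 < t")
    case True
    have "\<forall>\<^sub>F r in at_left t. \<bar>\<omega> r - (\<omega> t - jump \<omega> t)\<bar> < e"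
      using tendstoD[OF cadlag_left[OF c], of t e] True t01 e by (auto simp: dist_real_def)
    then obtain b where "b < t" "\<forall>r>b. r < t \<longrightarrow> \<bar>\<omega> r - (\<omega> t - jump \<omega> t)\<bar> < e"
      by (auto simp: eventually_at_left_field)
    then show ?thesis by (intro that[of b]) auto
  next
    case False
    then have "t = 0" using t01 by simp
    then show ?thesis by (intro that[of "-1"]) auto
  qed
  have "\<forall>\<^sub>F n in sequentially. (u \<circ> r) n \<in> {b<..<b'}" "\<forall>\<^sub>F n in sequentially. (v \<circ> r) n \<in> {b<..<b'}"
    using b b' by (intro topological_tendstoD[OF ur] topological_tendstoD[OF vr]; simp)+
  then obtain n where n: "(u \<circ> r) n \<in> {b<..<b'}" "(v \<circ> r) n \<in> {b<..<b'}"
    using eventually_happens[OF eventually_conj] by fastforce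
  define u' v' where "u' = u (r n)" and "v' = v (r n)"
  have u': "b < u'" "u' < b'" "b < v'" "v' < b'" "u' < v'" "p \<le> u'" "u' \<le> q" "p \<le> v'" "v' \<le> q"
    "a + 1 / real (Suc k) < \<bar>\<omega> v' - \<omega> u'\<bar>"
    using n uv(1,2,3,5)[of "r n"] D by (auto simp: u'_def v'_def)
  have lo: "\<bar>\<omega> x - (\<omega> t - jump \<omega> t)\<bar> < e" if "x \<in> {u', v'}" "x < t" for x
    using b(2) that u' assms by auto
  have hi: "\<bar>\<omega> x - \<omega> t\<bar> < e" if "x \<in> {u', v'}" "t \<le> x" for x
    using b'(2) that u' assms by auto
  have e2: "2 * e = 1 / real (Suc k)" by (simp add: e_def del: of_nat_Suc)
  \<comment> \<open>Two points on the same side of \<open>t\<close> would have values closer than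
    \<open>2 * e\<close>, so the pair must straddle \<open>t\<close> and its difference measures the
    jump there.\<close>
  have "u' < t"
  proof (rule ccontr)
    assume "\<not> u' < t"
    then have "\<bar>\<omega> v' - \<omega> u'\<bar> < 2 * e" using hi[of u'] hi[of v'] u' by auto
    then show False using u' e2 \<open>0 < a\<close> by linarith
  qed
  moreover have "t \<le> v'"
  proof (rule ccontr)
    assume "\<not> t \<le> v'"
    then have "\<bar>\<omega> v' - \<omega> u'\<bar> < 2 * e" using lo[of u'] lo[of v'] u' by auto
    then show False using u' e2 \<open>0 < a\<close> by linarith
  qed
  ultimately have "\<bar>\<omega> v' - \<omega> u'\<bar> < \<bar>jump \<omega> t\<bar> + 2 * e" using lo[of u'] hi[of v'] by auto
  then have "a < \<bar>jump \<omega> t\<bar>" using u' e2 by linarith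
  then show ?L using \<open>u' < t\<close> \<open>t \<le> v'\<close> u' by (intro bexI[of _ t]) auto
qed

lemma sets_jump_exceeds:
  assumes "0 \<le> p" "p < q" "q \<le> 1" "0 < a"
  shows "{\<omega> \<in> space path_space. \<exists>t\<in>{p<..q}. a < \<bar>jump \<omega> t\<bar>} \<in> sets path_space"
proof -
  define D where "D = (\<rat> \<inter> {p..q}) \<union> {q}"
  have D: "countable D" by (auto simp: D_def countable_rat)
  have D01: "u \<in> {0..1}" if "u \<in> D" for u using that assms by (auto simp: D_def)
  have "{\<omega> \<in> space path_space. \<exists>t\<in>{p<..q}. a < \<bar>jump \<omega> t\<bar>} =
    {\<omega> \<in> space path_space. \<exists>k::nat. \<forall>n::nat. \<exists>u\<in>D. \<exists>v\<in>D. u < v \<and> v - u < 1 / real (Suc n) \<and> a + 1 / real (Suc k) < \<bar>\<omega> v - \<omega> u\<bar>}"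
    by (intro Collect_cong conj_cong refl)
       (use jump_exceeds_iff[of _ p q a] assms in \<open>simp only: space_path_space D_def mem_Collect_eq\<close>)
  also have "\<dots> \<in> sets path_space"
  proof -
    have less: "{\<omega> \<in> space path_space. b < \<bar>\<omega> v - \<omega> u\<bar>} \<in> sets path_space" if "u \<in> D" "v \<in> D" for b u v
      by (intro borel_measurable_less borel_measurable_diff borel_measurable_abs borel_measurable_const
          measurable_path_eval[OF measurable_ident[of path_space], simplified id_def] D01 that)
    show ?thesis
      by (intro sets.sets_Collect_countable_Ex sets.sets_Collect_countable_All
          sets.sets_Collect_countable_Ex'[OF _ D] sets.sets_Collect_conj sets.sets_Collect_const less)
  qed
  finally show ?thesis .
qed

definition big_jumps :: "real \<Rightarrow> real \<Rightarrow> (real \<Rightarrow> real) \<Rightarrow> real set" where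
  "big_jumps a s \<omega> = {t. 0 < t \<and> t \<le> s \<and> a < \<bar>jump \<omega> t\<bar>}"

lemma finite_big_jumps': "cadlag \<omega> \<Longrightarrow> 0 < a \<Longrightarrow> finite (big_jumps a s \<omega>)"
  by (rule finite_subset[OF _ finite_big_jumps[of \<omega> a]]) (auto simp: big_jumps_def)

text \<open>A rational time separates the last large jump from the earlier ones. This makes the
  event a countable union and drives the induction that proves its measurability.\<close>

lemma less_card_big_jumps_Suc:
  assumes c: "cadlag \<omega>" and "0 < a"
  shows "Suc k < card (big_jumps a s \<omega>) \<longleftrightarrow>
    (\<exists>r\<in>\<rat> \<inter> {0..<s}. k < card (big_jumps a r \<omega>) \<and> (\<exists>t\<in>{r<..s}. a < \<bar>jump \<omega> t\<bar>))"
proof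
  let ?J = "big_jumps a"
  note fin = finite_big_jumps'[OF assms]
  assume k: "Suc k < card (?J s \<omega>)"
  define t where "t = Max (?J s \<omega>)"
  have "?J s \<omega> \<noteq> {}" using k by auto
  then have t: "t \<in> ?J s \<omega>" unfolding t_def by (intro Max_in fin)
  define J' where "J' = ?J s \<omega> - {t}"
  have cJ': "card J' = card (?J s \<omega>) - 1" using t fin by (simp add: J'_def)
  then have "card J' \<noteq> 0" using k by simp
  then have J': "finite J'" "J' \<noteq> {}" by (auto intro: card_ge_0_finite)
  then have "Max J' \<in> J'" by (rule Max_in)
  moreover have "x \<le> t" if "x \<in> ?J s \<omega>" for x using that fin by (simp add: t_def)
  ultimately have m: "0 < Max J'" "Max J' < t" by (auto simp: J'_def big_jumps_def less_le)
  then obtain r where r: "r \<in> \<rat>" "Max J' < r" "r < t" using Rats_dense_in_real by blast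
  have "x \<le> r" if "x \<in> J'" for x using Max_ge[OF J'(1) that] r by simp
  then have "J' \<subseteq> ?J r \<omega>" by (auto simp: J'_def big_jumps_def)
  then have "card J' \<le> card (?J r \<omega>)" by (intro card_mono fin)
  then have "k < card (?J r \<omega>)" using cJ' k by simp
  moreover have "r \<in> {0..<s}" "t \<in> {r<..s}" "a < \<bar>jump \<omega> t\<bar>" using r m t by (auto simp: big_jumps_def)
  ultimately show "\<exists>r\<in>\<rat> \<inter> {0..<s}. k < card (big_jumps a r \<omega>) \<and> (\<exists>t\<in>{r<..s}. a < \<bar>jump \<omega> t\<bar>)"
    using r(1) by blast
next
  let ?J = "big_jumps a"
  note fin = finite_big_jumps'[OF assms]
  assume "\<exists>r\<in>\<rat> \<inter> {0..<s}. k < card (big_jumps a r \<omega>) \<and> (\<exists>t\<in>{r<..s}. a < \<bar>jump \<omega> t\<bar>)"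
  then obtain r t where r: "0 \<le> r" "r < s" "k < card (?J r \<omega>)" "r < t" "t \<le> s" "a < \<bar>jump \<omega> t\<bar>" by auto
  have "insert t (?J r \<omega>) \<subseteq> ?J s \<omega>" using r by (auto simp: big_jumps_def)
  then have "card (insert t (?J r \<omega>)) \<le> card (?J s \<omega>)" by (intro card_mono fin)
  moreover have "t \<notin> ?J r \<omega>" using r by (auto simp: big_jumps_def)
  ultimately show "Suc k < card (?J s \<omega>)" using r fin by simp
qed

lemma sets_less_card_big_jumps:
  assumes "0 < a" "s \<le> 1"
  shows "{\<omega> \<in> space path_space. k < card (big_jumps a s \<omega>)} \<in> sets path_space"
  using assms(2)
proof (induction k arbitrary: s)
  case 0
  show ?case
  proof (cases "0 < s")
    case True
    have "{\<omega> \<in> space path_space. 0 < card (big_jumps a s \<omega>)} = {\<omega> \<in> space path_space. \<exists>t\<in>{0<..s}. a < \<bar>jump \<omega> t\<bar>}"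
      using finite_big_jumps'[OF _ \<open>0<a\<close>, of _ s] by (auto simp: card_gt_0_iff space_path_space) (auto simp: big_jumps_def)
    then show ?thesis using sets_jump_exceeds[of 0 s a] True 0 assms by simp
  next
    case False
    then have "big_jumps a s \<omega> = {}" for \<omega> by (auto simp: big_jumps_def)
    then show ?thesis by simp
  qed
next
  case (Suc k)
  have "{\<omega> \<in> space path_space. Suc k < card (big_jumps a s \<omega>)} =
    {\<omega> \<in> space path_space. \<exists>r\<in>\<rat> \<inter> {0..<s}. k < card (big_jumps a r \<omega>) \<and> (\<exists>t\<in>{r<..s}. a < \<bar>jump \<omega> t\<bar>)}"
    by (intro Collect_cong conj_cong refl less_card_big_jumps_Suc \<open>0 < a\<close>) (simp add: space_path_space)
  also have "\<dots> \<in> sets path_space"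
    by (intro sets.sets_Collect_countable_Ex' sets.sets_Collect_conj Suc.IH sets_jump_exceeds)
       (use assms Suc.prems in \<open>auto intro: countable_rat countable_Int1\<close>)
  finally show ?case .
qed

text \<open>The default 0 keeps the value in the unit interval and is never a jump time; sums over
  the enumeration are guarded by the count.\<close>

definition nth_jump :: "real \<Rightarrow> nat \<Rightarrow> (real \<Rightarrow> real) \<Rightarrow> real" where
  "nth_jump a i \<omega> = (if i < card (big_jumps a 1 \<omega>) then sorted_list_of_set (big_jumps a 1 \<omega>) ! i else 0)"

text \<open>Turns the events that determine the law of an enumerated jump time into counting events,
  whose measurability is already available.\<close>

lemma sorted_nth_le_iff:
  assumes "finite J" "i < card J"
  shows "sorted_list_of_set J ! i \<le> s \<longleftrightarrow> i < card {t\<in>J. t \<le> (s::real)}"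
proof -
  define l where "l = sorted_list_of_set J"
  have l: "sorted l" "distinct l" "set l = J" "length l = card J"
    using assms by (simp_all add: l_def)
  have "{t\<in>J. t \<le> s} = (\<lambda>j. l ! j) ` {j. j < length l \<and> l ! j \<le> s}"
    unfolding l(3)[symmetric] by (auto simp: in_set_conv_nth)
  moreover have "inj_on (\<lambda>j. l ! j) {j. j < length l \<and> l ! j \<le> s}"
    using l(2) by (auto simp: inj_on_def nth_eq_iff_index_eq)
  ultimately have c: "card {t\<in>J. t \<le> s} = card {j. j < length l \<and> l ! j \<le> s}"
    by (simp add: card_image)
  have "l ! i \<le> s \<longleftrightarrow> i < card {j. j < length l \<and> l ! j \<le> s}"
  proof
    assume le: "l ! i \<le> s"
    have "{..i} \<subseteq> {j. j < length l \<and> l ! j \<le> s}"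
      using le assms l sorted_nth_mono[OF l(1)] by (auto intro: order_trans)
    from card_mono[OF _ this] show "i < card {j. j < length l \<and> l ! j \<le> s}" by simp
  next
    assume less: "i < card {j. j < length l \<and> l ! j \<le> s}"
    show "l ! i \<le> s"
    proof (rule ccontr)
      assume "\<not> l ! i \<le> s"
      then have "{j. j < length l \<and> l ! j \<le> s} \<subseteq> {..<i}"
        using sorted_nth_mono[OF l(1), of i] by (force simp: not_le not_less)
      from card_mono[OF _ this] less show False by simp
    qed
  qed
  with c show ?thesis by (simp add: l_def)
qed

lemma nth_jump_mem:
  assumes "cadlag \<omega>" "0 < a" "i < card (big_jumps a 1 \<omega>)"
  shows "nth_jump a i \<omega> \<in> big_jumps a 1 \<omega>"
proof -
  have "nth_jump a i \<omega> \<in> set (sorted_list_of_set (big_jumps a 1 \<omega>))"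
    using assms by (auto simp: nth_jump_def)
  then show ?thesis using finite_big_jumps'[OF assms(1,2)] by simp
qed

lemma pred_less_card_big_jumps:
  assumes "0 < a" shows "Measurable.pred path_space (\<lambda>\<omega>. i < card (big_jumps a 1 \<omega>))"
  using sets_less_card_big_jumps[OF assms, of 1 i] by (simp add: pred_def)

lemma measurable_nth_jump:
  assumes "0 < a"
  shows "nth_jump a i \<in> path_space \<rightarrow>\<^sub>M restrict_space borel {0..1}"
proof (rule measurable_restrict_space2)
  show "nth_jump a i \<in> space path_space \<rightarrow> {0..1}"
  proof
    fix \<omega> assume \<omega>: "\<omega> \<in> space path_space"
    show "nth_jump a i \<omega> \<in> {0..1}"
    proof (cases "i < card (big_jumps a 1 \<omega>)")
      case True
      then show ?thesis using nth_jump_mem[OF _ assms True] \<omega> by (simp add: space_path_space big_jumps_def)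
    qed (simp add: nth_jump_def)
  qed
  show "nth_jump a i \<in> borel_measurable path_space"
    unfolding borel_measurable_iff_le
  proof
    fix s :: real
    consider "s < 0" | "0 \<le> s" by linarith
    then show "{\<omega> \<in> space path_space. nth_jump a i \<omega> \<le> s} \<in> sets path_space"
    proof cases
      case 1
      have "\<not> nth_jump a i \<omega> \<le> s" if "\<omega> \<in> space path_space" for \<omega>
      proof (cases "i < card (big_jumps a 1 \<omega>)")
        case True
        then show ?thesis using nth_jump_mem[OF _ assms True] that 1 by (auto simp: space_path_space big_jumps_def)
      qed (use 1 in \<open>simp add: nth_jump_def\<close>)
      then have "{\<omega> \<in> space path_space. nth_jump a i \<omega> \<le> s} = {}" by auto
      then show ?thesis by (simp only: sets.empty_sets)
    next
      case 2
      \<comment> \<open>A missing jump has the default value 0 and so lies below the nonnegative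
        \<open>s\<close>. The minimum with 1 keeps the count within the range of times for which it
        is known to be measurable.\<close>
      have "nth_jump a i \<omega> \<le> s \<longleftrightarrow> \<not> i < card (big_jumps a 1 \<omega>) \<or> i < card (big_jumps a (min s 1) \<omega>)"
        if "\<omega> \<in> space path_space" for \<omega>
      proof (cases "i < card (big_jumps a 1 \<omega>)")
        case True
        have "{t \<in> big_jumps a 1 \<omega>. t \<le> s} = big_jumps a (min s 1) \<omega>" by (auto simp: big_jumps_def)
        then show ?thesis
          using sorted_nth_le_iff[OF finite_big_jumps'[OF _ assms] True, of s] that True
          by (simp add: nth_jump_def space_path_space)
      qed (use 2 in \<open>simp add: nth_jump_def\<close>)
      then have "{\<omega> \<in> space path_space. nth_jump a i \<omega> \<le> s} =
        (space path_space - {\<omega> \<in> space path_space. i < card (big_jumps a 1 \<omega>)}) \<union> {\<omega> \<in> space path_space. i < card (big_jumps a (min s 1) \<omega>)}"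
        by auto
      also have "\<dots> \<in> sets path_space"
        using sets_less_card_big_jumps[OF assms] by auto
      finally show ?thesis .
    qed
  qed
qed

section \<open>Measurable sums over all jumps of a path\<close>

definition jump_sum :: "(mark \<Rightarrow> ennreal) \<Rightarrow> (real \<Rightarrow> real) \<Rightarrow> ennreal" where
  "jump_sum F \<omega> = (\<integral>\<^sup>+t. F (t, jump \<omega> t) \<partial>count_space (jump_times \<omega>))"

lemma jump_sum_finite: "finite (jump_times \<omega>) \<Longrightarrow> jump_sum F \<omega> = (\<Sum>t\<in>jump_times \<omega>. F (t, jump \<omega> t))"
  unfolding jump_sum_def by (rule nn_integral_count_space_finite)

text \<open>The finite sets of jumps above 1/(m+1) increase to all jumps, so monotone convergence
  applies; each finite sum is rewritten along the measurable enumeration.\<close>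

lemma jump_sum_eq_SUP:
  assumes c: "cadlag \<omega>"
  shows "jump_sum F \<omega> = (SUP m. \<Sum>i. if i < card (big_jumps (1 / real (Suc m)) 1 \<omega>)
     then F (nth_jump (1 / real (Suc m)) i \<omega>, jump \<omega> (nth_jump (1 / real (Suc m)) i \<omega>)) else 0)"
proof -
  define J where "J m = big_jumps (1 / real (Suc m)) 1 \<omega>" for m
  have fin: "finite (J m)" for m unfolding J_def by (intro finite_big_jumps' c) simp
  have UJ: "jump_times \<omega> = (\<Union>m. J m)"
  proof (intro equalityI subsetI)
    fix t assume "t \<in> jump_times \<omega>"
    moreover from this have "0 < \<bar>jump \<omega> t\<bar>" by (simp add: jump_times_iff)
    then obtain m where "1 / real (Suc m) < \<bar>jump \<omega> t\<bar>" by (rule nat_approx_posE)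
    ultimately show "t \<in> (\<Union>m. J m)" using jump_times_subset[of \<omega>]
      by (auto simp: J_def big_jumps_def intro!: exI[of _ m])
  qed (auto simp: J_def big_jumps_def jump_times_iff dest: less_trans[rotated])
  have mono: "J m \<subseteq> J n" if "m \<le> n" for m n
  proof -
    have "1 / real (Suc n) \<le> 1 / real (Suc m)" using that by (auto intro!: divide_left_mono)
    then show ?thesis by (auto simp: J_def big_jumps_def)
  qed
  have "jump_sum F \<omega> = (\<integral>\<^sup>+t. (SUP m. F (t, jump \<omega> t) * indicator (J m) t) \<partial>count_space UNIV)"
  proof -
    have "jump_sum F \<omega> = (\<integral>\<^sup>+t. F (t, jump \<omega> t) * indicator (\<Union>m. J m) t \<partial>count_space UNIV)"
      unfolding jump_sum_def UJ by (rule nn_integral_count_space_indicator) simp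
    also have "\<dots> = (\<integral>\<^sup>+t. (SUP m. F (t, jump \<omega> t) * indicator (J m) t) \<partial>count_space UNIV)"
    proof (rule nn_integral_cong)
      fix t
      show "F (t, jump \<omega> t) * indicator (\<Union>m. J m) t = (SUP m. F (t, jump \<omega> t) * indicator (J m) t)"
      proof (cases "t \<in> (\<Union>m. J m)")
        case True
        then obtain m where m: "t \<in> J m" by auto
        show ?thesis using True
          by (intro antisym SUP_upper2[of m] SUP_least) (auto simp: m indicator_def)
      qed (auto intro!: antisym SUP_least)
    qed
    finally show ?thesis .
  qed
  also have "\<dots> = (SUP m. \<integral>\<^sup>+t. F (t, jump \<omega> t) * indicator (J m) t \<partial>count_space UNIV)"
    by (rule nn_integral_monotone_convergence_SUP)
       (use mono in \<open>auto simp: incseq_def le_fun_def indicator_def\<close>)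
  also have "\<dots> = (SUP m. \<Sum>i. if i < card (J m) then F (nth_jump (1 / real (Suc m)) i \<omega>, jump \<omega> (nth_jump (1 / real (Suc m)) i \<omega>)) else 0)"
  proof (rule SUP_cong[OF refl])
    fix m
    have "(\<integral>\<^sup>+t. F (t, jump \<omega> t) * indicator (J m) t \<partial>count_space UNIV) = (\<integral>\<^sup>+t. F (t, jump \<omega> t) \<partial>count_space (J m))"
      by (rule nn_integral_count_space_indicator[symmetric]) simp
    also have "\<dots> = (\<Sum>t\<in>J m. F (t, jump \<omega> t))" using fin by (rule nn_integral_count_space_finite)
    also have "\<dots> = sum_list (map (\<lambda>t. F (t, jump \<omega> t)) (sorted_list_of_set (J m)))"
      using fin by (simp add: sum_list_distinct_conv_sum_set)
    also have "\<dots> = (\<Sum>i<card (J m). F (sorted_list_of_set (J m) ! i, jump \<omega> (sorted_list_of_set (J m) ! i)))"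
      by (simp add: sum_list_sum_nth atLeast0LessThan)
    also have "\<dots> = (\<Sum>i<card (J m). if i < card (J m) then F (nth_jump (1 / real (Suc m)) i \<omega>, jump \<omega> (nth_jump (1 / real (Suc m)) i \<omega>)) else 0)"
      by (intro sum.cong refl) (simp add: nth_jump_def J_def)
    also have "\<dots> = (\<Sum>i. if i < card (J m) then F (nth_jump (1 / real (Suc m)) i \<omega>, jump \<omega> (nth_jump (1 / real (Suc m)) i \<omega>)) else 0)"
      by (rule suminf_finite[symmetric]) auto
    finally show "(\<integral>\<^sup>+t. F (t, jump \<omega> t) * indicator (J m) t \<partial>count_space UNIV) = \<dots>" .
  qed
  finally show ?thesis by (simp add: J_def)
qed

text \<open>The summand may depend on a parameter, in particular on the path itself. This is what
  allows jump sums to be nested, as in sums over pairs of jumps.\<close>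

lemma measurable_jump_sum [measurable (raw)]:
  assumes F: "(\<lambda>(\<gamma>, p). F p \<gamma>) \<in> borel_measurable (marks \<Otimes>\<^sub>M M)" and g [measurable]: "g \<in> M \<rightarrow>\<^sub>M path_space"
  shows "(\<lambda>p. jump_sum (F p) (g p)) \<in> borel_measurable M"
proof -
  let ?a = "\<lambda>m. 1 / real (Suc m)"
  have pos: "0 < ?a m" for m by simp
  have p: "Measurable.pred M (\<lambda>p. i < card (big_jumps (?a m) 1 (g p)))" for m i
    by (rule measurable_compose[OF g pred_less_card_big_jumps[OF pos]])
  have t: "(\<lambda>p. nth_jump (?a m) i (g p)) \<in> M \<rightarrow>\<^sub>M restrict_space borel {0..1}" for m i
    by (rule measurable_compose[OF g measurable_nth_jump[OF pos]])
  have \<gamma>: "(\<lambda>p. (nth_jump (?a m) i (g p), jump (g p) (nth_jump (?a m) i (g p)))) \<in> M \<rightarrow>\<^sub>M marks" for m i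
    by (intro measurable_Pair measurable_jump t g measurable_unit_id[OF t])
  have F': "(\<lambda>p. F p (nth_jump (?a m) i (g p), jump (g p) (nth_jump (?a m) i (g p)))) \<in> borel_measurable M" for m i
    using measurable_compose[OF measurable_Pair[OF \<gamma> measurable_ident] F] by simp
  have "(\<lambda>p. SUP m. \<Sum>i. if i < card (big_jumps (?a m) 1 (g p))
     then F p (nth_jump (?a m) i (g p), jump (g p) (nth_jump (?a m) i (g p))) else 0) \<in> borel_measurable M"
    by (intro borel_measurable_SUP borel_measurable_suminf_order measurable_If F' p[unfolded pred_def] borel_measurable_const)
       simp
  also have "?this \<longleftrightarrow> ?thesis"
    by (rule measurable_cong)
       (use measurable_space[OF g] in \<open>simp add: space_path_space jump_sum_eq_SUP\<close>)
  finally show ?thesis .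
qed

section \<open>Pinned sums over marks\<close>

interpretation unit_lebesgue: prob_space unit_lebesgue
  by (rule prob_space_unit_lebesgue)

interpretation mark_lebesgue: sigma_finite_measure mark_lebesgue
  by (rule sigma_finite_mark_lebesgue)

interpretation mark_mark: pair_sigma_finite mark_lebesgue mark_lebesgue ..

interpretation unit_lborel: pair_sigma_finite unit_lebesgue "lborel :: real measure" ..

interpretation unit_unit: pair_sigma_finite unit_lebesgue unit_lebesgue ..

section \<open>Generic marks and changes of variables\<close>

lemma measurable_curried:
  assumes "(\<lambda>(a, b). F a b) \<in> borel_measurable (M \<Otimes>\<^sub>M N)" "f \<in> L \<rightarrow>\<^sub>M M" "g \<in> L \<rightarrow>\<^sub>M N"
  shows "(\<lambda>x. F (f x) (g x)) \<in> borel_measurable L"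
  using measurable_compose[OF measurable_Pair[OF assms(2,3)] assms(1)] by simp

text \<open>With \<open>C\<close> the jump times already present, a uniform time may be assumed
  positive and free of collisions.\<close>

lemma AE_unit_lebesgue:
  assumes "countable C"
  shows "AE s in unit_lebesgue. 0 < s \<and> s \<le> 1 \<and> s \<notin> C"
proof -
  have "insert 0 C \<in> null_sets lborel"
    using assms by (intro countable_imp_null_set_lborel) auto
  then have "AE s in lborel. s \<notin> insert 0 C" by (rule AE_not_in)
  then show ?thesis
    unfolding unit_lebesgue_def by (subst AE_restrict_space_iff) auto
qed

text \<open>The second exceptional set is for sizes: typically 0, which is no jump, and the total
  size, which would leave nothing for the other marks.\<close>

lemma AE_mark_lebesgue:
  assumes C: "countable C" "countable C'"
  shows "AE \<gamma> in mark_lebesgue. 0 < fst \<gamma> \<and> fst \<gamma> \<le> 1 \<and> fst \<gamma> \<notin> C \<and> snd \<gamma> \<notin> C'"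
proof -
  have cb: "A \<in> sets borel" if "countable A" for A :: "real set"
    using that by (rule sets.countable[rotated]) auto
  have [measurable]: "insert 0 C \<in> sets borel" "C' \<in> sets borel"
    using C by (auto intro: cb)
  have 1: "insert 0 C \<inter> {0..1} \<in> null_sets unit_lebesgue"
  proof -
    have "insert 0 C \<inter> {0..1} \<in> null_sets lborel"
      by (rule countable_imp_null_set_lborel) (use C in auto)
    then show ?thesis
      by (auto simp: null_sets_def unit_lebesgue_def emeasure_restrict_space sets_restrict_space_iff)
  qed
  have 2: "C' \<in> null_sets (lborel :: real measure)"
    by (rule countable_imp_null_set_lborel) (use C in auto)
  have "(insert 0 C \<inter> {0..1}) \<times> UNIV \<in> null_sets mark_lebesgue"
    unfolding mark_lebesgue_def using 1
    by (auto simp: null_sets_def lborel.emeasure_pair_measure_Times)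
  moreover have "{0..1} \<times> C' \<in> null_sets mark_lebesgue"
    unfolding mark_lebesgue_def using 2 sets.top[of unit_lebesgue]
    by (auto simp: null_sets_def lborel.emeasure_pair_measure_Times space_unit_lebesgue)
  ultimately have "AE \<gamma> in mark_lebesgue. \<gamma> \<notin> (insert 0 C \<inter> {0..1}) \<times> UNIV \<and> \<gamma> \<notin> {0..1} \<times> C'"
    by (intro AE_conjI AE_not_in)
  then show ?thesis
    by (rule AE_mp) (auto simp: space_mark_lebesgue intro!: AE_I2)
qed

lemma nn_integral_mark_lebesgue:
  assumes [measurable]: "g \<in> borel_measurable marks"
  shows "(\<integral>\<^sup>+\<gamma>. g \<gamma> \<partial>mark_lebesgue) = (\<integral>\<^sup>+x. \<integral>\<^sup>+s. g (s, x) \<partial>unit_lebesgue \<partial>lborel)"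
proof -
  have [measurable]: "g \<in> borel_measurable (unit_lebesgue \<Otimes>\<^sub>M lborel)"
    using assms by (simp add: measurable_cong_sets[OF sets_mark_lebesgue[unfolded mark_lebesgue_def] refl])
  show ?thesis
    unfolding mark_lebesgue_def by (rule unit_lborel.nn_integral_snd[symmetric]) measurable
qed

text \<open>Exchanges the free size and the forced size when two marks have total size
  \<open>z\<close>.\<close>

lemma nn_integral_reflect:
  fixes g :: "real \<Rightarrow> ennreal"
  assumes [measurable]: "g \<in> borel_measurable borel"
  shows "(\<integral>\<^sup>+x. g (z - x) \<partial>lborel) = (\<integral>\<^sup>+x. g x \<partial>lborel)"
  using nn_integral_real_affine[of g "-1" z] by simp

lemma nn_integral_shift:
  fixes g :: "real \<Rightarrow> ennreal"
  assumes [measurable]: "g \<in> borel_measurable borel"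
  shows "(\<integral>\<^sup>+x. g (x - z) \<partial>lborel) = (\<integral>\<^sup>+x. g x \<partial>lborel)"
  using nn_integral_real_affine[of g 1 "-z"] by simp

lemma jump_sum_cong:
  assumes "\<And>\<gamma>. \<gamma> \<in> space marks \<Longrightarrow> F \<gamma> = F' \<gamma>"
  shows "jump_sum F \<omega> = jump_sum F' \<omega>"
  unfolding jump_sum_def
  by (intro nn_integral_cong assms) (use jump_times_subset[of \<omega>] in \<open>auto simp: space_marks\<close>)

lemma jump_sum_const_path [simp]: "jump_sum F (const_path x) = 0"
  by (simp add: jump_sum_def nn_integral_empty)

lemma jump_sum_insert_jump:
  assumes "\<omega> \<in> space path_space" "0 < fst \<gamma>" "fst \<gamma> \<le> 1" "fst \<gamma> \<notin> jump_times \<omega>" "snd \<gamma> \<noteq> 0"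
  shows "jump_sum F (insert_jump \<gamma> \<omega>) = F \<gamma> + jump_sum F \<omega>"
proof -
  have c: "cadlag \<omega>" using assms by (simp add: space_path_space)
  let ?\<omega> = "insert_jump \<gamma> \<omega>"
  have \<gamma>: "(fst \<gamma>, jump ?\<omega> (fst \<gamma>)) = \<gamma>"
    using assms c by (simp add: jump_insert_jump jump_times_iff prod_eq_iff)
  have "jump_sum F ?\<omega> = (\<integral>\<^sup>+t. F (t, jump ?\<omega> t) * indicator (insert (fst \<gamma>) (jump_times \<omega>)) t \<partial>count_space UNIV)"
    unfolding jump_sum_def jump_times_insert_jump[OF c assms(2-)]
    by (rule nn_integral_count_space_indicator) simp
  also have "\<dots> = (\<integral>\<^sup>+t. F \<gamma> * indicator {fst \<gamma>} t + F (t, jump \<omega> t) * indicator (jump_times \<omega>) t \<partial>count_space UNIV)"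
    using assms c \<gamma> by (intro nn_integral_cong) (auto simp: indicator_def jump_insert_jump)
  also have "\<dots> = (\<integral>\<^sup>+t. F \<gamma> * indicator {fst \<gamma>} t \<partial>count_space UNIV) + (\<integral>\<^sup>+t. F (t, jump \<omega> t) * indicator (jump_times \<omega>) t \<partial>count_space UNIV)"
    by (rule nn_integral_add) auto
  also have "(\<integral>\<^sup>+t. F \<gamma> * indicator {fst \<gamma>} t \<partial>count_space UNIV) = F \<gamma>"
    by (subst nn_integral_cmult) (auto simp: one_ennreal_def[symmetric])
  also have "(\<integral>\<^sup>+t. F (t, jump \<omega> t) * indicator (jump_times \<omega>) t \<partial>count_space UNIV) = jump_sum F \<omega>"
    unfolding jump_sum_def by (rule nn_integral_count_space_indicator[symmetric]) simp
  finally show ?thesis .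
qed

section \<open>Integrals over marks of prescribed total size\<close>

locale jump_density =
  fixes f :: "real \<Rightarrow> real"
  assumes f_measurable [measurable]: "f \<in> borel_measurable borel"
    and f_pos: "0 < f x"
    and f_integrable: "(\<integral>\<^sup>+x. ennreal (f x) \<partial>lborel) < \<infinity>"
begin

text \<open>
  \<^term>\<open>pinned_sum n z \<omega> G\<close> integrates \<^term>\<open>G\<close> over the paths obtained from \<^term>\<open>\<omega>\<close> by inserting
  \<^term>\<open>Suc n\<close> marks at uniform times, with sizes weighted by \<^term>\<open>f\<close> and total size \<^term>\<open>z\<close>
  (the last size is the remaining one and is not integrated over).
\<close>

primrec pinned_sum :: "nat \<Rightarrow> real \<Rightarrow> (real \<Rightarrow> real) \<Rightarrow> ((real \<Rightarrow> real) \<Rightarrow> ennreal) \<Rightarrow> ennreal" where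
  "pinned_sum 0 z \<omega> G = ennreal (f z) * (\<integral>\<^sup>+s. G (insert_jump (s, z) \<omega>) \<partial>unit_lebesgue)"
| "pinned_sum (Suc n) z \<omega> G =
    (\<integral>\<^sup>+\<gamma>. ennreal (f (snd \<gamma>)) * pinned_sum n (z - snd \<gamma>) (insert_jump \<gamma> \<omega>) G \<partial>mark_lebesgue)"

text \<open>The reduced side of Campbell's formula: the functional also sees the mark inserted
  first. With a single mark this is the one whose size is forced.\<close>

fun first_mark_sum :: "nat \<Rightarrow> real \<Rightarrow> (real \<Rightarrow> real) \<Rightarrow> (mark \<Rightarrow> (real \<Rightarrow> real) \<Rightarrow> ennreal) \<Rightarrow> ennreal" where
  "first_mark_sum 0 z \<omega> F = ennreal (f z) * (\<integral>\<^sup>+s. F (s, z) (insert_jump (s, z) \<omega>) \<partial>unit_lebesgue)"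
| "first_mark_sum (Suc n) z \<omega> F =
    (\<integral>\<^sup>+\<gamma>. ennreal (f (snd \<gamma>)) * pinned_sum n (z - snd \<gamma>) (insert_jump \<gamma> \<omega>) (F \<gamma>) \<partial>mark_lebesgue)"

text \<open>Joint measurability in parameter, size and base path is the form that the induction
  preserves, because the recursion changes both size and base path.\<close>

lemma measurable_pinned_sum_aux:
  assumes [measurable]: "(\<lambda>(p, \<omega>). G p \<omega>) \<in> borel_measurable (M \<Otimes>\<^sub>M path_space)"
  shows "(\<lambda>(p, z, \<omega>). pinned_sum n z \<omega> (G p)) \<in> borel_measurable (M \<Otimes>\<^sub>M borel \<Otimes>\<^sub>M path_space)"
proof (induction n)
  case 0
  show ?case by simp
next
  case (Suc n)
  let ?N = "M \<Otimes>\<^sub>M borel \<Otimes>\<^sub>M path_space"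
  have [measurable]: "(\<lambda>x. (fst (fst x), fst (snd (fst x)) - snd (snd x), insert_jump (snd x) (snd (snd (fst x)))))
     \<in> ?N \<Otimes>\<^sub>M mark_lebesgue \<rightarrow>\<^sub>M ?N"
    by measurable
  have [measurable]: "(\<lambda>x. pinned_sum n (fst (snd (fst x)) - snd (snd x)) (insert_jump (snd x) (snd (snd (fst x)))) (G (fst (fst x))))
     \<in> borel_measurable (?N \<Otimes>\<^sub>M mark_lebesgue)"
    using measurable_compose[OF _ Suc.IH, of "\<lambda>x. (fst (fst x), fst (snd (fst x)) - snd (snd x), insert_jump (snd x) (snd (snd (fst x))))"]
    by simp
  have "(\<lambda>x. \<integral>\<^sup>+\<gamma>. ennreal (f (snd \<gamma>)) * pinned_sum n (fst (snd x) - snd \<gamma>) (insert_jump \<gamma> (snd (snd x))) (G (fst x)) \<partial>mark_lebesgue)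
     \<in> borel_measurable ?N"
    by measurable
  then show ?case by (simp add: split_beta')
qed

lemma measurable_pinned_sum [measurable (raw)]:
  assumes G: "(\<lambda>(p, \<omega>). G p \<omega>) \<in> borel_measurable (M \<Otimes>\<^sub>M path_space)"
    and [measurable]: "z \<in> borel_measurable M" "g \<in> M \<rightarrow>\<^sub>M path_space"
  shows "(\<lambda>p. pinned_sum n (z p) (g p) (G p)) \<in> borel_measurable M"
  using measurable_compose[OF _ measurable_pinned_sum_aux[OF G], of "\<lambda>p. (p, z p, g p)" M n] by simp

lemma pinned_sum_cong:
  assumes "\<And>\<omega>. \<omega> \<in> space path_space \<Longrightarrow> G \<omega> = G' \<omega>" "\<omega> \<in> space path_space"
  shows "pinned_sum n z \<omega> G = pinned_sum n z \<omega> G'"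
  using assms(2) by (induction n arbitrary: z \<omega>) (simp_all add: assms(1))

lemma pinned_sum_mult:
  assumes [measurable]: "G \<in> borel_measurable path_space" and "\<omega> \<in> space path_space"
  shows "pinned_sum n z \<omega> (\<lambda>\<omega>. c * G \<omega>) = c * pinned_sum n z \<omega> G"
  using assms(2)
proof (induction n arbitrary: z \<omega>)
  case (0 z \<omega>)
  note 0[measurable (raw)]
  show ?case by (simp add: nn_integral_cmult ac_simps)
next
  case (Suc n z \<omega>)
  note Suc.prems[measurable (raw)]
  show ?case using Suc.prems
    by (simp add: Suc.IH nn_integral_cmult mult.left_commute[of _ c])
qed

text \<open>Monotonicity is part of the conclusion because monotone convergence in the induction
  step needs it from the induction hypothesis.\<close>

lemma pinned_sum_SUP:
  assumes [measurable]: "\<And>i::nat. G i \<in> borel_measurable path_space" and "incseq G" and "\<omega> \<in> space path_space"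
  shows "pinned_sum n z \<omega> (\<lambda>\<omega>. SUP i. G i \<omega>) = (SUP i. pinned_sum n z \<omega> (G i)) \<and> incseq (\<lambda>i. pinned_sum n z \<omega> (G i))"
  using assms(3)
proof (induction n arbitrary: z \<omega>)
  case (0 z \<omega>)
  note 0[measurable (raw)]
  have inc: "incseq (\<lambda>i s. G i (insert_jump (s, z) \<omega>))"
    using assms(2) by (auto simp: incseq_def le_fun_def)
  have "(\<integral>\<^sup>+s. (SUP i. G i (insert_jump (s, z) \<omega>)) \<partial>unit_lebesgue) = (SUP i. \<integral>\<^sup>+s. G i (insert_jump (s, z) \<omega>) \<partial>unit_lebesgue)"
    by (rule nn_integral_monotone_convergence_SUP[OF inc]) measurable
  then show ?case using assms(2)
    by (auto simp: SUP_mult_left_ennreal incseq_def le_fun_def intro!: mult_left_mono nn_integral_mono)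
next
  case (Suc n z \<omega>)
  note Suc.prems[measurable (raw)]
  have IH: "pinned_sum n z (insert_jump \<gamma> \<omega>) (\<lambda>\<omega>. SUP i. G i \<omega>) = (SUP i. pinned_sum n z (insert_jump \<gamma> \<omega>) (G i))"
     "incseq (\<lambda>i. pinned_sum n z (insert_jump \<gamma> \<omega>) (G i))" for z \<gamma>
    using Suc.IH Suc.prems by auto
  have inc: "incseq (\<lambda>i \<gamma>. ennreal (f (snd \<gamma>)) * pinned_sum n (z - snd \<gamma>) (insert_jump \<gamma> \<omega>) (G i))"
    using IH(2) by (auto simp: incseq_def le_fun_def intro!: mult_left_mono)
  have "pinned_sum (Suc n) z \<omega> (\<lambda>\<omega>. SUP i. G i \<omega>) =
    (\<integral>\<^sup>+\<gamma>. (SUP i. ennreal (f (snd \<gamma>)) * pinned_sum n (z - snd \<gamma>) (insert_jump \<gamma> \<omega>) (G i)) \<partial>mark_lebesgue)"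
    by (simp add: IH SUP_mult_left_ennreal)
  also have "\<dots> = (SUP i. pinned_sum (Suc n) z \<omega> (G i))"
    unfolding pinned_sum.simps by (rule nn_integral_monotone_convergence_SUP[OF inc]) measurable
  finally show ?case using inc by (auto simp: incseq_def le_fun_def intro!: nn_integral_mono)
qed

lemma pinned_sum_Fubini:
  assumes G: "(\<lambda>(p, \<omega>). G p \<omega>) \<in> borel_measurable (M \<Otimes>\<^sub>M path_space)"
    and M: "sigma_finite_measure M" and "\<omega> \<in> space path_space"
  shows "pinned_sum n z \<omega> (\<lambda>\<omega>. \<integral>\<^sup>+p. G p \<omega> \<partial>M) = (\<integral>\<^sup>+p. pinned_sum n z \<omega> (G p) \<partial>M)"
  using assms(3)
proof (induction n arbitrary: z \<omega>)
  case (0 z \<omega>)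
  interpret M: sigma_finite_measure M by fact
  note [measurable (raw)] = measurable_curried[OF G]
  interpret pair_sigma_finite M unit_lebesgue ..
  note 0[measurable (raw)]
  have "(\<integral>\<^sup>+s. \<integral>\<^sup>+p. G p (insert_jump (s, z) \<omega>) \<partial>M \<partial>unit_lebesgue) = (\<integral>\<^sup>+p. \<integral>\<^sup>+s. G p (insert_jump (s, z) \<omega>) \<partial>unit_lebesgue \<partial>M)"
    by (rule Fubini') measurable
  then show ?case by (simp add: nn_integral_cmult)
next
  case (Suc n z \<omega>)
  interpret M: sigma_finite_measure M by fact
  note [measurable (raw)] = measurable_curried[OF G]
  interpret pair_sigma_finite M mark_lebesgue ..
  note Suc.prems[measurable (raw)]
  have "(\<integral>\<^sup>+\<gamma>. ennreal (f (snd \<gamma>)) * pinned_sum n (z - snd \<gamma>) (insert_jump \<gamma> \<omega>) (\<lambda>\<omega>. \<integral>\<^sup>+p. G p \<omega> \<partial>M) \<partial>mark_lebesgue) =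
     (\<integral>\<^sup>+\<gamma>. \<integral>\<^sup>+p. ennreal (f (snd \<gamma>)) * pinned_sum n (z - snd \<gamma>) (insert_jump \<gamma> \<omega>) (G p) \<partial>M \<partial>mark_lebesgue)"
    using Suc by (simp add: Suc.IH nn_integral_cmult cong: nn_integral_cong)
  also have "\<dots> = (\<integral>\<^sup>+p. \<integral>\<^sup>+\<gamma>. ennreal (f (snd \<gamma>)) * pinned_sum n (z - snd \<gamma>) (insert_jump \<gamma> \<omega>) (G p) \<partial>mark_lebesgue \<partial>M)"
    by (rule Fubini') measurable
  finally show ?case by simp
qed

lemma pinned_sum_add:
  assumes [measurable]: "G \<in> borel_measurable path_space" "G' \<in> borel_measurable path_space" and "\<omega> \<in> space path_space"
  shows "pinned_sum n z \<omega> (\<lambda>\<omega>. G \<omega> + G' \<omega>) = pinned_sum n z \<omega> G + pinned_sum n z \<omega> G'"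
proof -
  \<comment> \<open>A sum of two functionals is an integral over a two-point counting measure, so
    additivity is an instance of Fubini.\<close>
  let ?H = "\<lambda>b \<omega>. if b then G \<omega> else G' \<omega>"
  have "pinned_sum n z \<omega> (\<lambda>\<omega>. \<integral>\<^sup>+b. ?H b \<omega> \<partial>count_space UNIV) = (\<integral>\<^sup>+b. pinned_sum n z \<omega> (?H b) \<partial>count_space UNIV)"
    by (rule pinned_sum_Fubini) (auto intro!: sigma_finite_measure_count_space_finite assms)
  then show ?thesis by (simp add: nn_integral_count_space_finite UNIV_bool add.commute)
qed

lemma pinned_sum_0 [simp]: "pinned_sum n z \<omega> (\<lambda>\<omega>. 0) = 0"
  by (induction n arbitrary: z \<omega>) simp_all

lemma pinned_sum_insert_jump:
  "pinned_sum n z (insert_jump \<gamma> \<omega>) G = pinned_sum n z \<omega> (\<lambda>\<omega>. G (insert_jump \<gamma> \<omega>))"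
  by (induction n arbitrary: z \<omega>) (simp_all add: insert_jump_commute[of _ \<gamma>])

text \<open>All paths integrated over share their endpoints, up to the null event of a mark at time
  0, so a function of the endpoints factors out.\<close>

lemma pinned_sum_endpoints:
  assumes [measurable]: "G \<in> borel_measurable path_space" and "\<omega> \<in> space path_space"
  shows "pinned_sum n z \<omega> (\<lambda>\<omega>'. G \<omega>' * h (\<omega>' 0) (\<omega>' 1)) = h (\<omega> 0) (\<omega> 1 + z) * pinned_sum n z \<omega> G"
  using assms(2)
proof (induction n arbitrary: z \<omega>)
  case (0 z \<omega>)
  note 0[measurable (raw)]
  have "(\<integral>\<^sup>+s. G (insert_jump (s, z) \<omega>) * h (insert_jump (s, z) \<omega> 0) (insert_jump (s, z) \<omega> 1) \<partial>unit_lebesgue) =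
     (\<integral>\<^sup>+s. h (\<omega> 0) (\<omega> 1 + z) * G (insert_jump (s, z) \<omega>) \<partial>unit_lebesgue)"
    by (rule nn_integral_cong_AE) (rule AE_mp[OF AE_unit_lebesgue[of "{}"]], auto simp: insert_jump_1 mult.commute)
  then show ?case by (simp add: nn_integral_cmult mult.left_commute)
next
  case (Suc n z \<omega>)
  note Suc.prems[measurable (raw)]
  have "(\<integral>\<^sup>+\<gamma>. ennreal (f (snd \<gamma>)) * pinned_sum n (z - snd \<gamma>) (insert_jump \<gamma> \<omega>) (\<lambda>\<omega>'. G \<omega>' * h (\<omega>' 0) (\<omega>' 1)) \<partial>mark_lebesgue) =
     (\<integral>\<^sup>+\<gamma>. h (\<omega> 0) (\<omega> 1 + z) * (ennreal (f (snd \<gamma>)) * pinned_sum n (z - snd \<gamma>) (insert_jump \<gamma> \<omega>) G) \<partial>mark_lebesgue)"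
    by (rule nn_integral_cong_AE, rule AE_mp[OF AE_mark_lebesgue[of "{}" "{}"]])
       (use Suc in \<open>auto simp: insert_jump_1 mult.left_commute\<close>)
  then show ?case by (simp add: nn_integral_cmult)
qed

text \<open>Exchangeability: the mark seen by \<open>F\<close> is inserted second on the left and
  first on the right. If a third mark carries the forced size this is Tonelli. With only two marks
  one of the two is forced, and the exchange must also swap the free and the forced size.\<close>

lemma first_mark_sum_swap:
  assumes F: "(\<lambda>(\<gamma>, \<omega>). F \<gamma> \<omega>) \<in> borel_measurable (marks \<Otimes>\<^sub>M path_space)" and \<omega>: "\<omega> \<in> space path_space"
  shows "(\<integral>\<^sup>+\<gamma>. ennreal (f (snd \<gamma>)) * first_mark_sum n (z - snd \<gamma>) (insert_jump \<gamma> \<omega>) F \<partial>mark_lebesgue) = first_mark_sum (Suc n) z \<omega> F"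
proof (cases n)
  case 0
  note \<omega>[measurable (raw)]
  note [measurable (raw)] = measurable_curried[OF F]
  let ?F = "\<lambda>x s s'. F (s', z - x) (insert_jump (s', z - x) (insert_jump (s, x) \<omega>))"
  have "(\<integral>\<^sup>+\<gamma>. ennreal (f (snd \<gamma>)) * first_mark_sum n (z - snd \<gamma>) (insert_jump \<gamma> \<omega>) F \<partial>mark_lebesgue) =
    (\<integral>\<^sup>+x. \<integral>\<^sup>+s. ennreal (f x) * (ennreal (f (z - x)) * (\<integral>\<^sup>+s'. ?F x s s' \<partial>unit_lebesgue)) \<partial>unit_lebesgue \<partial>lborel)"
    unfolding 0 first_mark_sum.simps
  proof (subst nn_integral_mark_lebesgue, goal_cases)
    case 1 show ?case by measurable
  qed (use \<omega> in simp_all)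
  also have "\<dots> = (\<integral>\<^sup>+x. ennreal (f x) * (ennreal (f (z - x)) * (\<integral>\<^sup>+s. \<integral>\<^sup>+s'. ?F x s s' \<partial>unit_lebesgue \<partial>unit_lebesgue)) \<partial>lborel)"
    by ((subst nn_integral_cmult; (measurable; fail)?)+, simp?)
  also have "\<dots> = (\<integral>\<^sup>+x. ennreal (f x) * (ennreal (f (z - x)) * (\<integral>\<^sup>+s'. \<integral>\<^sup>+s. ?F x s s' \<partial>unit_lebesgue \<partial>unit_lebesgue)) \<partial>lborel)"
  proof (subst unit_unit.Fubini', goal_cases)
    case (1 x) show ?case by measurable
  qed (use \<omega> in simp_all)
  \<comment> \<open>The substitution of \<open>z - x\<close> for \<open>x\<close> makes the forced
    size the free one.\<close>
  also have "\<dots> = (\<integral>\<^sup>+x. ennreal (f (z - x)) * (ennreal (f (z - (z - x))) * (\<integral>\<^sup>+s'. \<integral>\<^sup>+s. ?F (z - x) s s' \<partial>unit_lebesgue \<partial>unit_lebesgue)) \<partial>lborel)"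
    by (rule nn_integral_reflect[symmetric]) measurable
  also have "\<dots> = (\<integral>\<^sup>+x. ennreal (f x) * (ennreal (f (z - x)) * (\<integral>\<^sup>+s'. \<integral>\<^sup>+s. F (s', x) (insert_jump (s, z - x) (insert_jump (s', x) \<omega>)) \<partial>unit_lebesgue \<partial>unit_lebesgue)) \<partial>lborel)"
    by (subst insert_jump_commute) (simp add: mult.left_commute)
  also have "\<dots> = (\<integral>\<^sup>+x. \<integral>\<^sup>+s'. ennreal (f x) * (ennreal (f (z - x)) * (\<integral>\<^sup>+s. F (s', x) (insert_jump (s, z - x) (insert_jump (s', x) \<omega>)) \<partial>unit_lebesgue)) \<partial>unit_lebesgue \<partial>lborel)"
    by ((subst nn_integral_cmult; (measurable; fail)?)+, simp?)
  also have "\<dots> = first_mark_sum (Suc n) z \<omega> F"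
    unfolding 0 first_mark_sum.simps pinned_sum.simps
  proof (subst nn_integral_mark_lebesgue, goal_cases)
    case 1 show ?case by measurable
  qed (use \<omega> in simp_all)
  finally show ?thesis .
next
  case (Suc m)
  note \<omega>[measurable (raw)]
  note [measurable (raw)] = measurable_curried[OF F]
  let ?F = "\<lambda>\<gamma> \<gamma>'. ennreal (f (snd \<gamma>)) * (ennreal (f (snd \<gamma>')) * pinned_sum m (z - snd \<gamma> - snd \<gamma>') (insert_jump \<gamma>' (insert_jump \<gamma> \<omega>)) (F \<gamma>'))"
  have "(\<integral>\<^sup>+\<gamma>. ennreal (f (snd \<gamma>)) * first_mark_sum n (z - snd \<gamma>) (insert_jump \<gamma> \<omega>) F \<partial>mark_lebesgue) =
    (\<integral>\<^sup>+\<gamma>. \<integral>\<^sup>+\<gamma>'. ?F \<gamma> \<gamma>' \<partial>mark_lebesgue \<partial>mark_lebesgue)"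
    unfolding Suc first_mark_sum.simps
  proof (intro nn_integral_cong)
    fix \<gamma> assume [measurable (raw)]: "\<gamma> \<in> space mark_lebesgue"
    then have [measurable (raw)]: "\<gamma> \<in> space marks" by (simp add: space_marks space_mark_lebesgue)
    show "ennreal (f (snd \<gamma>)) * (\<integral>\<^sup>+\<gamma>'. ennreal (f (snd \<gamma>')) * pinned_sum m (z - snd \<gamma> - snd \<gamma>') (insert_jump \<gamma>' (insert_jump \<gamma> \<omega>)) (F \<gamma>') \<partial>mark_lebesgue)
      = (\<integral>\<^sup>+\<gamma>'. ?F \<gamma> \<gamma>' \<partial>mark_lebesgue)"
      by (rule nn_integral_cmult[symmetric]) measurable
  qed
  also have "\<dots> = (\<integral>\<^sup>+\<gamma>'. \<integral>\<^sup>+\<gamma>. ?F \<gamma> \<gamma>' \<partial>mark_lebesgue \<partial>mark_lebesgue)"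
    by (rule mark_mark.Fubini') measurable
  also have "\<dots> = (\<integral>\<^sup>+\<gamma>'. \<integral>\<^sup>+\<gamma>. ennreal (f (snd \<gamma>')) * (ennreal (f (snd \<gamma>)) *
      pinned_sum m (z - snd \<gamma>' - snd \<gamma>) (insert_jump \<gamma> (insert_jump \<gamma>' \<omega>)) (F \<gamma>')) \<partial>mark_lebesgue \<partial>mark_lebesgue)"
    by (subst insert_jump_commute) (simp add: mult.left_commute algebra_simps)
  also have "\<dots> = first_mark_sum (Suc n) z \<omega> F"
    unfolding Suc first_mark_sum.simps pinned_sum.simps
  proof (intro nn_integral_cong)
    fix \<gamma> assume [measurable (raw)]: "\<gamma> \<in> space mark_lebesgue"
    then have [measurable (raw)]: "\<gamma> \<in> space marks" by (simp add: space_marks space_mark_lebesgue)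
    show "(\<integral>\<^sup>+\<gamma>'. ennreal (f (snd \<gamma>)) * (ennreal (f (snd \<gamma>')) *
        pinned_sum m (z - snd \<gamma> - snd \<gamma>') (insert_jump \<gamma>' (insert_jump \<gamma> \<omega>)) (F \<gamma>)) \<partial>mark_lebesgue) =
      ennreal (f (snd \<gamma>)) * (\<integral>\<^sup>+\<gamma>'. ennreal (f (snd \<gamma>')) *
        pinned_sum m (z - snd \<gamma> - snd \<gamma>') (insert_jump \<gamma>' (insert_jump \<gamma> \<omega>)) (F \<gamma>) \<partial>mark_lebesgue)"
      by (rule nn_integral_cmult) measurable
  qed
  finally show ?thesis .
qed

lemma measurable_first_mark_sum:
  assumes F: "(\<lambda>(\<gamma>, \<omega>). F \<gamma> \<omega>) \<in> borel_measurable (marks \<Otimes>\<^sub>M path_space)"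
    and [measurable]: "z \<in> borel_measurable M" "g \<in> M \<rightarrow>\<^sub>M path_space"
  shows "(\<lambda>p. first_mark_sum n (z p) (g p) F) \<in> borel_measurable M"
proof -
  note [measurable (raw)] = measurable_curried[OF F]
  show ?thesis by (cases n) (simp_all, measurable)
qed

text \<open>Campbell's formula: by exchangeability each of the inserted marks may be taken to be the first one.\<close>

lemma pinned_sum_jump_sum:
  assumes F: "(\<lambda>(\<gamma>, \<omega>). F \<gamma> \<omega>) \<in> borel_measurable (marks \<Otimes>\<^sub>M path_space)"
    and "\<omega> \<in> space path_space" "z \<noteq> 0"
  shows "pinned_sum n z \<omega> (\<lambda>\<omega>'. jump_sum (\<lambda>\<gamma>. F \<gamma> \<omega>') \<omega>') =
    of_nat (Suc n) * first_mark_sum n z \<omega> F + pinned_sum n z \<omega> (\<lambda>\<omega>'. jump_sum (\<lambda>\<gamma>. F \<gamma> \<omega>') \<omega>)"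
  using assms(2,3)
proof (induction n arbitrary: z \<omega>)
  case (0 z \<omega>)
  note 0(1)[measurable (raw)]
  note [measurable (raw)] = measurable_curried[OF F]
  have c: "cadlag \<omega>" using 0 by (simp add: space_path_space)
  have "(\<integral>\<^sup>+s. jump_sum (\<lambda>\<gamma>. F \<gamma> (insert_jump (s, z) \<omega>)) (insert_jump (s, z) \<omega>) \<partial>unit_lebesgue) =
    (\<integral>\<^sup>+s. F (s, z) (insert_jump (s, z) \<omega>) + jump_sum (\<lambda>\<gamma>. F \<gamma> (insert_jump (s, z) \<omega>)) \<omega> \<partial>unit_lebesgue)"
    by (rule nn_integral_cong_AE, rule AE_mp[OF AE_unit_lebesgue[OF countable_jump_times[OF c]]])
       (use 0 in \<open>auto simp: jump_sum_insert_jump\<close>)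
  also have "\<dots> = (\<integral>\<^sup>+s. F (s, z) (insert_jump (s, z) \<omega>) \<partial>unit_lebesgue) + (\<integral>\<^sup>+s. jump_sum (\<lambda>\<gamma>. F \<gamma> (insert_jump (s, z) \<omega>)) \<omega> \<partial>unit_lebesgue)"
    by (rule nn_integral_add) measurable
  finally show ?case by (simp add: distrib_left)
next
  case (Suc n z \<omega>)
  note Suc.prems(1)[measurable (raw)]
  note [measurable (raw)] = measurable_curried[OF F] measurable_first_mark_sum[OF F]
  have c: "cadlag \<omega>" using Suc by (simp add: space_path_space)
  let ?f = "\<lambda>\<gamma>. ennreal (f (snd \<gamma>))" and ?P = "\<lambda>\<gamma>. pinned_sum n (z - snd \<gamma>) (insert_jump \<gamma> \<omega>)"
  have "pinned_sum (Suc n) z \<omega> (\<lambda>\<omega>'. jump_sum (\<lambda>\<gamma>. F \<gamma> \<omega>') \<omega>') =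
     (\<integral>\<^sup>+\<gamma>. of_nat (Suc n) * (?f \<gamma> * first_mark_sum n (z - snd \<gamma>) (insert_jump \<gamma> \<omega>) F) + (?f \<gamma> * ?P \<gamma> (F \<gamma>) +
        ?f \<gamma> * ?P \<gamma> (\<lambda>\<omega>'. jump_sum (\<lambda>\<gamma>. F \<gamma> \<omega>') \<omega>)) \<partial>mark_lebesgue)"
    unfolding pinned_sum.simps
  \<comment> \<open>Size 0 is excluded because it creates no jump, size \<open>z\<close> because the
    remaining total would be 0, to which the induction hypothesis does not apply.\<close>
  proof (rule nn_integral_cong_AE, rule AE_mp[OF AE_mark_lebesgue[OF countable_jump_times[OF c], of "{0, z}"]])
    show "AE \<gamma> in mark_lebesgue. 0 < fst \<gamma> \<and> fst \<gamma> \<le> 1 \<and> fst \<gamma> \<notin> jump_times \<omega> \<and> snd \<gamma> \<notin> {0, z} \<longrightarrow>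
       ?f \<gamma> * ?P \<gamma> (\<lambda>\<omega>'. jump_sum (\<lambda>\<gamma>. F \<gamma> \<omega>') \<omega>') =
       of_nat (Suc n) * (?f \<gamma> * first_mark_sum n (z - snd \<gamma>) (insert_jump \<gamma> \<omega>) F) + (?f \<gamma> * ?P \<gamma> (F \<gamma>) +
        ?f \<gamma> * ?P \<gamma> (\<lambda>\<omega>'. jump_sum (\<lambda>\<gamma>. F \<gamma> \<omega>') \<omega>))"
    proof (intro AE_I2 impI)
      fix \<gamma> assume \<gamma>: "\<gamma> \<in> space mark_lebesgue"
        "0 < fst \<gamma> \<and> fst \<gamma> \<le> 1 \<and> fst \<gamma> \<notin> jump_times \<omega> \<and> snd \<gamma> \<notin> {0, z}"
      from \<gamma>(1) have [measurable (raw)]: "\<gamma> \<in> space marks" by (simp add: space_marks space_mark_lebesgue)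
      have "?P \<gamma> (\<lambda>\<omega>'. jump_sum (\<lambda>\<gamma>. F \<gamma> \<omega>') \<omega>') =
         of_nat (Suc n) * first_mark_sum n (z - snd \<gamma>) (insert_jump \<gamma> \<omega>) F + ?P \<gamma> (\<lambda>\<omega>'. jump_sum (\<lambda>\<gamma>. F \<gamma> \<omega>') (insert_jump \<gamma> \<omega>))"
        using Suc \<gamma> by (intro Suc.IH) auto
      \<comment> \<open>The base path of the induction hypothesis contains the new mark, which
        contributes one further term besides the jumps of the original base path.\<close>
      also have "?P \<gamma> (\<lambda>\<omega>'. jump_sum (\<lambda>\<gamma>. F \<gamma> \<omega>') (insert_jump \<gamma> \<omega>)) = ?P \<gamma> (\<lambda>\<omega>'. F \<gamma> \<omega>' + jump_sum (\<lambda>\<gamma>. F \<gamma> \<omega>') \<omega>)"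
        using \<gamma> Suc by (simp add: jump_sum_insert_jump)
      also have "\<dots> = ?P \<gamma> (F \<gamma>) + ?P \<gamma> (\<lambda>\<omega>'. jump_sum (\<lambda>\<gamma>. F \<gamma> \<omega>') \<omega>)"
      proof (rule pinned_sum_add)
        show "F \<gamma> \<in> borel_measurable path_space" by measurable
        show "(\<lambda>\<omega>'. jump_sum (\<lambda>\<gamma>. F \<gamma> \<omega>') \<omega>) \<in> borel_measurable path_space" by measurable
      qed (use Suc in simp)
      finally show "?f \<gamma> * ?P \<gamma> (\<lambda>\<omega>'. jump_sum (\<lambda>\<gamma>. F \<gamma> \<omega>') \<omega>') =
        of_nat (Suc n) * (?f \<gamma> * first_mark_sum n (z - snd \<gamma>) (insert_jump \<gamma> \<omega>) F) + (?f \<gamma> * ?P \<gamma> (F \<gamma>) +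
         ?f \<gamma> * ?P \<gamma> (\<lambda>\<omega>'. jump_sum (\<lambda>\<gamma>. F \<gamma> \<omega>') \<omega>))"
        by (simp add: distrib_left ac_simps)
    qed
  qed simp
  also have "\<dots> = of_nat (Suc n) * (\<integral>\<^sup>+\<gamma>. ?f \<gamma> * first_mark_sum n (z - snd \<gamma>) (insert_jump \<gamma> \<omega>) F \<partial>mark_lebesgue) +
     ((\<integral>\<^sup>+\<gamma>. ?f \<gamma> * ?P \<gamma> (F \<gamma>) \<partial>mark_lebesgue) + (\<integral>\<^sup>+\<gamma>. ?f \<gamma> * ?P \<gamma> (\<lambda>\<omega>'. jump_sum (\<lambda>\<gamma>. F \<gamma> \<omega>') \<omega>) \<partial>mark_lebesgue))"
    by ((subst nn_integral_add nn_integral_cmult; (measurable; fail)?)+, simp?)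
  also have "(\<integral>\<^sup>+\<gamma>. ?f \<gamma> * first_mark_sum n (z - snd \<gamma>) (insert_jump \<gamma> \<omega>) F \<partial>mark_lebesgue) = first_mark_sum (Suc n) z \<omega> F"
    using Suc by (intro first_mark_sum_swap F)
  also have "(\<integral>\<^sup>+\<gamma>. ?f \<gamma> * ?P \<gamma> (F \<gamma>) \<partial>mark_lebesgue) = first_mark_sum (Suc n) z \<omega> F" by simp
  \<comment> \<open>The \<open>Suc n\<close> marks of the inner sum, each swapped to the front, and
    the mark already in front give the factor \<open>Suc (Suc n)\<close>.\<close>
  finally have "pinned_sum (Suc n) z \<omega> (\<lambda>\<omega>'. jump_sum (\<lambda>\<gamma>. F \<gamma> \<omega>') \<omega>') = of_nat (Suc n) * first_mark_sum (Suc n) z \<omega> F +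
     (first_mark_sum (Suc n) z \<omega> F + pinned_sum (Suc n) z \<omega> (\<lambda>\<omega>'. jump_sum (\<lambda>\<gamma>. F \<gamma> \<omega>') \<omega>))"
    by simp
  then show ?case
    by (simp only: of_nat_Suc[of "Suc n"] distrib_right mult_1_left add.assoc add.left_commute)
qed

end

section \<open>Splitting and merging jumps\<close>

definition merge_sum ::
  "(real \<Rightarrow> real) \<Rightarrow> (mark \<times> mark \<times> mark \<times> (real \<Rightarrow> real) \<Rightarrow> ennreal) \<Rightarrow> (real \<Rightarrow> real) \<Rightarrow> ennreal" where
  "merge_sum f \<Phi> \<omega> = (\<integral>\<^sup>+(s1, s2).
              (\<integral>\<^sup>+t. \<Phi> ((t, jump \<omega> s1 + jump \<omega> s2), (s1, jump \<omega> s1), (s2, jump \<omega> s2), \<omega>)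
                \<partial>unit_lebesgue)
              * ennreal (chi f (jump \<omega> s1) (jump \<omega> s2))
            \<partial>count_space {(s1, s2). s1 \<in> jump_times \<omega> \<and> s2 \<in> jump_times \<omega> \<and> s1 \<noteq> s2})"

lemma splitting_identity_iff:
  "splitting_identity f Q \<longleftrightarrow> (\<forall>\<Phi> \<in> borel_measurable (marks \<Otimes>\<^sub>M marks \<Otimes>\<^sub>M marks \<Otimes>\<^sub>M path_space).
     (\<integral>\<^sup>+\<omega>. split_op \<Phi> \<omega> \<partial>Q) = (\<integral>\<^sup>+\<omega>. merge_sum f \<Phi> \<omega> \<partial>Q))"
  unfolding splitting_identity_def merge_sum_def mark_space_def ..

text \<open>As nested jump sums over marks the expression becomes accessible to Campbell's formula
  and to the measurability of \<open>jump_sum\<close>.\<close>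

lemma merge_sum_eq:
  "merge_sum f \<Phi> \<omega> = jump_sum (\<lambda>\<gamma>1. jump_sum (\<lambda>\<gamma>2. if fst \<gamma>1 \<noteq> fst \<gamma>2 then
     (\<integral>\<^sup>+t. \<Phi> ((t, snd \<gamma>1 + snd \<gamma>2), \<gamma>1, \<gamma>2, \<omega>) \<partial>unit_lebesgue) * ennreal (chi f (snd \<gamma>1) (snd \<gamma>2)) else 0) \<omega>) \<omega>"
proof -
  let ?J = "jump_times \<omega>"
  let ?K = "\<lambda>s1 s2. (\<integral>\<^sup>+t. \<Phi> ((t, jump \<omega> s1 + jump \<omega> s2), (s1, jump \<omega> s1), (s2, jump \<omega> s2), \<omega>) \<partial>unit_lebesgue)
     * ennreal (chi f (jump \<omega> s1) (jump \<omega> s2))"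
  let ?P = "{(s1, s2). s1 \<in> ?J \<and> s2 \<in> ?J \<and> s1 \<noteq> s2}"
  have "merge_sum f \<Phi> \<omega> = (\<integral>\<^sup>+p. (case p of (s1, s2) \<Rightarrow> ?K s1 s2) * indicator ?P p \<partial>count_space UNIV)"
    unfolding merge_sum_def by (rule nn_integral_count_space_indicator) simp
  also have "\<dots> = (\<integral>\<^sup>+s1. \<integral>\<^sup>+s2. ?K s1 s2 * indicator ?P (s1, s2) \<partial>count_space UNIV \<partial>count_space UNIV)"
    by (subst nn_integral_fst_count_space[symmetric]) simp
  also have "\<dots> = (\<integral>\<^sup>+s1. (\<integral>\<^sup>+s2. (if s1 \<noteq> s2 then ?K s1 s2 else 0) * indicator ?J s2 \<partial>count_space UNIV) * indicator ?J s1 \<partial>count_space UNIV)"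
    by (rule nn_integral_cong) (auto simp: indicator_def intro!: nn_integral_cong)
  also have "\<dots> = (\<integral>\<^sup>+s1. (\<integral>\<^sup>+s2. (if s1 \<noteq> s2 then ?K s1 s2 else 0) \<partial>count_space ?J) \<partial>count_space ?J)"
    by (simp add: nn_integral_count_space_indicator)
  finally show ?thesis unfolding jump_sum_def fst_conv snd_conv .
qed

lemma chi_measurable [measurable (raw)]:
  assumes [measurable]: "f \<in> borel_measurable borel" "g \<in> borel_measurable M" "h \<in> borel_measurable M"
  shows "(\<lambda>x. chi f (g x) (h x)) \<in> borel_measurable M"
  unfolding chi_def by measurable

lemma measurable_mark_neq:
  assumes "g \<in> M \<rightarrow>\<^sub>M marks" "h \<in> M \<rightarrow>\<^sub>M marks"
  shows "Measurable.pred M (\<lambda>x. fst (g x) \<noteq> fst (h x))"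
  using assms[THEN measurable_mark_time] by measurable

lemma measurable_merge_sum [measurable]:
  assumes [measurable]: "\<Phi> \<in> borel_measurable (marks \<Otimes>\<^sub>M marks \<Otimes>\<^sub>M marks \<Otimes>\<^sub>M path_space)" "f \<in> borel_measurable borel"
  shows "merge_sum f \<Phi> \<in> borel_measurable path_space"
proof -
  note [measurable (raw)] = measurable_mark_neq
  show ?thesis unfolding merge_sum_eq by measurable
qed

lemma nn_integral_return_borel:
  "g \<in> borel_measurable borel \<Longrightarrow> (\<integral>\<^sup>+x. g x \<partial>return borel (a :: real)) = g a"
  by (rule nn_integral_return) auto

text \<open>The point mass forces the second size to be the rest of the split jump; the first time
  and size combine into one integral over marks.\<close>

lemma split_op_eq:
  assumes [measurable]: "\<Phi> \<in> borel_measurable (marks \<Otimes>\<^sub>M marks \<Otimes>\<^sub>M marks \<Otimes>\<^sub>M path_space)"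
    and \<omega> [measurable (raw)]: "\<omega> \<in> space path_space"
  shows "split_op \<Phi> \<omega> = jump_sum (\<lambda>\<gamma>. \<integral>\<^sup>+\<gamma>1. \<integral>\<^sup>+s2. \<Phi> (\<gamma>, \<gamma>1, (s2, snd \<gamma> - snd \<gamma>1),
     split_path \<gamma> \<gamma>1 (s2, snd \<gamma> - snd \<gamma>1) \<omega>) \<partial>unit_lebesgue \<partial>mark_lebesgue) \<omega>"
  unfolding split_op_def jump_sum_def
proof (rule nn_integral_cong)
  fix t assume "t \<in> space (count_space (jump_times \<omega>))"
  then have t: "t \<in> {0..1}" using jump_times_subset[of \<omega>] by auto
  then have \<gamma> [measurable (raw)]: "(t, jump \<omega> t) \<in> space marks" by (simp add: space_marks)
  let ?F = "\<lambda>x1 x2 s1 s2. \<Phi> ((t, jump \<omega> t), (s1, x1), (s2, x2), split_path (t, jump \<omega> t) (s1, x1) (s2, x2) \<omega>)"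
  have m: "(\<lambda>x. ?F (fst (fst (fst x))) (snd (fst (fst x))) (snd (fst x)) (snd x))
      \<in> borel_measurable (((borel \<Otimes>\<^sub>M borel) \<Otimes>\<^sub>M unit_lebesgue) \<Otimes>\<^sub>M unit_lebesgue)"
    using measurable_const[OF \<gamma>] by measurable
  then have [measurable (raw)]: "(\<lambda>x. ?F (a x) (b x) (c x) (d x)) \<in> borel_measurable M"
    if "a \<in> borel_measurable M" "b \<in> borel_measurable M" "c \<in> M \<rightarrow>\<^sub>M unit_lebesgue" "d \<in> M \<rightarrow>\<^sub>M unit_lebesgue"
    for a b c d and M :: "'x measure"
    using measurable_compose[OF measurable_Pair[OF measurable_Pair[OF measurable_Pair[OF that(1,2)] that(3)] that(4)] m] by simp
  have "(\<integral>\<^sup>+x1. \<integral>\<^sup>+x2. \<integral>\<^sup>+s1. \<integral>\<^sup>+s2. ?F x1 x2 s1 s2 \<partial>unit_lebesgue \<partial>unit_lebesgue \<partial>return borel (jump \<omega> t - x1) \<partial>lborel) =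
    (\<integral>\<^sup>+x1. \<integral>\<^sup>+s1. \<integral>\<^sup>+s2. ?F x1 (jump \<omega> t - x1) s1 s2 \<partial>unit_lebesgue \<partial>unit_lebesgue \<partial>lborel)"
    by (intro nn_integral_cong nn_integral_return_borel) measurable
  also have "\<dots> = (\<integral>\<^sup>+\<gamma>1. \<integral>\<^sup>+s2. ?F (snd \<gamma>1) (jump \<omega> t - snd \<gamma>1) (fst \<gamma>1) s2 \<partial>unit_lebesgue \<partial>mark_lebesgue)"
  proof (subst nn_integral_mark_lebesgue, goal_cases)
    case 1
    show ?case using measurable_const[OF \<gamma>] by measurable
  qed simp
  finally show "(\<integral>\<^sup>+x1. \<integral>\<^sup>+x2. \<integral>\<^sup>+s1. \<integral>\<^sup>+s2. ?F x1 x2 s1 s2 \<partial>unit_lebesgue \<partial>unit_lebesgue \<partial>return borel (jump \<omega> t - x1) \<partial>lborel) =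
    (\<integral>\<^sup>+\<gamma>1. \<integral>\<^sup>+s2. \<Phi> ((t, jump \<omega> t), \<gamma>1, (s2, snd (t, jump \<omega> t) - snd \<gamma>1),
     split_path (t, jump \<omega> t) \<gamma>1 (s2, snd (t, jump \<omega> t) - snd \<gamma>1) \<omega>) \<partial>unit_lebesgue \<partial>mark_lebesgue)"
    by simp
qed

lemma measurable_split_op [measurable]:
  assumes [measurable]: "\<Phi> \<in> borel_measurable (marks \<Otimes>\<^sub>M marks \<Otimes>\<^sub>M marks \<Otimes>\<^sub>M path_space)"
  shows "split_op \<Phi> \<in> borel_measurable path_space"
proof -
  have "(\<lambda>\<omega>. jump_sum (\<lambda>\<gamma>. \<integral>\<^sup>+\<gamma>1. \<integral>\<^sup>+s2. \<Phi> (\<gamma>, \<gamma>1, (s2, snd \<gamma> - snd \<gamma>1),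
     split_path \<gamma> \<gamma>1 (s2, snd \<gamma> - snd \<gamma>1) \<omega>) \<partial>unit_lebesgue \<partial>mark_lebesgue) \<omega>) \<in> borel_measurable path_space"
    by measurable
  also have "?this \<longleftrightarrow> ?thesis"
    by (rule measurable_cong) (simp add: split_op_eq)
  finally show ?thesis .
qed

text \<open>The change of variables between (split mark, first part) and (first part, second part):
  for a fixed first part the total size is a translate of the second size, Lebesgue measure is
  translation invariant, and the times are exchanged by Fubini.\<close>

lemma split_merge_integral:
  fixes \<Theta> :: "mark \<Rightarrow> mark \<Rightarrow> mark \<Rightarrow> ennreal"
  assumes [measurable]: "(\<lambda>(\<gamma>, \<gamma>1, \<gamma>2). \<Theta> \<gamma> \<gamma>1 \<gamma>2) \<in> borel_measurable (marks \<Otimes>\<^sub>M marks \<Otimes>\<^sub>M marks)"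
  shows "(\<integral>\<^sup>+\<gamma>. \<integral>\<^sup>+\<gamma>1. \<integral>\<^sup>+s2. \<Theta> \<gamma> \<gamma>1 (s2, snd \<gamma> - snd \<gamma>1) \<partial>unit_lebesgue \<partial>mark_lebesgue \<partial>mark_lebesgue) =
    (\<integral>\<^sup>+\<gamma>1. \<integral>\<^sup>+\<gamma>2. \<integral>\<^sup>+t. \<Theta> (t, snd \<gamma>1 + snd \<gamma>2) \<gamma>1 \<gamma>2 \<partial>unit_lebesgue \<partial>mark_lebesgue \<partial>mark_lebesgue)"
proof -
  have m [measurable (raw)]: "(\<lambda>x. \<Theta> (a x) (b x) (c x)) \<in> borel_measurable M"
    if "a \<in> M \<rightarrow>\<^sub>M marks" "b \<in> M \<rightarrow>\<^sub>M marks" "c \<in> M \<rightarrow>\<^sub>M marks" for a b c and M :: "'x measure"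
    using measurable_compose[OF measurable_Pair[OF that(1) measurable_Pair[OF that(2,3)]] assms] by simp
  have "(\<integral>\<^sup>+\<gamma>. \<integral>\<^sup>+\<gamma>1. \<integral>\<^sup>+s2. \<Theta> \<gamma> \<gamma>1 (s2, snd \<gamma> - snd \<gamma>1) \<partial>unit_lebesgue \<partial>mark_lebesgue \<partial>mark_lebesgue) =
     (\<integral>\<^sup>+\<gamma>1. \<integral>\<^sup>+\<gamma>. \<integral>\<^sup>+s2. \<Theta> \<gamma> \<gamma>1 (s2, snd \<gamma> - snd \<gamma>1) \<partial>unit_lebesgue \<partial>mark_lebesgue \<partial>mark_lebesgue)"
    by (rule mark_mark.Fubini') measurable
  also have "\<dots> = (\<integral>\<^sup>+\<gamma>1. \<integral>\<^sup>+\<gamma>2. \<integral>\<^sup>+t. \<Theta> (t, snd \<gamma>1 + snd \<gamma>2) \<gamma>1 \<gamma>2 \<partial>unit_lebesgue \<partial>mark_lebesgue \<partial>mark_lebesgue)"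
  proof (rule nn_integral_cong)
    fix \<gamma>1 assume "\<gamma>1 \<in> space mark_lebesgue"
    then have [measurable (raw)]: "\<gamma>1 \<in> space marks" by (simp add: space_marks space_mark_lebesgue)
    let ?g = "\<lambda>x. \<integral>\<^sup>+t. \<integral>\<^sup>+s2. \<Theta> (t, snd \<gamma>1 + x) \<gamma>1 (s2, x) \<partial>unit_lebesgue \<partial>unit_lebesgue"
    have "(\<integral>\<^sup>+\<gamma>. \<integral>\<^sup>+s2. \<Theta> \<gamma> \<gamma>1 (s2, snd \<gamma> - snd \<gamma>1) \<partial>unit_lebesgue \<partial>mark_lebesgue) = (\<integral>\<^sup>+x. ?g (x - snd \<gamma>1) \<partial>lborel)"
    proof (subst nn_integral_mark_lebesgue, goal_cases)
      case 1 show ?case by measurable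
    qed simp
    also have "\<dots> = (\<integral>\<^sup>+x. ?g x \<partial>lborel)"
      by (rule nn_integral_shift) measurable
    also have "\<dots> = (\<integral>\<^sup>+x. \<integral>\<^sup>+s2. \<integral>\<^sup>+t. \<Theta> (t, snd \<gamma>1 + x) \<gamma>1 (s2, x) \<partial>unit_lebesgue \<partial>unit_lebesgue \<partial>lborel)"
      by (intro nn_integral_cong unit_unit.Fubini') measurable
    also have "\<dots> = (\<integral>\<^sup>+\<gamma>2. \<integral>\<^sup>+t. \<Theta> (t, snd \<gamma>1 + snd \<gamma>2) \<gamma>1 \<gamma>2 \<partial>unit_lebesgue \<partial>mark_lebesgue)"
    proof (subst nn_integral_mark_lebesgue, goal_cases)
      case 1 show ?case by measurable
    qed simp
    finally show "(\<integral>\<^sup>+\<gamma>. \<integral>\<^sup>+s2. \<Theta> \<gamma> \<gamma>1 (s2, snd \<gamma> - snd \<gamma>1) \<partial>unit_lebesgue \<partial>mark_lebesgue) =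
       (\<integral>\<^sup>+\<gamma>2. \<integral>\<^sup>+t. \<Theta> (t, snd \<gamma>1 + snd \<gamma>2) \<gamma>1 \<gamma>2 \<partial>unit_lebesgue \<partial>mark_lebesgue)" .
  qed
  finally show ?thesis .
qed

section \<open>The identity for a fixed number of jumps\<close>

context jump_density begin

text \<open>This is the purpose of \<open>chi\<close>: it turns the weight of two marks into the
  weight of the merged mark.\<close>

lemma chi_mult: "ennreal (f x1) * (ennreal (f x2) * ennreal (chi f x1 x2)) = ennreal (f (x1 + x2))"
  using f_pos[of x1] f_pos[of x2] f_pos[of "x1+x2"]
  by (simp add: chi_def ennreal_mult'[symmetric] less_imp_le)

lemma first_mark_sum_time_neq:
  "first_mark_sum n z \<omega> (\<lambda>\<gamma> \<omega>'. if t \<noteq> fst \<gamma> then F \<gamma> \<omega>' else 0) = first_mark_sum n z \<omega> F"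
proof (cases n)
  case 0
  show ?thesis unfolding 0 first_mark_sum.simps
    by (intro arg_cong[where f="\<lambda>x. _ * x"] nn_integral_cong_AE)
       (rule AE_mp[OF AE_unit_lebesgue[of "{t}"]], auto)
next
  case (Suc m)
  show ?thesis unfolding Suc first_mark_sum.simps
    by (intro nn_integral_cong_AE)
       (rule AE_mp[OF AE_mark_lebesgue[of "{t}" "{}"]], auto)
qed

lemma jump_sum_single:
  assumes "cadlag (insert_jump \<gamma> (const_path x))" and "\<And>x. F (fst \<gamma>, x) = 0"
  shows "jump_sum F (insert_jump \<gamma> (const_path x)) = 0"
proof -
  have "F (t, jump (insert_jump \<gamma> (const_path x)) t) = 0" if "t \<in> jump_times (insert_jump \<gamma> (const_path x))" for t
  proof -
    have "t = fst \<gamma>" using that by (auto simp: jump_times_iff jump_insert_jump cadlag_const_path split: if_splits)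
    then show ?thesis using assms(2) by simp
  qed
  then show ?thesis unfolding jump_sum_def by (intro nn_integral_0_iff_AE[THEN iffD2]) (auto simp: AE_count_space)
qed

text \<open>Campbell's formula applied twice; the factors count the choices of the first and then of
  the second mark. Unequal times exclude only the pairing of a mark with itself, since distinct
  marks share a time with probability zero. With one mark there is no pair.\<close>

lemma pinned_sum_pairs:
  assumes F: "(\<lambda>(\<gamma>1, \<gamma>2, \<omega>). F \<gamma>1 \<gamma>2 \<omega>) \<in> borel_measurable (marks \<Otimes>\<^sub>M marks \<Otimes>\<^sub>M path_space)"
    and "z \<noteq> 0"
  defines "G \<equiv> (\<lambda>\<gamma>1 \<gamma>2 \<omega>. if fst \<gamma>1 \<noteq> fst \<gamma>2 then F \<gamma>1 \<gamma>2 \<omega> else 0)"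
  shows "pinned_sum (Suc n) z (const_path x) (\<lambda>\<omega>. jump_sum (\<lambda>\<gamma>1. jump_sum (\<lambda>\<gamma>2. G \<gamma>1 \<gamma>2 \<omega>) \<omega>) \<omega>) =
      of_nat (Suc (Suc n)) * (of_nat (Suc n) * (\<integral>\<^sup>+\<gamma>1. ennreal (f (snd \<gamma>1)) *
        first_mark_sum n (z - snd \<gamma>1) (insert_jump \<gamma>1 (const_path x)) (F \<gamma>1) \<partial>mark_lebesgue))" (is ?S)
    and "pinned_sum 0 z (const_path x) (\<lambda>\<omega>. jump_sum (\<lambda>\<gamma>1. jump_sum (\<lambda>\<gamma>2. G \<gamma>1 \<gamma>2 \<omega>) \<omega>) \<omega>) = 0" (is ?Z)
proof -
  let ?\<omega> = "const_path x"
  have \<omega> [measurable (raw)]: "?\<omega> \<in> space path_space" by simp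
  have [measurable (raw)]: "(\<lambda>x. F (a x) (b x) (c x)) \<in> borel_measurable M"
    if "a \<in> M \<rightarrow>\<^sub>M marks" "b \<in> M \<rightarrow>\<^sub>M marks" "c \<in> M \<rightarrow>\<^sub>M path_space" for a b c and M :: "'x measure"
    using measurable_compose[OF measurable_Pair[OF that(1) measurable_Pair[OF that(2,3)]] F] by simp
  note [measurable (raw)] = measurable_mark_neq
  have Gm [measurable (raw)]: "(\<lambda>x. G (a x) (b x) (c x)) \<in> borel_measurable M"
    if [measurable]: "a \<in> M \<rightarrow>\<^sub>M marks" "b \<in> M \<rightarrow>\<^sub>M marks" "c \<in> M \<rightarrow>\<^sub>M path_space" for a b c and M :: "'x measure"
    unfolding G_def by measurable
  have Campbell: "pinned_sum n z ?\<omega> (\<lambda>\<omega>. jump_sum (\<lambda>\<gamma>1. jump_sum (\<lambda>\<gamma>2. G \<gamma>1 \<gamma>2 \<omega>) \<omega>) \<omega>) =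
     of_nat (Suc n) * first_mark_sum n z ?\<omega> (\<lambda>\<gamma>1 \<omega>. jump_sum (\<lambda>\<gamma>2. G \<gamma>1 \<gamma>2 \<omega>) \<omega>)" for n
  proof (subst pinned_sum_jump_sum, goal_cases)
    case 1 show ?case by measurable
  qed (use \<open>z \<noteq> 0\<close> in simp_all)
  show ?Z
    unfolding Campbell first_mark_sum.simps
    by (simp add: jump_sum_single G_def cadlag_insert_jump cadlag_const_path)
  have "first_mark_sum (Suc n) z ?\<omega> (\<lambda>\<gamma>1 \<omega>. jump_sum (\<lambda>\<gamma>2. G \<gamma>1 \<gamma>2 \<omega>) \<omega>) =
     (\<integral>\<^sup>+\<gamma>1. of_nat (Suc n) * (ennreal (f (snd \<gamma>1)) * first_mark_sum n (z - snd \<gamma>1) (insert_jump \<gamma>1 ?\<omega>) (F \<gamma>1)) \<partial>mark_lebesgue)"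
    unfolding first_mark_sum.simps
  proof (rule nn_integral_cong_AE, rule AE_mp[OF AE_mark_lebesgue[of "{}" "{z}"]])
    show "AE \<gamma> in mark_lebesgue. 0 < fst \<gamma> \<and> fst \<gamma> \<le> 1 \<and> fst \<gamma> \<notin> {} \<and> snd \<gamma> \<notin> {z} \<longrightarrow>
       ennreal (f (snd \<gamma>)) * pinned_sum n (z - snd \<gamma>) (insert_jump \<gamma> ?\<omega>) (\<lambda>\<omega>. jump_sum (\<lambda>\<gamma>2. G \<gamma> \<gamma>2 \<omega>) \<omega>) =
       of_nat (Suc n) * (ennreal (f (snd \<gamma>)) * first_mark_sum n (z - snd \<gamma>) (insert_jump \<gamma> ?\<omega>) (F \<gamma>))"
    proof (intro AE_I2 impI)
      fix \<gamma> assume \<gamma>: "\<gamma> \<in> space mark_lebesgue" "0 < fst \<gamma> \<and> fst \<gamma> \<le> 1 \<and> fst \<gamma> \<notin> {} \<and> snd \<gamma> \<notin> {z}"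
      then have [measurable (raw)]: "\<gamma> \<in> space marks" by (simp add: space_marks space_mark_lebesgue)
      have "pinned_sum n (z - snd \<gamma>) (insert_jump \<gamma> ?\<omega>) (\<lambda>\<omega>. jump_sum (\<lambda>\<gamma>2. G \<gamma> \<gamma>2 \<omega>) \<omega>) =
        of_nat (Suc n) * first_mark_sum n (z - snd \<gamma>) (insert_jump \<gamma> ?\<omega>) (G \<gamma>) +
        pinned_sum n (z - snd \<gamma>) (insert_jump \<gamma> ?\<omega>) (\<lambda>\<omega>. jump_sum (\<lambda>\<gamma>2. G \<gamma> \<gamma>2 \<omega>) (insert_jump \<gamma> ?\<omega>))"
      proof (rule pinned_sum_jump_sum)
        show "(\<lambda>(\<gamma>2, \<omega>). G \<gamma> \<gamma>2 \<omega>) \<in> borel_measurable (marks \<Otimes>\<^sub>M path_space)" by measurable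
      qed (use \<gamma> in simp_all)
      \<comment> \<open>The only jump of this base path is the first mark itself, and it may not be
        paired with itself.\<close>
      also have "(\<lambda>\<omega>. jump_sum (\<lambda>\<gamma>2. G \<gamma> \<gamma>2 \<omega>) (insert_jump \<gamma> ?\<omega>)) = (\<lambda>\<omega>. 0)"
        by (intro ext jump_sum_single) (auto simp: G_def cadlag_insert_jump cadlag_const_path)
      also have "first_mark_sum n (z - snd \<gamma>) (insert_jump \<gamma> ?\<omega>) (G \<gamma>) = first_mark_sum n (z - snd \<gamma>) (insert_jump \<gamma> ?\<omega>) (F \<gamma>)"
        unfolding G_def by (rule first_mark_sum_time_neq)
      finally show "ennreal (f (snd \<gamma>)) * pinned_sum n (z - snd \<gamma>) (insert_jump \<gamma> ?\<omega>) (\<lambda>\<omega>. jump_sum (\<lambda>\<gamma>2. G \<gamma> \<gamma>2 \<omega>) \<omega>) =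
        of_nat (Suc n) * (ennreal (f (snd \<gamma>)) * first_mark_sum n (z - snd \<gamma>) (insert_jump \<gamma> ?\<omega>) (F \<gamma>))"
        by (simp add: mult.left_commute)
    qed
  qed simp_all
  also have "\<dots> = of_nat (Suc n) * (\<integral>\<^sup>+\<gamma>1. ennreal (f (snd \<gamma>1)) * first_mark_sum n (z - snd \<gamma>1) (insert_jump \<gamma>1 ?\<omega>) (F \<gamma>1) \<partial>mark_lebesgue)"
  proof (rule nn_integral_cmult)
    have "(\<lambda>\<gamma>1. first_mark_sum n (z - snd \<gamma>1) (insert_jump \<gamma>1 ?\<omega>) (F \<gamma>1)) \<in> borel_measurable mark_lebesgue"
      by (cases n) (simp_all, measurable)
    then show "(\<lambda>\<gamma>1. ennreal (f (snd \<gamma>1)) * first_mark_sum n (z - snd \<gamma>1) (insert_jump \<gamma>1 ?\<omega>) (F \<gamma>1)) \<in> borel_measurable mark_lebesgue"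
      by measurable
  qed
  finally show ?S unfolding Campbell by simp
qed

text \<open>On the left one of \<open>n + 1\<close> marks is singled out, on the right an ordered
  pair among \<open>n + 2\<close>; the quotient of these counts is \<open>n + 2\<close>. What
  remains is an equality of integrals with the chosen marks free, given by the change of variables
  together with \<open>chi_mult\<close>.\<close>

lemma pinned_sum_split_op:
  assumes \<Phi> [measurable]: "\<Phi> \<in> borel_measurable (marks \<Otimes>\<^sub>M marks \<Otimes>\<^sub>M marks \<Otimes>\<^sub>M path_space)" and z: "z \<noteq> 0"
  shows "of_nat (Suc (Suc n)) * pinned_sum n z (const_path x) (split_op \<Phi>) =
     pinned_sum (Suc n) z (const_path x) (merge_sum f \<Phi>)"
proof -
  let ?\<omega> = "const_path x"
  have \<omega> [measurable (raw)]: "?\<omega> \<in> space path_space" by simp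
  define F where "F \<gamma> \<omega> = (\<integral>\<^sup>+\<gamma>1. \<integral>\<^sup>+s2. \<Phi> (\<gamma>, \<gamma>1, (s2, snd \<gamma> - snd \<gamma>1),
     split_path \<gamma> \<gamma>1 (s2, snd \<gamma> - snd \<gamma>1) \<omega>) \<partial>unit_lebesgue \<partial>mark_lebesgue)" for \<gamma> \<omega>
  define K where "K \<gamma>1 \<gamma>2 \<omega> = (\<integral>\<^sup>+t. \<Phi> ((t, snd \<gamma>1 + snd \<gamma>2), \<gamma>1, \<gamma>2, \<omega>) \<partial>unit_lebesgue) * ennreal (chi f (snd \<gamma>1) (snd \<gamma>2))" for \<gamma>1 \<gamma>2 \<omega>
  have F [measurable]: "(\<lambda>(\<gamma>, \<omega>). F \<gamma> \<omega>) \<in> borel_measurable (marks \<Otimes>\<^sub>M path_space)"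
    unfolding F_def by measurable
  have K [measurable]: "(\<lambda>(\<gamma>1, \<gamma>2, \<omega>). K \<gamma>1 \<gamma>2 \<omega>) \<in> borel_measurable (marks \<Otimes>\<^sub>M marks \<Otimes>\<^sub>M path_space)"
    unfolding K_def by measurable
  \<comment> \<open>On a path containing the mark being split, splitting is the insertion of the two
    parts in its place; parts at time 0 form a null set.\<close>
  have F_insert: "F \<gamma> (insert_jump \<gamma> \<omega>) = (\<integral>\<^sup>+\<gamma>1. \<integral>\<^sup>+s2. \<Phi> (\<gamma>, \<gamma>1, (s2, snd \<gamma> - snd \<gamma>1),
     insert_jump (s2, snd \<gamma> - snd \<gamma>1) (insert_jump \<gamma>1 \<omega>)) \<partial>unit_lebesgue \<partial>mark_lebesgue)" if "0 < fst \<gamma>" for \<gamma> \<omega>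
    unfolding F_def
  proof (rule nn_integral_cong_AE)
    have *: "(\<integral>\<^sup>+s2. \<Phi> (\<gamma>, \<gamma>1, (s2, snd \<gamma> - snd \<gamma>1), split_path \<gamma> \<gamma>1 (s2, snd \<gamma> - snd \<gamma>1) (insert_jump \<gamma> \<omega>)) \<partial>unit_lebesgue) =
      (\<integral>\<^sup>+s2. \<Phi> (\<gamma>, \<gamma>1, (s2, snd \<gamma> - snd \<gamma>1), insert_jump (s2, snd \<gamma> - snd \<gamma>1) (insert_jump \<gamma>1 \<omega>)) \<partial>unit_lebesgue)"
      if "0 < fst \<gamma>1" for \<gamma>1
      by (rule nn_integral_cong_AE, rule AE_mp[OF AE_unit_lebesgue[of "{}"]])
         (use \<open>0 < fst \<gamma>\<close> that in \<open>auto simp: split_path_insert_jump\<close>)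
    show "AE \<gamma>1 in mark_lebesgue.
      (\<integral>\<^sup>+s2. \<Phi> (\<gamma>, \<gamma>1, (s2, snd \<gamma> - snd \<gamma>1), split_path \<gamma> \<gamma>1 (s2, snd \<gamma> - snd \<gamma>1) (insert_jump \<gamma> \<omega>)) \<partial>unit_lebesgue) =
      (\<integral>\<^sup>+s2. \<Phi> (\<gamma>, \<gamma>1, (s2, snd \<gamma> - snd \<gamma>1), insert_jump (s2, snd \<gamma> - snd \<gamma>1) (insert_jump \<gamma>1 \<omega>)) \<partial>unit_lebesgue)"
      by (rule AE_mp[OF AE_mark_lebesgue[of "{}" "{}"]]) (auto simp: *)
  qed
  have L: "pinned_sum n z ?\<omega> (split_op \<Phi>) = of_nat (Suc n) * first_mark_sum n z ?\<omega> F"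
  proof -
    have "pinned_sum n z ?\<omega> (split_op \<Phi>) = pinned_sum n z ?\<omega> (\<lambda>\<omega>. jump_sum (\<lambda>\<gamma>. F \<gamma> \<omega>) \<omega>)"
      by (rule pinned_sum_cong) (simp_all add: split_op_eq F_def)
    then show ?thesis using pinned_sum_jump_sum[OF F _ z, of ?\<omega> n] by simp
  qed
  have R: "pinned_sum (Suc n) z ?\<omega> (merge_sum f \<Phi>) = of_nat (Suc (Suc n)) * (of_nat (Suc n) * (\<integral>\<^sup>+\<gamma>1. ennreal (f (snd \<gamma>1)) *
        first_mark_sum n (z - snd \<gamma>1) (insert_jump \<gamma>1 ?\<omega>) (K \<gamma>1) \<partial>mark_lebesgue))"
  proof -
    have "merge_sum f \<Phi> = (\<lambda>\<omega>. jump_sum (\<lambda>\<gamma>1. jump_sum (\<lambda>\<gamma>2. if fst \<gamma>1 \<noteq> fst \<gamma>2 then K \<gamma>1 \<gamma>2 \<omega> else 0) \<omega>) \<omega>)"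
      by (intro ext) (simp only: merge_sum_eq K_def)
    then show ?thesis using pinned_sum_pairs(1)[OF K z, of n x] by (simp only:)
  qed
  have chi2: "ennreal (f a) * (ennreal (f b) * (y * ennreal (chi f a b))) = ennreal (f (a + b)) * y" for a b y
    unfolding chi_mult[symmetric] by (simp add: ac_simps)
  have "first_mark_sum n z ?\<omega> F = (\<integral>\<^sup>+\<gamma>1. ennreal (f (snd \<gamma>1)) *
        first_mark_sum n (z - snd \<gamma>1) (insert_jump \<gamma>1 ?\<omega>) (K \<gamma>1) \<partial>mark_lebesgue)"
  proof (cases n)
    case 0
    \<comment> \<open>The only mark has the forced size \<open>z\<close>, so no total size is
      integrated and only the order of the time integrals has to change.\<close>
    let ?P = "\<lambda>t \<gamma>1 s2. \<Phi> ((t, z), \<gamma>1, (s2, z - snd \<gamma>1), insert_jump (s2, z - snd \<gamma>1) (insert_jump \<gamma>1 ?\<omega>))"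
    interpret um: pair_sigma_finite unit_lebesgue mark_lebesgue ..
    have "first_mark_sum n z ?\<omega> F = ennreal (f z) * (\<integral>\<^sup>+t. \<integral>\<^sup>+\<gamma>1. \<integral>\<^sup>+s2. ?P t \<gamma>1 s2 \<partial>unit_lebesgue \<partial>mark_lebesgue \<partial>unit_lebesgue)"
      unfolding 0 first_mark_sum.simps
      by (intro arg_cong[where f="\<lambda>x. _ * x"] nn_integral_cong_AE, rule AE_mp[OF AE_unit_lebesgue[of "{}"]])
         (auto simp: F_insert)
    also have "\<dots> = ennreal (f z) * (\<integral>\<^sup>+\<gamma>1. \<integral>\<^sup>+t. \<integral>\<^sup>+s2. ?P t \<gamma>1 s2 \<partial>unit_lebesgue \<partial>unit_lebesgue \<partial>mark_lebesgue)"
      by (subst um.Fubini'; (measurable; fail)?)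
    also have "(\<integral>\<^sup>+\<gamma>1. \<integral>\<^sup>+t. \<integral>\<^sup>+s2. ?P t \<gamma>1 s2 \<partial>unit_lebesgue \<partial>unit_lebesgue \<partial>mark_lebesgue) =
       (\<integral>\<^sup>+\<gamma>1. \<integral>\<^sup>+s2. \<integral>\<^sup>+t. ?P t \<gamma>1 s2 \<partial>unit_lebesgue \<partial>unit_lebesgue \<partial>mark_lebesgue)"
    proof (rule nn_integral_cong)
      fix \<gamma>1 assume "\<gamma>1 \<in> space mark_lebesgue"
      then have [measurable (raw)]: "\<gamma>1 \<in> space marks" by (simp add: space_marks space_mark_lebesgue)
      show "(\<integral>\<^sup>+t. \<integral>\<^sup>+s2. ?P t \<gamma>1 s2 \<partial>unit_lebesgue \<partial>unit_lebesgue) = (\<integral>\<^sup>+s2. \<integral>\<^sup>+t. ?P t \<gamma>1 s2 \<partial>unit_lebesgue \<partial>unit_lebesgue)"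
        by (rule unit_unit.Fubini') measurable
    qed
    also have "ennreal (f z) * \<dots> = (\<integral>\<^sup>+\<gamma>1. ennreal (f z) * (\<integral>\<^sup>+s2. \<integral>\<^sup>+t. ?P t \<gamma>1 s2 \<partial>unit_lebesgue \<partial>unit_lebesgue) \<partial>mark_lebesgue)"
      by (rule nn_integral_cmult[symmetric]) measurable
    also have "\<dots> = (\<integral>\<^sup>+\<gamma>1. ennreal (f (snd \<gamma>1)) *
        first_mark_sum n (z - snd \<gamma>1) (insert_jump \<gamma>1 ?\<omega>) (K \<gamma>1) \<partial>mark_lebesgue)"
    proof (rule nn_integral_cong)
      fix \<gamma>1 assume "\<gamma>1 \<in> space mark_lebesgue"
      then have [measurable (raw)]: "\<gamma>1 \<in> space marks" by (simp add: space_marks space_mark_lebesgue)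
      have "(\<integral>\<^sup>+s2. K \<gamma>1 (s2, z - snd \<gamma>1) (insert_jump (s2, z - snd \<gamma>1) (insert_jump \<gamma>1 ?\<omega>)) \<partial>unit_lebesgue) =
        (\<integral>\<^sup>+s2. \<integral>\<^sup>+t. ?P t \<gamma>1 s2 \<partial>unit_lebesgue \<partial>unit_lebesgue) * ennreal (chi f (snd \<gamma>1) (z - snd \<gamma>1))"
        unfolding K_def by (simp, intro nn_integral_multc) measurable
      then show "ennreal (f z) * (\<integral>\<^sup>+s2. \<integral>\<^sup>+t. ?P t \<gamma>1 s2 \<partial>unit_lebesgue \<partial>unit_lebesgue) =
        ennreal (f (snd \<gamma>1)) * first_mark_sum n (z - snd \<gamma>1) (insert_jump \<gamma>1 ?\<omega>) (K \<gamma>1)"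
        unfolding 0 first_mark_sum.simps by (simp only: chi2) simp
    qed
    finally show ?thesis .
  next
    case (Suc m)
    \<comment> \<open>The unselected marks are integrated out with the three distinguished marks
      held fixed, so the change of variables concerns a function of three marks only.\<close>
    define \<Psi> where "\<Psi> \<gamma> \<gamma>1 \<gamma>2 = pinned_sum m (z - snd \<gamma>) ?\<omega> (\<lambda>\<omega>. \<Phi> (\<gamma>, \<gamma>1, \<gamma>2, insert_jump \<gamma>2 (insert_jump \<gamma>1 \<omega>)))" for \<gamma> \<gamma>1 \<gamma>2
    have \<Psi> [measurable]: "(\<lambda>(\<gamma>, \<gamma>1, \<gamma>2). \<Psi> \<gamma> \<gamma>1 \<gamma>2) \<in> borel_measurable (marks \<Otimes>\<^sub>M marks \<Otimes>\<^sub>M marks)"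
      unfolding \<Psi>_def by measurable
    have \<Psi>m [measurable (raw)]: "(\<lambda>x. \<Psi> (a x) (b x) (c x)) \<in> borel_measurable M"
      if "a \<in> M \<rightarrow>\<^sub>M marks" "b \<in> M \<rightarrow>\<^sub>M marks" "c \<in> M \<rightarrow>\<^sub>M marks" for a b c and M :: "'x measure"
      using measurable_compose[OF measurable_Pair[OF that(1) measurable_Pair[OF that(2,3)]] \<Psi>] by simp
    have "first_mark_sum n z ?\<omega> F = (\<integral>\<^sup>+\<gamma>. \<integral>\<^sup>+\<gamma>1. \<integral>\<^sup>+s2. ennreal (f (snd \<gamma>)) * \<Psi> \<gamma> \<gamma>1 (s2, snd \<gamma> - snd \<gamma>1) \<partial>unit_lebesgue \<partial>mark_lebesgue \<partial>mark_lebesgue)"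
      unfolding Suc first_mark_sum.simps
    proof (rule nn_integral_cong_AE, rule AE_mp[OF AE_mark_lebesgue[of "{}" "{}"]])
      show "AE \<gamma> in mark_lebesgue. 0 < fst \<gamma> \<and> fst \<gamma> \<le> 1 \<and> fst \<gamma> \<notin> {} \<and> snd \<gamma> \<notin> {} \<longrightarrow>
        ennreal (f (snd \<gamma>)) * pinned_sum m (z - snd \<gamma>) (insert_jump \<gamma> ?\<omega>) (F \<gamma>) =
        (\<integral>\<^sup>+\<gamma>1. \<integral>\<^sup>+s2. ennreal (f (snd \<gamma>)) * \<Psi> \<gamma> \<gamma>1 (s2, snd \<gamma> - snd \<gamma>1) \<partial>unit_lebesgue \<partial>mark_lebesgue)"
      proof (intro AE_I2 impI)
        fix \<gamma> assume \<gamma>: "\<gamma> \<in> space mark_lebesgue" "0 < fst \<gamma> \<and> fst \<gamma> \<le> 1 \<and> fst \<gamma> \<notin> {} \<and> snd \<gamma> \<notin> {}"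
        then have [measurable (raw)]: "\<gamma> \<in> space marks" by (simp add: space_marks space_mark_lebesgue)
        have "pinned_sum m (z - snd \<gamma>) (insert_jump \<gamma> ?\<omega>) (F \<gamma>) =
          pinned_sum m (z - snd \<gamma>) ?\<omega> (\<lambda>\<omega>. \<integral>\<^sup>+\<gamma>1. \<integral>\<^sup>+s2. \<Phi> (\<gamma>, \<gamma>1, (s2, snd \<gamma> - snd \<gamma>1),
            insert_jump (s2, snd \<gamma> - snd \<gamma>1) (insert_jump \<gamma>1 \<omega>)) \<partial>unit_lebesgue \<partial>mark_lebesgue)"
          using \<gamma> by (simp add: pinned_sum_insert_jump F_insert)
        also have "\<dots> = (\<integral>\<^sup>+\<gamma>1. pinned_sum m (z - snd \<gamma>) ?\<omega> (\<lambda>\<omega>. \<integral>\<^sup>+s2. \<Phi> (\<gamma>, \<gamma>1, (s2, snd \<gamma> - snd \<gamma>1),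
            insert_jump (s2, snd \<gamma> - snd \<gamma>1) (insert_jump \<gamma>1 \<omega>)) \<partial>unit_lebesgue) \<partial>mark_lebesgue)"
          by (rule pinned_sum_Fubini[OF _ sigma_finite_mark_lebesgue \<omega>]) measurable
        also have "\<dots> = (\<integral>\<^sup>+\<gamma>1. \<integral>\<^sup>+s2. \<Psi> \<gamma> \<gamma>1 (s2, snd \<gamma> - snd \<gamma>1) \<partial>unit_lebesgue \<partial>mark_lebesgue)"
        proof (rule nn_integral_cong)
          fix \<gamma>1 assume "\<gamma>1 \<in> space mark_lebesgue"
          then have [measurable (raw)]: "\<gamma>1 \<in> space marks" by (simp add: space_marks space_mark_lebesgue)
          show "pinned_sum m (z - snd \<gamma>) ?\<omega> (\<lambda>\<omega>. \<integral>\<^sup>+s2. \<Phi> (\<gamma>, \<gamma>1, (s2, snd \<gamma> - snd \<gamma>1),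
            insert_jump (s2, snd \<gamma> - snd \<gamma>1) (insert_jump \<gamma>1 \<omega>)) \<partial>unit_lebesgue) =
            (\<integral>\<^sup>+s2. \<Psi> \<gamma> \<gamma>1 (s2, snd \<gamma> - snd \<gamma>1) \<partial>unit_lebesgue)"
            unfolding \<Psi>_def by (rule pinned_sum_Fubini[OF _ sigma_finite_unit_lebesgue \<omega>]) measurable
        qed
        finally have "ennreal (f (snd \<gamma>)) * pinned_sum m (z - snd \<gamma>) (insert_jump \<gamma> ?\<omega>) (F \<gamma>) =
          ennreal (f (snd \<gamma>)) * (\<integral>\<^sup>+\<gamma>1. \<integral>\<^sup>+s2. \<Psi> \<gamma> \<gamma>1 (s2, snd \<gamma> - snd \<gamma>1) \<partial>unit_lebesgue \<partial>mark_lebesgue)" by simp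
        also have "\<dots> = (\<integral>\<^sup>+\<gamma>1. ennreal (f (snd \<gamma>)) * (\<integral>\<^sup>+s2. \<Psi> \<gamma> \<gamma>1 (s2, snd \<gamma> - snd \<gamma>1) \<partial>unit_lebesgue) \<partial>mark_lebesgue)"
          by (rule nn_integral_cmult[symmetric]) measurable
        also have "\<dots> = (\<integral>\<^sup>+\<gamma>1. \<integral>\<^sup>+s2. ennreal (f (snd \<gamma>)) * \<Psi> \<gamma> \<gamma>1 (s2, snd \<gamma> - snd \<gamma>1) \<partial>unit_lebesgue \<partial>mark_lebesgue)"
        proof (rule nn_integral_cong)
          fix \<gamma>1 assume "\<gamma>1 \<in> space mark_lebesgue"
          then have [measurable (raw)]: "\<gamma>1 \<in> space marks" by (simp add: space_marks space_mark_lebesgue)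
          show "ennreal (f (snd \<gamma>)) * (\<integral>\<^sup>+s2. \<Psi> \<gamma> \<gamma>1 (s2, snd \<gamma> - snd \<gamma>1) \<partial>unit_lebesgue) = (\<integral>\<^sup>+s2. ennreal (f (snd \<gamma>)) * \<Psi> \<gamma> \<gamma>1 (s2, snd \<gamma> - snd \<gamma>1) \<partial>unit_lebesgue)"
            by (rule nn_integral_cmult[symmetric]) measurable
        qed
        finally show "ennreal (f (snd \<gamma>)) * pinned_sum m (z - snd \<gamma>) (insert_jump \<gamma> ?\<omega>) (F \<gamma>) =
          (\<integral>\<^sup>+\<gamma>1. \<integral>\<^sup>+s2. ennreal (f (snd \<gamma>)) * \<Psi> \<gamma> \<gamma>1 (s2, snd \<gamma> - snd \<gamma>1) \<partial>unit_lebesgue \<partial>mark_lebesgue)" .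
      qed
    qed simp_all
    also have "\<dots> = (\<integral>\<^sup>+\<gamma>1. \<integral>\<^sup>+\<gamma>2. \<integral>\<^sup>+t. ennreal (f (snd \<gamma>1 + snd \<gamma>2)) * \<Psi> (t, snd \<gamma>1 + snd \<gamma>2) \<gamma>1 \<gamma>2 \<partial>unit_lebesgue \<partial>mark_lebesgue \<partial>mark_lebesgue)"
      using split_merge_integral[of "\<lambda>\<gamma> \<gamma>1 \<gamma>2. ennreal (f (snd \<gamma>)) * \<Psi> \<gamma> \<gamma>1 \<gamma>2"] by simp
    also have "\<dots> = (\<integral>\<^sup>+\<gamma>1. ennreal (f (snd \<gamma>1)) *
        first_mark_sum n (z - snd \<gamma>1) (insert_jump \<gamma>1 ?\<omega>) (K \<gamma>1) \<partial>mark_lebesgue)"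
    proof (rule nn_integral_cong)
      fix \<gamma>1 assume "\<gamma>1 \<in> space mark_lebesgue"
      then have [measurable (raw)]: "\<gamma>1 \<in> space marks" by (simp add: space_marks space_mark_lebesgue)
      have "(\<integral>\<^sup>+t. ennreal (f (snd \<gamma>1 + snd \<gamma>2)) * \<Psi> (t, snd \<gamma>1 + snd \<gamma>2) \<gamma>1 \<gamma>2 \<partial>unit_lebesgue) =
        ennreal (f (snd \<gamma>1)) * (ennreal (f (snd \<gamma>2)) * pinned_sum m (z - snd \<gamma>1 - snd \<gamma>2) (insert_jump \<gamma>2 (insert_jump \<gamma>1 ?\<omega>)) (K \<gamma>1 \<gamma>2))"
        if "\<gamma>2 \<in> space mark_lebesgue" for \<gamma>2
      proof -
        have [measurable (raw)]: "\<gamma>2 \<in> space marks" using that by (simp add: space_marks space_mark_lebesgue)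
        let ?P = "\<lambda>t \<omega>. \<Phi> ((t, snd \<gamma>1 + snd \<gamma>2), \<gamma>1, \<gamma>2, insert_jump \<gamma>2 (insert_jump \<gamma>1 \<omega>))"
        have "pinned_sum m (z - snd \<gamma>1 - snd \<gamma>2) (insert_jump \<gamma>2 (insert_jump \<gamma>1 ?\<omega>)) (K \<gamma>1 \<gamma>2) =
          pinned_sum m (z - snd \<gamma>1 - snd \<gamma>2) ?\<omega> (\<lambda>\<omega>. ennreal (chi f (snd \<gamma>1) (snd \<gamma>2)) * (\<integral>\<^sup>+t. ?P t \<omega> \<partial>unit_lebesgue))"
          by (simp add: pinned_sum_insert_jump K_def insert_jump_commute[of \<gamma>1 \<gamma>2] mult.commute)
        also have "\<dots> = ennreal (chi f (snd \<gamma>1) (snd \<gamma>2)) * pinned_sum m (z - snd \<gamma>1 - snd \<gamma>2) ?\<omega> (\<lambda>\<omega>. \<integral>\<^sup>+t. ?P t \<omega> \<partial>unit_lebesgue)"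
          by (rule pinned_sum_mult[OF _ \<omega>]) measurable
        also have "pinned_sum m (z - snd \<gamma>1 - snd \<gamma>2) ?\<omega> (\<lambda>\<omega>. \<integral>\<^sup>+t. ?P t \<omega> \<partial>unit_lebesgue) = (\<integral>\<^sup>+t. \<Psi> (t, snd \<gamma>1 + snd \<gamma>2) \<gamma>1 \<gamma>2 \<partial>unit_lebesgue)"
          unfolding \<Psi>_def snd_conv diff_diff_eq
          by (rule pinned_sum_Fubini[OF _ sigma_finite_unit_lebesgue \<omega>]) measurable
        finally have "ennreal (f (snd \<gamma>1)) * (ennreal (f (snd \<gamma>2)) * pinned_sum m (z - snd \<gamma>1 - snd \<gamma>2) (insert_jump \<gamma>2 (insert_jump \<gamma>1 ?\<omega>)) (K \<gamma>1 \<gamma>2)) =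
          ennreal (f (snd \<gamma>1)) * (ennreal (f (snd \<gamma>2)) * ((\<integral>\<^sup>+t. \<Psi> (t, snd \<gamma>1 + snd \<gamma>2) \<gamma>1 \<gamma>2 \<partial>unit_lebesgue) * ennreal (chi f (snd \<gamma>1) (snd \<gamma>2))))"
          by (simp add: mult.commute)
        also have "\<dots> = ennreal (f (snd \<gamma>1 + snd \<gamma>2)) * (\<integral>\<^sup>+t. \<Psi> (t, snd \<gamma>1 + snd \<gamma>2) \<gamma>1 \<gamma>2 \<partial>unit_lebesgue)"
          by (rule chi2)
        also have "\<dots> = (\<integral>\<^sup>+t. ennreal (f (snd \<gamma>1 + snd \<gamma>2)) * \<Psi> (t, snd \<gamma>1 + snd \<gamma>2) \<gamma>1 \<gamma>2 \<partial>unit_lebesgue)"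
          by (rule nn_integral_cmult[symmetric]) measurable
        finally show ?thesis ..
      qed
      then have "(\<integral>\<^sup>+\<gamma>2. \<integral>\<^sup>+t. ennreal (f (snd \<gamma>1 + snd \<gamma>2)) * \<Psi> (t, snd \<gamma>1 + snd \<gamma>2) \<gamma>1 \<gamma>2 \<partial>unit_lebesgue \<partial>mark_lebesgue) =
        (\<integral>\<^sup>+\<gamma>2. ennreal (f (snd \<gamma>1)) * (ennreal (f (snd \<gamma>2)) * pinned_sum m (z - snd \<gamma>1 - snd \<gamma>2) (insert_jump \<gamma>2 (insert_jump \<gamma>1 ?\<omega>)) (K \<gamma>1 \<gamma>2)) \<partial>mark_lebesgue)"
        by (rule nn_integral_cong)
      also have "\<dots> = ennreal (f (snd \<gamma>1)) * first_mark_sum n (z - snd \<gamma>1) (insert_jump \<gamma>1 ?\<omega>) (K \<gamma>1)"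
        unfolding Suc first_mark_sum.simps
      proof (rule nn_integral_cmult)
        have [measurable (raw)]: "(\<lambda>x. K \<gamma>1 (b x) (c x)) \<in> borel_measurable M"
          if "b \<in> M \<rightarrow>\<^sub>M marks" "c \<in> M \<rightarrow>\<^sub>M path_space" for b c and M :: "'x measure"
          using measurable_compose[OF measurable_Pair[OF measurable_const measurable_Pair[OF that]] K, of \<gamma>1] \<open>\<gamma>1 \<in> space marks\<close> by simp
        show "(\<lambda>\<gamma>2. ennreal (f (snd \<gamma>2)) * pinned_sum m (z - snd \<gamma>1 - snd \<gamma>2) (insert_jump \<gamma>2 (insert_jump \<gamma>1 ?\<omega>)) (K \<gamma>1 \<gamma>2)) \<in> borel_measurable mark_lebesgue"
          by measurable
      qed
      finally show "(\<integral>\<^sup>+\<gamma>2. \<integral>\<^sup>+t. ennreal (f (snd \<gamma>1 + snd \<gamma>2)) * \<Psi> (t, snd \<gamma>1 + snd \<gamma>2) \<gamma>1 \<gamma>2 \<partial>unit_lebesgue \<partial>mark_lebesgue) =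
        ennreal (f (snd \<gamma>1)) * first_mark_sum n (z - snd \<gamma>1) (insert_jump \<gamma>1 ?\<omega>) (K \<gamma>1)" .
    qed
    finally show ?thesis .
  qed
  then show ?thesis unfolding L R by simp
qed

lemma pinned_sum_0_merge_sum:
  assumes [measurable]: "\<Phi> \<in> borel_measurable (marks \<Otimes>\<^sub>M marks \<Otimes>\<^sub>M marks \<Otimes>\<^sub>M path_space)" and z: "z \<noteq> 0"
  shows "pinned_sum 0 z (const_path x) (merge_sum f \<Phi>) = 0"
proof -
  have K: "(\<lambda>(\<gamma>1, \<gamma>2, \<omega>). (\<integral>\<^sup>+t. \<Phi> ((t, snd \<gamma>1 + snd \<gamma>2), \<gamma>1, \<gamma>2, \<omega>) \<partial>unit_lebesgue) * ennreal (chi f (snd \<gamma>1) (snd \<gamma>2)))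
     \<in> borel_measurable (marks \<Otimes>\<^sub>M marks \<Otimes>\<^sub>M path_space)"
    by measurable
  show ?thesis
    unfolding merge_sum_eq by (rule pinned_sum_pairs(2)[OF K z])
qed

end

section \<open>The bridge kernel\<close>

text \<open>A functional on nonnegative measurable functions that is additive, homogeneous and
  continuous along increasing sequences is integration against a measure. It allows the bridge to be
  defined through a formula for its integrals.\<close>

lemma measure_of_functional:
  fixes T :: "('a \<Rightarrow> ennreal) \<Rightarrow> ennreal" and N :: "'a measure"
  assumes cong: "\<And>u v. (\<And>x. x \<in> space N \<Longrightarrow> u x = v x) \<Longrightarrow> T u = T v"
    and add: "\<And>u v. u \<in> borel_measurable N \<Longrightarrow> v \<in> borel_measurable N \<Longrightarrow> T (\<lambda>x. u x + v x) = T u + T v"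
    and mult: "\<And>u c. u \<in> borel_measurable N \<Longrightarrow> T (\<lambda>x. c * u x) = c * T u"
    and SUP: "\<And>U :: nat \<Rightarrow> 'a \<Rightarrow> ennreal. (\<And>i. U i \<in> borel_measurable N) \<Longrightarrow> incseq U \<Longrightarrow> T (\<lambda>x. SUP i. U i x) = (SUP i. T (U i))"
  defines "M \<equiv> measure_of (space N) (sets N) (\<lambda>A. T (indicator A))"
  shows "sets M = sets N" and "A \<in> sets N \<Longrightarrow> emeasure M A = T (indicator A)"
    and "u \<in> borel_measurable N \<Longrightarrow> (\<integral>\<^sup>+x. u x \<partial>M) = T u"
proof -
  show sets: "sets M = sets N" unfolding M_def by simp
  have 0: "T (\<lambda>x. 0) = 0" using mult[of "\<lambda>x. 0" 0] by simp
  have fin: "T (\<lambda>x. \<Sum>i<n. u i x) = (\<Sum>i<n. T (u i))" if "\<And>i. u i \<in> borel_measurable N" for u :: "nat \<Rightarrow> 'a \<Rightarrow> ennreal" and n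
  proof (induction n)
    case (Suc n)
    then show ?case using that by (simp add: add[of "\<lambda>x. \<Sum>i<n. u i x" "u n"])
  qed (simp add: 0)
  have em: "emeasure M A = T (indicator A)" if "A \<in> sets N" for A
    unfolding M_def
  proof (rule emeasure_measure_of_sigma[OF _ _ _ that])
    show "sigma_algebra (space N) (sets N)" by (rule sets.sigma_algebra_axioms)
    show "positive (sets N) (\<lambda>A. T (indicator A))"
      using 0 by (simp add: positive_def indicator_def[abs_def])
    show "countably_additive (sets N) (\<lambda>A. T (indicator A))"
    proof (rule countably_additiveI)
      fix A :: "nat \<Rightarrow> 'a set" assume A: "range A \<subseteq> sets N" "disjoint_family A"
      have m [measurable]: "A i \<in> sets N" for i using A by auto
      have "T (indicator (\<Union>i. A i)) = T (\<lambda>x. SUP n. \<Sum>i<n. indicator (A i) x)"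
        by (rule cong) (simp add: suminf_indicator[OF A(2), symmetric] suminf_eq_SUP)
      also have "\<dots> = (SUP n. T (\<lambda>x. \<Sum>i<n. indicator (A i) x))"
        by (rule SUP) (auto simp: incseq_def le_fun_def intro!: sum_mono2)
      also have "\<dots> = (\<Sum>i. T (indicator (A i)))"
        by (simp add: fin suminf_eq_SUP)
      finally show "(\<Sum>i. T (indicator (A i))) = T (indicator (\<Union>i. A i))" ..
    qed
  qed
  then show "A \<in> sets N \<Longrightarrow> emeasure M A = T (indicator A)" .
  note [measurable_cong] = sets
  have space: "space M = space N" using sets by (rule sets_eq_imp_space_eq)
  show "(\<integral>\<^sup>+x. u x \<partial>M) = T u" if "u \<in> borel_measurable N"
    using that
  proof (induction rule: borel_measurable_induct)
    case (cong f g)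
    then show ?case using assms(1)[of f g] nn_integral_cong[of M f g] by (simp add: space)
  next
    case (set A)
    then show ?case by (simp add: em)
  next
    case (mult u c)
    then show ?case by (simp add: assms(3) nn_integral_cmult)
  next
    case (add u v)
    then show ?case by (simp add: assms(2) nn_integral_add)
  next
    case (seq U)
    have "(\<integral>\<^sup>+x. (SUP i. U i x) \<partial>M) = (SUP i. \<integral>\<^sup>+x. U i x \<partial>M)"
      using seq by (intro nn_integral_monotone_convergence_SUP) auto
    also have "\<dots> = (SUP i. T (U i))" using seq by simp
    also have "\<dots> = T (\<lambda>x. SUP i. U i x)" using seq by (intro SUP[symmetric]) auto
    finally show ?case by (simp add: image_comp)
  qed
qed

section \<open>The kernel obtained by normalising pinned sums\<close>

context jump_density begin

text \<open>The factorial passes from labelled marks to sets of jumps. The term without jumps is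
  absent because it cannot produce an increment \<open>z \<noteq> 0\<close>, and the Poisson factor
  \<open>exp (- rate)\<close> would cancel in the normalisation.\<close>

definition bridge_sum :: "real \<Rightarrow> real \<Rightarrow> ((real \<Rightarrow> real) \<Rightarrow> ennreal) \<Rightarrow> ennreal" where
  "bridge_sum x z G = (\<Sum>n. ennreal (1 / fact (Suc n)) * pinned_sum n z (const_path x) G)"

text \<open>Up to the factor \<open>exp (- rate)\<close> this is the density at \<open>z\<close> of
  the absolutely continuous part of the increment of the Levy process over the unit
  interval.\<close>

definition bridge_mass :: "real \<Rightarrow> real \<Rightarrow> ennreal" where
  "bridge_mass x z = bridge_sum x z (\<lambda>\<omega>. 1)"

text \<open>
  The mass is finite for almost every \<^term>\<open>z\<close> only. At the exceptional endpoints no bridge is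
  determined by the conditioning, and a constant path is chosen, for which both sides of the
  splitting identity vanish.
\<close>

definition bridge_integral :: "real \<times> real \<Rightarrow> ((real \<Rightarrow> real) \<Rightarrow> ennreal) \<Rightarrow> ennreal" where
  "bridge_integral p G =
    (if fst p \<noteq> snd p \<and> bridge_mass (fst p) (snd p - fst p) < \<infinity>
     then bridge_sum (fst p) (snd p - fst p) G / bridge_mass (fst p) (snd p - fst p)
     else G (const_path (fst p)))"

definition bridge :: "real \<times> real \<Rightarrow> (real \<Rightarrow> real) measure" where
  "bridge p = measure_of (space path_space) (sets path_space) (\<lambda>A. bridge_integral p (indicator A))"

lemma bridge_sum_cong: "(\<And>\<omega>. \<omega> \<in> space path_space \<Longrightarrow> G \<omega> = G' \<omega>) \<Longrightarrow> bridge_sum x z G = bridge_sum x z G'"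
  unfolding bridge_sum_def by (intro suminf_cong arg_cong[where f="\<lambda>x. _ * x"] pinned_sum_cong) simp_all

lemma bridge_sum_add:
  "G \<in> borel_measurable path_space \<Longrightarrow> G' \<in> borel_measurable path_space \<Longrightarrow>
   bridge_sum x z (\<lambda>\<omega>. G \<omega> + G' \<omega>) = bridge_sum x z G + bridge_sum x z G'"
  unfolding bridge_sum_def by (simp add: pinned_sum_add distrib_left suminf_add)

lemma bridge_sum_mult:
  "G \<in> borel_measurable path_space \<Longrightarrow> bridge_sum x z (\<lambda>\<omega>. c * G \<omega>) = c * bridge_sum x z G"
  unfolding bridge_sum_def by (simp add: pinned_sum_mult mult.left_commute[of _ c])

lemma bridge_sum_SUP:
  assumes G: "\<And>i::nat. G i \<in> borel_measurable path_space" "incseq G"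
  shows "bridge_sum x z (\<lambda>\<omega>. SUP i. G i \<omega>) = (SUP i. bridge_sum x z (G i))"
proof -
  note * = pinned_sum_SUP[OF G const_path_in_space]
  have "bridge_sum x z (\<lambda>\<omega>. SUP i. G i \<omega>) = (\<Sum>n. SUP i. ennreal (1 / fact (Suc n)) * pinned_sum n z (const_path x) (G i))"
    unfolding bridge_sum_def by (simp only: *[THEN conjunct1] SUP_mult_left_ennreal)
  also have "\<dots> = (SUP i. bridge_sum x z (G i))"
    unfolding bridge_sum_def
    by (rule ennreal_suminf_SUP_eq) (use *[THEN conjunct2] in \<open>auto simp: incseq_def intro!: mult_left_mono\<close>)
  finally show ?thesis .
qed

text \<open>Already the term with a single jump equals \<open>f z\<close>, which is
  positive.\<close>

lemma bridge_mass_pos: "0 < bridge_mass x z"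
proof -
  have "0 < ennreal (1 / fact (Suc 0)) * pinned_sum 0 z (const_path x) (\<lambda>\<omega>. 1)"
    using f_pos[of z] by (simp add: space_unit_lebesgue emeasure_unit_lebesgue)
  also have "\<dots> \<le> bridge_mass x z"
    unfolding bridge_mass_def bridge_sum_def
    using sum_le_suminf[OF summableI, of "{0}" "\<lambda>n. ennreal (1 / fact (Suc n)) * pinned_sum n z (const_path x) (\<lambda>\<omega>. 1)"]
    by simp
  finally show ?thesis .
qed

lemma sets_bridge [simp]: "sets (bridge p) = sets path_space"
  unfolding bridge_def by simp

lemma
  shows emeasure_bridge: "A \<in> sets path_space \<Longrightarrow> emeasure (bridge p) A = bridge_integral p (indicator A)"
    and nn_integral_bridge: "G \<in> borel_measurable path_space \<Longrightarrow> (\<integral>\<^sup>+\<omega>. G \<omega> \<partial>bridge p) = bridge_integral p G"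
proof -
  have c: "bridge_integral p u = bridge_integral p v" if "\<And>\<omega>. \<omega> \<in> space path_space \<Longrightarrow> u \<omega> = v \<omega>" for u v
    using that bridge_sum_cong[of u v] by (simp add: bridge_integral_def)
  have a: "bridge_integral p (\<lambda>x. u x + v x) = bridge_integral p u + bridge_integral p v"
    if "u \<in> borel_measurable path_space" "v \<in> borel_measurable path_space" for u v
    using that by (simp add: bridge_integral_def bridge_sum_add divide_ennreal_def distrib_right)
  have m: "bridge_integral p (\<lambda>x. c * u x) = c * bridge_integral p u"
    if "u \<in> borel_measurable path_space" for u c
    using that by (simp add: bridge_integral_def bridge_sum_mult divide_ennreal_def mult.assoc)
  have s: "bridge_integral p (\<lambda>x. SUP i. U i x) = (SUP i. bridge_integral p (U i))"
    if "\<And>i. U i \<in> borel_measurable path_space" "incseq U" for U :: "nat \<Rightarrow> (real \<Rightarrow> real) \<Rightarrow> ennreal"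
    using that by (simp add: bridge_integral_def bridge_sum_SUP divide_ennreal_def SUP_mult_right_ennreal)
  note F = measure_of_functional[of path_space "bridge_integral p", OF c a m s, folded bridge_def]
  show "A \<in> sets path_space \<Longrightarrow> emeasure (bridge p) A = bridge_integral p (indicator A)"
    by (rule F(2))
  show "G \<in> borel_measurable path_space \<Longrightarrow> (\<integral>\<^sup>+\<omega>. G \<omega> \<partial>bridge p) = bridge_integral p G"
    by (rule F(3))
qed

lemma bridge_eq_return:
  assumes "\<not> (x \<noteq> y \<and> bridge_mass x (y - x) < \<infinity>)"
  shows "bridge (x, y) = return path_space (const_path x)"
  by (rule measure_eqI) (use assms in \<open>auto simp: emeasure_bridge bridge_integral_def\<close>)

lemma prob_space_bridge: "prob_space (bridge p)"
proof
  have "emeasure (bridge p) (space (bridge p)) = bridge_integral p (\<lambda>\<omega>. 1)"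
    using nn_integral_bridge[of "\<lambda>\<omega>. 1" p] by simp
  also have "\<dots> = 1"
    using bridge_mass_pos[of "fst p" "snd p - fst p"]
    by (auto simp: bridge_integral_def bridge_mass_def[symmetric] ennreal_divide_self)
  finally show "emeasure (bridge p) (space (bridge p)) = 1" .
qed

lemma measurable_bridge_sum [measurable (raw)]:
  assumes [measurable]: "x \<in> borel_measurable M" "z \<in> borel_measurable M" "(\<lambda>(p, \<omega>). G p \<omega>) \<in> borel_measurable (M \<Otimes>\<^sub>M path_space)"
  shows "(\<lambda>p. bridge_sum (x p) (z p) (G p)) \<in> borel_measurable M"
  unfolding bridge_sum_def by measurable

lemma measurable_bridge_mass [measurable (raw)]:
  assumes [measurable]: "x \<in> borel_measurable M" "z \<in> borel_measurable M"
  shows "(\<lambda>p. bridge_mass (x p) (z p)) \<in> borel_measurable M"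
  unfolding bridge_mass_def by measurable

lemma measurable_bridge: "bridge \<in> borel \<Otimes>\<^sub>M borel \<rightarrow>\<^sub>M prob_algebra path_space"
proof (rule measurable_prob_algebra_generated)
  show "sets path_space = sigma_sets (space path_space) (sets path_space)" by (simp add: sets.sigma_sets_eq)
  show "Int_stable (sets path_space)" by (auto simp: Int_stable_def)
  show "sets path_space \<subseteq> Pow (space path_space)" by (rule sets.space_closed)
  fix A assume A [measurable]: "A \<in> sets path_space"
  have [measurable]: "(\<lambda>p. bridge_sum (fst p) (snd p - fst p) (indicator A)) \<in> borel_measurable (borel \<Otimes>\<^sub>M borel)"
    using measurable_bridge_sum[of fst "borel \<Otimes>\<^sub>M borel" "\<lambda>p. snd p - fst p" "\<lambda>p. indicator A"] by measurable
  show "(\<lambda>p. emeasure (bridge p) A) \<in> borel_measurable (borel \<Otimes>\<^sub>M borel)"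
    unfolding emeasure_bridge[OF A] bridge_integral_def by measurable
qed (simp_all add: prob_space_bridge)

lemma bridge_sum_split_op:
  assumes \<Phi> [measurable]: "\<Phi> \<in> borel_measurable (marks \<Otimes>\<^sub>M marks \<Otimes>\<^sub>M marks \<Otimes>\<^sub>M path_space)" and z: "z \<noteq> 0"
  shows "bridge_sum x z (split_op \<Phi>) = bridge_sum x z (merge_sum f \<Phi>)"
proof -
  let ?c = "\<lambda>n. ennreal (1 / fact (Suc n))"
  \<comment> \<open>The count \<open>n + 2\<close> from \<open>pinned_sum_split_op\<close> turns
    1/(n+2)! into 1/(n+1)!.\<close>
  have c: "?c (Suc n) * of_nat (Suc (Suc n)) = ?c n" for n
  proof -
    have "?c (Suc n) * of_nat (Suc (Suc n)) = ennreal (1 / fact (Suc (Suc n)) * real (Suc (Suc n)))"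
      by (subst ennreal_mult) (simp_all add: ennreal_of_nat_eq_real_of_nat del: fact_Suc of_nat_Suc)
    also have "1 / fact (Suc (Suc n)) * real (Suc (Suc n)) = 1 / fact (Suc n)"
      by (subst fact_Suc) (simp del: fact_Suc of_nat_Suc)
    finally show ?thesis .
  qed
  have "?c n * pinned_sum n z (const_path x) (split_op \<Phi>) = ?c (Suc n) * pinned_sum (Suc n) z (const_path x) (merge_sum f \<Phi>)" for n
    unfolding pinned_sum_split_op[OF \<Phi> z, symmetric] mult.assoc[symmetric] c ..
  then have "(\<lambda>n. ?c (Suc n) * pinned_sum (Suc n) z (const_path x) (merge_sum f \<Phi>)) sums bridge_sum x z (split_op \<Phi>)"
    unfolding bridge_sum_def by (metis (no_types, lifting) suminf_cong summableI summable_sums)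
  \<comment> \<open>The merge series is the split series shifted by one index; its additional
    initial term vanishes because a single jump forms no pair.\<close>
  from sums_Suc[OF this] show ?thesis
    by (simp add: pinned_sum_0_merge_sum[OF \<Phi> z] bridge_sum_def sums_iff del: pinned_sum.simps)
qed

lemma splitting_identity_const_path: "splitting_identity f (return path_space (const_path x))"
  unfolding splitting_identity_iff
proof
  fix \<Phi> :: "mark \<times> mark \<times> mark \<times> (real \<Rightarrow> real) \<Rightarrow> ennreal"
  assume [measurable]: "\<Phi> \<in> borel_measurable (marks \<Otimes>\<^sub>M marks \<Otimes>\<^sub>M marks \<Otimes>\<^sub>M path_space)"
  have "split_op \<Phi> (const_path x) = 0" "merge_sum f \<Phi> (const_path x) = 0"
    by (simp_all add: split_op_eq merge_sum_eq)
  then show "(\<integral>\<^sup>+\<omega>. split_op \<Phi> \<omega> \<partial>return path_space (const_path x)) = (\<integral>\<^sup>+\<omega>. merge_sum f \<Phi> \<omega> \<partial>return path_space (const_path x))"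
    by (simp add: nn_integral_return)
qed

lemma splitting_identity_bridge: "splitting_identity f (bridge (x, y))"
proof (cases "x \<noteq> y \<and> bridge_mass x (y - x) < \<infinity>")
  case True
  then show ?thesis
    unfolding splitting_identity_iff
    by (auto simp: nn_integral_bridge bridge_integral_def bridge_sum_split_op)
next
  case False
  then show ?thesis using bridge_eq_return splitting_identity_const_path by simp
qed

end

section \<open>Paths satisfying the splitting identity have finitely many jumps\<close>

text \<open>Inserting the opposite mark deletes the jump. Any path with a jump thereby takes the
  form of an insertion, to which \<open>split_path_insert_jump\<close> applies.\<close>

lemma remove_jump:
  assumes \<omega>: "\<omega> \<in> space path_space" and t: "t \<in> jump_times \<omega>"
  obtains \<omega>' where "\<omega>' \<in> space path_space" "\<omega> = insert_jump (t, jump \<omega> t) \<omega>'" "jump_times \<omega>' = jump_times \<omega> - {t}"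
    "\<And>u. u \<noteq> t \<Longrightarrow> jump \<omega>' u = jump \<omega> u"
proof
  let ?\<omega> = "insert_jump (t, - jump \<omega> t) \<omega>"
  have c: "cadlag \<omega>" using \<omega> by (simp add: space_path_space)
  have t': "0 < t" "t \<le> 1" using t jump_times_subset[of \<omega>] by auto
  show "?\<omega> \<in> space path_space" using \<omega> by simp
  show "\<omega> = insert_jump (t, jump \<omega> t) ?\<omega>"
    using \<omega> by (auto simp: insert_jump_def fun_eq_iff restrict_def space_path_space extensional_def)
  show "jump_times ?\<omega> = jump_times \<omega> - {t}" using t' c
    by (auto simp: jump_times_iff jump_insert_jump split: if_splits)
  show "jump ?\<omega> u = jump \<omega> u" if "u \<noteq> t" for u using that c by (simp add: jump_insert_jump)
qed

text \<open>Almost every split is generic: two new, distinct, positive times and two nonzero sizes.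
  Comparing functionals only there allows a condition on the split path to be traded for one on the
  original path.\<close>

lemma split_op_cong:
  assumes [measurable]: "\<Phi> \<in> borel_measurable (marks \<Otimes>\<^sub>M marks \<Otimes>\<^sub>M marks \<Otimes>\<^sub>M path_space)" "\<Psi> \<in> borel_measurable (marks \<Otimes>\<^sub>M marks \<Otimes>\<^sub>M marks \<Otimes>\<^sub>M path_space)"
    and \<omega>: "\<omega> \<in> space path_space"
    and eq: "\<And>\<gamma> \<gamma>1 \<gamma>2 \<omega>'. \<omega>' \<in> space path_space \<Longrightarrow> fst \<gamma> \<in> jump_times \<omega> \<Longrightarrow> \<omega> = insert_jump \<gamma> \<omega>' \<Longrightarrow> fst \<gamma> \<notin> jump_times \<omega>' \<Longrightarrow> snd \<gamma> \<noteq> 0 \<Longrightarrow>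
      0 < fst \<gamma> \<Longrightarrow> fst \<gamma> \<le> 1 \<Longrightarrow> 0 < fst \<gamma>1 \<Longrightarrow> fst \<gamma>1 \<le> 1 \<Longrightarrow> 0 < fst \<gamma>2 \<Longrightarrow> fst \<gamma>2 \<le> 1 \<Longrightarrow>
      fst \<gamma>1 \<notin> jump_times \<omega>' \<Longrightarrow> fst \<gamma>2 \<notin> jump_times \<omega>' \<Longrightarrow> fst \<gamma>1 \<noteq> fst \<gamma>2 \<Longrightarrow> snd \<gamma>1 \<noteq> 0 \<Longrightarrow> snd \<gamma>2 \<noteq> 0 \<Longrightarrow>
      snd \<gamma>1 + snd \<gamma>2 = snd \<gamma> \<Longrightarrow>
      \<Phi> (\<gamma>, \<gamma>1, \<gamma>2, insert_jump \<gamma>2 (insert_jump \<gamma>1 \<omega>')) = \<Psi> (\<gamma>, \<gamma>1, \<gamma>2, insert_jump \<gamma>2 (insert_jump \<gamma>1 \<omega>'))"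
  shows "split_op \<Phi> \<omega> = split_op \<Psi> \<omega>"
  unfolding split_op_eq[OF assms(1) \<omega>] split_op_eq[OF assms(2) \<omega>] jump_sum_def
proof (rule nn_integral_cong)
  fix t assume "t \<in> space (count_space (jump_times \<omega>))"
  then have t: "t \<in> jump_times \<omega>" "0 < t" "t \<le> 1" "jump \<omega> t \<noteq> 0" using jump_times_subset[of \<omega>] by (auto simp: jump_times_iff)
  obtain \<omega>' where \<omega>': "\<omega>' \<in> space path_space" "\<omega> = insert_jump (t, jump \<omega> t) \<omega>'" "jump_times \<omega>' = jump_times \<omega> - {t}"
    by (rule remove_jump[OF \<omega> t(1)])
  have cnt: "countable (jump_times \<omega>')" using \<omega>'(1) by (intro countable_jump_times) (simp add: space_path_space)
  define z where "z = jump \<omega> t"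
  have \<omega>z: "\<omega> = insert_jump (t, z) \<omega>'" unfolding z_def by (rule \<omega>'(2))
  have z0: "z \<noteq> 0" using t by (simp add: z_def)
  let ?L = "\<lambda>\<Phi> \<gamma>1 s2. \<Phi> ((t, z), \<gamma>1, (s2, z - snd \<gamma>1), split_path (t, z) \<gamma>1 (s2, z - snd \<gamma>1) \<omega>) :: ennreal"
  have *: "(\<integral>\<^sup>+s2. ?L \<Phi> \<gamma>1 s2 \<partial>unit_lebesgue) = (\<integral>\<^sup>+s2. ?L \<Psi> \<gamma>1 s2 \<partial>unit_lebesgue)"
    if \<gamma>1: "0 < fst \<gamma>1" "fst \<gamma>1 \<le> 1" "fst \<gamma>1 \<notin> jump_times \<omega>'" "snd \<gamma>1 \<notin> {0, z}" for \<gamma>1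
  proof (rule nn_integral_cong_AE, rule AE_mp[OF AE_unit_lebesgue[of "insert (fst \<gamma>1) (jump_times \<omega>')"]])
    show "AE s2 in unit_lebesgue. 0 < s2 \<and> s2 \<le> 1 \<and> s2 \<notin> insert (fst \<gamma>1) (jump_times \<omega>') \<longrightarrow> ?L \<Phi> \<gamma>1 s2 = ?L \<Psi> \<gamma>1 s2"
    proof (intro AE_I2 impI)
      fix s2 assume s2: "0 < s2 \<and> s2 \<le> 1 \<and> s2 \<notin> insert (fst \<gamma>1) (jump_times \<omega>')"
      have "split_path (t, z) \<gamma>1 (s2, z - snd \<gamma>1) \<omega> = insert_jump (s2, z - snd \<gamma>1) (insert_jump \<gamma>1 \<omega>')"
        unfolding \<omega>z using t(2) \<gamma>1(1) s2 by (intro split_path_insert_jump) auto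
      moreover have "\<Phi> ((t, z), \<gamma>1, (s2, z - snd \<gamma>1), insert_jump (s2, z - snd \<gamma>1) (insert_jump \<gamma>1 \<omega>')) =
        \<Psi> ((t, z), \<gamma>1, (s2, z - snd \<gamma>1), insert_jump (s2, z - snd \<gamma>1) (insert_jump \<gamma>1 \<omega>'))"
      proof (rule eq)
        show "\<omega> = insert_jump (t, z) \<omega>'" by (rule \<omega>z)
      qed (use \<omega>'(1,3) t(1,2,3) z0 \<gamma>1 s2 in auto)
      ultimately show "?L \<Phi> \<gamma>1 s2 = ?L \<Psi> \<gamma>1 s2" by simp
    qed
  qed (use cnt in simp)
  have "(\<integral>\<^sup>+\<gamma>1. \<integral>\<^sup>+s2. ?L \<Phi> \<gamma>1 s2 \<partial>unit_lebesgue \<partial>mark_lebesgue) = (\<integral>\<^sup>+\<gamma>1. \<integral>\<^sup>+s2. ?L \<Psi> \<gamma>1 s2 \<partial>unit_lebesgue \<partial>mark_lebesgue)"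
    by (rule nn_integral_cong_AE, rule AE_mp[OF AE_mark_lebesgue[OF cnt, of "{0, z}"]]) (auto simp: *)
  then show "(\<integral>\<^sup>+\<gamma>1. \<integral>\<^sup>+s2. \<Phi> ((t, jump \<omega> t), \<gamma>1, (s2, snd (t, jump \<omega> t) - snd \<gamma>1),
      split_path (t, jump \<omega> t) \<gamma>1 (s2, snd (t, jump \<omega> t) - snd \<gamma>1) \<omega>) \<partial>unit_lebesgue \<partial>mark_lebesgue) =
    (\<integral>\<^sup>+\<gamma>1. \<integral>\<^sup>+s2. \<Psi> ((t, jump \<omega> t), \<gamma>1, (s2, snd (t, jump \<omega> t) - snd \<gamma>1),
      split_path (t, jump \<omega> t) \<gamma>1 (s2, snd (t, jump \<omega> t) - snd \<gamma>1) \<omega>) \<partial>unit_lebesgue \<partial>mark_lebesgue)"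
    by (simp add: z_def)
qed

lemma jump_sum_mult_right:
  "jump_sum (\<lambda>\<gamma>. F \<gamma> * c) \<omega> = jump_sum F \<omega> * c"
  unfolding jump_sum_def by (rule nn_integral_multc) simp

lemma jump_sum_mult_left:
  "jump_sum (\<lambda>\<gamma>. c * F \<gamma>) \<omega> = c * jump_sum F \<omega>"
  unfolding jump_sum_def by (rule nn_integral_cmult) simp

lemma jump_sum_mono: "(\<And>t. t \<in> jump_times \<omega> \<Longrightarrow> F (t, jump \<omega> t) \<le> G (t, jump \<omega> t)) \<Longrightarrow> jump_sum F \<omega> \<le> jump_sum G \<omega>"
  unfolding jump_sum_def by (rule nn_integral_mono) simp

lemma jump_sum_ge: "t \<in> jump_times \<omega> \<Longrightarrow> F (t, jump \<omega> t) \<le> jump_sum F \<omega>"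
proof -
  assume t: "t \<in> jump_times \<omega>"
  have "F (t, jump \<omega> t) = (\<integral>\<^sup>+u. F (u, jump \<omega> u) * indicator {t} u \<partial>count_space UNIV)"
  proof -
    have "(\<integral>\<^sup>+u. F (u, jump \<omega> u) * indicator {t} u \<partial>count_space UNIV) = (\<integral>\<^sup>+u. F (t, jump \<omega> t) * indicator {t} u \<partial>count_space UNIV)"
      by (intro nn_integral_cong) (simp add: indicator_def)
    also have "\<dots> = F (t, jump \<omega> t)"
      by (subst nn_integral_cmult) (auto simp: one_ennreal_def[symmetric])
    finally show ?thesis ..
  qed
  also have "\<dots> \<le> (\<integral>\<^sup>+u. F (u, jump \<omega> u) * indicator (jump_times \<omega>) u \<partial>count_space UNIV)"
    using t by (intro nn_integral_mono) (auto simp: indicator_def)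
  also have "\<dots> = jump_sum F \<omega>"
    unfolding jump_sum_def by (rule nn_integral_count_space_indicator[symmetric]) simp
  finally show ?thesis .
qed

lemma split_op_mult:
  assumes [measurable]: "\<Phi> \<in> borel_measurable (marks \<Otimes>\<^sub>M marks \<Otimes>\<^sub>M marks \<Otimes>\<^sub>M path_space)" and \<omega> [measurable (raw)]: "\<omega> \<in> space path_space"
  shows "split_op (\<lambda>p. \<Phi> p * c) \<omega> = split_op \<Phi> \<omega> * c"
proof -
  have m: "(\<lambda>p. \<Phi> p * c) \<in> borel_measurable (marks \<Otimes>\<^sub>M marks \<Otimes>\<^sub>M marks \<Otimes>\<^sub>M path_space)" by measurable
  have "split_op (\<lambda>p. \<Phi> p * c) \<omega> = jump_sum (\<lambda>\<gamma>. (\<integral>\<^sup>+\<gamma>1. \<integral>\<^sup>+s2. \<Phi> (\<gamma>, \<gamma>1, (s2, snd \<gamma> - snd \<gamma>1),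
     split_path \<gamma> \<gamma>1 (s2, snd \<gamma> - snd \<gamma>1) \<omega>) \<partial>unit_lebesgue \<partial>mark_lebesgue) * c) \<omega>"
    unfolding split_op_eq[OF m \<omega>]
  proof (rule jump_sum_cong)
    fix \<gamma> assume \<gamma> [measurable (raw)]: "\<gamma> \<in> space marks"
    have "(\<integral>\<^sup>+\<gamma>1. \<integral>\<^sup>+s2. \<Phi> (\<gamma>, \<gamma>1, (s2, snd \<gamma> - snd \<gamma>1), split_path \<gamma> \<gamma>1 (s2, snd \<gamma> - snd \<gamma>1) \<omega>) * c \<partial>unit_lebesgue \<partial>mark_lebesgue) =
       (\<integral>\<^sup>+\<gamma>1. (\<integral>\<^sup>+s2. \<Phi> (\<gamma>, \<gamma>1, (s2, snd \<gamma> - snd \<gamma>1), split_path \<gamma> \<gamma>1 (s2, snd \<gamma> - snd \<gamma>1) \<omega>) \<partial>unit_lebesgue) * c \<partial>mark_lebesgue)"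
    proof (rule nn_integral_cong)
      fix \<gamma>1 assume "\<gamma>1 \<in> space mark_lebesgue"
      then have [measurable (raw)]: "\<gamma>1 \<in> space marks" by (simp add: space_marks space_mark_lebesgue)
      show "(\<integral>\<^sup>+s2. \<Phi> (\<gamma>, \<gamma>1, (s2, snd \<gamma> - snd \<gamma>1), split_path \<gamma> \<gamma>1 (s2, snd \<gamma> - snd \<gamma>1) \<omega>) * c \<partial>unit_lebesgue) =
        (\<integral>\<^sup>+s2. \<Phi> (\<gamma>, \<gamma>1, (s2, snd \<gamma> - snd \<gamma>1), split_path \<gamma> \<gamma>1 (s2, snd \<gamma> - snd \<gamma>1) \<omega>) \<partial>unit_lebesgue) * c"
        by (rule nn_integral_multc) measurable
    qed
    also have "\<dots> = (\<integral>\<^sup>+\<gamma>1. \<integral>\<^sup>+s2. \<Phi> (\<gamma>, \<gamma>1, (s2, snd \<gamma> - snd \<gamma>1), split_path \<gamma> \<gamma>1 (s2, snd \<gamma> - snd \<gamma>1) \<omega>) \<partial>unit_lebesgue \<partial>mark_lebesgue) * c"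
      by (rule nn_integral_multc) measurable
    finally show "(\<integral>\<^sup>+\<gamma>1. \<integral>\<^sup>+s2. \<Phi> (\<gamma>, \<gamma>1, (s2, snd \<gamma> - snd \<gamma>1), split_path \<gamma> \<gamma>1 (s2, snd \<gamma> - snd \<gamma>1) \<omega>) * c \<partial>unit_lebesgue \<partial>mark_lebesgue) =
       (\<integral>\<^sup>+\<gamma>1. \<integral>\<^sup>+s2. \<Phi> (\<gamma>, \<gamma>1, (s2, snd \<gamma> - snd \<gamma>1), split_path \<gamma> \<gamma>1 (s2, snd \<gamma> - snd \<gamma>1) \<omega>) \<partial>unit_lebesgue \<partial>mark_lebesgue) * c" .
  qed
  then show ?thesis by (simp add: jump_sum_mult_right split_op_eq \<omega>)
qed

text \<open>Unlike splitting, the merge side leaves its path unchanged, so a factor depending on the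
  path alone comes out.\<close>

lemma merge_sum_path_mult:
  assumes [measurable]: "\<Phi> \<in> borel_measurable (marks \<Otimes>\<^sub>M marks \<Otimes>\<^sub>M marks \<Otimes>\<^sub>M path_space)" and \<omega> [measurable (raw)]: "\<omega> \<in> space path_space"
  shows "merge_sum f (\<lambda>(\<gamma>, \<gamma>1, \<gamma>2, \<omega>). \<Phi> (\<gamma>, \<gamma>1, \<gamma>2, \<omega>) * h \<omega>) \<omega> = merge_sum f \<Phi> \<omega> * h \<omega>"
proof -
  have "(\<integral>\<^sup>+t. \<Phi> ((t, a), \<gamma>1, \<gamma>2, \<omega>) * h \<omega> \<partial>unit_lebesgue) = (\<integral>\<^sup>+t. \<Phi> ((t, a), \<gamma>1, \<gamma>2, \<omega>) \<partial>unit_lebesgue) * h \<omega>"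
    if [measurable (raw)]: "\<gamma>1 \<in> space marks" "\<gamma>2 \<in> space marks" for a \<gamma>1 \<gamma>2
    by (rule nn_integral_multc) measurable
  then have "merge_sum f (\<lambda>(\<gamma>, \<gamma>1, \<gamma>2, \<omega>). \<Phi> (\<gamma>, \<gamma>1, \<gamma>2, \<omega>) * h \<omega>) \<omega> =
     jump_sum (\<lambda>\<gamma>1. jump_sum (\<lambda>\<gamma>2. (if fst \<gamma>1 \<noteq> fst \<gamma>2 then
     (\<integral>\<^sup>+t. \<Phi> ((t, snd \<gamma>1 + snd \<gamma>2), \<gamma>1, \<gamma>2, \<omega>) \<partial>unit_lebesgue) * ennreal (chi f (snd \<gamma>1) (snd \<gamma>2)) else 0) * h \<omega>) \<omega>) \<omega>"
    unfolding merge_sum_eq by (intro jump_sum_cong) (simp add: ac_simps)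
  then show ?thesis by (simp only: jump_sum_mult_right merge_sum_eq)
qed

text \<open>A form of continuity of translation. By compactness an open neighbourhood
  \<open>V\<close> of slightly larger measure contains every small translate; a translate has the
  measure of \<open>U\<close>, and less than half of it fits into \<open>V - U\<close>.\<close>

lemma translate_overlap:
  fixes U :: "real set"
  assumes U: "compact U" "0 < emeasure lborel U"
  obtains d where "0 < d" "\<And>h. \<bar>h\<bar> < d \<Longrightarrow> emeasure lborel U / 2 \<le> emeasure lborel {u \<in> U. u + h \<in> U}"
proof -
  have Ub [measurable]: "U \<in> sets borel" using U by (simp add: compact_imp_closed borel_closed)
  have fin: "emeasure lborel U < \<infinity>" using U by (intro emeasure_bounded_finite compact_imp_bounded) auto
  define m where "m = measure lborel U"
  have m: "emeasure lborel U = ennreal m" "0 < m"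
    using fin U(2) emeasure_eq_ennreal_measure[of lborel U] by (auto simp: m_def less_top)
  obtain V where V: "open V" "U \<subseteq> V" "emeasure lborel (V - U) < ennreal (m/2)"
    by (rule outer_regular_lborel[OF Ub, of "m/2"]) (use m in auto)
  have Vb [measurable]: "V \<in> sets borel" using V by simp
  obtain d where d: "0 < d" "(\<Union>x\<in>U. ball x d) \<subseteq> V"
    by (rule compact_subset_open_imp_ball_epsilon_subset[OF U(1) V(1,2)])
  show ?thesis
  proof (rule that[OF d(1)])
    fix h :: real assume h: "\<bar>h\<bar> < d"
    let ?Uh = "(\<lambda>u. u + h) -` U"
    have Uh [measurable]: "?Uh \<in> sets borel"
      using measurable_sets[of "\<lambda>u. u + h" borel borel U] by simp
    have "emeasure lborel ?Uh = (\<integral>\<^sup>+u. indicator ?Uh u \<partial>lborel)"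
      by (rule nn_integral_indicator[symmetric]) simp
    also have "\<dots> = (\<integral>\<^sup>+u. indicator U (u - (- h)) \<partial>lborel)"
      by (intro nn_integral_cong) (simp add: indicator_def)
    also have "\<dots> = ennreal m" by (subst nn_integral_shift) (auto simp: m)
    finally have mUh: "emeasure lborel ?Uh = ennreal m" .
    have "?Uh \<subseteq> V"
    proof
      fix u assume "u \<in> ?Uh"
      then have "u + h \<in> U" "u \<in> ball (u + h) d" using h by (auto simp: dist_real_def)
      then show "u \<in> V" using d(2) by blast
    qed
    then have "emeasure lborel (?Uh - U) \<le> emeasure lborel (V - U)" by (intro emeasure_mono) auto
    then have small: "emeasure lborel (?Uh - U) \<le> ennreal (m/2)" using V(3) by (simp add: less_imp_le)
    have "ennreal m = emeasure lborel (?Uh \<inter> U) + emeasure lborel (?Uh - U)"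
    proof -
      have "emeasure lborel (?Uh \<inter> U) + emeasure lborel (?Uh - U) = emeasure lborel ((?Uh \<inter> U) \<union> (?Uh - U))"
        by (rule plus_emeasure) auto
      also have "(?Uh \<inter> U) \<union> (?Uh - U) = ?Uh" by blast
      finally show ?thesis using mUh by simp
    qed
    also have "\<dots> \<le> emeasure lborel (?Uh \<inter> U) + ennreal (m/2)" using small by (rule add_left_mono)
    finally have "ennreal (m/2) + ennreal (m/2) \<le> ennreal (m/2) + emeasure lborel (?Uh \<inter> U)"
      using m by (simp add: ennreal_plus[symmetric] add.commute del: ennreal_plus)
    then have "ennreal (m/2) \<le> emeasure lborel (?Uh \<inter> U)"
      by (subst (asm) ennreal_add_left_cancel_le) simp_all
    moreover have "?Uh \<inter> U = {u \<in> U. u + h \<in> U}" by auto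
    moreover have "emeasure lborel U / 2 = ennreal (m/2)"
      unfolding m(1) using m(2) divide_ennreal[of m 2] by simp
    ultimately show "emeasure lborel U / 2 \<le> emeasure lborel {u \<in> U. u + h \<in> U}" by simp
  qed
qed

text \<open>The set is the decreasing intersection of the tails \<open>B m\<close>. Each tail
  contains an overlap for a small translation and so has at least half the measure of
  \<open>U\<close>; continuity from above keeps this bound.\<close>

lemma translates_infinitely_often:
  fixes U :: "real set" and x :: "nat \<Rightarrow> real"
  assumes U: "compact U" "0 < emeasure lborel U" and x: "\<And>d m. 0 < d \<Longrightarrow> \<exists>i\<ge>m. \<bar>x i\<bar> < d"
  shows "0 < emeasure lborel {u \<in> U. \<forall>m. \<exists>i\<ge>m. u + x i \<in> U}" and "{u \<in> U. \<forall>m. \<exists>i\<ge>m. u + x i \<in> U} \<in> sets borel"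
proof -
  have Ub [measurable]: "U \<in> sets borel" using U by (simp add: compact_imp_closed borel_closed)
  have fin: "emeasure lborel U < \<infinity>" using U by (intro emeasure_bounded_finite compact_imp_bounded) auto
  define B where "B m = (\<Union>i\<in>{m..}. {u \<in> U. u + x i \<in> U})" for m
  have [measurable]: "{u \<in> U. u + x i \<in> U} \<in> sets borel" for i
  proof -
    have "(\<lambda>u. u + x i) -` U \<in> sets borel"
      using measurable_sets[of "\<lambda>u. u + x i" borel borel U] by simp
    moreover have "{u \<in> U. u + x i \<in> U} = U \<inter> (\<lambda>u. u + x i) -` U" by auto
    ultimately show ?thesis by simp
  qed
  then have B [measurable]: "B m \<in> sets borel" for m unfolding B_def by auto
  have INT: "{u \<in> U. \<forall>m. \<exists>i\<ge>m. u + x i \<in> U} = (\<Inter>m. B m)" by (auto simp: B_def)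
  show "{u \<in> U. \<forall>m. \<exists>i\<ge>m. u + x i \<in> U} \<in> sets borel" unfolding INT by auto
  obtain d where d: "0 < d" "\<And>h. \<bar>h\<bar> < d \<Longrightarrow> emeasure lborel U / 2 \<le> emeasure lborel {u \<in> U. u + h \<in> U}"
    by (rule translate_overlap[OF U]) blast
  have "emeasure lborel U / 2 \<le> emeasure lborel (B m)" for m
  proof -
    obtain i where i: "i \<ge> m" "\<bar>x i\<bar> < d" using x[OF d(1)] by blast
    have "emeasure lborel U / 2 \<le> emeasure lborel {u \<in> U. u + x i \<in> U}" by (rule d(2)[OF i(2)])
    also have "\<dots> \<le> emeasure lborel (B m)" using i(1) by (intro emeasure_mono) (auto simp: B_def)
    finally show ?thesis .
  qed
  then have "emeasure lborel U / 2 \<le> (INF m. emeasure lborel (B m))" by (rule INF_greatest)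
  also have "\<dots> = emeasure lborel (\<Inter>m. B m)"
  proof (rule INF_emeasure_decseq)
    show "decseq B" by (auto simp: decseq_def B_def intro: order_trans)
    show "emeasure lborel (B i) \<noteq> \<infinity>" for i
    proof -
      have "B i \<subseteq> U" by (auto simp: B_def)
      then have "emeasure lborel (B i) \<le> emeasure lborel U" by (rule emeasure_mono) simp
      with fin show ?thesis by auto
    qed
  qed auto
  finally have "emeasure lborel U / 2 \<le> emeasure lborel (\<Inter>m. B m)" .
  moreover have "0 < emeasure lborel U / 2"
    using U(2) by (simp add: ennreal_zero_less_divide)
  ultimately show "0 < emeasure lborel {u \<in> U. \<forall>m. \<exists>i\<ge>m. u + x i \<in> U}" unfolding INT by (rule less_le_trans[rotated])
qed

definition num_jumps :: "(real \<Rightarrow> real) \<Rightarrow> ennreal" where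
  "num_jumps \<omega> = jump_sum (\<lambda>\<gamma>. 1) \<omega>"

lemma measurable_num_jumps [measurable]: "num_jumps \<in> borel_measurable path_space"
  unfolding num_jumps_def by measurable

lemma num_jumps_finite: "finite (jump_times \<omega>) \<Longrightarrow> num_jumps \<omega> = of_nat (card (jump_times \<omega>))"
  by (simp add: num_jumps_def jump_sum_finite)

lemma num_jumps_infinite: "infinite (jump_times \<omega>) \<Longrightarrow> num_jumps \<omega> = \<infinity>"
  by (simp add: num_jumps_def jump_sum_def)

lemma num_jumps_eq_of_nat: "num_jumps \<omega> = of_nat n \<longleftrightarrow> finite (jump_times \<omega>) \<and> card (jump_times \<omega>) = n"
  using num_jumps_finite[of \<omega>] num_jumps_infinite[of \<omega>] ennreal_of_nat_neq_top[of n]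
  by (cases "finite (jump_times \<omega>)") auto

section \<open>Localisation by the number of jumps and exclusion of infinitely many\<close>

context jump_density begin

text \<open>A generic split raises the number of jumps by exactly one. Testing with the indicator of
  \<open>n + 1\<close> jumps therefore restricts the split side to \<open>n\<close> jumps.\<close>

lemma splitting_identity_level:
  assumes Q: "sets Q = sets path_space" "splitting_identity f Q"
    and \<Phi> [measurable]: "\<Phi> \<in> borel_measurable (marks \<Otimes>\<^sub>M marks \<Otimes>\<^sub>M marks \<Otimes>\<^sub>M path_space)"
  defines "L \<equiv> (\<lambda>n. {\<omega> \<in> space path_space. num_jumps \<omega> = of_nat n})"
  shows "(\<integral>\<^sup>+\<omega>. split_op \<Phi> \<omega> * indicator (L n) \<omega> \<partial>Q) = (\<integral>\<^sup>+\<omega>. merge_sum f \<Phi> \<omega> * indicator (L (Suc n)) \<omega> \<partial>Q)"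
proof -
  note [measurable_cong] = Q(1)
  have sp: "space Q = space path_space" using Q(1) by (rule sets_eq_imp_space_eq)
  have [measurable]: "L n \<in> sets path_space" for n unfolding L_def by measurable
  define \<Psi> where "\<Psi> = (\<lambda>(\<gamma>, \<gamma>1, \<gamma>2, \<omega>). \<Phi> (\<gamma>, \<gamma>1, \<gamma>2, \<omega>) * indicator (L (Suc n)) \<omega>)"
  have \<Psi> [measurable]: "\<Psi> \<in> borel_measurable (marks \<Otimes>\<^sub>M marks \<Otimes>\<^sub>M marks \<Otimes>\<^sub>M path_space)"
    unfolding \<Psi>_def by measurable
  have "(\<integral>\<^sup>+\<omega>. split_op \<Phi> \<omega> * indicator (L n) \<omega> \<partial>Q) = (\<integral>\<^sup>+\<omega>. split_op \<Psi> \<omega> \<partial>Q)"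
  proof (rule nn_integral_cong)
    fix \<omega> assume "\<omega> \<in> space Q"
    then have \<omega>: "\<omega> \<in> space path_space" by (simp add: sp)
    have "split_op \<Phi> \<omega> * indicator (L n) \<omega> = split_op (\<lambda>p. \<Phi> p * indicator (L n) \<omega>) \<omega>"
      by (rule split_op_mult[OF \<Phi> \<omega>, symmetric])
    also have "\<dots> = split_op \<Psi> \<omega>"
    proof (rule split_op_cong[OF _ \<Psi> \<omega>])
      fix \<gamma> \<gamma>1 \<gamma>2 :: mark and \<omega>'
      assume *: "\<omega>' \<in> space path_space" "\<omega> = insert_jump \<gamma> \<omega>'" "fst \<gamma> \<notin> jump_times \<omega>'" "snd \<gamma> \<noteq> 0"
        "0 < fst \<gamma>" "fst \<gamma> \<le> 1" "0 < fst \<gamma>1" "fst \<gamma>1 \<le> 1" "0 < fst \<gamma>2" "fst \<gamma>2 \<le> 1"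
        "fst \<gamma>1 \<notin> jump_times \<omega>'" "fst \<gamma>2 \<notin> jump_times \<omega>'" "fst \<gamma>1 \<noteq> fst \<gamma>2" "snd \<gamma>1 \<noteq> 0" "snd \<gamma>2 \<noteq> 0"
      let ?\<omega> = "insert_jump \<gamma>2 (insert_jump \<gamma>1 \<omega>')"
      have c: "cadlag \<omega>'" using *(1) by (simp add: space_path_space)
      have "fst \<gamma>2 \<notin> jump_times (insert_jump \<gamma>1 \<omega>')" using * c by (simp add: jump_times_insert_jump)
      then have "num_jumps ?\<omega> = 1 + (1 + num_jumps \<omega>')"
        using * unfolding num_jumps_def by (simp add: jump_sum_insert_jump)
      moreover have "num_jumps \<omega> = 1 + num_jumps \<omega>'"
        using * unfolding num_jumps_def by (simp add: jump_sum_insert_jump)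
      ultimately have "num_jumps ?\<omega> = of_nat (Suc n) \<longleftrightarrow> num_jumps \<omega> = of_nat n"
        by (simp add: ennreal_add_left_cancel)
      then show "\<Phi> (\<gamma>, \<gamma>1, \<gamma>2, ?\<omega>) * indicator (L n) \<omega> = \<Psi> (\<gamma>, \<gamma>1, \<gamma>2, ?\<omega>)"
        using *(1) \<omega> by (simp add: \<Psi>_def L_def indicator_def)
    qed measurable
    finally show "split_op \<Phi> \<omega> * indicator (L n) \<omega> = split_op \<Psi> \<omega>" .
  qed
  also have "\<dots> = (\<integral>\<^sup>+\<omega>. merge_sum f \<Psi> \<omega> \<partial>Q)"
    using Q(2) \<Psi> by (simp add: splitting_identity_iff)
  also have "\<dots> = (\<integral>\<^sup>+\<omega>. merge_sum f \<Phi> \<omega> * indicator (L (Suc n)) \<omega> \<partial>Q)"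
    unfolding \<Psi>_def by (intro nn_integral_cong merge_sum_path_mult[OF \<Phi>]) (simp add: sp)
  finally show ?thesis .
qed

text \<open>The identity is used twice. First with a functional whose split side is finite, to bound
  the number of pairs with a size and the pair sum in \<open>U\<close>; then with the indicator of
  infinitely many such pairs, whose merge side is therefore zero.\<close>

lemma AE_finitely_many_jumps:
  assumes Q: "sets Q = sets path_space" "finite_measure Q" "splitting_identity f Q"
  shows "AE \<omega> in Q. finite (jump_times \<omega>)"
proof -
  note [measurable_cong] = Q(1)
  have sp: "space Q = space path_space" using Q(1) by (rule sets_eq_imp_space_eq)
  interpret Q: finite_measure Q by fact
  \<comment> \<open>The density has no uniform bounds, so \<open>U\<close> is taken inside a level
    set of positive measure. The interval [1,2] serves only to stay away from size 0 and within a
    bounded set.\<close>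
  obtain U b where U: "compact U" "0 < emeasure lborel U" "U \<subseteq> {1..2}" and b: "0 < b" "\<And>x. x \<in> U \<Longrightarrow> b \<le> f x" "\<And>x. x \<in> U \<Longrightarrow> f x \<le> 1 / b"
  proof -
    define A where "A k = {x \<in> {1..2::real}. 1 / real (Suc k) \<le> f x \<and> f x \<le> real (Suc k)}" for k
    have [measurable]: "A k \<in> sets borel" for k unfolding A_def by measurable
    have "(\<Union>k. A k) = {1..2}"
    proof (intro equalityI subsetI)
      fix x :: real assume x: "x \<in> {1..2}"
      obtain k where k: "1 / real (Suc k) < f x" using nat_approx_posE[OF f_pos] by blast
      obtain l where l: "f x \<le> real l" using real_arch_simple by blast
      have "1 / real (Suc (max k l)) \<le> 1 / real (Suc k)" by (auto intro!: divide_left_mono)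
      then have "x \<in> A (max k l)" using x k l by (auto simp: A_def)
      then show "x \<in> (\<Union>k. A k)" by blast
    qed (auto simp: A_def)
    then have "emeasure lborel (\<Union>k. A k) \<noteq> 0" by simp
    then obtain k where k: "emeasure lborel (A k) \<noteq> 0"
      using emeasure_UN_eq_0[of lborel A] by fastforce
    have Ak: "A k \<subseteq> {1..2}" by (auto simp: A_def)
    have fin: "emeasure lborel (A k) \<le> 1"
      using emeasure_mono[OF Ak, of lborel] by simp
    define m where "m = measure lborel (A k)"
    have m: "emeasure lborel (A k) = ennreal m"
      unfolding m_def using fin by (intro emeasure_eq_ennreal_measure) (auto simp: top_unique)
    have m0: "0 < m" using k m by (cases "0 < m") (auto simp: ennreal_eq_0_iff)
    \<comment> \<open>Inner approximation of the level set by a compact set, obtained from outer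
      approximation of its complement; \<open>[1,2] - V\<close> is the compact set.\<close>
    obtain V where V: "open V" "{1..2} - A k \<subseteq> V" "emeasure lborel (V - ({1..2} - A k)) < ennreal m"
      by (rule outer_regular_lborel[of "{1..2} - A k" m]) (use m0 in auto)
    have [measurable]: "V \<in> sets borel" using V by simp
    have "A k \<subseteq> ({1..2} - V) \<union> (V - ({1..2} - A k))" using Ak by blast
    then have "emeasure lborel (A k) \<le> emeasure lborel (({1..2} - V) \<union> (V - ({1..2} - A k)))"
      by (rule emeasure_mono) simp
    also have "\<dots> \<le> emeasure lborel ({1..2} - V) + emeasure lborel (V - ({1..2} - A k))"
      by (rule emeasure_subadditive) auto
    finally have le: "ennreal m \<le> emeasure lborel ({1..2} - V) + emeasure lborel (V - ({1..2} - A k))"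
      by (simp add: m)
    show ?thesis
    proof (rule that[of "{1..2} - V" "1 / real (Suc k)"])
      show "compact ({1..2} - V)" using V by (intro compact_diff) auto
      show "0 < emeasure lborel ({1..2} - V)"
      proof (rule ccontr)
        assume "\<not> 0 < emeasure lborel ({1..2} - V)"
        then show False using le V(3) by (simp add: not_gr_zero)
      qed
      fix x assume "x \<in> {1..2} - V"
      then have "x \<in> A k" using V(2) by auto
      then show "1 / real (Suc k) \<le> f x" "f x \<le> 1 / (1 / real (Suc k))" by (auto simp: A_def)
    qed auto
  qed
  have Ub [measurable]: "U \<in> sets borel" using U by (simp add: compact_imp_closed borel_closed)
  \<comment> \<open>Counts ordered pairs of jumps whose second size and whose sum both lie in
    \<open>U\<close>.\<close>
  define T where "T \<omega> = jump_sum (\<lambda>\<gamma>1. jump_sum (\<lambda>\<gamma>2. if fst \<gamma>1 \<noteq> fst \<gamma>2 then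
     indicator U (snd \<gamma>2) * indicator U (snd \<gamma>1 + snd \<gamma>2) else 0) \<omega>) \<omega>" for \<omega>
  \<comment> \<open>Counts the jumps with size in \<open>U\<close>. It is finite on every path, but
    no expectation of it is known to be finite, hence the truncation at levels \<open>K\<close>
    below.\<close>
  define M where "M \<omega> = jump_sum (\<lambda>\<gamma>. indicator U (snd \<gamma>)) \<omega>" for \<omega>
  note [measurable (raw)] = measurable_mark_neq
  have [measurable]: "T \<in> borel_measurable path_space" unfolding T_def by measurable
  have [measurable]: "M \<in> borel_measurable path_space" unfolding M_def by measurable
  have M_fin: "\<exists>K::nat. M \<omega> \<le> of_nat K" if "\<omega> \<in> space path_space" for \<omega>
  proof -
    let ?J = "{t \<in> jump_times \<omega>. jump \<omega> t \<in> U}"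
    have "?J \<subseteq> {t. 1 \<le> \<bar>jump \<omega> t\<bar>}" using U(3) by force
    then have fin: "finite ?J" using finite_big_jumps[of \<omega> 1] that by (auto intro: finite_subset simp: space_path_space)
    have "M \<omega> = (\<integral>\<^sup>+t. indicator U (jump \<omega> t) * indicator (jump_times \<omega>) t \<partial>count_space UNIV)"
      unfolding M_def jump_sum_def by (simp add: nn_integral_count_space_indicator)
    also have "\<dots> = (\<integral>\<^sup>+t. indicator ?J t \<partial>count_space UNIV)"
      by (intro nn_integral_cong) (auto simp: indicator_def)
    also have "\<dots> = of_nat (card ?J)" using fin by simp
    finally show ?thesis by (intro exI[of _ "card ?J"]) simp
  qed
  define l where "l = (\<integral>\<^sup>+x. ennreal (f x) \<partial>lborel)"
  have l: "l < \<infinity>" using f_integrable by (simp add: l_def)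
  have T_fin: "AE \<omega> in Q. M \<omega> \<le> of_nat K \<longrightarrow> T \<omega> \<noteq> \<infinity>" for K :: nat
  proof -
    define h where "h \<omega> = (if M \<omega> \<le> of_nat K then 1 else 0 :: ennreal)" for \<omega>
    \<comment> \<open>The factor \<open>f\<close> at the first part has the finite integral
      \<open>l\<close> on the split side; on the merge side it cancels against \<open>chi\<close>
      and leaves the quotient of \<open>f\<close> at the sum and at the second size.\<close>
    define \<Phi> where "\<Phi> = (\<lambda>(\<gamma> :: mark, \<gamma>1 :: mark, \<gamma>2 :: mark, \<omega>).
      indicator U (snd \<gamma>) * (indicator U (snd \<gamma>2) * ennreal (f (snd \<gamma>1))) * h \<omega>)"
    have [measurable]: "h \<in> borel_measurable path_space" unfolding h_def by measurable
    have \<Phi> [measurable]: "\<Phi> \<in> borel_measurable (marks \<Otimes>\<^sub>M marks \<Otimes>\<^sub>M marks \<Otimes>\<^sub>M path_space)"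
      unfolding \<Phi>_def by measurable
    have lower: "ennreal (b * b) * (T \<omega> * h \<omega>) \<le> merge_sum f \<Phi> \<omega>" for \<omega>
    proof -
      have "T \<omega> * (ennreal (b * b) * h \<omega>) = jump_sum (\<lambda>\<gamma>1. jump_sum (\<lambda>\<gamma>2. (if fst \<gamma>1 \<noteq> fst \<gamma>2 then
         indicator U (snd \<gamma>2) * indicator U (snd \<gamma>1 + snd \<gamma>2) else 0) * (ennreal (b * b) * h \<omega>)) \<omega>) \<omega>"
        unfolding T_def by (simp only: jump_sum_mult_right)
      also have "\<dots> \<le> merge_sum f \<Phi> \<omega>"
        unfolding merge_sum_eq
      proof (intro jump_sum_mono, goal_cases)
        case (1 s1 s2)
        let ?x1 = "jump \<omega> s1" and ?x2 = "jump \<omega> s2"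
        have "(indicator U ?x2 * indicator U (?x1 + ?x2)) * (ennreal (b * b) * h \<omega>) \<le>
           indicator U (?x1 + ?x2) * (indicator U ?x2 * ennreal (f ?x1)) * h \<omega> * ennreal (chi f ?x1 ?x2)"
        proof (cases "?x2 \<in> U \<and> ?x1 + ?x2 \<in> U")
          case True
          \<comment> \<open>On \<open>U\<close> the numerator is at least \<open>b\<close> and the
            denominator at most \<open>1 / b\<close>.\<close>
          have "b * b \<le> f (?x1 + ?x2) / f ?x2"
          proof -
            have "b * (b * f ?x2) \<le> b * 1"
              using b(1) b(3)[of ?x2] True by (intro mult_left_mono) (auto simp: field_simps)
            also have "\<dots> \<le> f (?x1 + ?x2)" using b(2) True by simp
            finally show ?thesis using f_pos[of ?x2] by (simp add: field_simps)
          qed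
          also have "f (?x1 + ?x2) / f ?x2 = f ?x1 * chi f ?x1 ?x2"
            using f_pos[of ?x1] by (simp add: chi_def)
          finally have "ennreal (b * b) \<le> ennreal (f ?x1) * ennreal (chi f ?x1 ?x2)"
            using f_pos[of ?x1] f_pos[of ?x2] f_pos[of "?x1 + ?x2"]
            by (simp add: ennreal_mult[symmetric] chi_def less_imp_le ennreal_leI)
          then have "ennreal (b * b) * h \<omega> \<le> (ennreal (f ?x1) * ennreal (chi f ?x1 ?x2)) * h \<omega>"
            by (rule mult_right_mono) simp
          then show ?thesis using True by (simp add: ac_simps)
        qed (auto simp: indicator_def)
        then show ?case
          by (simp add: \<Phi>_def space_unit_lebesgue emeasure_unit_lebesgue)
      qed
      finally show ?thesis by (simp add: ac_simps)
    qed
    have upper: "split_op \<Phi> \<omega> \<le> of_nat (Suc K) * l" if \<omega> [measurable (raw)]: "\<omega> \<in> space path_space" for \<omega>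
    proof -
      define c where "c = (if M \<omega> \<le> of_nat (Suc K) then 1 else 0 :: ennreal)"
      have "split_op \<Phi> \<omega> = split_op (\<lambda>p. \<Phi> p * c) \<omega>"
      proof (rule split_op_cong[OF \<Phi> _ \<omega>])
        fix \<gamma> \<gamma>1 \<gamma>2 :: mark and \<omega>'
        assume *: "\<omega>' \<in> space path_space" "\<omega> = insert_jump \<gamma> \<omega>'" "fst \<gamma> \<notin> jump_times \<omega>'" "snd \<gamma> \<noteq> 0"
          "0 < fst \<gamma>" "fst \<gamma> \<le> 1" "0 < fst \<gamma>1" "fst \<gamma>1 \<le> 1" "0 < fst \<gamma>2" "fst \<gamma>2 \<le> 1"
          "fst \<gamma>1 \<notin> jump_times \<omega>'" "fst \<gamma>2 \<notin> jump_times \<omega>'" "fst \<gamma>1 \<noteq> fst \<gamma>2" "snd \<gamma>1 \<noteq> 0" "snd \<gamma>2 \<noteq> 0"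
        let ?\<omega> = "insert_jump \<gamma>2 (insert_jump \<gamma>1 \<omega>')"
        have "cadlag \<omega>'" using *(1) by (simp add: space_path_space)
        then have "fst \<gamma>2 \<notin> jump_times (insert_jump \<gamma>1 \<omega>')" using * by (simp add: jump_times_insert_jump)
        then have "M ?\<omega> = indicator U (snd \<gamma>2) + (indicator U (snd \<gamma>1) + M \<omega>')"
          using * unfolding M_def by (simp add: jump_sum_insert_jump)
        then have "M \<omega>' \<le> M ?\<omega>" by (metis add_increasing2 order_refl zero_le add.commute)
        moreover have "M \<omega> = indicator U (snd \<gamma>) + M \<omega>'"
          using * unfolding M_def by (simp add: jump_sum_insert_jump)
        moreover have "(indicator U (snd \<gamma>) :: ennreal) \<le> 1" by (simp add: indicator_def)
        \<comment> \<open>Splitting removes one jump, so the count in \<open>U\<close> drops by at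
          most one; this is the origin of the bound \<open>Suc K\<close>.\<close>
        ultimately have "M \<omega> \<le> 1 + M ?\<omega>" by (metis add_mono)
        then have "M ?\<omega> \<le> of_nat K \<Longrightarrow> M \<omega> \<le> of_nat (Suc K)"
          by (metis add_left_mono of_nat_Suc order_trans)
        then show "\<Phi> (\<gamma>, \<gamma>1, \<gamma>2, ?\<omega>) = \<Phi> (\<gamma>, \<gamma>1, \<gamma>2, ?\<omega>) * c"
          by (simp add: \<Phi>_def h_def c_def del: of_nat_Suc)
      qed measurable
      also have "\<dots> = split_op \<Phi> \<omega> * c" by (rule split_op_mult[OF \<Phi> \<omega>])
      also have "split_op \<Phi> \<omega> \<le> jump_sum (\<lambda>\<gamma>. indicator U (snd \<gamma>) * l) \<omega>"
        unfolding split_op_eq[OF \<Phi> \<omega>]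
      proof (rule jump_sum_mono)
        fix t assume "t \<in> jump_times \<omega>"
        let ?\<gamma> = "(t, jump \<omega> t)"
        have "(\<integral>\<^sup>+\<gamma>1. \<integral>\<^sup>+s2. \<Phi> (?\<gamma>, \<gamma>1, (s2, snd ?\<gamma> - snd \<gamma>1), split_path ?\<gamma> \<gamma>1 (s2, snd ?\<gamma> - snd \<gamma>1) \<omega>) \<partial>unit_lebesgue \<partial>mark_lebesgue)
          \<le> (\<integral>\<^sup>+\<gamma>1. indicator U (snd ?\<gamma>) * ennreal (f (snd \<gamma>1)) \<partial>mark_lebesgue)"
        proof (intro nn_integral_mono)
          fix \<gamma>1 :: mark
          have "(\<integral>\<^sup>+s2. \<Phi> (?\<gamma>, \<gamma>1, (s2, snd ?\<gamma> - snd \<gamma>1), split_path ?\<gamma> \<gamma>1 (s2, snd ?\<gamma> - snd \<gamma>1) \<omega>) \<partial>unit_lebesgue)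
            \<le> (\<integral>\<^sup>+s2. indicator U (snd ?\<gamma>) * ennreal (f (snd \<gamma>1)) \<partial>unit_lebesgue)"
            by (intro nn_integral_mono) (auto simp: \<Phi>_def h_def indicator_def)
          then show "(\<integral>\<^sup>+s2. \<Phi> (?\<gamma>, \<gamma>1, (s2, snd ?\<gamma> - snd \<gamma>1), split_path ?\<gamma> \<gamma>1 (s2, snd ?\<gamma> - snd \<gamma>1) \<omega>) \<partial>unit_lebesgue)
            \<le> indicator U (snd ?\<gamma>) * ennreal (f (snd \<gamma>1))"
            by (simp add: space_unit_lebesgue emeasure_unit_lebesgue)
        qed
        also have "\<dots> = indicator U (snd ?\<gamma>) * l"
        proof -
          have "(\<integral>\<^sup>+\<gamma>1. ennreal (f (snd \<gamma>1)) \<partial>mark_lebesgue) = l"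
            by (subst nn_integral_mark_lebesgue) (simp_all add: space_unit_lebesgue emeasure_unit_lebesgue l_def)
          then show ?thesis by (subst nn_integral_cmult) simp_all
        qed
        finally show "(\<integral>\<^sup>+\<gamma>1. \<integral>\<^sup>+s2. \<Phi> (?\<gamma>, \<gamma>1, (s2, snd ?\<gamma> - snd \<gamma>1), split_path ?\<gamma> \<gamma>1 (s2, snd ?\<gamma> - snd \<gamma>1) \<omega>) \<partial>unit_lebesgue \<partial>mark_lebesgue)
          \<le> indicator U (snd ?\<gamma>) * l" .
      qed
      also have "\<dots> = M \<omega> * l" by (simp add: jump_sum_mult_right M_def)
      finally have "split_op \<Phi> \<omega> \<le> M \<omega> * l * c" by (simp add: mult_right_mono)
      also have "\<dots> \<le> of_nat (Suc K) * l"
        by (auto simp: c_def intro: mult_right_mono simp del: of_nat_Suc)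
      finally show ?thesis .
    qed
    have "ennreal (b * b) * (\<integral>\<^sup>+\<omega>. T \<omega> * h \<omega> \<partial>Q) = (\<integral>\<^sup>+\<omega>. ennreal (b * b) * (T \<omega> * h \<omega>) \<partial>Q)"
      by (rule nn_integral_cmult[symmetric]) measurable
    also have "\<dots> \<le> (\<integral>\<^sup>+\<omega>. merge_sum f \<Phi> \<omega> \<partial>Q)" by (intro nn_integral_mono lower)
    also have "\<dots> = (\<integral>\<^sup>+\<omega>. split_op \<Phi> \<omega> \<partial>Q)" using Q(3) \<Phi> by (simp add: splitting_identity_iff)
    also have "\<dots> \<le> (\<integral>\<^sup>+\<omega>. of_nat (Suc K) * l \<partial>Q)" by (intro nn_integral_mono upper) (simp add: sp)
    also have "\<dots> = of_nat (Suc K) * l * emeasure Q (space Q)" by (simp del: of_nat_Suc)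
    also have "\<dots> < \<infinity>" using l Q.emeasure_finite[of "space Q"] ennreal_of_nat_neq_top[of "Suc K"]
      unfolding infinity_ennreal_def less_top[symmetric] ennreal_mult_eq_top_iff by auto
    finally have "(\<integral>\<^sup>+\<omega>. T \<omega> * h \<omega> \<partial>Q) \<noteq> \<infinity>"
      using b(1) by (auto simp: ennreal_mult_less_top)
    then have "AE \<omega> in Q. T \<omega> * h \<omega> \<noteq> \<infinity>" by (rule nn_integral_noteq_infinite[rotated]) measurable
    then show ?thesis by eventually_elim (auto simp: h_def)
  qed
  have T_AE: "AE \<omega> in Q. T \<omega> \<noteq> \<infinity>"
  proof -
    have "AE \<omega> in Q. \<forall>K::nat. M \<omega> \<le> of_nat K \<longrightarrow> T \<omega> \<noteq> \<infinity>" unfolding AE_all_countable using T_fin by blast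
    then show ?thesis
      by (rule AE_mp) (use M_fin in \<open>auto intro!: AE_I2 simp: sp\<close>)
  qed
  \<comment> \<open>The second test functional: the first part lies in \<open>U\<close> and the path
    after splitting has infinitely many pairs. Its merge side is zero because \<open>T\<close> is
    almost surely finite.\<close>
  define h where "h \<omega> = (if T \<omega> = \<infinity> then 1 else 0 :: ennreal)" for \<omega>
  define \<Phi>' where "\<Phi>' = (\<lambda>(\<gamma> :: mark, \<gamma>1 :: mark, \<gamma>2 :: mark, \<omega> :: real \<Rightarrow> real). indicator U (snd \<gamma>1) :: ennreal)"
  define \<Phi> where "\<Phi> = (\<lambda>(\<gamma>, \<gamma>1, \<gamma>2, \<omega>). \<Phi>' (\<gamma>, \<gamma>1, \<gamma>2, \<omega>) * h \<omega>)"
  have [measurable]: "h \<in> borel_measurable path_space" unfolding h_def by measurable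
  have \<Phi>' [measurable]: "\<Phi>' \<in> borel_measurable (marks \<Otimes>\<^sub>M marks \<Otimes>\<^sub>M marks \<Otimes>\<^sub>M path_space)"
    unfolding \<Phi>'_def by measurable
  have \<Phi> [measurable]: "\<Phi> \<in> borel_measurable (marks \<Otimes>\<^sub>M marks \<Otimes>\<^sub>M marks \<Otimes>\<^sub>M path_space)"
    unfolding \<Phi>_def by measurable
  have "(\<integral>\<^sup>+\<omega>. split_op \<Phi> \<omega> \<partial>Q) = (\<integral>\<^sup>+\<omega>. merge_sum f \<Phi> \<omega> \<partial>Q)" using Q(3) \<Phi> by (simp add: splitting_identity_iff)
  also have "\<dots> = (\<integral>\<^sup>+\<omega>. merge_sum f \<Phi>' \<omega> * h \<omega> \<partial>Q)"
    unfolding \<Phi>_def by (intro nn_integral_cong merge_sum_path_mult[OF \<Phi>']) (simp add: sp)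
  also have "\<dots> = 0"
    by (subst nn_integral_0_iff_AE) (use T_AE in \<open>auto simp: h_def elim!: eventually_mono\<close>)
  finally have "AE \<omega> in Q. split_op \<Phi> \<omega> = 0" by (subst (asm) nn_integral_0_iff_AE) simp_all
  then show ?thesis
  proof (rule AE_mp, intro AE_I2 impI)
    fix \<omega> assume "\<omega> \<in> space Q" and zero: "split_op \<Phi> \<omega> = 0"
    then have \<omega>: "\<omega> \<in> space path_space" by (simp add: sp)
    show "finite (jump_times \<omega>)"
    proof (rule ccontr)
      assume inf: "infinite (jump_times \<omega>)"
      then have "jump_times \<omega> \<noteq> {}" by (metis finite.emptyI)
      then obtain t where t: "t \<in> jump_times \<omega>" by blast
      have t01: "0 < t" "t \<le> 1" using t jump_times_subset[of \<omega>] by auto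
      define z where "z = jump \<omega> t"
      obtain \<omega>' where \<omega>': "\<omega>' \<in> space path_space" and \<omega>z: "\<omega> = insert_jump (t, z) \<omega>'" and jt: "jump_times \<omega>' = jump_times \<omega> - {t}"
        using remove_jump[OF \<omega> t] unfolding z_def by metis
      have c: "cadlag \<omega>'" using \<omega>' by (simp add: space_path_space)
      have "infinite (jump_times \<omega>')" using inf jt by simp
      then obtain \<tau> :: "nat \<Rightarrow> real" where \<tau>: "inj \<tau>" "range \<tau> \<subseteq> jump_times \<omega>'"
        using infinite_countable_subset by blast
      \<comment> \<open>Sizes of infinitely many distinct jumps other than the one to be split. Some
        of them are arbitrarily small beyond any index, as only finitely many jumps exceed a given
        size.\<close>
      define x where "x i = jump \<omega>' (\<tau> i)" for i
      have small: "\<exists>i\<ge>m. \<bar>x i\<bar> < d" if "0 < d" for d m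
      proof (rule ccontr)
        assume "\<not> (\<exists>i\<ge>m. \<bar>x i\<bar> < d)"
        then have "\<tau> ` {m..} \<subseteq> {t. d \<le> \<bar>jump \<omega>' t\<bar>}" by (auto simp: x_def not_less)
        then have "finite (\<tau> ` {m..})" using finite_big_jumps[OF c that] by (rule finite_subset)
        then show False using \<tau>(1) by (simp add: finite_image_iff inj_on_subset infinite_Ici)
      qed
      \<comment> \<open>First parts \<open>u\<close> that form a pair with infinitely many of the
        other jumps; the translation argument gives this set positive measure.\<close>
      define B where "B = {u \<in> U. \<forall>m. \<exists>i\<ge>m. u + x i \<in> U}"
      have B: "0 < emeasure lborel B" and [measurable]: "B \<in> sets borel"
        using translates_infinitely_often[OF U(1,2) small] by (simp_all add: B_def)
      have T_inf: "T (insert_jump \<gamma>2 (insert_jump \<gamma>1 \<omega>')) = \<infinity>"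
        if \<gamma>: "0 < fst \<gamma>1" "fst \<gamma>1 \<le> 1" "0 < fst \<gamma>2" "fst \<gamma>2 \<le> 1" "fst \<gamma>1 \<notin> jump_times \<omega>'" "fst \<gamma>2 \<notin> jump_times \<omega>'"
          "fst \<gamma>1 \<noteq> fst \<gamma>2" "snd \<gamma>1 \<in> B" for \<gamma>1 \<gamma>2
      proof -
        let ?\<omega> = "insert_jump \<gamma>2 (insert_jump \<gamma>1 \<omega>')"
        define I where "I = \<tau> ` {i. snd \<gamma>1 + x i \<in> U}"
        have u: "snd \<gamma>1 \<in> U" "snd \<gamma>1 \<noteq> 0" using \<gamma>(8) U(3) by (auto simp: B_def)
        have "infinite {i. snd \<gamma>1 + x i \<in> U}"
          unfolding infinite_nat_iff_unbounded_le using \<gamma>(8) by (auto simp: B_def)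
        then have I: "infinite I" using \<tau>(1) unfolding I_def by (simp add: finite_image_iff inj_on_subset)
        have j1: "jump ?\<omega> (fst \<gamma>1) = snd \<gamma>1"
          using \<gamma> c by (simp add: jump_insert_jump cadlag_insert_jump jump_times_iff)
        have jI: "jump ?\<omega> r = jump \<omega>' r" "r \<in> jump_times ?\<omega>" "r \<noteq> fst \<gamma>1" "snd \<gamma>1 + jump \<omega>' r \<in> U" if "r \<in> I" for r
        proof -
          have r: "r \<in> jump_times \<omega>'" using that \<tau>(2) by (auto simp: I_def)
          then have "r \<noteq> fst \<gamma>1" "r \<noteq> fst \<gamma>2" using \<gamma> by auto
          then show "jump ?\<omega> r = jump \<omega>' r" "r \<noteq> fst \<gamma>1"
            using c by (simp_all add: jump_insert_jump cadlag_insert_jump)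
          then show "r \<in> jump_times ?\<omega>" using r by (simp add: jump_times_iff)
          show "snd \<gamma>1 + jump \<omega>' r \<in> U" using that by (auto simp: I_def x_def)
        qed
        have "\<infinity> = emeasure (count_space UNIV) I" using I by simp
        also have "\<dots> = (\<integral>\<^sup>+r. indicator I r \<partial>count_space UNIV)" by simp
        also have "\<dots> \<le> (\<integral>\<^sup>+r. (if r \<noteq> fst \<gamma>1 then indicator U (jump ?\<omega> r + snd \<gamma>1) else 0) * indicator (jump_times ?\<omega>) r \<partial>count_space UNIV)"
          by (intro nn_integral_mono) (auto simp: indicator_def jI add.commute)
        also have "\<dots> = jump_sum (\<lambda>\<gamma>. if fst \<gamma> \<noteq> fst \<gamma>1 then indicator U (snd \<gamma> + snd \<gamma>1) else 0) ?\<omega>"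
          unfolding jump_sum_def fst_conv snd_conv by (rule nn_integral_count_space_indicator[symmetric]) simp
        \<comment> \<open>The new part takes the second place in the pairs counted by
          \<open>T\<close>; one of the other jumps takes the first.\<close>
        also have "\<dots> \<le> T ?\<omega>"
          unfolding T_def
        proof (rule jump_sum_mono)
          fix r
          let ?F = "\<lambda>\<gamma>2. if fst (r, jump ?\<omega> r) \<noteq> fst \<gamma>2 then indicator U (snd \<gamma>2) * indicator U (snd (r, jump ?\<omega> r) + snd \<gamma>2) else 0 :: ennreal"
          have "fst \<gamma>1 \<in> jump_times ?\<omega>" using j1 u by (simp add: jump_times_iff)
          from jump_sum_ge[OF this, of ?F]
          show "(if fst (r, jump ?\<omega> r) \<noteq> fst \<gamma>1 then indicator U (snd (r, jump ?\<omega> r) + snd \<gamma>1) else 0) \<le> jump_sum ?F ?\<omega>"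
            using u unfolding fst_conv snd_conv j1 by (cases "r = fst \<gamma>1") simp_all
        qed
        finally show ?thesis by (simp add: top_unique)
      qed
      have cnt: "countable (jump_times \<omega>')" using c by (rule countable_jump_times)
      \<comment> \<open>Splitting this single jump already gives the split side at least the measure
        of \<open>B\<close>, although that side was shown to be zero.\<close>
      have "emeasure lborel B = (\<integral>\<^sup>+\<gamma>1. indicator B (snd \<gamma>1) \<partial>mark_lebesgue)"
        by (subst nn_integral_mark_lebesgue) (simp_all add: space_unit_lebesgue emeasure_unit_lebesgue)
      also have "\<dots> \<le> (\<integral>\<^sup>+\<gamma>1. \<integral>\<^sup>+s2. \<Phi> ((t, z), \<gamma>1, (s2, z - snd \<gamma>1), split_path (t, z) \<gamma>1 (s2, z - snd \<gamma>1) \<omega>) \<partial>unit_lebesgue \<partial>mark_lebesgue)"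
      proof (rule nn_integral_mono_AE, rule AE_mp[OF AE_mark_lebesgue[OF cnt countable_empty]], intro AE_I2 impI)
        fix \<gamma>1 :: mark assume \<gamma>1: "0 < fst \<gamma>1 \<and> fst \<gamma>1 \<le> 1 \<and> fst \<gamma>1 \<notin> jump_times \<omega>' \<and> snd \<gamma>1 \<notin> {}"
        have "indicator B (snd \<gamma>1) = (\<integral>\<^sup>+s2. indicator B (snd \<gamma>1) \<partial>unit_lebesgue)"
          by (simp add: space_unit_lebesgue emeasure_unit_lebesgue)
        also have "\<dots> \<le> (\<integral>\<^sup>+s2. \<Phi> ((t, z), \<gamma>1, (s2, z - snd \<gamma>1), split_path (t, z) \<gamma>1 (s2, z - snd \<gamma>1) \<omega>) \<partial>unit_lebesgue)"
        proof (rule nn_integral_mono_AE, rule AE_mp[OF AE_unit_lebesgue[of "insert (fst \<gamma>1) (jump_times \<omega>')"]])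
          show "AE s2 in unit_lebesgue. 0 < s2 \<and> s2 \<le> 1 \<and> s2 \<notin> insert (fst \<gamma>1) (jump_times \<omega>') \<longrightarrow>
            indicator B (snd \<gamma>1) \<le> \<Phi> ((t, z), \<gamma>1, (s2, z - snd \<gamma>1), split_path (t, z) \<gamma>1 (s2, z - snd \<gamma>1) \<omega>)"
          proof (intro AE_I2 impI)
            fix s2 assume s2: "0 < s2 \<and> s2 \<le> 1 \<and> s2 \<notin> insert (fst \<gamma>1) (jump_times \<omega>')"
            have eq: "split_path (t, z) \<gamma>1 (s2, z - snd \<gamma>1) \<omega> = insert_jump (s2, z - snd \<gamma>1) (insert_jump \<gamma>1 \<omega>')"
              unfolding \<omega>z using t01 \<gamma>1 s2 by (intro split_path_insert_jump) auto
            show "indicator B (snd \<gamma>1) \<le> \<Phi> ((t, z), \<gamma>1, (s2, z - snd \<gamma>1), split_path (t, z) \<gamma>1 (s2, z - snd \<gamma>1) \<omega>)"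
            proof (cases "snd \<gamma>1 \<in> B")
              case True
              have "T (insert_jump (s2, z - snd \<gamma>1) (insert_jump \<gamma>1 \<omega>')) = \<infinity>"
                using \<gamma>1 s2 True by (intro T_inf) auto
              moreover have "snd \<gamma>1 \<in> U" using True by (simp add: B_def)
              ultimately show ?thesis unfolding eq using True by (simp add: \<Phi>_def \<Phi>'_def h_def)
            qed simp
          qed
        qed (use cnt in simp)
        finally show "indicator B (snd \<gamma>1) \<le> (\<integral>\<^sup>+s2. \<Phi> ((t, z), \<gamma>1, (s2, z - snd \<gamma>1), split_path (t, z) \<gamma>1 (s2, z - snd \<gamma>1) \<omega>) \<partial>unit_lebesgue)" .
      qed
      also have "\<dots> \<le> split_op \<Phi> \<omega>"
        unfolding split_op_eq[OF \<Phi> \<omega>]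
        using jump_sum_ge[OF t, of "\<lambda>\<gamma>. \<integral>\<^sup>+\<gamma>1. \<integral>\<^sup>+s2. \<Phi> (\<gamma>, \<gamma>1, (s2, snd \<gamma> - snd \<gamma>1), split_path \<gamma> \<gamma>1 (s2, snd \<gamma> - snd \<gamma>1) \<omega>) \<partial>unit_lebesgue \<partial>mark_lebesgue"]
        by (simp add: z_def)
      finally show False using B zero by simp
    qed
  qed
qed

end

section \<open>Uniqueness\<close>

lemma jump_sum_all_pairs:
  assumes "finite (jump_times \<omega>)" "card (jump_times \<omega>) = Suc n"
  shows "jump_sum (\<lambda>\<gamma>1. jump_sum (\<lambda>\<gamma>2. if fst \<gamma>1 \<noteq> fst \<gamma>2 then c else 0) \<omega>) \<omega> = of_nat (Suc n) * (of_nat n * c)"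
proof -
  have "(\<Sum>t2\<in>jump_times \<omega>. if t1 \<noteq> t2 then c else 0) = of_nat n * c" if "t1 \<in> jump_times \<omega>" for t1
  proof -
    have "(\<Sum>t2\<in>jump_times \<omega>. if t1 \<noteq> t2 then c else 0) = (\<Sum>t2\<in>jump_times \<omega> - {t1}. c)"
      by (rule sum.mono_neutral_cong_right) (use assms in auto)
    then show ?thesis using assms that by simp
  qed
  then show ?thesis using assms by (simp add: jump_sum_finite cong: sum.cong)
qed

context jump_density begin

lemma f_mass_pos: "0 < (\<integral>\<^sup>+x. ennreal (f x) \<partial>lborel)"
proof (rule ccontr)
  assume "\<not> ?thesis"
  then have "AE x in lborel. ennreal (f x) = 0" by (simp add: nn_integral_0_iff_AE)
  then have "AE x in lborel :: real measure. False"
    by (rule AE_mp) (use f_pos in \<open>auto intro!: AE_I2 simp: ennreal_eq_0_iff not_le\<close>)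
  then have "ae_filter (lborel :: real measure) = bot" by (simp add: eventually_False)
  then show False unfolding ae_filter_eq_bot_iff by simp
qed

lemma first_mark_sum_const: "first_mark_sum n z \<omega> (\<lambda>_. G) = pinned_sum n z \<omega> G"
  by (cases n) simp_all

lemma chi_pos: "0 < chi f a b"
  using f_pos by (simp add: chi_def)

context
  fixes Q :: "(real \<Rightarrow> real) measure"
  assumes Q: "sets Q = sets path_space" "prob_space Q" "splitting_identity f Q"
begin

interpretation Q: prob_space Q by (rule Q)

text \<open>Tested with \<open>g\<close> of the time of the split mark, the split side sees
  \<open>g\<close> at the jump time while the merge side integrates that time out and sees only the
  mean of \<open>g\<close>. The case \<open>g = 1\<close> eliminates the unknown contribution of two
  jumps.\<close>

lemma level_one_times_uniform:
  defines "L \<equiv> (\<lambda>n. {\<omega> \<in> space path_space. num_jumps \<omega> = of_nat n})"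
  assumes g [measurable]: "g \<in> borel_measurable unit_lebesgue"
  shows "(\<integral>\<^sup>+\<omega>. jump_sum (\<lambda>\<gamma>. g (fst \<gamma>)) \<omega> * indicator (L 1) \<omega> \<partial>Q) = (\<integral>\<^sup>+s. g s \<partial>unit_lebesgue) * emeasure Q (L 1)"
proof -
  note [measurable_cong] = Q(1)
  have sp: "space Q = space path_space" using Q(1) by (rule sets_eq_imp_space_eq)
  define l where "l = (\<integral>\<^sup>+x. ennreal (f x) \<partial>lborel)"
  have [measurable]: "L n \<in> sets path_space" for n unfolding L_def by measurable
  \<comment> \<open>The unknown contribution of paths with two jumps. The weight \<open>f\<close> in
    the test functional makes the common factor \<open>l\<close> on the split side finite and
    positive, so that it can be cancelled.\<close>
  define R where "R \<omega> = jump_sum (\<lambda>\<gamma>1. jump_sum (\<lambda>\<gamma>2. if fst \<gamma>1 \<noteq> fst \<gamma>2 then ennreal (f (snd \<gamma>1)) * ennreal (chi f (snd \<gamma>1) (snd \<gamma>2)) else 0) \<omega>) \<omega>" for \<omega>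
  note [measurable (raw)] = measurable_mark_neq
  have [measurable]: "R \<in> borel_measurable path_space" unfolding R_def by measurable
  have main: "l * (\<integral>\<^sup>+\<omega>. jump_sum (\<lambda>\<gamma>. g (fst \<gamma>)) \<omega> * indicator (L 1) \<omega> \<partial>Q) = (\<integral>\<^sup>+s. g s \<partial>unit_lebesgue) * (\<integral>\<^sup>+\<omega>. R \<omega> * indicator (L 2) \<omega> \<partial>Q)"
    if g [measurable]: "g \<in> borel_measurable unit_lebesgue" for g
  proof -
    have [measurable (raw)]: "(\<lambda>x. g (fst (a x))) \<in> borel_measurable M" if "a \<in> M \<rightarrow>\<^sub>M marks" for a and M :: "'x measure"
    proof -
      have "(\<lambda>x. fst (a x)) \<in> M \<rightarrow>\<^sub>M unit_lebesgue"
        using measurable_compose[OF that measurable_fst] by (simp add: measurable_cong_sets[OF refl sets_unit_lebesgue])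
      then show ?thesis by (rule measurable_compose) measurable
    qed
    define \<Phi> where "\<Phi> = (\<lambda>(\<gamma> :: mark, \<gamma>1 :: mark, \<gamma>2 :: mark, \<omega> :: real \<Rightarrow> real). g (fst \<gamma>) * ennreal (f (snd \<gamma>1)))"
    have \<Phi> [measurable]: "\<Phi> \<in> borel_measurable (marks \<Otimes>\<^sub>M marks \<Otimes>\<^sub>M marks \<Otimes>\<^sub>M path_space)"
      unfolding \<Phi>_def by measurable
    have split: "split_op \<Phi> \<omega> = l * jump_sum (\<lambda>\<gamma>. g (fst \<gamma>)) \<omega>" if "\<omega> \<in> space path_space" for \<omega>
    proof -
      have "split_op \<Phi> \<omega> = jump_sum (\<lambda>\<gamma>. l * g (fst \<gamma>)) \<omega>"
        unfolding split_op_eq[OF \<Phi> that]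
      proof (rule jump_sum_cong)
        fix \<gamma> :: mark assume "\<gamma> \<in> space marks"
        have "(\<integral>\<^sup>+\<gamma>1. \<integral>\<^sup>+s2. \<Phi> (\<gamma>, \<gamma>1, (s2, snd \<gamma> - snd \<gamma>1), split_path \<gamma> \<gamma>1 (s2, snd \<gamma> - snd \<gamma>1) \<omega>) \<partial>unit_lebesgue \<partial>mark_lebesgue) =
          (\<integral>\<^sup>+\<gamma>1. g (fst \<gamma>) * ennreal (f (snd \<gamma>1)) \<partial>mark_lebesgue)"
          by (simp add: \<Phi>_def space_unit_lebesgue emeasure_unit_lebesgue)
        also have "\<dots> = g (fst \<gamma>) * (\<integral>\<^sup>+\<gamma>1. ennreal (f (snd \<gamma>1)) \<partial>mark_lebesgue)"
          by (rule nn_integral_cmult) measurable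
        also have "(\<integral>\<^sup>+\<gamma>1. ennreal (f (snd \<gamma>1)) \<partial>mark_lebesgue) = l"
          by (subst nn_integral_mark_lebesgue) (simp_all add: space_unit_lebesgue emeasure_unit_lebesgue l_def)
        finally show "(\<integral>\<^sup>+\<gamma>1. \<integral>\<^sup>+s2. \<Phi> (\<gamma>, \<gamma>1, (s2, snd \<gamma> - snd \<gamma>1), split_path \<gamma> \<gamma>1 (s2, snd \<gamma> - snd \<gamma>1) \<omega>) \<partial>unit_lebesgue \<partial>mark_lebesgue) =
          l * g (fst \<gamma>)" by (simp add: mult.commute)
      qed
      then show ?thesis by (simp add: jump_sum_mult_left)
    qed
    have merge: "merge_sum f \<Phi> \<omega> = (\<integral>\<^sup>+s. g s \<partial>unit_lebesgue) * R \<omega>" for \<omega>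
    proof -
      have "merge_sum f \<Phi> \<omega> = jump_sum (\<lambda>\<gamma>1. jump_sum (\<lambda>\<gamma>2. (\<integral>\<^sup>+s. g s \<partial>unit_lebesgue) *
          (if fst \<gamma>1 \<noteq> fst \<gamma>2 then ennreal (f (snd \<gamma>1)) * ennreal (chi f (snd \<gamma>1) (snd \<gamma>2)) else 0)) \<omega>) \<omega>"
        unfolding merge_sum_eq \<Phi>_def
        by (intro arg_cong2[where f=jump_sum] ext refl) (simp add: nn_integral_multc ac_simps)
      then show ?thesis by (simp only: jump_sum_mult_left R_def)
    qed
    have "l * (\<integral>\<^sup>+\<omega>. jump_sum (\<lambda>\<gamma>. g (fst \<gamma>)) \<omega> * indicator (L 1) \<omega> \<partial>Q) = (\<integral>\<^sup>+\<omega>. l * (jump_sum (\<lambda>\<gamma>. g (fst \<gamma>)) \<omega> * indicator (L 1) \<omega>) \<partial>Q)"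
      by (rule nn_integral_cmult[symmetric]) measurable
    also have "\<dots> = (\<integral>\<^sup>+\<omega>. split_op \<Phi> \<omega> * indicator (L 1) \<omega> \<partial>Q)"
      by (intro nn_integral_cong) (simp add: split sp mult.assoc)
    also have "\<dots> = (\<integral>\<^sup>+\<omega>. merge_sum f \<Phi> \<omega> * indicator (L 2) \<omega> \<partial>Q)"
      using splitting_identity_level[OF Q(1,3) \<Phi>, of 1] by (simp add: L_def numeral_2_eq_2)
    also have "\<dots> = (\<integral>\<^sup>+\<omega>. (\<integral>\<^sup>+s. g s \<partial>unit_lebesgue) * (R \<omega> * indicator (L 2) \<omega>) \<partial>Q)"
      by (simp add: merge mult.assoc)
    also have "\<dots> = (\<integral>\<^sup>+s. g s \<partial>unit_lebesgue) * (\<integral>\<^sup>+\<omega>. R \<omega> * indicator (L 2) \<omega> \<partial>Q)"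
      by (rule nn_integral_cmult) measurable
    finally show ?thesis .
  qed
  have "(\<integral>\<^sup>+\<omega>. jump_sum (\<lambda>\<gamma>. 1) \<omega> * indicator (L 1) \<omega> \<partial>Q) = (\<integral>\<^sup>+\<omega>. indicator (L 1) \<omega> \<partial>Q)"
    by (intro nn_integral_cong) (auto simp: L_def num_jumps_def[symmetric] indicator_def)
  \<comment> \<open>The constant function expresses the unknown two-jump contribution through the
    probability of one jump.\<close>
  then have one: "l * emeasure Q (L 1) = (\<integral>\<^sup>+\<omega>. R \<omega> * indicator (L 2) \<omega> \<partial>Q)"
    using main[of "\<lambda>s. 1"] by (simp add: space_unit_lebesgue emeasure_unit_lebesgue)
  have "l * (\<integral>\<^sup>+\<omega>. jump_sum (\<lambda>\<gamma>. g (fst \<gamma>)) \<omega> * indicator (L 1) \<omega> \<partial>Q) = l * ((\<integral>\<^sup>+s. g s \<partial>unit_lebesgue) * emeasure Q (L 1))"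
    unfolding main[OF g] one[symmetric] by (simp add: ac_simps)
  then show ?thesis
    using f_integrable f_mass_pos unfolding l_def[symmetric] by (auto simp: ennreal_mult_cancel_left)
qed

text \<open>Division by \<open>chi\<close> removes the weight on the merge side, which then only
  counts the ordered pairs of jumps. The same computation for pinned sums makes the recursions of an
  arbitrary solution and of the bridge identical.\<close>

lemma level_Suc:
  assumes G [measurable]: "G \<in> borel_measurable path_space"
  defines "L \<equiv> (\<lambda>n. {\<omega> \<in> space path_space. num_jumps \<omega> = of_nat n})"
    and "\<Phi> \<equiv> (\<lambda>(\<gamma> :: mark, \<gamma>1 :: mark, \<gamma>2 :: mark, \<omega>). G \<omega> * ennreal (1 / chi f (snd \<gamma>1) (snd \<gamma>2)))"
  shows "of_nat (Suc (Suc n)) * (of_nat (Suc n) * (\<integral>\<^sup>+\<omega>. G \<omega> * indicator (L (Suc (Suc n))) \<omega> \<partial>Q)) =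
      (\<integral>\<^sup>+\<omega>. split_op \<Phi> \<omega> * indicator (L (Suc n)) \<omega> \<partial>Q)"
    and "z \<noteq> 0 \<Longrightarrow> pinned_sum (Suc n) z (const_path x) (merge_sum f \<Phi>) =
      of_nat (Suc (Suc n)) * (of_nat (Suc n) * pinned_sum (Suc n) z (const_path x) G)"
    and "\<Phi> \<in> borel_measurable (marks \<Otimes>\<^sub>M marks \<Otimes>\<^sub>M marks \<Otimes>\<^sub>M path_space)"
proof -
  note [measurable_cong] = Q(1)
  have [measurable]: "L n \<in> sets path_space" for n unfolding L_def by measurable
  show \<Phi> [measurable]: "\<Phi> \<in> borel_measurable (marks \<Otimes>\<^sub>M marks \<Otimes>\<^sub>M marks \<Otimes>\<^sub>M path_space)"
    unfolding \<Phi>_def by measurable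
  have chi: "ennreal (1 / chi f a b) * ennreal (chi f a b) = 1" for a b
    using chi_pos[of a b] by (simp add: ennreal_mult[symmetric] less_imp_le)
  have merge: "merge_sum f \<Phi> \<omega> = jump_sum (\<lambda>\<gamma>1. jump_sum (\<lambda>\<gamma>2. if fst \<gamma>1 \<noteq> fst \<gamma>2 then G \<omega> else 0) \<omega>) \<omega>" for \<omega>
    unfolding merge_sum_eq \<Phi>_def
    by (intro arg_cong2[where f=jump_sum] ext refl)
       (simp add: space_unit_lebesgue emeasure_unit_lebesgue mult.assoc chi)
  have "(\<integral>\<^sup>+\<omega>. split_op \<Phi> \<omega> * indicator (L (Suc n)) \<omega> \<partial>Q) = (\<integral>\<^sup>+\<omega>. merge_sum f \<Phi> \<omega> * indicator (L (Suc (Suc n))) \<omega> \<partial>Q)"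
    unfolding L_def by (rule splitting_identity_level[OF Q(1,3) \<Phi>])
  also have "\<dots> = (\<integral>\<^sup>+\<omega>. of_nat (Suc (Suc n)) * (of_nat (Suc n) * (G \<omega> * indicator (L (Suc (Suc n))) \<omega>)) \<partial>Q)"
  proof (rule nn_integral_cong)
    fix \<omega>
    show "merge_sum f \<Phi> \<omega> * indicator (L (Suc (Suc n))) \<omega> = of_nat (Suc (Suc n)) * (of_nat (Suc n) * (G \<omega> * indicator (L (Suc (Suc n))) \<omega>))"
    proof (cases "\<omega> \<in> L (Suc (Suc n))")
      case True
      then have "finite (jump_times \<omega>)" "card (jump_times \<omega>) = Suc (Suc n)"
        by (simp_all add: L_def num_jumps_eq_of_nat del: of_nat_Suc)
      from jump_sum_all_pairs[OF this, of "G \<omega>"] True show ?thesis by (simp add: merge del: of_nat_Suc)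
    qed simp
  qed
  also have "\<dots> = of_nat (Suc (Suc n)) * (of_nat (Suc n) * (\<integral>\<^sup>+\<omega>. G \<omega> * indicator (L (Suc (Suc n))) \<omega> \<partial>Q))"
    by (subst nn_integral_cmult, measurable, subst nn_integral_cmult, measurable)
  finally show "of_nat (Suc (Suc n)) * (of_nat (Suc n) * (\<integral>\<^sup>+\<omega>. G \<omega> * indicator (L (Suc (Suc n))) \<omega> \<partial>Q)) =
      (\<integral>\<^sup>+\<omega>. split_op \<Phi> \<omega> * indicator (L (Suc n)) \<omega> \<partial>Q)" ..
  show "pinned_sum (Suc n) z (const_path x) (merge_sum f \<Phi>) =
      of_nat (Suc (Suc n)) * (of_nat (Suc n) * pinned_sum (Suc n) z (const_path x) G)" if "z \<noteq> 0"
  proof -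
    have "(\<lambda>(\<gamma>1 :: mark, \<gamma>2 :: mark, \<omega>). G \<omega>) \<in> borel_measurable (marks \<Otimes>\<^sub>M marks \<Otimes>\<^sub>M path_space)" by measurable
    from pinned_sum_pairs(1)[OF this that, of n x]
    have "pinned_sum (Suc n) z (const_path x) (merge_sum f \<Phi>) = of_nat (Suc (Suc n)) * (of_nat (Suc n) *
        (\<integral>\<^sup>+\<gamma>1. ennreal (f (snd \<gamma>1)) * first_mark_sum n (z - snd \<gamma>1) (insert_jump \<gamma>1 (const_path x)) (\<lambda>_. G) \<partial>mark_lebesgue))"
      unfolding merge[abs_def] by (simp only:)
    then show ?thesis by (simp only: first_mark_sum_const pinned_sum.simps)
  qed
qed

end

lemma pinned_pure_jumpD:
  assumes Q: "pinned_pure_jump Q x y"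
  shows "sets Q = sets path_space" "prob_space Q"
    and "AE \<omega> in Q. \<omega> \<in> space path_space \<and> \<omega> 0 = x \<and> \<omega> 1 = y \<and> (finite (jump_times \<omega>) \<longrightarrow>
      (\<forall>t\<in>{0..1}. \<omega> t - \<omega> 0 = (\<Sum>s\<in>{s \<in> jump_times \<omega>. s \<le> t}. jump \<omega> s)))"
proof -
  show s: "sets Q = sets path_space" and p: "prob_space Q"
    using Q by (auto simp: pinned_pure_jump_def space_prob_algebra)
  interpret prob_space Q by (rule p)
  note [measurable_cong] = s
  have sp: "space Q = space path_space" using s by (rule sets_eq_imp_space_eq)
  have [measurable]: "(\<lambda>\<omega>. \<omega> 0) \<in> borel_measurable Q" "(\<lambda>\<omega>. \<omega> 1) \<in> borel_measurable Q"
    by (intro measurable_path_eval; simp)+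
  have "AE \<omega> in Q. \<omega> 0 = x" "AE \<omega> in Q. \<omega> 1 = y"
    using Q by (simp_all add: pinned_pure_jump_def prob_Collect_eq_1)
  moreover have "AE \<omega> in Q. \<forall>t\<in>{0..1}. (jump \<omega> has_sum (\<omega> t - \<omega> 0)) {s\<in>jump_times \<omega>. s \<le> t}"
    using Q by (simp add: pinned_pure_jump_def pure_jump_def)
  moreover have "AE \<omega> in Q. \<omega> \<in> space path_space" by (rule AE_I2) (simp add: sp)
  ultimately show "AE \<omega> in Q. \<omega> \<in> space path_space \<and> \<omega> 0 = x \<and> \<omega> 1 = y \<and> (finite (jump_times \<omega>) \<longrightarrow>
      (\<forall>t\<in>{0..1}. \<omega> t - \<omega> 0 = (\<Sum>s\<in>{s \<in> jump_times \<omega>. s \<le> t}. jump \<omega> s)))"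
  proof eventually_elim
    case (elim \<omega>)
    have "\<omega> t - \<omega> 0 = (\<Sum>s\<in>{s \<in> jump_times \<omega>. s \<le> t}. jump \<omega> s)" if "finite (jump_times \<omega>)" "t \<in> {0..1}" for t
    proof -
      have "(jump \<omega> has_sum (\<Sum>s\<in>{s \<in> jump_times \<omega>. s \<le> t}. jump \<omega> s)) {s \<in> jump_times \<omega>. s \<le> t}"
        using that by (intro has_sum_finite) auto
      then show ?thesis using elim(3) that has_sum_unique by blast
    qed
    with elim show ?case by blast
  qed
qed

text \<open>A single jump of a pure jump path carries the whole increment \<open>y - x\<close>, so
  only its time is left undetermined.\<close>

lemma AE_level_one:
  assumes Q: "pinned_pure_jump Q x y"
  shows "AE \<omega> in Q. num_jumps \<omega> = 1 \<longrightarrow> y \<noteq> x \<and> (\<exists>T. jump_times \<omega> = {T} \<and> \<omega> = insert_jump (T, y - x) (const_path x))"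
  using pinned_pure_jumpD(3)[OF Q]
proof eventually_elim
  case (elim \<omega>)
  show ?case
  proof
    assume "num_jumps \<omega> = 1"
    then have "finite (jump_times \<omega>)" "card (jump_times \<omega>) = 1"
      using num_jumps_eq_of_nat[of \<omega> 1] by simp_all
    then obtain T where T: "jump_times \<omega> = {T}" using card_1_singletonE by blast
    have T01: "0 < T" "T \<le> 1" "jump \<omega> T \<noteq> 0" using T jump_times_subset[of \<omega>] jump_times_iff[of T \<omega>] by auto
    have val: "\<omega> t - x = (if T \<le> t then jump \<omega> T else 0)" if "t \<in> {0..1}" for t
    proof -
      have "\<omega> t - \<omega> 0 = (\<Sum>s\<in>{s \<in> jump_times \<omega>. s \<le> t}. jump \<omega> s)"
        using elim that \<open>finite (jump_times \<omega>)\<close> by blast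
      also have "{s \<in> jump_times \<omega>. s \<le> t} = (if T \<le> t then {T} else {})" using T by auto
      finally show ?thesis using elim by (simp split: if_splits)
    qed
    have z: "jump \<omega> T = y - x" using val[of 1] T01 elim by simp
    have "\<omega> = insert_jump (T, y - x) (const_path x)"
    proof
      fix t
      show "\<omega> t = insert_jump (T, y - x) (const_path x) t"
      proof (cases "t \<in> {0..1}")
        case True
        then show ?thesis using val[OF True] T01 z by (auto simp: insert_jump_def split: if_splits)
      next
        case False
        then show ?thesis using elim by (auto simp: insert_jump_def space_path_space extensional_def restrict_def)
      qed
    qed
    then show "y \<noteq> x \<and> (\<exists>T. jump_times \<omega> = {T} \<and> \<omega> = insert_jump (T, y - x) (const_path x))"
      using T z T01 by auto
  qed
qed

text \<open>Every level with at least one jump is the corresponding pinned sum times one and the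
  same constant \<open>c\<close>. Total mass one then forces the normalising mass to be finite and
  \<open>c\<close> to be its inverse.\<close>

lemma pinned_unique:
  assumes Q: "pinned_pure_jump Q x y" and si: "splitting_identity f Q" and xy: "x \<noteq> y"
  shows "Q = bridge (x, y)"
proof -
  note s = pinned_pure_jumpD(1)[OF Q] and p = pinned_pure_jumpD(2)[OF Q]
  interpret Q: prob_space Q by (rule p)
  note [measurable_cong] = s
  define z where "z = y - x"
  have z: "z \<noteq> 0" using xy by (simp add: z_def)
  define L where "L n = {\<omega> \<in> space path_space. num_jumps \<omega> = of_nat n}" for n
  have [measurable]: "L n \<in> sets path_space" for n unfolding L_def by measurable
  \<comment> \<open>Read off from one jump: \<open>pinned_sum 0 z\<close> contributes
    \<open>f z\<close> times a uniform time average.\<close>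
  define c where "c = emeasure Q (L 1) * ennreal (1 / f z)"
  let ?c = "\<lambda>n. ennreal (1 / fact (Suc n))"
  have level: "(\<integral>\<^sup>+\<omega>. G \<omega> * indicator (L (Suc n)) \<omega> \<partial>Q) = c * (?c n * pinned_sum n z (const_path x) G)"
    if "G \<in> borel_measurable path_space" for G n
    using that
  proof (induction n arbitrary: G)
    case (0 G)
    note [measurable] = 0
    let ?g = "\<lambda>s. G (insert_jump (s, z) (const_path x))"
    have [measurable]: "?g \<in> borel_measurable unit_lebesgue"
    proof -
      have [measurable (raw)]: "const_path x \<in> space path_space" by simp
      show ?thesis by measurable
    qed
    have "(\<integral>\<^sup>+\<omega>. G \<omega> * indicator (L 1) \<omega> \<partial>Q) = (\<integral>\<^sup>+\<omega>. jump_sum (\<lambda>\<gamma>. ?g (fst \<gamma>)) \<omega> * indicator (L 1) \<omega> \<partial>Q)"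
    proof (rule nn_integral_cong_AE)
      show "AE \<omega> in Q. G \<omega> * indicator (L 1) \<omega> = jump_sum (\<lambda>\<gamma>. ?g (fst \<gamma>)) \<omega> * indicator (L 1) \<omega>"
        using AE_level_one[OF Q]
      proof eventually_elim
        case (elim \<omega>)
        show ?case
        proof (cases "\<omega> \<in> L 1")
          case True
          then obtain T where T: "jump_times \<omega> = {T}" "\<omega> = insert_jump (T, z) (const_path x)"
            using elim by (auto simp: L_def z_def)
          have "jump_sum (\<lambda>\<gamma>. ?g (fst \<gamma>)) \<omega> = ?g T" using T(1) by (simp add: jump_sum_finite)
          then show ?thesis using T(2) by simp
        qed simp
      qed
    qed
    also have "\<dots> = (\<integral>\<^sup>+s. ?g s \<partial>unit_lebesgue) * emeasure Q (L 1)"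
      unfolding L_def by (rule level_one_times_uniform[OF s p si]) measurable
    also have "\<dots> = c * (?c 0 * pinned_sum 0 z (const_path x) G)"
    proof -
      have "ennreal (1 / f z) * ennreal (f z) = 1"
        using f_pos[of z] by (simp add: ennreal_mult[symmetric] less_imp_le)
      then have "emeasure Q (L 1) * (ennreal (1 / f z) * ennreal (f z)) * (\<integral>\<^sup>+s. ?g s \<partial>unit_lebesgue) = emeasure Q (L 1) * (\<integral>\<^sup>+s. ?g s \<partial>unit_lebesgue)"
        by simp
      then show ?thesis by (simp add: c_def ac_simps)
    qed
    finally show ?case by simp
  next
    case (Suc n G)
    note [measurable] = Suc.prems
    define \<Phi> where "\<Phi> = (\<lambda>(\<gamma> :: mark, \<gamma>1 :: mark, \<gamma>2 :: mark, \<omega>). G \<omega> * ennreal (1 / chi f (snd \<gamma>1) (snd \<gamma>2)))"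
    note lS = level_Suc[OF s p si Suc.prems, folded L_def \<Phi>_def]
    note [measurable] = lS(3)
    let ?a = "of_nat (Suc (Suc n)) * of_nat (Suc n) :: ennreal"
    have cc: "?c n = ?c (Suc n) * of_nat (Suc (Suc n))"
    proof -
      have "?c (Suc n) * of_nat (Suc (Suc n)) = ennreal (1 / fact (Suc (Suc n)) * real (Suc (Suc n)))"
        by (subst ennreal_mult) (simp_all add: ennreal_of_nat_eq_real_of_nat del: fact_Suc of_nat_Suc)
      also have "1 / fact (Suc (Suc n)) * real (Suc (Suc n)) = 1 / fact (Suc n)"
        by (subst fact_Suc) (simp del: fact_Suc of_nat_Suc)
      finally show ?thesis ..
    qed
    have "?a * (\<integral>\<^sup>+\<omega>. G \<omega> * indicator (L (Suc (Suc n))) \<omega> \<partial>Q) = (\<integral>\<^sup>+\<omega>. split_op \<Phi> \<omega> * indicator (L (Suc n)) \<omega> \<partial>Q)"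
      using lS(1)[of n] by (simp only: mult.assoc L_def)
    also have "\<dots> = c * (?c n * pinned_sum n z (const_path x) (split_op \<Phi>))"
      by (rule Suc.IH) measurable
    also have "\<dots> = c * (?c (Suc n) * pinned_sum (Suc n) z (const_path x) (merge_sum f \<Phi>))"
      unfolding cc pinned_sum_split_op[OF lS(3) z, symmetric] by (simp only: mult.assoc)
    also have "\<dots> = ?a * (c * (?c (Suc n) * pinned_sum (Suc n) z (const_path x) G))"
      unfolding lS(2)[OF z] by (simp only: ac_simps)
    finally show ?case
      by (subst (asm) ennreal_mult_cancel_left) (simp add: ennreal_mult_eq_top_iff ennreal_of_nat_neq_top del: of_nat_Suc)
  qed
  have total: "(\<integral>\<^sup>+\<omega>. G \<omega> \<partial>Q) = c * bridge_sum x z G" if [measurable]: "G \<in> borel_measurable path_space" for G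
  proof -
    \<comment> \<open>Almost every path has a finite number of jumps, and not zero of them since
      \<open>x \<noteq> y\<close>; exactly one summand is therefore active.\<close>
    have "AE \<omega> in Q. G \<omega> = (\<Sum>n. G \<omega> * indicator (L (Suc n)) \<omega>)"
      using AE_finitely_many_jumps[OF s Q.finite_measure_axioms si] pinned_pure_jumpD(3)[OF Q]
    proof eventually_elim
      case (elim \<omega>)
      define m where "m = card (jump_times \<omega>)"
      have "m \<noteq> 0"
      proof
        assume "m = 0"
        then have "jump_times \<omega> = {}" using elim(1) by (simp add: m_def)
        moreover have "\<omega> 1 - \<omega> 0 = (\<Sum>s\<in>{s \<in> jump_times \<omega>. s \<le> 1}. jump \<omega> s)" using elim(2) elim(1) atLeastAtMost_iff[of 1 0 "1::real"] zero_le_one order_refl[of "1::real"] by blast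
        ultimately have "\<omega> 1 - \<omega> 0 = 0" by simp
        moreover have "\<omega> 0 = x" "\<omega> 1 = y" using elim(2) by blast+
        ultimately show False using xy by simp
      qed
      then obtain k where k: "m = Suc k" by (cases m) auto
      have "\<omega> \<in> L n \<longleftrightarrow> n = m" for n
        using elim(1) conjunct1[OF elim(2)] num_jumps_eq_of_nat[of \<omega> n] by (auto simp: L_def m_def)
      then have "(\<Sum>n. G \<omega> * indicator (L (Suc n)) \<omega>) = (\<Sum>n\<in>{k}. G \<omega> * indicator (L (Suc n)) \<omega>)"
        by (intro suminf_finite) (auto simp: k)
      also have "\<dots> = G \<omega>" using \<open>\<And>n. \<omega> \<in> L n \<longleftrightarrow> n = m\<close> by (simp add: k)
      finally show ?case ..
    qed
    then have "(\<integral>\<^sup>+\<omega>. G \<omega> \<partial>Q) = (\<integral>\<^sup>+\<omega>. (\<Sum>n. G \<omega> * indicator (L (Suc n)) \<omega>) \<partial>Q)" by (rule nn_integral_cong_AE)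
    also have "\<dots> = (\<Sum>n. \<integral>\<^sup>+\<omega>. G \<omega> * indicator (L (Suc n)) \<omega> \<partial>Q)" by (rule nn_integral_suminf) measurable
    also have "\<dots> = c * bridge_sum x z G" by (simp add: level bridge_sum_def)
    finally show ?thesis .
  qed
  \<comment> \<open>An infinite normalising mass is incompatible with this equation, so a law
    satisfying the hypotheses exists only at endpoints where the bridge is the normalised
    sum.\<close>
  have one: "c * bridge_mass x z = 1"
    using total[of "\<lambda>\<omega>. 1"] Q.emeasure_space_1 by (simp add: bridge_mass_def)
  have fin: "bridge_mass x z < \<infinity>"
  proof (rule ccontr)
    assume "\<not> bridge_mass x z < \<infinity>"
    then have "bridge_mass x z = \<infinity>" by (simp add: less_top[symmetric])
    with one show False by (cases "c = 0") (auto simp: ennreal_mult_top ennreal_mult_eq_top_iff)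
  qed
  have c: "c = 1 / bridge_mass x z"
    using one fin bridge_mass_pos[of x z]
    by (metis ennreal_mult_divide_eq less_irrefl less_top infinity_ennreal_def mult.commute)
  show ?thesis
  proof (rule measure_eqI)
    fix A assume A: "A \<in> sets Q"
    then have [measurable]: "A \<in> sets path_space" by (simp add: s)
    have "emeasure Q A = c * bridge_sum x z (indicator A)"
      using total[of "indicator A"] A by simp
    also have "\<dots> = emeasure (bridge (x, y)) A"
      using xy fin by (simp add: emeasure_bridge bridge_integral_def c z_def[symmetric] divide_ennreal_def mult.commute)
    finally show "emeasure Q A = emeasure (bridge (x, y)) A" .
  qed (simp add: s)
qed

text \<open>\<open>level_Suc\<close> with the constant functional 1 passes nullity from one number
  of jumps to the next, starting from the impossible single jump of a loop.\<close>

lemma loop_constant: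
  assumes Q: "pinned_pure_jump Q x x" and si: "splitting_identity f Q"
  shows "AE \<omega> in Q. jump_times \<omega> = {}"
proof -
  note s = pinned_pure_jumpD(1)[OF Q] and p = pinned_pure_jumpD(2)[OF Q]
  interpret Q: prob_space Q by (rule p)
  note [measurable_cong] = s
  define L where "L n = {\<omega> \<in> space path_space. num_jumps \<omega> = of_nat n}" for n
  have [measurable]: "L n \<in> sets path_space" for n unfolding L_def by measurable
  have L0: "AE \<omega> in Q. \<omega> \<notin> L (Suc n)" for n
  proof (induction n)
    case 0
    show ?case using AE_level_one[OF Q] by eventually_elim (simp add: L_def)
  next
    case (Suc n)
    define \<Phi> where "\<Phi> = (\<lambda>(\<gamma> :: mark, \<gamma>1 :: mark, \<gamma>2 :: mark, \<omega> :: real \<Rightarrow> real). 1 * ennreal (1 / chi f (snd \<gamma>1) (snd \<gamma>2)))"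
    have m: "(\<lambda>\<omega>. 1) \<in> borel_measurable path_space" by simp
    note lS = level_Suc[OF s p si m, folded \<Phi>_def]
    have "(\<integral>\<^sup>+\<omega>. split_op \<Phi> \<omega> * indicator (L (Suc n)) \<omega> \<partial>Q) = (\<integral>\<^sup>+\<omega>. 0 \<partial>Q)"
      by (rule nn_integral_cong_AE) (use Suc in eventually_elim, simp)
    then have "of_nat (Suc (Suc n)) * (of_nat (Suc n) * (\<integral>\<^sup>+\<omega>. 1 * indicator (L (Suc (Suc n))) \<omega> \<partial>Q)) = 0"
      using lS(1)[of n] by (simp only: L_def) simp
    then have "(\<integral>\<^sup>+\<omega>. indicator (L (Suc (Suc n))) \<omega> \<partial>Q) = 0" by auto
    then have "emeasure Q (L (Suc (Suc n))) = 0" by simp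
    then show ?case by (intro AE_not_in) (simp add: null_sets_def)
  qed
  have "AE \<omega> in Q. \<forall>n. \<omega> \<notin> L (Suc n)" using L0 by (simp add: AE_all_countable)
  then show ?thesis
    using AE_finitely_many_jumps[OF s Q.finite_measure_axioms si] pinned_pure_jumpD(3)[OF Q]
  proof eventually_elim
    case (elim \<omega>)
    show ?case
    proof (rule ccontr)
      assume "jump_times \<omega> \<noteq> {}"
      then obtain k where "card (jump_times \<omega>) = Suc k" using elim(2) by (cases "card (jump_times \<omega>)") auto
      then have "\<omega> \<in> L (Suc k)" using elim(2) conjunct1[OF elim(3)] by (simp add: L_def num_jumps_eq_of_nat del: of_nat_Suc)
      then show False using elim(1) by blast
    qed
  qed
qed

end

section \<open>Characteristic functions determine finite measures\<close>

lemma (in finite_measure) integrable_iexp_finite: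
  "X \<in> borel_measurable M \<Longrightarrow> integrable M (\<lambda>\<omega>. iexp (X \<omega>))"
  by (rule integrable_const_bound[of _ 1]) auto

text \<open>The value of the characteristic function at 0 is the total mass. A positive mass can be
  normalised, which reduces to Levy's uniqueness theorem; a zero mass is separate.\<close>

lemma finite_measure_eqI_char:
  fixes M N :: "real measure"
  assumes M: "finite_measure M" "sets M = sets borel" and N: "finite_measure N" "sets N = sets borel"
    and eq: "\<And>t. char M t = char N t"
  shows "M = N"
proof -
  interpret M: finite_measure M by fact
  interpret N: finite_measure N by fact
  note [measurable_cong] = M(2) N(2)
  have sp: "space M = UNIV" "space N = UNIV"
    using M(2) N(2) sets_eq_imp_space_eq[of M borel] sets_eq_imp_space_eq[of N borel] by auto
  define m where "m = measure M UNIV"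
  have m: "measure M UNIV = m" "measure N UNIV = m"
    using eq[of 0] unfolding char_def m_def by (simp_all add: sp)
  then have em: "emeasure M UNIV = ennreal m" "emeasure N UNIV = ennreal m"
    by (simp_all add: M.emeasure_eq_measure N.emeasure_eq_measure)
  show ?thesis
  proof (cases "m = 0")
    case True
    show ?thesis
    proof (rule measure_eqI)
      fix A assume "A \<in> sets M"
      then have "emeasure M A \<le> emeasure M UNIV" "emeasure N A \<le> emeasure N UNIV"
        using emeasure_space[of M A] emeasure_space[of N A] by (simp_all add: sp)
      then show "emeasure M A = emeasure N A" using em True by simp
    qed (simp add: M N)
  next
    case False
    then have m0: "0 < m" by (simp add: m_def less_le)
    have scale: "real_distribution (density M (\<lambda>_. ennreal (1/m))) \<and> char (density M (\<lambda>_. ennreal (1/m))) = (\<lambda>t. of_real (1/m) * char M t)"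
      if "finite_measure M" "sets M = sets borel" "emeasure M UNIV = ennreal m" for M :: "real measure"
    proof
      interpret finite_measure M by fact
      note [measurable_cong] = that(2)
      have sp: "space M = UNIV" using that(2) sets_eq_imp_space_eq[of M borel] by auto
      show "real_distribution (density M (\<lambda>_. ennreal (1/m)))"
      proof (intro real_distribution.intro prob_spaceI real_distribution_axioms.intro)
        show "emeasure (density M (\<lambda>_. ennreal (1/m))) (space (density M (\<lambda>_. ennreal (1/m)))) = 1"
          using m0 that(3) by (simp add: emeasure_density sp nn_integral_cmult ennreal_mult[symmetric])
      qed (simp add: that(2))
      show "char (density M (\<lambda>_. ennreal (1/m))) = (\<lambda>t. of_real (1/m) * char M t)"
        unfolding char_def using m0
        by (intro ext) (simp add: integral_density scaleR_conv_of_real)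
    qed
    have "density M (\<lambda>_. ennreal (1/m)) = density N (\<lambda>_. ennreal (1/m))"
      by (rule Levy_uniqueness) (use scale[OF M em(1)] scale[OF N em(2)] eq in auto)
    then have d: "emeasure (density M (\<lambda>_. ennreal (1/m))) A = emeasure (density N (\<lambda>_. ennreal (1/m))) A" for A by simp
    show ?thesis
    proof (rule measure_eqI)
      fix A assume "A \<in> sets M"
      then have A: "A \<in> sets borel" by (simp add: M)
      have "ennreal (1/m) * emeasure M A = ennreal (1/m) * emeasure N A"
        using d[of A] A M(2) N(2) by (simp add: emeasure_density nn_integral_cmult)
      then show "emeasure M A = emeasure N A"
        using m0 by (subst (asm) ennreal_mult_cancel_left) auto
    qed (simp add: M N)
  qed
qed

text \<open>Induction over coordinates: with the frequencies of the others fixed, the law of one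
  coordinate is identified under weighted measures, and both measures are then restricted to an
  event of that coordinate. Restriction loses mass, so the statement is about finite measures,
  arbitrary in the induction.\<close>

lemma joint_law_eqI_char:
  fixes X :: "'i \<Rightarrow> 'a \<Rightarrow> real"
  assumes "finite I" "finite_measure M" "finite_measure N" "sets M = sets K" "sets N = sets K"
    and "\<And>i. i \<in> I \<Longrightarrow> X i \<in> borel_measurable K"
    and "\<And>w :: 'i \<Rightarrow> real. (CLINT \<omega>|M. iexp (\<Sum>i\<in>I. w i * X i \<omega>)) = (CLINT \<omega>|N. iexp (\<Sum>i\<in>I. w i * X i \<omega>))"
    and "\<And>i. i \<in> I \<Longrightarrow> B i \<in> sets borel"
  shows "emeasure M {\<omega> \<in> space K. \<forall>i\<in>I. X i \<omega> \<in> B i} = emeasure N {\<omega> \<in> space K. \<forall>i\<in>I. X i \<omega> \<in> B i}"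
  using assms
proof (induction I arbitrary: M N rule: finite_induct)
  case (empty M N)
  interpret M: finite_measure M by fact
  interpret N: finite_measure N by fact
  have "space M = space K" "space N = space K" using empty sets_eq_imp_space_eq by blast+
  moreover have "of_real (measure M (space M)) = (of_real (measure N (space N)) :: complex)"
    using empty(6) by simp
  ultimately show ?case by (simp add: M.emeasure_eq_measure N.emeasure_eq_measure)
next
  case (insert j I M N)
  note fM = insert.prems(1) and fN = insert.prems(2)
  note sets = insert.prems(3,4)
  have X: "X i \<in> borel_measurable K" if "i \<in> I" for i using insert.prems(5) that by simp
  have Xj [measurable]: "X j \<in> borel_measurable K" using insert.prems(5) by simp
  have Bj [measurable]: "B j \<in> sets borel" using insert.prems(7) by simp
  define S where "S w \<omega> = (\<Sum>i\<in>I. w i * X i \<omega>)" for w \<omega>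
  have S [measurable]: "S w \<in> borel_measurable K" for w
    unfolding S_def using X by (intro borel_measurable_sum borel_measurable_times) auto
  \<comment> \<open>The separated coordinate receives its own frequency \<open>t\<close>, the others
    keep theirs.\<close>
  have base: "(CLINT \<omega>|M. iexp (t * X j \<omega> + S w \<omega>)) = (CLINT \<omega>|N. iexp (t * X j \<omega> + S w \<omega>))" for t w
  proof -
    have "(\<Sum>i\<in>insert j I. (w(j := t)) i * X i \<omega>) = t * X j \<omega> + S w \<omega>" for \<omega>
      using insert.hyps by (simp add: S_def) (intro sum.cong, auto)
    then show ?thesis using insert.prems(6)[of "w(j := t)"] by simp
  qed
  have neg: "S (\<lambda>i. - w i) \<omega> = - S w \<omega>" for w \<omega> by (simp add: S_def sum_negf)
  have zero: "S (\<lambda>i. 0) \<omega> = 0" for \<omega> by (simp add: S_def)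
  txt \<open>Weighting by the nonnegative functions 1 + cos and 1 + sin reduces to one dimension.\<close>
  have weight: "(\<integral>\<omega>. indicator (B j) (X j \<omega>) * (1 + g (S w \<omega>)) \<partial>M) = (\<integral>\<omega>. indicator (B j) (X j \<omega>) * (1 + g (S w \<omega>)) \<partial>N)"
    if g: "g = cos \<or> g = sin" for g :: "real \<Rightarrow> real" and w
  proof -
    have [measurable]: "g \<in> borel_measurable borel" using g by (auto intro!: borel_measurable_continuous_onI continuous_intros)
    have g1: "\<bar>g x\<bar> \<le> 1" "0 \<le> 1 + g x" "\<bar>1 + g x\<bar> \<le> 2" for x
    proof -
      show "\<bar>g x\<bar> \<le> 1" using g by auto
      then show "0 \<le> 1 + g x" "\<bar>1 + g x\<bar> \<le> 2" by linarith+
    qed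
    define D where "D M = distr (density M (\<lambda>\<omega>. ennreal (1 + g (S w \<omega>)))) borel (X j)" for M
    have D: "finite_measure (D M) \<and> sets (D M) = sets borel \<and>
        (\<forall>t. char (D M) t = (CLINT \<omega>|M. of_real (1 + g (S w \<omega>)) * iexp (t * X j \<omega>))) \<and>
        measure (D M) (B j) = (\<integral>\<omega>. indicator (B j) (X j \<omega>) * (1 + g (S w \<omega>)) \<partial>M)"
      if M: "finite_measure M" "sets M = sets K" for M
    proof (intro conjI allI)
      interpret finite_measure M by fact
      note [measurable_cong] = M(2)
      have int: "integrable M (\<lambda>\<omega>. 1 + g (S w \<omega>))"
        by (rule integrable_const_bound[of _ 2]) (use g1(3) in auto)
      have "emeasure (density M (\<lambda>\<omega>. ennreal (1 + g (S w \<omega>)))) (space M) < \<infinity>"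
        using integrable_iff_bounded[of M "\<lambda>\<omega>. 1 + g (S w \<omega>)"] int g1(2) by (simp add: emeasure_density cong: nn_integral_cong)
      then have "finite_measure (density M (\<lambda>\<omega>. ennreal (1 + g (S w \<omega>))))"
        by (intro finite_measureI) auto
      then show "finite_measure (D M)" unfolding D_def by (rule finite_measure.finite_measure_distr) simp
      show "sets (D M) = sets borel" by (simp add: D_def)
      show "char (D M) t = (CLINT \<omega>|M. of_real (1 + g (S w \<omega>)) * iexp (t * X j \<omega>))" for t
        unfolding char_def D_def using g1(2)
        by (simp add: integral_distr integral_density scaleR_conv_of_real)
      show "measure (D M) (B j) = (\<integral>\<omega>. indicator (B j) (X j \<omega>) * (1 + g (S w \<omega>)) \<partial>M)"
      proof -
        have "measure (D M) (B j) = (\<integral>x. indicator (B j) x \<partial>D M)" by (simp add: D_def)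
        also have "\<dots> = (\<integral>\<omega>. indicator (B j) (X j \<omega>) \<partial>density M (\<lambda>\<omega>. ennreal (1 + g (S w \<omega>))))"
          unfolding D_def by (rule integral_distr) measurable
        also have "\<dots> = (\<integral>\<omega>. (1 + g (S w \<omega>)) *\<^sub>R indicator (B j) (X j \<omega>) \<partial>M)"
          by (rule integral_density) (use g1(2) in simp_all)
        finally show ?thesis by (simp add: mult.commute)
      qed
    qed
    have "\<exists>a b. \<forall>x. of_real (g x) = a * iexp x + b * iexp (- x)"
    proof -
      have "of_real (cos x) = 1/2 * iexp x + 1/2 * iexp (- x)" "of_real (sin x) = (- \<i> / 2) * iexp x + (\<i> / 2) * iexp (- x)" for x
        by (auto simp: complex_eq_iff Re_exp Im_exp)
      with g show ?thesis by blast
    qed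
    then obtain a b where ab: "\<And>x. of_real (g x) = a * iexp x + b * iexp (- x)" by blast
    \<comment> \<open>Euler's formula writes the weighted characteristic function as a combination
      of unweighted joint ones, which agree by assumption.\<close>
    have expand: "(CLINT \<omega>|M. of_real (1 + g (S w \<omega>)) * iexp (t * X j \<omega>)) =
       (CLINT \<omega>|M. iexp (t * X j \<omega> + S (\<lambda>i. 0) \<omega>)) + (a * (CLINT \<omega>|M. iexp (t * X j \<omega> + S w \<omega>)) + b * (CLINT \<omega>|M. iexp (t * X j \<omega> + S (\<lambda>i. - w i) \<omega>)))"
      if M: "finite_measure M" "sets M = sets K" for M t
    proof -
      interpret finite_measure M by fact
      note [measurable_cong] = M(2)
      have i: "integrable M (\<lambda>\<omega>. iexp (t * X j \<omega> + S w \<omega>))" for w by (rule integrable_iexp_finite) measurable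
      have "of_real (1 + g (S w \<omega>)) * iexp (t * X j \<omega>) = iexp (t * X j \<omega> + S (\<lambda>i. 0) \<omega>) + (a * iexp (t * X j \<omega> + S w \<omega>) + b * iexp (t * X j \<omega> + S (\<lambda>i. - w i) \<omega>))" for \<omega>
        by (simp add: ab neg zero exp_add distrib_left distrib_right right_diff_distrib exp_diff exp_minus divide_inverse ac_simps)
      then show ?thesis using i by (simp del: of_real_add)
    qed
    have "char (D M) t = char (D N) t" for t
    proof -
      have "char (D M) t = (CLINT \<omega>|M. of_real (1 + g (S w \<omega>)) * iexp (t * X j \<omega>))"
        "char (D N) t = (CLINT \<omega>|N. of_real (1 + g (S w \<omega>)) * iexp (t * X j \<omega>))"
        using D[OF fM sets(1)] D[OF fN sets(2)] by blast+
      then show ?thesis by (simp only: expand[OF fM sets(1)] expand[OF fN sets(2)] base)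
    qed
    then have "D M = D N"
      using D[OF fM sets(1)] D[OF fN sets(2)] by (intro finite_measure_eqI_char) blast+
    then show ?thesis using D[OF fM sets(1)] D[OF fN sets(2)] by metis
  qed
  have bnd: "integrable M (\<lambda>\<omega>. indicator (B j) (X j \<omega>) * h \<omega>)" if M: "finite_measure M" "sets M = sets K" and h: "h \<in> borel_measurable K" "\<And>\<omega>. \<bar>h \<omega>\<bar> \<le> 1" for M and h :: "'a \<Rightarrow> real"
  proof -
    interpret finite_measure M by fact
    note [measurable_cong] = M(2)
    note [measurable] = h(1)
    show ?thesis by (rule integrable_const_bound[of _ 1]) (use h(2) in \<open>auto simp: indicator_def\<close>)
  qed
  \<comment> \<open>Sine with zero frequencies vanishes, which isolates the constant part of the
    weight so that it can be subtracted.\<close>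
  have one: "(\<integral>\<omega>. indicator (B j) (X j \<omega>) * (1 :: real) \<partial>M) = (\<integral>\<omega>. indicator (B j) (X j \<omega>) * (1 :: real) \<partial>N)"
    using weight[of sin "\<lambda>i. 0"] by (simp add: zero)
  have plain: "(\<integral>\<omega>. indicator (B j) (X j \<omega>) * g (S w \<omega>) \<partial>M) = (\<integral>\<omega>. indicator (B j) (X j \<omega>) * g (S w \<omega>) \<partial>N)"
    if g: "g = cos \<or> g = sin" for g :: "real \<Rightarrow> real" and w
  proof -
    have [measurable]: "g \<in> borel_measurable borel" using g by (auto intro!: borel_measurable_continuous_onI continuous_intros)
    have g1: "\<bar>g x\<bar> \<le> 1" for x using g by auto
    have "(\<integral>\<omega>. indicator (B j) (X j \<omega>) * (1 + g (S w \<omega>)) \<partial>M) = (\<integral>\<omega>. indicator (B j) (X j \<omega>) * (1 :: real) \<partial>M) + (\<integral>\<omega>. indicator (B j) (X j \<omega>) * g (S w \<omega>) \<partial>M)"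
      if M: "finite_measure M" "sets M = sets K" for M
      unfolding distrib_left by (intro Bochner_Integration.integral_add bnd M) (use g1 in simp_all)
    from this[OF fM sets(1)] this[OF fN sets(2)] show ?thesis using weight[OF g, of w] one by simp
  qed
  \<comment> \<open>Restriction to the event of coordinate \<open>j\<close>. Its joint
    characteristic function in the other coordinates is recovered from the cosine and sine
    integrals.\<close>
  define M' where "M' M = density M (\<lambda>\<omega>. indicator (B j) (X j \<omega>))" for M :: "'a measure"
  have fin': "finite_measure (M' M)" if M: "finite_measure M" "sets M = sets K" for M
  proof (rule finite_measureI)
    interpret finite_measure M by fact
    note [measurable_cong] = M(2)
    have "emeasure (M' M) (space (M' M)) = (\<integral>\<^sup>+\<omega>. indicator (B j) (X j \<omega>) * indicator (space M) \<omega> \<partial>M)"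
      unfolding M'_def by (subst emeasure_density) simp_all
    also have "\<dots> \<le> (\<integral>\<^sup>+\<omega>. 1 \<partial>M)" by (intro nn_integral_mono) (simp add: indicator_def)
    finally have "emeasure (M' M) (space (M' M)) \<le> (\<integral>\<^sup>+\<omega>. 1 \<partial>M)" .
    then show "emeasure (M' M) (space (M' M)) \<noteq> \<infinity>" by (auto simp: top_unique)
  qed
  have "emeasure (M' M) {\<omega> \<in> space K. \<forall>i\<in>I. X i \<omega> \<in> B i} = emeasure (M' N) {\<omega> \<in> space K. \<forall>i\<in>I. X i \<omega> \<in> B i}"
  proof (rule insert.IH)
    show "(CLINT \<omega>|M' M. iexp (\<Sum>i\<in>I. w i * X i \<omega>)) = (CLINT \<omega>|M' N. iexp (\<Sum>i\<in>I. w i * X i \<omega>))" for w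
    proof -
      have "(CLINT \<omega>|M' M. iexp (S w \<omega>)) = of_real (\<integral>\<omega>. indicator (B j) (X j \<omega>) * cos (S w \<omega>) \<partial>M) + \<i> * of_real (\<integral>\<omega>. indicator (B j) (X j \<omega>) * sin (S w \<omega>) \<partial>M)"
        if M: "finite_measure M" "sets M = sets K" for M
      proof -
        note [measurable_cong] = M(2)
        have "(CLINT \<omega>|M' M. iexp (S w \<omega>)) = (CLINT \<omega>|M. indicator (B j) (X j \<omega>) *\<^sub>R iexp (S w \<omega>))"
          unfolding M'_def by (subst ennreal_indicator[symmetric], subst integral_density) auto
        also have "\<dots> = (CLINT \<omega>|M. of_real (indicator (B j) (X j \<omega>) * cos (S w \<omega>)) + \<i> * of_real (indicator (B j) (X j \<omega>) * sin (S w \<omega>)))"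
          by (intro Bochner_Integration.integral_cong) (auto simp: indicator_def complex_eq_iff Re_exp Im_exp)
        also have "\<dots> = of_real (\<integral>\<omega>. indicator (B j) (X j \<omega>) * cos (S w \<omega>) \<partial>M) + \<i> * of_real (\<integral>\<omega>. indicator (B j) (X j \<omega>) * sin (S w \<omega>) \<partial>M)"
          using bnd[OF M, of "\<lambda>\<omega>. cos (S w \<omega>)"] bnd[OF M, of "\<lambda>\<omega>. sin (S w \<omega>)"]
          by (simp del: of_real_mult)
        finally show ?thesis .
      qed
      from this[OF fM sets(1)] this[OF fN sets(2)] show ?thesis by (simp add: S_def[symmetric] plain)
    qed
  qed (use fin' fM fN sets X insert.prems(7) in \<open>auto simp: M'_def\<close>)
  moreover have "emeasure (M' M) {\<omega> \<in> space K. \<forall>i\<in>I. X i \<omega> \<in> B i} = emeasure M {\<omega> \<in> space K. \<forall>i\<in>insert j I. X i \<omega> \<in> B i}"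
    if M: "sets M = sets K" for M
  proof -
    note [measurable_cong] = M
    have A: "{\<omega> \<in> space K. \<forall>i\<in>I. X i \<omega> \<in> B i} \<in> sets K"
      using X insert.prems(7) insert.hyps(1) by (intro sets.sets_Collect_finite_All) (auto intro: measurable_sets_Collect)
    then have [measurable]: "{\<omega> \<in> space K. \<forall>i\<in>I. X i \<omega> \<in> B i} \<in> sets M" by (simp add: M)
    have J: "{\<omega> \<in> space K. X j \<omega> \<in> B j} \<in> sets K" by measurable
    have "emeasure (M' M) {\<omega> \<in> space K. \<forall>i\<in>I. X i \<omega> \<in> B i} = (\<integral>\<^sup>+\<omega>. indicator {\<omega> \<in> space K. \<forall>i\<in>insert j I. X i \<omega> \<in> B i} \<omega> \<partial>M)"
      unfolding M'_def by (subst emeasure_density) (auto intro!: nn_integral_cong simp: indicator_def)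
    also have "{\<omega> \<in> space K. \<forall>i\<in>insert j I. X i \<omega> \<in> B i} = {\<omega> \<in> space K. X j \<omega> \<in> B j} \<inter> {\<omega> \<in> space K. \<forall>i\<in>I. X i \<omega> \<in> B i}" by auto
    also have "(\<integral>\<^sup>+\<omega>. indicator \<dots> \<omega> \<partial>M) = emeasure M \<dots>"
      using A J by (intro nn_integral_indicator) (simp add: M)
    finally show ?thesis by (simp only:) (auto intro!: arg_cong[where f="emeasure M"])
  qed
  ultimately show ?case using sets by simp
qed

section \<open>The compound Poisson law on path space\<close>

text \<open>Rational times and bounds make the family countable, so an almost everywhere statement
  can be taken for all members at once. Times outside the unit interval impose nothing, so that
  every list is admissible.\<close>

definition cylinder :: "(rat \<times> rat) list \<Rightarrow> (real \<Rightarrow> real) set" where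
  "cylinder l = {\<omega> \<in> space path_space. \<forall>(r, q)\<in>set l. of_rat r \<in> {0..1::real} \<longrightarrow> \<omega> (of_rat r) \<le> of_rat q}"

lemma cylinder_eq:
  "cylinder l = {\<omega> \<in> space path_space. \<forall>x\<in>(of_rat ` fst ` set l) \<inter> {0..1}. \<omega> x \<in> {y. \<forall>(r, q)\<in>set l. of_rat r = x \<longrightarrow> y \<le> of_rat q}}"
  by (force simp: cylinder_def)

lemma sets_cylinder_bound: "{y :: real. \<forall>(r, q)\<in>set l. of_rat r = x \<longrightarrow> y \<le> of_rat q} \<in> sets borel"
proof -
  have "{y :: real. \<forall>(r, q)\<in>set l. of_rat r = x \<longrightarrow> y \<le> of_rat q} = {y \<in> space borel. \<forall>p\<in>set l. of_rat (fst p) = x \<longrightarrow> y \<le> of_rat (snd p)}"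
    by auto
  also have "\<dots> \<in> sets borel" by (intro sets.sets_Collect_finite_All) auto
  finally show ?thesis .
qed

text \<open>By right continuity a value at any time before 1 is a limit of values at rational times,
  and a real upper bound is the infimum of the rational bounds above it.\<close>

lemma sets_path_space_cylinder: "sets path_space = sigma_sets (space path_space) (range cylinder)"
proof
  have "cylinder l \<in> sets path_space" for l
    unfolding cylinder_eq
  proof (rule sets.sets_Collect_finite_All)
    fix x :: real assume "x \<in> of_rat ` fst ` set l \<inter> {0..1}"
    then have "(\<lambda>\<omega>. \<omega> x) \<in> borel_measurable path_space"
      by (intro measurable_path_eval) simp_all
    from measurable_sets[OF this sets_cylinder_bound[of l x]]
    have "(\<lambda>\<omega>. \<omega> x) -` {y. \<forall>(r, q)\<in>set l. of_rat r = x \<longrightarrow> y \<le> of_rat q} \<inter> space path_space \<in> sets path_space" .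
    also have "(\<lambda>\<omega>. \<omega> x) -` {y. \<forall>(r, q)\<in>set l. of_rat r = x \<longrightarrow> y \<le> of_rat q} \<inter> space path_space =
      {\<omega> \<in> space path_space. \<omega> x \<in> {y. \<forall>(r, q)\<in>set l. of_rat r = x \<longrightarrow> y \<le> of_rat q}}" by blast
    finally show "{\<omega> \<in> space path_space. \<omega> x \<in> {y. \<forall>(r, q)\<in>set l. of_rat r = x \<longrightarrow> y \<le> of_rat q}} \<in> sets path_space" .
  qed simp
  then show "sigma_sets (space path_space) (range cylinder) \<subseteq> sets path_space"
    by (intro sets.sigma_sets_subset) auto
next
  let ?S = "sigma (space path_space) (range cylinder)"
  have S: "sets ?S = sigma_sets (space path_space) (range cylinder)" "space ?S = space path_space"
    by (auto simp: cylinder_def intro!: sets_measure_of space_measure_of)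
  have rat: "(\<lambda>\<omega>. \<omega> (of_rat r)) \<in> borel_measurable ?S" if "of_rat r \<in> {0..1::real}" for r
  proof (rule borel_measurable_iff_le[THEN iffD2], rule allI)
    fix a :: real
    have "{\<omega> \<in> space ?S. \<omega> (of_rat r) \<le> a} = (\<Inter>q\<in>{q. a < of_rat q}. cylinder [(r, q)])"
    proof (intro equalityI subsetI INT_I)
      fix \<omega> assume "\<omega> \<in> (\<Inter>q\<in>{q. a < of_rat q}. cylinder [(r, q)])"
      then have *: "a < of_rat q \<Longrightarrow> \<omega> \<in> space path_space \<and> \<omega> (of_rat r) \<le> of_rat q" for q
        using that by (auto simp: cylinder_def)
      obtain q0 where "a < of_rat q0" using of_rat_dense[of a "a+1"] by auto
      moreover have "\<omega> (of_rat r) \<le> a"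
      proof (rule ccontr)
        assume "\<not> \<omega> (of_rat r) \<le> a"
        then obtain q where "a < of_rat q" "of_rat q < \<omega> (of_rat r)" using of_rat_dense by (metis not_le)
        with * show False by (metis not_le)
      qed
      ultimately show "\<omega> \<in> {\<omega> \<in> space ?S. \<omega> (of_rat r) \<le> a}" using * by (auto simp: S)
    qed (unfold S(2), auto simp: cylinder_def)
    also have "\<dots> \<in> sets ?S"
    proof (rule sets.countable_INT')
      have "\<exists>q. a < of_rat q" using of_rat_dense[of a "a+1"] by auto
      then show "{q. a < of_rat q} \<noteq> {}" by simp
    qed (auto simp: S intro: countable_subset[OF subset_UNIV])
    finally show "{\<omega> \<in> space ?S. \<omega> (of_rat r) \<le> a} \<in> sets ?S" .
  qed
  have "(\<lambda>\<omega>. \<omega>) \<in> ?S \<rightarrow>\<^sub>M path_space"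
  proof (rule measurable_path_spaceI)
    fix u :: real assume u: "u \<in> {0..1}"
    show "(\<lambda>\<omega>. \<omega> u) \<in> borel_measurable ?S"
    \<comment> \<open>Time 1 has no right neighbourhood in the interval but is itself
      rational.\<close>
    proof (cases "u = 1")
      case True
      then show ?thesis using rat[of 1] by simp
    next
      case False
      have "\<exists>r :: nat \<Rightarrow> rat. \<forall>n. u < of_rat (r n) \<and> of_rat (r n) < min 1 (u + 1 / real (Suc n))"
      proof (intro choice allI)
        fix n
        have "u < min 1 (u + 1 / real (Suc n))" using u False by simp
        then show "\<exists>q. u < of_rat q \<and> of_rat q < min 1 (u + 1 / real (Suc n))" by (rule of_rat_dense)
      qed
      then obtain r :: "nat \<Rightarrow> rat" where r: "\<And>n. u < of_rat (r n)" "\<And>n. of_rat (r n) < min 1 (u + 1 / real (Suc n))"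
        by blast
      have lim: "(\<lambda>n. of_rat (r n) :: real) \<longlonglongrightarrow> u"
      proof (rule tendsto_sandwich)
        show "(\<lambda>n. u) \<longlonglongrightarrow> u" by simp
        show "(\<lambda>n. u + 1 / real (Suc n)) \<longlonglongrightarrow> u"
          using tendsto_add[OF tendsto_const LIMSEQ_inverse_real_of_nat, of u] by (simp add: inverse_eq_divide)
      qed (use r in \<open>auto intro!: always_eventually simp: less_imp_le simp del: of_nat_Suc\<close>)
      have flt: "filterlim (\<lambda>n. of_rat (r n) :: real) (at_right u) sequentially"
        unfolding filterlim_at using lim r(1)
        by (intro conjI always_eventually allI) (auto dest: less_imp_neq[symmetric])
      show ?thesis
      proof (rule borel_measurable_LIMSEQ_real)
        fix \<omega> assume "\<omega> \<in> space ?S"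
        then have "\<omega> \<in> space path_space" unfolding S(2) .
        then have "cadlag \<omega>" by (simp add: space_path_space)
        then have "(\<omega> \<longlongrightarrow> \<omega> u) (at_right u)" using u False by (intro cadlag_right) auto
        from filterlim_compose[OF this flt] show "(\<lambda>n. \<omega> (of_rat (r n))) \<longlonglongrightarrow> \<omega> u" .
      next
        show "(\<lambda>\<omega>. \<omega> (of_rat (r n))) \<in> borel_measurable ?S" for n
        proof (rule rat)
          have "u < of_rat (r n)" "of_rat (r n) < (1 :: real)" using r(1)[of n] r(2)[of n] by simp_all
          then show "of_rat (r n) \<in> {0..1 :: real}" using u unfolding atLeastAtMost_iff by linarith
        qed
      qed
    qed
  qed (unfold S(2), simp)
  then have "A \<inter> space path_space \<in> sigma_sets (space path_space) (range cylinder)" if "A \<in> sets path_space" for A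
    using measurable_sets[of "\<lambda>\<omega>. \<omega>" ?S path_space A] that unfolding S by (simp add: vimage_def)
  then show "sets path_space \<subseteq> sigma_sets (space path_space) (range cylinder)"
    using sets.sets_into_space[of _ path_space] by (metis inf.absorb1 subsetI)
qed

lemma Int_stable_cylinder: "Int_stable (range cylinder)"
proof -
  have "cylinder l \<inter> cylinder l' = cylinder (l @ l')" for l l'
    by (auto simp: cylinder_def)
  then show ?thesis by (auto simp: Int_stable_def)
qed

lemma cylinder_Nil: "cylinder [] = space path_space"
  by (simp add: cylinder_def)

lemma path_measure_eqI:
  assumes "finite_measure M" "sets M = sets path_space" "sets N = sets path_space"
    and "\<And>l. emeasure M (cylinder l) = emeasure N (cylinder l)"
  shows "M = N"
proof (rule measure_eqI_generator_eq[OF Int_stable_cylinder, of "space path_space" M N "\<lambda>_. cylinder []"])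
  interpret finite_measure M by fact
  show "emeasure M (cylinder []) \<noteq> \<infinity>" by simp
  show "range cylinder \<subseteq> Pow (space path_space)" by (auto simp: cylinder_def)
  show "range (\<lambda>_. cylinder []) \<subseteq> range cylinder" by blast
qed (use assms in \<open>auto simp: sets_path_space_cylinder cylinder_Nil\<close>)

lemma path_measure_eqI_char:
  assumes M: "finite_measure M" "sets M = sets path_space" and N: "finite_measure N" "sets N = sets path_space"
    and char: "\<And>F w. finite F \<Longrightarrow> F \<subseteq> {0..1} \<Longrightarrow> (CLINT \<omega>|M. iexp (\<Sum>r\<in>F. w r * \<omega> r)) = (CLINT \<omega>|N. iexp (\<Sum>r\<in>F. w r * \<omega> r))"
  shows "M = N"
proof (rule path_measure_eqI[OF M N(2)])
  fix l
  show "emeasure M (cylinder l) = emeasure N (cylinder l)"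
    unfolding cylinder_eq
  proof (rule joint_law_eqI_char[OF _ M(1) N(1) M(2) N(2)])
    fix w :: "real \<Rightarrow> real"
    show "(CLINT \<omega>|M. iexp (\<Sum>r\<in>(of_rat ` fst ` set l) \<inter> {0..1}. w r * \<omega> r)) = (CLINT \<omega>|N. iexp (\<Sum>r\<in>(of_rat ` fst ` set l) \<inter> {0..1}. w r * \<omega> r))"
      by (rule char) auto
  qed (auto intro!: sets_cylinder_bound measurable_path_eval[OF measurable_ident, simplified id_def])
qed

text \<open>Real and imaginary parts are treated separately; the uniform bound makes every integral
  involved finite.\<close>

lemma integral_bind_complex:
  fixes g :: "'b \<Rightarrow> complex"
  assumes M: "prob_space M" and N: "N \<in> M \<rightarrow>\<^sub>M prob_algebra K" and g [measurable]: "g \<in> borel_measurable K"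
    and bound: "\<And>x. norm (g x) \<le> B"
  shows "(\<integral>x. g x \<partial>(M \<bind> N)) = (\<integral>x. \<integral>y. g y \<partial>N x \<partial>M)"
proof -
  interpret M: prob_space M by fact
  have N' [measurable]: "N \<in> M \<rightarrow>\<^sub>M subprob_algebra K" by (rule measurable_prob_algebraD[OF N])
  have Nx: "prob_space (N x)" "sets (N x) = sets K" if "x \<in> space M" for x
    using measurable_space[OF N that] by (auto simp: space_prob_algebra)
  have int: "integrable (N x) g" if "x \<in> space M" for x
  proof -
    interpret prob_space "N x" by (rule Nx[OF that])
    have "g \<in> borel_measurable (N x)" using g by (simp add: measurable_cong_sets[OF Nx(2)[OF that] refl])
    then show ?thesis by (rule integrable_const_bound[of _ B, rotated]) (use bound in simp)
  qed
  have bindM: "prob_space (M \<bind> N)"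
    by (rule M.prob_space_bind[OF _ N']) (use Nx in \<open>auto intro!: AE_I2\<close>)
  have sb: "sets (M \<bind> N) = sets K"
    by (rule sets_bind[OF _ M.not_empty]) (use Nx in auto)
  have intb: "integrable (M \<bind> N) g"
  proof -
    interpret prob_space "M \<bind> N" by (rule bindM)
    have "g \<in> borel_measurable (M \<bind> N)" using g by (simp add: measurable_cong_sets[OF sb refl])
    then show ?thesis by (rule integrable_const_bound[of _ B, rotated]) (use bound in simp)
  qed
  have part: "(\<integral>x. h (g x) \<partial>(M \<bind> N)) = (\<integral>x. \<integral>y. h (g y) \<partial>N x \<partial>M) \<and> integrable M (\<lambda>x. \<integral>y. h (g y) \<partial>N x)"
    if h [measurable]: "h \<in> borel_measurable borel" "\<And>z. \<bar>h z\<bar> \<le> norm z" for h :: "complex \<Rightarrow> real"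
  proof
    have b: "\<bar>h (g x)\<bar> \<le> B" for x using h(2)[of "g x"] bound[of x] by simp
    show "(\<integral>x. h (g x) \<partial>(M \<bind> N)) = (\<integral>x. \<integral>y. h (g y) \<partial>N x \<partial>M)"
    proof (rule integral_bind[OF _ _ N' M.finite_measure_axioms])
      show "AE x in M. emeasure (N x) (space (N x)) \<le> ennreal 1"
        by (rule AE_I2) (simp add: prob_space.emeasure_space_1[OF Nx(1)])
    qed (use b in simp_all)
    show "integrable M (\<lambda>x. \<integral>y. h (g y) \<partial>N x)"
    proof (rule M.integrable_const_bound[of _ B])
      have "(\<lambda>x. \<integral>y. h (g y) \<partial>x) \<in> borel_measurable (subprob_algebra K)"
        by (rule integral_measurable_subprob_algebra) (use b in \<open>auto\<close>)
      from measurable_compose[OF N' this] show "(\<lambda>x. \<integral>y. h (g y) \<partial>N x) \<in> borel_measurable M" .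
      show "AE x in M. norm (\<integral>y. h (g y) \<partial>N x) \<le> B"
      proof (rule AE_I2)
        fix x assume x: "x \<in> space M"
        interpret Nx: prob_space "N x" by (rule Nx[OF x])
        have "(\<lambda>y. h (g y)) \<in> borel_measurable K" by measurable
        then have m: "(\<lambda>y. h (g y)) \<in> borel_measurable (N x)" by (simp add: measurable_cong_sets[OF Nx(2)[OF x] refl])
        have "norm (\<integral>y. h (g y) \<partial>N x) \<le> (\<integral>y. norm (h (g y)) \<partial>N x)" by (rule integral_norm_bound)
        also have "\<dots> \<le> (\<integral>y. B \<partial>N x)"
        proof (rule integral_mono)
          show "integrable (N x) (\<lambda>y. norm (h (g y)))"
            using m b by (intro integrable_norm Nx.integrable_const_bound[of _ B]) simp_all
        qed (use b in simp_all)
        finally show "norm (\<integral>y. h (g y) \<partial>N x) \<le> B" by (simp add: Nx.prob_space)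
      qed
    qed
  qed
  have Re: "Re \<in> borel_measurable borel" "\<And>z. \<bar>Re z\<bar> \<le> norm z" and Im: "Im \<in> borel_measurable borel" "\<And>z. \<bar>Im z\<bar> \<le> norm z"
    by (auto simp: abs_Re_le_cmod abs_Im_le_cmod intro!: borel_measurable_continuous_onI continuous_intros)
  have eqc: "(\<integral>y. g y \<partial>N x) = Complex (\<integral>y. Re (g y) \<partial>N x) (\<integral>y. Im (g y) \<partial>N x)" if "x \<in> space M" for x
    using int[OF that] by (simp add: complex_eq_iff)
  have "(\<integral>x. \<integral>y. g y \<partial>N x \<partial>M) = (\<integral>x. Complex (\<integral>y. Re (g y) \<partial>N x) (\<integral>y. Im (g y) \<partial>N x) \<partial>M)"
    by (intro Bochner_Integration.integral_cong) (simp_all add: eqc)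
  also have "\<dots> = Complex (\<integral>x. \<integral>y. Re (g y) \<partial>N x \<partial>M) (\<integral>x. \<integral>y. Im (g y) \<partial>N x \<partial>M)"
    using part[OF Re] part[OF Im] unfolding Complex_eq by simp
  also have "\<dots> = (\<integral>x. g x \<partial>(M \<bind> N))"
    using part[OF Re] part[OF Im] intb by (simp add: complex_eq_iff)
  finally show ?thesis ..
qed

section \<open>Chains of independent marks and their characteristic functions\<close>

context jump_density begin

definition rate :: real where
  "rate = enn2real (\<integral>\<^sup>+x. ennreal (f x) \<partial>lborel)"

lemma ennreal_rate: "ennreal rate = (\<integral>\<^sup>+x. ennreal (f x) \<partial>lborel)"
  unfolding rate_def using f_integrable by (simp add: ennreal_enn2real_if less_top)

lemma rate_pos: "0 < rate"
  using f_mass_pos unfolding ennreal_rate[symmetric] by simp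

definition size_law :: "real measure" where
  "size_law = density lborel (\<lambda>x. ennreal (f x / rate))"

lemma sets_size_law [measurable_cong]: "sets size_law = sets borel"
  by (simp add: size_law_def)

lemma f_eq: "ennreal (f x) = ennreal rate * ennreal (f x / rate)"
  using rate_pos f_pos[of x] by (simp add: ennreal_mult[symmetric] less_imp_le)

lemma prob_space_size_law: "prob_space size_law"
proof
  have "ennreal rate * emeasure size_law (space size_law) = ennreal rate * 1"
    by (simp add: size_law_def emeasure_density nn_integral_cmult[symmetric] f_eq[symmetric] ennreal_rate[symmetric])
  then show "emeasure size_law (space size_law) = 1"
    using rate_pos by (subst (asm) ennreal_mult_cancel_left) auto
qed

definition mark_law :: "mark measure" where
  "mark_law = unit_lebesgue \<Otimes>\<^sub>M size_law"

lemma sets_mark_law [measurable_cong]: "sets mark_law = sets marks"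
  unfolding mark_law_def by (intro sets_pair_measure_cong sets_unit_lebesgue sets_size_law)

lemma space_mark_law: "space mark_law = {0..1} \<times> UNIV"
  using sets_eq_imp_space_eq[OF sets_mark_law] by (simp add: space_marks)

lemma prob_space_mark_law: "prob_space mark_law"
  unfolding mark_law_def by (intro prob_space_pair prob_space_unit_lebesgue prob_space_size_law)

lemma mark_law_in [measurable]: "mark_law \<in> space (prob_algebra marks)"
  by (simp add: space_prob_algebra prob_space_mark_law sets_mark_law)

lemma nn_integral_mark_law:
  assumes [measurable]: "g \<in> borel_measurable marks"
  shows "ennreal rate * (\<integral>\<^sup>+\<gamma>. g \<gamma> \<partial>mark_law) = (\<integral>\<^sup>+\<gamma>. ennreal (f (snd \<gamma>)) * g \<gamma> \<partial>mark_lebesgue)"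
proof -
  interpret S: prob_space size_law by (rule prob_space_size_law)
  interpret US: pair_sigma_finite unit_lebesgue size_law ..
  have gs: "(\<lambda>x. g (s, x)) \<in> borel_measurable borel" if "s \<in> {0..1}" for s
    using measurable_compose[OF measurable_Pair1'[of s "restrict_space borel {0..1}" borel] assms] that by (simp add: space_restrict_space)
  have "(\<integral>\<^sup>+\<gamma>. g \<gamma> \<partial>mark_law) = (\<integral>\<^sup>+s. \<integral>\<^sup>+x. g (s, x) \<partial>size_law \<partial>unit_lebesgue)"
    unfolding mark_law_def by (rule S.nn_integral_fst[symmetric]) measurable
  also have "ennreal rate * \<dots> = (\<integral>\<^sup>+s. ennreal rate * (\<integral>\<^sup>+x. g (s, x) \<partial>size_law) \<partial>unit_lebesgue)"
    by (rule nn_integral_cmult[symmetric]) measurable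
  also have "\<dots> = (\<integral>\<^sup>+s. \<integral>\<^sup>+x. ennreal (f x) * g (s, x) \<partial>lborel \<partial>unit_lebesgue)"
  proof (rule nn_integral_cong)
    fix s assume "s \<in> space unit_lebesgue"
    then have [measurable]: "(\<lambda>x. g (s, x)) \<in> borel_measurable borel" by (intro gs) (simp add: space_unit_lebesgue)
    have "(\<integral>\<^sup>+x. g (s, x) \<partial>size_law) = (\<integral>\<^sup>+x. ennreal (f x / rate) * g (s, x) \<partial>lborel)"
      unfolding size_law_def by (rule nn_integral_density) measurable
    then show "ennreal rate * (\<integral>\<^sup>+x. g (s, x) \<partial>size_law) = (\<integral>\<^sup>+x. ennreal (f x) * g (s, x) \<partial>lborel)"
      by (simp add: nn_integral_cmult[symmetric] f_eq mult.assoc)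
  qed
  also have "\<dots> = (\<integral>\<^sup>+\<gamma>. ennreal (f (snd \<gamma>)) * g \<gamma> \<partial>mark_lebesgue)"
  proof -
    have "(\<lambda>\<gamma>. ennreal (f (snd \<gamma>)) * g \<gamma>) \<in> borel_measurable mark_lebesgue" by measurable
    from lborel.nn_integral_fst[OF this[unfolded mark_lebesgue_def]]
    show ?thesis unfolding mark_lebesgue_def by simp
  qed
  finally show ?thesis .
qed

text \<open>The unpinned counterpart of \<open>pinned_sum\<close>: \<open>n\<close> independent
  marks, all of whose sizes are free.\<close>

primrec jump_chain :: "nat \<Rightarrow> (real \<Rightarrow> real) \<Rightarrow> (real \<Rightarrow> real) measure" where
  "jump_chain 0 \<omega> = return path_space \<omega>"
| "jump_chain (Suc n) \<omega> = mark_law \<bind> (\<lambda>\<gamma>. jump_chain n (insert_jump \<gamma> \<omega>))"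

lemma measurable_jump_chain [measurable]: "jump_chain n \<in> path_space \<rightarrow>\<^sub>M prob_algebra path_space"
proof (induction n)
  case 0
  have "jump_chain 0 = return path_space" by (intro ext) simp
  then show ?case by simp
next
  case (Suc n)
  note [measurable] = Suc.IH
  have "(\<lambda>\<omega>. mark_law \<bind> (\<lambda>\<gamma>. jump_chain n (insert_jump \<gamma> \<omega>))) \<in> path_space \<rightarrow>\<^sub>M prob_algebra path_space"
    by (rule measurable_bind_prob_space2[where N=marks]) measurable
  then show ?case by simp
qed

lemma measurable_jump_chain_insert:
  "\<omega> \<in> space path_space \<Longrightarrow> (\<lambda>\<gamma>. jump_chain n (insert_jump \<gamma> \<omega>)) \<in> marks \<rightarrow>\<^sub>M prob_algebra path_space"
  by (rule measurable_compose[OF _ measurable_jump_chain]) measurable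

lemma measurable_jump_chain_insert':
  "\<omega> \<in> space path_space \<Longrightarrow> (\<lambda>\<gamma>. jump_chain n (insert_jump \<gamma> \<omega>)) \<in> mark_law \<rightarrow>\<^sub>M prob_algebra path_space"
  using measurable_jump_chain_insert[of \<omega> n] by (simp add: measurable_cong_sets[OF sets_mark_law refl])

text \<open>Integrating over the total size frees the forced last size, so pinned sums disintegrate
  the chain along its total size. Each of the \<open>Suc n\<close> marks contributes a factor
  \<open>rate\<close> when \<open>f\<close> is normalised.\<close>

lemma nn_integral_pinned_sum:
  assumes G [measurable]: "G \<in> borel_measurable path_space" and "\<omega> \<in> space path_space"
  shows "(\<integral>\<^sup>+z. pinned_sum n z \<omega> G \<partial>lborel) = ennreal (rate ^ Suc n) * (\<integral>\<^sup>+\<omega>'. G \<omega>' \<partial>jump_chain (Suc n) \<omega>)"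
  using assms(2)
proof (induction n arbitrary: \<omega>)
  case (0 \<omega>)
  note 0[measurable (raw)]
  have "(\<integral>\<^sup>+z. pinned_sum 0 z \<omega> G \<partial>lborel) = (\<integral>\<^sup>+z. \<integral>\<^sup>+s. ennreal (f z) * G (insert_jump (s, z) \<omega>) \<partial>unit_lebesgue \<partial>lborel)"
    unfolding pinned_sum.simps by (intro nn_integral_cong nn_integral_cmult[symmetric]) measurable
  also have "\<dots> = (\<integral>\<^sup>+\<gamma>. ennreal (f (snd \<gamma>)) * G (insert_jump \<gamma> \<omega>) \<partial>mark_lebesgue)"
  proof (subst nn_integral_mark_lebesgue, goal_cases)
    case 1 show ?case by measurable
  qed simp
  also have "\<dots> = ennreal rate * (\<integral>\<^sup>+\<gamma>. G (insert_jump \<gamma> \<omega>) \<partial>mark_law)"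
    by (rule nn_integral_mark_law[symmetric]) measurable
  also have "(\<integral>\<^sup>+\<gamma>. G (insert_jump \<gamma> \<omega>) \<partial>mark_law) = (\<integral>\<^sup>+\<omega>'. G \<omega>' \<partial>jump_chain (Suc 0) \<omega>)"
    using measurable_prob_algebraD[OF measurable_jump_chain_insert'[OF 0, of 0]] 0
    by (simp add: nn_integral_bind[OF G] nn_integral_return)
  finally show ?case by simp
next
  case (Suc n \<omega>)
  note Suc.prems[measurable (raw)]
  have "(\<integral>\<^sup>+z. pinned_sum (Suc n) z \<omega> G \<partial>lborel) = (\<integral>\<^sup>+\<gamma>. \<integral>\<^sup>+z. ennreal (f (snd \<gamma>)) * pinned_sum n (z - snd \<gamma>) (insert_jump \<gamma> \<omega>) G \<partial>lborel \<partial>mark_lebesgue)"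
  proof -
    interpret pair_sigma_finite mark_lebesgue "lborel :: real measure" ..
    show ?thesis unfolding pinned_sum.simps by (rule Fubini') measurable
  qed
  also have "\<dots> = (\<integral>\<^sup>+\<gamma>. ennreal (f (snd \<gamma>)) * (ennreal (rate ^ Suc n) * (\<integral>\<^sup>+\<omega>'. G \<omega>' \<partial>jump_chain (Suc n) (insert_jump \<gamma> \<omega>))) \<partial>mark_lebesgue)"
  proof (rule nn_integral_cong)
    fix \<gamma> assume "\<gamma> \<in> space mark_lebesgue"
    then have [measurable (raw)]: "\<gamma> \<in> space marks" by (simp add: space_marks space_mark_lebesgue)
    have "(\<integral>\<^sup>+z. ennreal (f (snd \<gamma>)) * pinned_sum n (z - snd \<gamma>) (insert_jump \<gamma> \<omega>) G \<partial>lborel) =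
      ennreal (f (snd \<gamma>)) * (\<integral>\<^sup>+z. pinned_sum n (z - snd \<gamma>) (insert_jump \<gamma> \<omega>) G \<partial>lborel)"
      by (rule nn_integral_cmult) measurable
    \<comment> \<open>After one mark is taken out, the total of the rest is only shifted by its
      size.\<close>
    also have "(\<integral>\<^sup>+z. pinned_sum n (z - snd \<gamma>) (insert_jump \<gamma> \<omega>) G \<partial>lborel) = (\<integral>\<^sup>+z. pinned_sum n z (insert_jump \<gamma> \<omega>) G \<partial>lborel)"
      by (rule nn_integral_shift) measurable
    also have "\<dots> = ennreal (rate ^ Suc n) * (\<integral>\<^sup>+\<omega>'. G \<omega>' \<partial>jump_chain (Suc n) (insert_jump \<gamma> \<omega>))"
      using Suc by (intro Suc.IH) simp
    finally show "(\<integral>\<^sup>+z. ennreal (f (snd \<gamma>)) * pinned_sum n (z - snd \<gamma>) (insert_jump \<gamma> \<omega>) G \<partial>lborel) =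
       ennreal (f (snd \<gamma>)) * (ennreal (rate ^ Suc n) * (\<integral>\<^sup>+\<omega>'. G \<omega>' \<partial>jump_chain (Suc n) (insert_jump \<gamma> \<omega>)))" .
  qed
  also have "\<dots> = ennreal rate * (\<integral>\<^sup>+\<gamma>. ennreal (rate ^ Suc n) * (\<integral>\<^sup>+\<omega>'. G \<omega>' \<partial>jump_chain (Suc n) (insert_jump \<gamma> \<omega>)) \<partial>mark_law)"
  proof (rule nn_integral_mark_law[symmetric])
    have "(\<lambda>\<gamma>. \<integral>\<^sup>+\<omega>'. G \<omega>' \<partial>jump_chain (Suc n) (insert_jump \<gamma> \<omega>)) \<in> borel_measurable marks"
      using measurable_compose[OF measurable_prob_algebraD[OF measurable_jump_chain_insert[OF Suc.prems]] nn_integral_measurable_subprob_algebra[OF G]] .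
    then show "(\<lambda>\<gamma>. ennreal (rate ^ Suc n) * (\<integral>\<^sup>+\<omega>'. G \<omega>' \<partial>jump_chain (Suc n) (insert_jump \<gamma> \<omega>))) \<in> borel_measurable marks"
      by measurable
  qed
  also have "(\<integral>\<^sup>+\<gamma>. ennreal (rate ^ Suc n) * (\<integral>\<^sup>+\<omega>'. G \<omega>' \<partial>jump_chain (Suc n) (insert_jump \<gamma> \<omega>)) \<partial>mark_law) =
     ennreal (rate ^ Suc n) * (\<integral>\<^sup>+\<gamma>. (\<integral>\<^sup>+\<omega>'. G \<omega>' \<partial>jump_chain (Suc n) (insert_jump \<gamma> \<omega>)) \<partial>mark_law)"
    using measurable_compose[OF measurable_prob_algebraD[OF measurable_jump_chain_insert'[OF Suc.prems]] nn_integral_measurable_subprob_algebra[OF G]]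
    by (rule nn_integral_cmult)
  also have "(\<integral>\<^sup>+\<gamma>. (\<integral>\<^sup>+\<omega>'. G \<omega>' \<partial>jump_chain (Suc n) (insert_jump \<gamma> \<omega>)) \<partial>mark_law) = (\<integral>\<^sup>+\<omega>'. G \<omega>' \<partial>jump_chain (Suc (Suc n)) \<omega>)"
    using measurable_prob_algebraD[OF measurable_jump_chain_insert'[OF Suc.prems, of "Suc n"]]
    by (subst jump_chain.simps(2)[of "Suc n"]) (rule nn_integral_bind[OF G, symmetric])
  finally show ?case using rate_pos by (simp add: ennreal_mult mult.assoc del: jump_chain.simps)
qed

text \<open>A mark of size x at time s adds \<open>V s\<close> times x to a weighted sum of path
  values, where \<open>V s\<close> will be the total weight of the evaluation times not before
  s.\<close>

definition mark_char :: "(real \<Rightarrow> real) \<Rightarrow> complex" where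
  "mark_char V = (CLINT \<gamma>|mark_law. iexp (V (fst \<gamma>) * snd \<gamma>))"

text \<open>Each independent mark adds its own contribution to the linear functional of the path,
  hence multiplies the characteristic function by the same factor.\<close>

lemma char_jump_chain:
  fixes w :: "real \<Rightarrow> real"
  assumes F: "finite F" "F \<subseteq> {0..1}" and \<omega>: "\<omega> \<in> space path_space"
  defines "V \<equiv> (\<lambda>s. \<Sum>r\<in>F. w r * indicator {t. 0 < t \<and> t \<le> r} s)"
  shows "(CLINT \<omega>'|jump_chain n \<omega>. iexp (\<Sum>r\<in>F. w r * \<omega>' r)) = iexp (\<Sum>r\<in>F. w r * \<omega> r) * mark_char V ^ n"
  using \<omega>
proof (induction n arbitrary: \<omega>)
  case (0 \<omega>)
  have m: "(\<lambda>\<omega>'. iexp (\<Sum>r\<in>F. w r * \<omega>' r)) \<in> borel_measurable path_space"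
  proof -
    have "(\<lambda>\<omega>'. \<Sum>r\<in>F. w r * \<omega>' r) \<in> borel_measurable path_space"
      by (intro borel_measurable_sum borel_measurable_times borel_measurable_const measurable_path_eval[OF measurable_ident, simplified id_def])
         (use F in auto)
    then show ?thesis by measurable
  qed
  show ?case using 0 m by (simp add: integral_return)
next
  case (Suc n \<omega>)
  have m: "(\<lambda>\<omega>'. iexp (\<Sum>r\<in>F. w r * \<omega>' r)) \<in> borel_measurable path_space"
  proof -
    have "(\<lambda>\<omega>'. \<Sum>r\<in>F. w r * \<omega>' r) \<in> borel_measurable path_space"
      by (intro borel_measurable_sum borel_measurable_times borel_measurable_const measurable_path_eval[OF measurable_ident, simplified id_def])
         (use F in auto)
    then show ?thesis by measurable
  qed
  have ins: "(\<Sum>r\<in>F. w r * insert_jump \<gamma> \<omega> r) = (\<Sum>r\<in>F. w r * \<omega> r) + V (fst \<gamma>) * snd \<gamma>" for \<gamma>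
    unfolding V_def sum_distrib_right sum.distrib[symmetric]
    by (intro sum.cong refl) (use F in \<open>auto simp: insert_jump_apply algebra_simps\<close>)
  have "(CLINT \<omega>'|jump_chain (Suc n) \<omega>. iexp (\<Sum>r\<in>F. w r * \<omega>' r)) =
     (CLINT \<gamma>|mark_law. CLINT \<omega>'|jump_chain n (insert_jump \<gamma> \<omega>). iexp (\<Sum>r\<in>F. w r * \<omega>' r))"
    unfolding jump_chain.simps
    by (rule integral_bind_complex[OF prob_space_mark_law measurable_jump_chain_insert'[OF Suc.prems] m, of 1]) simp
  also have "\<dots> = (CLINT \<gamma>|mark_law. (iexp (\<Sum>r\<in>F. w r * \<omega> r) * mark_char V ^ n) * iexp (V (fst \<gamma>) * snd \<gamma>))"
  proof (rule Bochner_Integration.integral_cong[OF refl])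
    fix \<gamma>
    have "(CLINT \<omega>'|jump_chain n (insert_jump \<gamma> \<omega>). iexp (\<Sum>r\<in>F. w r * \<omega>' r)) = iexp (\<Sum>r\<in>F. w r * insert_jump \<gamma> \<omega> r) * mark_char V ^ n"
      using Suc by (intro Suc.IH) simp
    also have "\<dots> = (iexp (\<Sum>r\<in>F. w r * \<omega> r) * mark_char V ^ n) * iexp (V (fst \<gamma>) * snd \<gamma>)"
      unfolding ins of_real_add distrib_left exp_add by (simp only: ac_simps)
    finally show "(CLINT \<omega>'|jump_chain n (insert_jump \<gamma> \<omega>). iexp (\<Sum>r\<in>F. w r * \<omega>' r)) =
      (iexp (\<Sum>r\<in>F. w r * \<omega> r) * mark_char V ^ n) * iexp (V (fst \<gamma>) * snd \<gamma>)" .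
  qed
  also have "\<dots> = iexp (\<Sum>r\<in>F. w r * \<omega> r) * mark_char V ^ Suc n"
    unfolding mark_char_def by simp
  finally show ?case .
qed

section \<open>Compound Poisson laws\<close>

definition poisson_path :: "real \<Rightarrow> (real \<Rightarrow> real) measure" where
  "poisson_path x = measure_pmf (poisson_pmf rate) \<bind> (\<lambda>n. jump_chain n (const_path x))"

definition poisson_law :: "real measure \<Rightarrow> (real \<Rightarrow> real) measure" where
  "poisson_law \<mu> = \<mu> \<bind> poisson_path"

lemma poisson_in: "measure_pmf (poisson_pmf rate) \<in> space (prob_algebra (count_space UNIV))"
  by (simp add: space_prob_algebra prob_space_measure_pmf)

lemma measurable_poisson_path: "poisson_path \<in> borel \<rightarrow>\<^sub>M prob_algebra path_space"
proof -
  have m: "(\<lambda>(x, n). jump_chain n (const_path x)) \<in> borel \<Otimes>\<^sub>M count_space UNIV \<rightarrow>\<^sub>M prob_algebra path_space"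
    unfolding split_beta'
  proof (rule measurable_compose_countable[where f="\<lambda>n p. jump_chain n (const_path (fst p))"])
    show "(\<lambda>x. jump_chain i (const_path (fst x))) \<in> borel \<Otimes>\<^sub>M count_space UNIV \<rightarrow>\<^sub>M prob_algebra path_space" for i
      by (rule measurable_compose[OF _ measurable_jump_chain]) measurable
  qed measurable
  have "(\<lambda>x. measure_pmf (poisson_pmf rate) \<bind> (\<lambda>n. jump_chain n (const_path x))) \<in> borel \<rightarrow>\<^sub>M prob_algebra path_space"
    by (rule measurable_bind_prob_space2[OF measurable_const[OF poisson_in] m])
  then show ?thesis by (simp add: poisson_path_def[abs_def])
qed

lemma measurable_chain_count: "(\<lambda>n. jump_chain n (const_path x)) \<in> count_space UNIV \<rightarrow>\<^sub>M prob_algebra path_space"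
  using measurable_space[OF measurable_jump_chain const_path_in_space] by simp

lemma measurable_chain_pmf: "(\<lambda>n. jump_chain n (const_path x)) \<in> measure_pmf (poisson_pmf rate) \<rightarrow>\<^sub>M prob_algebra path_space"
  using measurable_chain_count by (simp add: measurable_cong_sets[OF sets_measure_pmf_count_space refl])

text \<open>The Poisson generating function evaluated at the one-mark factor
  \<open>mark_char V\<close>.\<close>

lemma char_poisson_path:
  fixes w :: "real \<Rightarrow> real"
  assumes F: "finite F" "F \<subseteq> {0..1}"
  defines "V \<equiv> (\<lambda>s. \<Sum>r\<in>F. w r * indicator {t. 0 < t \<and> t \<le> r} s)"
  shows "(CLINT \<omega>|poisson_path x. iexp (\<Sum>r\<in>F. w r * \<omega> r)) = iexp ((\<Sum>r\<in>F. w r) * x) * exp (of_real rate * (mark_char V - 1))"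
proof -
  have m: "(\<lambda>\<omega>'. iexp (\<Sum>r\<in>F. w r * \<omega>' r)) \<in> borel_measurable path_space"
  proof -
    have "(\<lambda>\<omega>'. \<Sum>r\<in>F. w r * \<omega>' r) \<in> borel_measurable path_space"
      by (intro borel_measurable_sum borel_measurable_times borel_measurable_const measurable_path_eval[OF measurable_ident, simplified id_def])
         (use F in auto)
    then show ?thesis by measurable
  qed
  have c: "(\<Sum>r\<in>F. w r * const_path x r) = (\<Sum>r\<in>F. w r) * x"
    unfolding sum_distrib_right by (intro sum.cong refl) (use F in \<open>auto simp: subset_iff\<close>)
  let ?a = "mark_char V" and ?e = "iexp ((\<Sum>r\<in>F. w r) * x)"
  let ?h = "\<lambda>n. pmf (poisson_pmf rate) n *\<^sub>R (?e * ?a ^ n)"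
  have "(\<lambda>n. (of_real rate * ?a) ^ n /\<^sub>R fact n) sums exp (of_real rate * ?a)"
    by (rule exp_converges)
  from sums_mult[OF this, of "?e * of_real (exp (- rate))"]
  have s: "?h sums (?e * of_real (exp (- rate)) * exp (of_real rate * ?a))"
    by (rule sums_cong[THEN iffD1, rotated])
       (simp add: rate_pos scaleR_conv_of_real power_mult_distrib divide_inverse ac_simps)
  have "(CLINT \<omega>|poisson_path x. iexp (\<Sum>r\<in>F. w r * \<omega> r)) = (CLINT n|measure_pmf (poisson_pmf rate). CLINT \<omega>|jump_chain n (const_path x). iexp (\<Sum>r\<in>F. w r * \<omega> r))"
    unfolding poisson_path_def
    by (rule integral_bind_complex[OF prob_space_measure_pmf measurable_chain_pmf m, of 1]) simp
  also have "\<dots> = (CLINT n|measure_pmf (poisson_pmf rate). ?e * ?a ^ n)"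
    by (simp only: char_jump_chain[OF F const_path_in_space] c V_def)
  also have "\<dots> = (CLINT n|count_space UNIV. ?h n)"
    unfolding measure_pmf_eq_density by (subst integral_density) (auto simp: rate_pos less_imp_le intro!: AE_I2)
  also have "\<dots> = ?e * of_real (exp (- rate)) * exp (of_real rate * ?a)"
  proof -
    have "summable (\<lambda>n. norm (?h n))"
    proof -
      have "summable (\<lambda>n. norm ((of_real rate * ?a) ^ n /\<^sub>R fact n))" by (rule summable_norm_exp)
      from summable_mult[OF this, of "norm (?e * of_real (exp (- rate)))"]
      have "summable (\<lambda>n. norm (?e * of_real (exp (- rate))) * norm ((of_real rate * ?a) ^ n /\<^sub>R fact n))" .
      moreover have "norm (?e * of_real (exp (- rate))) * norm ((of_real rate * ?a) ^ n /\<^sub>R fact n) = norm (?h n)" for n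
        by (simp add: rate_pos abs_of_pos[OF rate_pos] abs_mult power_abs norm_mult norm_power power_mult_distrib divide_inverse ac_simps)
      ultimately show ?thesis by (simp only:)
    qed
    then have "integrable (count_space UNIV) ?h" by (simp only: integrable_count_space_nat_iff)
    from sums_unique2[OF sums_integral_count_space_nat[OF this] s] show ?thesis .
  qed
  also have "\<dots> = ?e * exp (of_real rate * (?a - 1))"
  proof -
    have "of_real (exp (- rate)) * exp (of_real rate * ?a) = exp (of_real rate * (?a - 1))"
      unfolding exp_of_real[symmetric] exp_add[symmetric] by (simp add: right_diff_distrib)
    then show ?thesis by (simp only: mult.assoc)
  qed
  finally show ?thesis .
qed

lemma char_poisson_law:
  fixes w :: "real \<Rightarrow> real"
  assumes \<mu>: "prob_space \<mu>" "sets \<mu> = sets borel" and F: "finite F" "F \<subseteq> {0..1}"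
  defines "V \<equiv> (\<lambda>s. \<Sum>r\<in>F. w r * indicator {t. 0 < t \<and> t \<le> r} s)"
  shows "(CLINT \<omega>|poisson_law \<mu>. iexp (\<Sum>r\<in>F. w r * \<omega> r)) = char \<mu> (\<Sum>r\<in>F. w r) * exp (of_real rate * (mark_char V - 1))"
proof -
  have m: "(\<lambda>\<omega>'. iexp (\<Sum>r\<in>F. w r * \<omega>' r)) \<in> borel_measurable path_space"
  proof -
    have "(\<lambda>\<omega>'. \<Sum>r\<in>F. w r * \<omega>' r) \<in> borel_measurable path_space"
      by (intro borel_measurable_sum borel_measurable_times borel_measurable_const measurable_path_eval[OF measurable_ident, simplified id_def])
         (use F in auto)
    then show ?thesis by measurable
  qed
  have p: "poisson_path \<in> \<mu> \<rightarrow>\<^sub>M prob_algebra path_space"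
    using measurable_poisson_path by (simp add: measurable_cong_sets[OF \<mu>(2) refl])
  have "(CLINT \<omega>|poisson_law \<mu>. iexp (\<Sum>r\<in>F. w r * \<omega> r)) = (CLINT x|\<mu>. CLINT \<omega>|poisson_path x. iexp (\<Sum>r\<in>F. w r * \<omega> r))"
    unfolding poisson_law_def by (rule integral_bind_complex[OF \<mu>(1) p m, of 1]) simp
  also have "\<dots> = (CLINT x|\<mu>. iexp ((\<Sum>r\<in>F. w r) * x) * exp (of_real rate * (mark_char V - 1)))"
    by (simp only: char_poisson_path[OF F] V_def)
  also have "\<dots> = char \<mu> (\<Sum>r\<in>F. w r) * exp (of_real rate * (mark_char V - 1))"
    unfolding char_def by simp
  finally show ?thesis .
qed

lemma poisson_law_prob: "prob_space \<mu> \<Longrightarrow> sets \<mu> = sets borel \<Longrightarrow> poisson_law \<mu> \<in> space (prob_algebra path_space)"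
  unfolding poisson_law_def
  using measurable_bind_prob_space[OF measurable_const measurable_poisson_path, of \<mu> "count_space UNIV", THEN measurable_space, of undefined]
  by (simp add: space_prob_algebra)

section \<open>Levy laws are compound Poisson laws\<close>

abbreviation jump_measure :: "real measure" where
  "jump_measure \<equiv> density lborel (\<lambda>x. ennreal (f x))"

lemma integral_jump_measure:
  fixes g :: "real \<Rightarrow> complex"
  assumes [measurable]: "g \<in> borel_measurable borel"
  shows "(\<integral>x. g x \<partial>jump_measure) = of_real rate * (\<integral>x. g x \<partial>size_law)"
proof -
  have "(\<integral>x. g x \<partial>jump_measure) = (\<integral>x. f x *\<^sub>R g x \<partial>lborel)"
    by (rule integral_density) (use f_pos in \<open>auto intro!: AE_I2 less_imp_le\<close>)
  also have "\<dots> = (\<integral>x. of_real rate * ((f x / rate) *\<^sub>R g x) \<partial>lborel)"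
    using rate_pos by (intro Bochner_Integration.integral_cong refl) (simp add: scaleR_conv_of_real)
  also have "\<dots> = of_real rate * (\<integral>x. (f x / rate) *\<^sub>R g x \<partial>lborel)"
    by (rule integral_mult_right_zero)
  also have "(\<integral>x. (f x / rate) *\<^sub>R g x \<partial>lborel) = (\<integral>x. g x \<partial>size_law)"
    unfolding size_law_def
    by (rule integral_density[symmetric]) (use f_pos rate_pos in \<open>auto intro!: AE_I2 divide_nonneg_pos less_imp_le\<close>)
  finally show ?thesis .
qed

text \<open>The times in a block (a,b], where \<open>V'\<close> is silent and \<open>V\<close> has
  the constant value \<open>v\<close>, add exactly the Levy-Khintchine exponent of an increment of
  length \<open>b - a\<close>.\<close>

lemma mark_char_increment:
  assumes ab: "0 \<le> a" "a < b" "b \<le> 1" and V [measurable]: "V \<in> borel_measurable borel" "V' \<in> borel_measurable borel"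
    and eq: "\<And>s. s \<in> {0..1} \<Longrightarrow> V s = (if s \<in> {a<..b} then v else V' s)" "\<And>s. s \<in> {a<..b} \<Longrightarrow> V' s = 0"
  shows "of_real rate * (mark_char V - 1) = of_real rate * (mark_char V' - 1) + of_real (b - a) * (CLINT x|jump_measure. iexp (v * x) - 1)"
proof -
  interpret S: prob_space size_law by (rule prob_space_size_law)
  interpret US: pair_sigma_finite unit_lebesgue size_law ..
  interpret M: prob_space mark_law by (rule prob_space_mark_law)
  have t [measurable]: "(\<lambda>\<gamma>. fst \<gamma>) \<in> borel_measurable mark_law" "(\<lambda>\<gamma>. snd \<gamma>) \<in> borel_measurable mark_law"
    using measurable_mark_time[of "\<lambda>\<gamma>. \<gamma>" mark_law] by (simp_all add: measurable_cong_sets[OF sets_mark_law refl])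
  let ?g = "\<lambda>\<gamma>. indicator {a<..b} (fst \<gamma>) *\<^sub>R (iexp (v * snd \<gamma>) - 1)"
  have i1: "integrable mark_law (\<lambda>\<gamma>. iexp (V' (fst \<gamma>) * snd \<gamma>))" by (rule M.integrable_iexp_finite) measurable
  have i2: "integrable mark_law ?g"
  proof (rule M.integrable_const_bound[of _ 2])
    have "norm (iexp y - 1) \<le> 2" for y
      using norm_triangle_ineq4[of "iexp y" 1] by simp
    then show "AE \<gamma> in mark_law. norm (?g \<gamma>) \<le> 2" by (auto simp: indicator_def simp del: of_real_mult intro!: AE_I2)
  qed measurable
  have "mark_char V = (CLINT \<gamma>|mark_law. iexp (V' (fst \<gamma>) * snd \<gamma>) + ?g \<gamma>)"
    unfolding mark_char_def
    by (intro Bochner_Integration.integral_cong refl) (auto simp: space_mark_law eq indicator_def)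
  also have "\<dots> = mark_char V' + (CLINT \<gamma>|mark_law. ?g \<gamma>)"
    using i1 i2 by (simp add: mark_char_def)
  also have "(CLINT \<gamma>|mark_law. ?g \<gamma>) = (CLINT s|unit_lebesgue. CLINT x|size_law. ?g (s, x))"
    unfolding mark_law_def by (rule US.integral_fst'[symmetric]) (use i2 in \<open>simp add: mark_law_def\<close>)
  also have "\<dots> = (CLINT s|unit_lebesgue. indicator {a<..b} s *\<^sub>R (CLINT x|size_law. iexp (v * x) - 1))"
    by simp
  also have "\<dots> = of_real (b - a) * (CLINT x|size_law. iexp (v * x) - 1)"
  proof -
    have "measure unit_lebesgue {a<..b} = b - a"
      unfolding unit_lebesgue_def using ab by (subst measure_restrict_space) auto
    moreover have "{a<..b} \<in> sets unit_lebesgue"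
      unfolding unit_lebesgue_def using ab by (subst sets_restrict_space_iff) auto
    ultimately show ?thesis
      by (simp add: scaleR_conv_of_real unit_lebesgue.emeasure_eq_measure)
  qed
  finally have V: "mark_char V = mark_char V' + of_real (b - a) * (CLINT x|size_law. iexp (v * x) - 1)" .
  have J: "(CLINT x|jump_measure. iexp (v * x) - 1) = of_real rate * (CLINT x|size_law. iexp (v * x) - 1)"
    by (rule integral_jump_measure) measurable
  show ?thesis unfolding V J by (simp only: algebra_simps)
qed

text \<open>Induction on the largest time: the increment into it is independent of the earlier path,
  and its weight moves to the preceding time. The initial value keeps its own weight
  \<open>u\<close> because its law is arbitrary and it is the preceding time when no other
  remains.\<close>

lemma char_levy_law_aux:
  fixes w :: "real \<Rightarrow> real"
  assumes P: "levy_law jump_measure P" and F: "finite F" "F \<subseteq> {0<..1}"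
  shows "(CLINT \<omega>|P. iexp (u * \<omega> 0 + (\<Sum>r\<in>F. w r * \<omega> r))) =
    char (distr P borel (\<lambda>\<omega>. \<omega> 0)) (u + (\<Sum>r\<in>F. w r)) *
    exp (of_real rate * (mark_char (\<lambda>s. \<Sum>r\<in>F. w r * indicator {t. 0 < t \<and> t \<le> r} s) - 1))"
  using F
proof (induction F arbitrary: u w rule: finite_linorder_max_induct)
  case empty
  have s: "sets P = sets path_space" and p: "prob_space P"
    using P by (auto simp: levy_law_def space_prob_algebra)
  interpret M: prob_space mark_law by (rule prob_space_mark_law)
  have [measurable]: "(\<lambda>\<omega>. \<omega> 0) \<in> borel_measurable P"
    using measurable_path_eval[of "\<lambda>\<omega>. \<omega>" path_space 0] by (simp add: measurable_cong_sets[OF s refl])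
  have "mark_char (\<lambda>s. 0) = 1" by (simp add: mark_char_def M.prob_space)
  then show ?case by (simp add: char_def integral_distr)
next
  case (insert b A u w)
  have s: "sets P = sets path_space" and p: "prob_space P"
    using P by (auto simp: levy_law_def space_prob_algebra)
  interpret P: prob_space P by (rule p)
  have ev: "(\<lambda>\<omega>. \<omega> r) \<in> borel_measurable P" if "r \<in> {0..1}" for r
    using measurable_path_eval[of "\<lambda>\<omega>. \<omega>" path_space r] that by (simp add: measurable_cong_sets[OF s refl])
  \<comment> \<open>The preceding evaluation time, or 0 if there is none; in that case the weight of
    \<open>b\<close> is added to the weight \<open>u\<close> of the initial value.\<close>
  define a where "a = (if A = {} then 0 else Max A)"
  define u' where "u' = (if A = {} then u + w b else u)"
  define w' where "w' = (if A = {} then w else w(a := w a + w b))"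
  have A01: "A \<subseteq> {0<..1}" and b01: "0 < b" "b \<le> 1" using insert.prems by auto
  have bA: "b \<notin> A" using insert.hyps(2) by auto
  have a4: "a \<in> A" if "A \<noteq> {}" using Max_in[OF insert.hyps(1) that] that by (simp add: a_def)
  have a3: "r \<le> a" if "r \<in> A" for r
  proof -
    have "A \<noteq> {}" using that by auto
    then show ?thesis using Max_ge[OF insert.hyps(1) that] by (simp add: a_def)
  qed
  have a12: "0 \<le> a \<and> a < b"
  proof (cases "A = {}")
    case True
    then show ?thesis using b01 by (simp add: a_def)
  next
    case False
    from a4[OF this] show ?thesis using A01 insert.hyps(2) by fastforce
  qed
  note a = conjunct1[OF a12] conjunct2[OF a12] a3 a4
  \<comment> \<open>Stated for an arbitrary function of time because it is used for the path, for
    the constant 1 and for the indicators that build \<open>V\<close>.\<close>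
  have gen: "u' * \<phi> 0 + (\<Sum>r\<in>A. w' r * \<phi> r) = u * \<phi> 0 + (\<Sum>r\<in>A. w r * \<phi> r) + w b * \<phi> a" for \<phi> :: "real \<Rightarrow> real"
  proof (cases "A = {}")
    case True
    then show ?thesis by (simp add: u'_def a_def distrib_right)
  next
    case False
    then have "a \<in> A" by (rule a)
    have "(\<Sum>r\<in>A. w' r * \<phi> r) = (\<Sum>r\<in>A. w r * \<phi> r + (if r = a then w b * \<phi> a else 0))"
      using False by (intro sum.cong) (auto simp: w'_def distrib_right)
    also have "\<dots> = (\<Sum>r\<in>A. w r * \<phi> r) + w b * \<phi> a"
      using insert.hyps(1) \<open>a \<in> A\<close> by (simp add: sum.distrib)
    finally show ?thesis using False by (simp add: u'_def)
  qed
  define X1 where "X1 \<omega> = u' * \<omega> 0 + (\<Sum>r\<in>A. w' r * \<omega> r)" for \<omega> :: "real \<Rightarrow> real"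
  define X2 where "X2 \<omega> = w b * (\<omega> b - \<omega> a)" for \<omega> :: "real \<Rightarrow> real"
  have X1 [measurable]: "X1 \<in> borel_measurable P"
    unfolding X1_def using A01
    by (intro borel_measurable_add borel_measurable_sum borel_measurable_times borel_measurable_const ev) auto
  have \<Delta> [measurable]: "(\<lambda>\<omega>. \<omega> b - \<omega> a) \<in> borel_measurable P"
    using a b01 by (intro borel_measurable_diff ev) auto
  have X2 [measurable]: "X2 \<in> borel_measurable P" unfolding X2_def by measurable
  have split: "u * \<omega> 0 + (\<Sum>r\<in>insert b A. w r * \<omega> r) = X1 \<omega> + X2 \<omega>" for \<omega>
    using gen[of \<omega>] insert.hyps(1) bA unfolding X1_def X2_def by (simp add: algebra_simps)
  have levy: "P.indep_set (sets (vimage_algebra (space P) (\<lambda>\<omega>. restrict \<omega> {0..a}) (\<Pi>\<^sub>M r\<in>{0..a}. (borel :: real measure))))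
          (sets (vimage_algebra (space P) (\<lambda>\<omega>. \<omega> b - \<omega> a) borel))"
    "char (distr P borel (\<lambda>\<omega>. \<omega> b - \<omega> a)) v = exp (of_real (b - a) * (CLINT x|jump_measure. iexp (v * x) - 1))" for v
    using P a b01 unfolding levy_law_def by auto
  have "P.indep_var borel X1 borel X2"
    unfolding P.indep_var_eq
  proof (intro conjI X1 X2)
    let ?V1 = "vimage_algebra (space P) (\<lambda>\<omega>. restrict \<omega> {0..a}) (\<Pi>\<^sub>M r\<in>{0..a}. (borel :: real measure))"
    let ?V2 = "vimage_algebra (space P) (\<lambda>\<omega>. \<omega> b - \<omega> a) borel"
    have sub1: "sigma_sets (space P) {X1 -` B \<inter> space P |B. B \<in> sets borel} \<subseteq> sets ?V1"
    proof -
      define h where "h = (\<lambda>\<phi> :: real \<Rightarrow> real. u' * \<phi> 0 + (\<Sum>r\<in>A. w' r * \<phi> r))"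
      have h: "h \<in> borel_measurable (\<Pi>\<^sub>M r\<in>{0..a}. (borel :: real measure))"
        unfolding h_def using A01 a
        by (intro borel_measurable_add borel_measurable_sum borel_measurable_times borel_measurable_const measurable_component_singleton) auto
      have "X1 \<omega> = h (restrict \<omega> {0..a})" for \<omega>
        unfolding X1_def h_def using A01 a by (auto intro!: sum.cong simp: subset_iff)
      have "X1 -` B \<inter> space P \<in> sets ?V1" if "B \<in> sets borel" for B
      proof -
        have "h -` B \<inter> space (\<Pi>\<^sub>M r\<in>{0..a}. (borel :: real measure)) \<in> sets (\<Pi>\<^sub>M r\<in>{0..a}. (borel :: real measure))"
          by (rule measurable_sets[OF h that])
        from in_vimage_algebra[OF this, of "\<lambda>\<omega>. restrict \<omega> {0..a}" "space P"]
        have "(\<lambda>\<omega>. restrict \<omega> {0..a}) -` (h -` B \<inter> space (\<Pi>\<^sub>M r\<in>{0..a}. (borel :: real measure))) \<inter> space P \<in> sets ?V1" .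
        also have "(\<lambda>\<omega>. restrict \<omega> {0..a}) -` (h -` B \<inter> space (\<Pi>\<^sub>M r\<in>{0..a}. (borel :: real measure))) \<inter> space P = X1 -` B \<inter> space P"
          using \<open>\<And>\<omega>. X1 \<omega> = h (restrict \<omega> {0..a})\<close> by (auto simp: space_PiM)
        finally show ?thesis .
      qed
      then have "{X1 -` B \<inter> space P |B. B \<in> sets borel} \<subseteq> sets ?V1" by auto
      from sets.sigma_sets_subset[OF this] show ?thesis by simp
    qed
    have sub2: "sigma_sets (space P) {X2 -` B \<inter> space P |B. B \<in> sets borel} \<subseteq> sets ?V2"
    proof -
      have "X2 -` B \<inter> space P \<in> sets ?V2" if "B \<in> sets borel" for B
      proof -
        have "(\<lambda>x. w b * x) -` B \<in> sets borel" using measurable_sets[of "\<lambda>x. w b * x" borel borel B] that by simp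
        from in_vimage_algebra[OF this, of "\<lambda>\<omega>. \<omega> b - \<omega> a" "space P"] show ?thesis
          by (simp add: X2_def vimage_def)
      qed
      then have "{X2 -` B \<inter> space P |B. B \<in> sets borel} \<subseteq> sets ?V2" by auto
      from sets.sigma_sets_subset[OF this] show ?thesis by simp
    qed
    show "P.indep_set (sigma_sets (space P) {X1 -` B \<inter> space P |B. B \<in> sets borel}) (sigma_sets (space P) {X2 -` B \<inter> space P |B. B \<in> sets borel})"
      using levy(1) sub1 sub2 unfolding P.indep_sets2_eq by blast
  qed
  from P.char_distr_add[OF this, of 1]
  have "char (distr P borel (\<lambda>\<omega>. X1 \<omega> + X2 \<omega>)) 1 = char (distr P borel X1) 1 * char (distr P borel X2) 1" .
  moreover have "char (distr P borel X) 1 = (CLINT \<omega>|P. iexp (X \<omega>))" if [measurable]: "X \<in> borel_measurable P" for X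
    by (simp add: char_def integral_distr)
  ultimately have prod: "(CLINT \<omega>|P. iexp (X1 \<omega> + X2 \<omega>)) = (CLINT \<omega>|P. iexp (X1 \<omega>)) * (CLINT \<omega>|P. iexp (X2 \<omega>))"
    using X1 X2 by (simp only: borel_measurable_add)
  have "(CLINT \<omega>|P. iexp (X2 \<omega>)) = char (distr P borel (\<lambda>\<omega>. \<omega> b - \<omega> a)) (w b)"
    unfolding char_def X2_def by (simp add: integral_distr)
  also have "\<dots> = exp (of_real (b - a) * (CLINT x|jump_measure. iexp (w b * x) - 1))" by (rule levy(2))
  finally have 2: "(CLINT \<omega>|P. iexp (X2 \<omega>)) = \<dots>" .
  let ?I = "\<lambda>r. indicator {t. 0 < t \<and> t \<le> r} :: real \<Rightarrow> real"
  have 1: "(CLINT \<omega>|P. iexp (X1 \<omega>)) = char (distr P borel (\<lambda>\<omega>. \<omega> 0)) (u' + (\<Sum>r\<in>A. w' r)) *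
    exp (of_real rate * (mark_char (\<lambda>s. \<Sum>r\<in>A. w' r * ?I r s) - 1))"
    unfolding X1_def by (rule insert.IH[OF A01])
  have 3: "u' + (\<Sum>r\<in>A. w' r) = u + (\<Sum>r\<in>insert b A. w r)"
    using gen[of "\<lambda>_. 1"] insert.hyps(1) bA by (simp add: algebra_simps)
  have V': "(\<Sum>r\<in>A. w' r * ?I r s) = (\<Sum>r\<in>A. w r * ?I r s) + w b * ?I a s" for s
  proof -
    have "?I 0 s = 0" by (simp add: indicator_def)
    with gen[of "\<lambda>r. ?I r s"] show ?thesis by (simp only: mult_zero_right add_0)
  qed
  \<comment> \<open>On (a,b] only the time \<open>b\<close> still counts, so the new profile equals
    \<open>w b\<close> there and the old one is zero; elsewhere in the unit interval the moved
    weight makes both profiles agree.\<close>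
  have 4: "of_real rate * (mark_char (\<lambda>s. \<Sum>r\<in>insert b A. w r * ?I r s) - 1) =
     of_real rate * (mark_char (\<lambda>s. \<Sum>r\<in>A. w' r * ?I r s) - 1) + of_real (b - a) * (CLINT x|jump_measure. iexp (w b * x) - 1)"
  proof (rule mark_char_increment)
    fix s :: real
    have zero: "(\<Sum>r\<in>A. w r * ?I r s) = 0" if "a < s"
      by (rule sum.neutral) (use a(3) that in \<open>force simp: indicator_def\<close>)
    show "(\<Sum>r\<in>A. w' r * ?I r s) = 0" if "s \<in> {a<..b}"
      unfolding V' using that zero by (simp add: indicator_def)
    show "(\<Sum>r\<in>insert b A. w r * ?I r s) = (if s \<in> {a<..b} then w b else (\<Sum>r\<in>A. w' r * ?I r s))"
      unfolding V' using zero insert.hyps(1) bA a(1,2) by (auto simp: indicator_def)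
  qed (use a b01 in \<open>auto intro!: borel_measurable_sum\<close>)
  show ?case
    unfolding split prod 1 2 3 4 exp_add by (simp only: mult.assoc)
qed

lemma char_levy_law:
  fixes w :: "real \<Rightarrow> real"
  assumes P: "levy_law jump_measure P" and F: "finite F" "F \<subseteq> {0..1}"
  shows "(CLINT \<omega>|P. iexp (\<Sum>r\<in>F. w r * \<omega> r)) =
    char (distr P borel (\<lambda>\<omega>. \<omega> 0)) (\<Sum>r\<in>F. w r) *
    exp (of_real rate * (mark_char (\<lambda>s. \<Sum>r\<in>F. w r * indicator {t. 0 < t \<and> t \<le> r} s) - 1))"
proof -
  define u where "u = (if 0 \<in> F then w 0 else 0)"
  have sum: "(\<Sum>r\<in>F. w r * \<phi> r) = u * \<phi> 0 + (\<Sum>r\<in>F - {0}. w r * \<phi> r)" for \<phi> :: "real \<Rightarrow> real"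
    using F(1) by (auto simp: u_def sum.remove)
  have "F - {0} \<subseteq> {0<..1}" using F(2) by (auto simp: less_le)
  from char_levy_law_aux[OF P _ this, of u w]
  have "(CLINT \<omega>|P. iexp (\<Sum>r\<in>F. w r * \<omega> r)) =
    char (distr P borel (\<lambda>\<omega>. \<omega> 0)) (u + (\<Sum>r\<in>F - {0}. w r)) *
    exp (of_real rate * (mark_char (\<lambda>s. \<Sum>r\<in>F - {0}. w r * indicator {t. 0 < t \<and> t \<le> r} s) - 1))"
    using F(1) by (simp only: sum[symmetric] finite_Diff)
  moreover have "u + (\<Sum>r\<in>F - {0}. w r) = (\<Sum>r\<in>F. w r)" using sum[of "\<lambda>_. 1"] by simp
  moreover have "(\<Sum>r\<in>F - {0}. w r * indicator {t. 0 < t \<and> t \<le> r} s) = (\<Sum>r\<in>F. w r * indicator {t. 0 < t \<and> t \<le> r} s)" for s :: real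
    using sum[of "\<lambda>r. indicator {t. 0 < t \<and> t \<le> r} s"] by (simp add: indicator_def)
  ultimately show ?thesis by simp
qed

lemma levy_law_eq_poisson_law:
  assumes P: "levy_law jump_measure P"
  shows "P = poisson_law (distr P borel (\<lambda>\<omega>. \<omega> 0))"
proof -
  have s: "sets P = sets path_space" and p: "prob_space P"
    using P by (auto simp: levy_law_def space_prob_algebra)
  interpret P: prob_space P by (rule p)
  have [measurable]: "(\<lambda>\<omega>. \<omega> 0) \<in> borel_measurable P"
    using measurable_path_eval[of "\<lambda>\<omega>. \<omega>" path_space 0] by (simp add: measurable_cong_sets[OF s refl])
  let ?\<mu> = "distr P borel (\<lambda>\<omega>. \<omega> 0)"
  have \<mu>: "prob_space ?\<mu>" by (rule P.prob_space_distr) measurable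
  have R: "poisson_law ?\<mu> \<in> space (prob_algebra path_space)" by (rule poisson_law_prob[OF \<mu>]) simp
  interpret R: prob_space "poisson_law ?\<mu>" using R by (simp add: space_prob_algebra)
  show ?thesis
  proof (rule path_measure_eqI_char)
    show "sets (poisson_law ?\<mu>) = sets path_space" using R by (simp add: space_prob_algebra)
    fix F :: "real set" and w :: "real \<Rightarrow> real" assume F: "finite F" "F \<subseteq> {0..1}"
    show "(CLINT \<omega>|P. iexp (\<Sum>r\<in>F. w r * \<omega> r)) = (CLINT \<omega>|poisson_law ?\<mu>. iexp (\<Sum>r\<in>F. w r * \<omega> r))"
      unfolding char_levy_law[OF P F] by (rule char_poisson_law[OF \<mu> _ F, symmetric]) simp
  qed (unfold_locales, rule s)
qed

text \<open>Disintegration along the endpoints: an atom of weight \<open>exp (- rate)\<close> on the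
  constant path, and a part with density given by \<open>bridge_sum\<close>. The functional is kept
  separate from its endpoint factor, which leaves the pinned sums unchanged.\<close>

lemma nn_integral_poisson_law:
  assumes \<mu>: "prob_space \<mu>" "sets \<mu> = sets borel" and G [measurable]: "G \<in> borel_measurable path_space"
    and g [measurable]: "(\<lambda>(x, y). g x y) \<in> borel_measurable (borel \<Otimes>\<^sub>M borel)"
  shows "(\<integral>\<^sup>+\<omega>. G \<omega> * g (\<omega> 0) (\<omega> 1) \<partial>poisson_law \<mu>) =
    (\<integral>\<^sup>+x. ennreal (exp (- rate)) * (G (const_path x) * g x x + (\<integral>\<^sup>+z. g x (x + z) * bridge_sum x z G \<partial>lborel)) \<partial>\<mu>)"
proof -
  have [measurable]: "(\<lambda>\<omega>. \<omega> 0) \<in> borel_measurable path_space" "(\<lambda>\<omega>. \<omega> 1) \<in> borel_measurable path_space"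
    by (intro measurable_path_eval measurable_ident; simp)+
  note [measurable (raw)] = measurable_curried[OF g]
  let ?G = "\<lambda>\<omega>. G \<omega> * g (\<omega> 0) (\<omega> 1)"
  have m [measurable]: "?G \<in> borel_measurable path_space" by measurable
  have p: "poisson_path \<in> \<mu> \<rightarrow>\<^sub>M prob_algebra path_space"
    using measurable_poisson_path by (simp add: measurable_cong_sets[OF \<mu>(2) refl])
  have path: "(\<integral>\<^sup>+\<omega>. ?G \<omega> \<partial>poisson_path x) = ennreal (exp (- rate)) * (G (const_path x) * g x x + (\<integral>\<^sup>+z. g x (x + z) * bridge_sum x z G \<partial>lborel))" for x
  proof -
    have m_pinned: "(\<lambda>z. pinned_sum n z (const_path x) G) \<in> borel_measurable lborel" for n
    proof (rule measurable_pinned_sum[where G="\<lambda>_. G" and z="\<lambda>z. z" and g="\<lambda>_. const_path x"])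
      show "(\<lambda>(p, \<omega>). G \<omega>) \<in> borel_measurable (lborel \<Otimes>\<^sub>M path_space)" by measurable
      show "(\<lambda>_. const_path x) \<in> lborel \<rightarrow>\<^sub>M path_space" by (rule measurable_const) simp
    qed simp
    have m_g: "(\<lambda>z. g x (x + z)) \<in> borel_measurable lborel"
      using measurable_compose[OF _ g, of "\<lambda>z. (x, x + z)" lborel] by simp
    let ?N = "\<lambda>n. \<integral>\<^sup>+\<omega>. ?G \<omega> \<partial>jump_chain n (const_path x)"
    let ?p = "\<lambda>n. ennreal (pmf (poisson_pmf rate) n)"
    have "(\<integral>\<^sup>+\<omega>. ?G \<omega> \<partial>poisson_path x) = (\<integral>\<^sup>+n. ?N n \<partial>measure_pmf (poisson_pmf rate))"
      unfolding poisson_path_def by (rule nn_integral_bind[OF m measurable_prob_algebraD[OF measurable_chain_pmf]])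
    also have "\<dots> = (\<Sum>n. ?p n * ?N n)"
      by (simp add: nn_integral_measure_pmf nn_integral_count_space_nat)
    also have "\<dots> = ?p 0 * ?N 0 + (\<Sum>n. ?p (Suc n) * ?N (Suc n))"
    proof -
      have "(\<lambda>n. ?p (Suc n) * ?N (Suc n)) sums (\<Sum>n. ?p (Suc n) * ?N (Suc n))" by (intro summable_sums summableI)
      from sums_unique[OF sums_Suc[OF this]] show ?thesis by (simp only: add.commute)
    qed
    also have "?p 0 * ?N 0 = ennreal (exp (- rate)) * (G (const_path x) * g x x)"
      using m by (simp add: rate_pos nn_integral_return)
    also have "(\<Sum>n. ?p (Suc n) * ?N (Suc n)) = (\<Sum>n. ennreal (exp (- rate)) * (\<integral>\<^sup>+z. g x (x + z) * (ennreal (1 / fact (Suc n)) * pinned_sum n z (const_path x) G) \<partial>lborel))"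
    proof (rule suminf_cong)
      fix n
      \<comment> \<open>The power of \<open>rate\<close> in the Poisson weight is absorbed by
        \<open>nn_integral_pinned_sum\<close>, leaving only the factorial.\<close>
      have "?p (Suc n) = ennreal (exp (- rate)) * (ennreal (1 / fact (Suc n)) * ennreal (rate ^ Suc n))"
        using rate_pos by (simp add: ennreal_mult[symmetric] mult.commute)
      then have "?p (Suc n) * ?N (Suc n) = ennreal (exp (- rate)) * (ennreal (1 / fact (Suc n)) * (ennreal (rate ^ Suc n) * ?N (Suc n)))"
        by (simp only: mult.assoc)
      also have "ennreal (rate ^ Suc n) * ?N (Suc n) = (\<integral>\<^sup>+z. pinned_sum n z (const_path x) ?G \<partial>lborel)"
        by (rule nn_integral_pinned_sum[OF m const_path_in_space, symmetric])
      also have "\<dots> = (\<integral>\<^sup>+z. g x (x + z) * pinned_sum n z (const_path x) G \<partial>lborel)"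
        by (subst pinned_sum_endpoints[OF G const_path_in_space]) simp
      also have "ennreal (1 / fact (Suc n)) * \<dots> = (\<integral>\<^sup>+z. ennreal (1 / fact (Suc n)) * (g x (x + z) * pinned_sum n z (const_path x) G) \<partial>lborel)"
        by (rule nn_integral_cmult[symmetric, OF borel_measurable_times_ennreal[OF m_g m_pinned]])
      also have "\<dots> = (\<integral>\<^sup>+z. g x (x + z) * (ennreal (1 / fact (Suc n)) * pinned_sum n z (const_path x) G) \<partial>lborel)"
        by (simp only: mult.left_commute)
      finally show "?p (Suc n) * ?N (Suc n) = ennreal (exp (- rate)) * (\<integral>\<^sup>+z. g x (x + z) * (ennreal (1 / fact (Suc n)) * pinned_sum n z (const_path x) G) \<partial>lborel)" .
    qed
    also have "\<dots> = ennreal (exp (- rate)) * (\<integral>\<^sup>+z. g x (x + z) * bridge_sum x z G \<partial>lborel)"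
    proof -
      have "(\<integral>\<^sup>+z. g x (x + z) * bridge_sum x z G \<partial>lborel) = (\<integral>\<^sup>+z. (\<Sum>n. g x (x + z) * (ennreal (1 / fact (Suc n)) * pinned_sum n z (const_path x) G)) \<partial>lborel)"
        by (simp add: bridge_sum_def)
      also have "\<dots> = (\<Sum>n. \<integral>\<^sup>+z. g x (x + z) * (ennreal (1 / fact (Suc n)) * pinned_sum n z (const_path x) G) \<partial>lborel)"
        by (intro nn_integral_suminf borel_measurable_times_ennreal borel_measurable_const m_g m_pinned)
      finally show ?thesis by simp
    qed
    finally show ?thesis by (simp only: distrib_left)
  qed
  have "(\<integral>\<^sup>+\<omega>. ?G \<omega> \<partial>poisson_law \<mu>) = (\<integral>\<^sup>+x. \<integral>\<^sup>+\<omega>. ?G \<omega> \<partial>poisson_path x \<partial>\<mu>)"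
    unfolding poisson_law_def by (rule nn_integral_bind[OF m measurable_prob_algebraD[OF p]])
  then show ?thesis by (simp only: path)
qed

text \<open>The disintegration formula tested with 1, started from the point \<open>x\<close>, shows
  that the mass has a finite integral over \<open>z\<close>.\<close>

lemma AE_bridge_mass_finite: "AE z in lborel. bridge_mass x z < \<infinity>"
proof -
  have r: "prob_space (return borel x)" by (rule prob_space_return) simp
  interpret R: prob_space "poisson_law (return borel x)"
    using poisson_law_prob[OF r] by (simp add: space_prob_algebra)
  let ?h = "\<lambda>x. ennreal (exp (- rate)) * (1 + (\<integral>\<^sup>+z. bridge_mass x z \<partial>lborel))"
  have h: "?h \<in> borel_measurable borel" by measurable
  have "1 = (\<integral>\<^sup>+\<omega>. 1 \<partial>poisson_law (return borel x))" using R.emeasure_space_1 by simp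
  also have "\<dots> = (\<integral>\<^sup>+x. ?h x \<partial>return borel x)"
  proof -
    have "(\<integral>\<^sup>+\<omega>. (\<lambda>\<omega>. 1) \<omega> * (\<lambda>_ _. 1) (\<omega> 0) (\<omega> 1) \<partial>poisson_law (return borel x)) =
      (\<integral>\<^sup>+x. ennreal (exp (- rate)) * ((\<lambda>\<omega>. 1) (const_path x) * (\<lambda>_ _. 1) x x +
        (\<integral>\<^sup>+z. (\<lambda>_ _. 1) x (x + z) * bridge_sum x z (\<lambda>\<omega>. 1) \<partial>lborel)) \<partial>return borel x)"
      by (rule nn_integral_poisson_law[OF r]) simp_all
    then show ?thesis by (simp add: bridge_mass_def)
  qed
  also have "\<dots> = ?h x" by (rule nn_integral_return[OF _ h]) simp
  finally have "?h x < \<infinity>" by simp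
  then have "(\<integral>\<^sup>+z. bridge_mass x z \<partial>lborel) \<noteq> \<infinity>"
    by (auto simp: ennreal_mult_less_top)
  then have "AE z in lborel. bridge_mass x z \<noteq> \<infinity>" by (rule nn_integral_noteq_infinite[rotated]) measurable
  then show ?thesis by (simp add: less_top)
qed

text \<open>The disintegration formula is used twice, for the indicator of \<open>A\<close> and,
  with the kernel placed in the endpoint factor, for the functional 1. The integrands agree because
  the kernel times the mass is \<open>bridge_sum\<close>.\<close>

lemma bridge_family_bridge: "bridge_family jump_measure bridge"
  unfolding bridge_family_def
proof (intro conjI allI impI ballI measurable_bridge)
  fix P A and B :: "(real \<times> real) set"
  assume P: "levy_law jump_measure P" and A [measurable]: "A \<in> sets path_space" and B [measurable]: "B \<in> sets (borel \<Otimes>\<^sub>M borel)"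
  have s: "sets P = sets path_space" and p: "prob_space P"
    using P by (auto simp: levy_law_def space_prob_algebra)
  note [measurable_cong] = s
  interpret P: prob_space P by (rule p)
  have [measurable]: "(\<lambda>\<omega>. \<omega> 0) \<in> borel_measurable path_space" "(\<lambda>\<omega>. \<omega> 1) \<in> borel_measurable path_space"
    by (intro measurable_path_eval measurable_ident; simp)+
  define \<mu> where "\<mu> = distr P borel (\<lambda>\<omega>. \<omega> 0)"
  have \<mu>: "prob_space \<mu>" "sets \<mu> = sets borel" unfolding \<mu>_def by (auto intro: P.prob_space_distr)
  have P_eq: "P = poisson_law \<mu>" unfolding \<mu>_def by (rule levy_law_eq_poisson_law[OF P])
  have em [measurable]: "(\<lambda>p. emeasure (bridge p) A) \<in> borel_measurable (borel \<Otimes>\<^sub>M borel)"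
    by (rule measurable_compose[OF measurable_prob_algebraD[OF measurable_bridge] measurable_emeasure_subprob_algebra[OF A]])
  have AP: "A \<subseteq> space path_space" using A by (rule sets.sets_into_space)
  have "{\<omega> \<in> A. (\<omega> 0, \<omega> 1) \<in> B} = A \<inter> {\<omega> \<in> space path_space. (\<omega> 0, \<omega> 1) \<in> B}" using AP by auto
  also have "\<dots> \<in> sets path_space" by measurable
  finally have [measurable]: "{\<omega> \<in> A. (\<omega> 0, \<omega> 1) \<in> B} \<in> sets path_space" .
  have "emeasure P {\<omega> \<in> A. (\<omega> 0, \<omega> 1) \<in> B} = (\<integral>\<^sup>+\<omega>. indicator {\<omega> \<in> A. (\<omega> 0, \<omega> 1) \<in> B} \<omega> \<partial>P)"
    by (rule nn_integral_indicator[symmetric]) (simp add: s)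
  also have "\<dots> = (\<integral>\<^sup>+\<omega>. indicator A \<omega> * indicator B (\<omega> 0, \<omega> 1) \<partial>P)"
    by (intro nn_integral_cong) (simp add: indicator_def)
  also have "\<dots> = (\<integral>\<^sup>+x. ennreal (exp (- rate)) * (indicator A (const_path x) * indicator B (x, x) +
       (\<integral>\<^sup>+z. indicator B (x, x + z) * bridge_sum x z (indicator A) \<partial>lborel)) \<partial>\<mu>)"
    unfolding P_eq by (rule nn_integral_poisson_law[OF \<mu>]) measurable
  also have "\<dots> = (\<integral>\<^sup>+x. ennreal (exp (- rate)) * (1 * (emeasure (bridge (x, x)) A * indicator B (x, x)) +
       (\<integral>\<^sup>+z. (emeasure (bridge (x, x + z)) A * indicator B (x, x + z)) * bridge_sum x z (\<lambda>\<omega>. 1) \<partial>lborel)) \<partial>\<mu>)"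
  proof (rule nn_integral_cong)
    fix x
    \<comment> \<open>The atom of paths without jumps sits on equal endpoints; there the kernel is
      the point mass at the constant path.\<close>
    have 1: "indicator A (const_path x) * indicator B (x, x) = 1 * (emeasure (bridge (x, x)) A * indicator B (x, x))"
      by (simp add: emeasure_bridge bridge_integral_def)
    have 2: "(\<integral>\<^sup>+z. indicator B (x, x + z) * bridge_sum x z (indicator A) \<partial>lborel) =
      (\<integral>\<^sup>+z. (emeasure (bridge (x, x + z)) A * indicator B (x, x + z)) * bridge_sum x z (\<lambda>\<omega>. 1) \<partial>lborel)"
    proof (rule nn_integral_cong_AE)
      \<comment> \<open>Zero increment and increments of infinite mass, where the kernel is not the
        normalised sum, are Lebesgue null.\<close>
      have "AE z in lborel. z \<noteq> (0::real)" by (rule AE_lborel_singleton)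
      with AE_bridge_mass_finite[of x]
      show "AE z in lborel. indicator B (x, x + z) * bridge_sum x z (indicator A) =
        (emeasure (bridge (x, x + z)) A * indicator B (x, x + z)) * bridge_sum x z (\<lambda>\<omega>. 1)"
      proof eventually_elim
        case (elim z)
        have "bridge_sum x z (indicator A) / bridge_mass x z * bridge_mass x z = bridge_sum x z (indicator A)"
          using elim bridge_mass_pos[of x z] by (simp add: ennreal_divide_times)
        then have eq: "emeasure (bridge (x, x + z)) A * bridge_mass x z = bridge_sum x z (indicator A)"
          using elim by (simp add: emeasure_bridge bridge_integral_def)
        show ?case unfolding eq[symmetric] unfolding bridge_mass_def[symmetric]
          by (simp only: ac_simps)
      qed
    qed
    show "ennreal (exp (- rate)) * (indicator A (const_path x) * indicator B (x, x) +
       (\<integral>\<^sup>+z. indicator B (x, x + z) * bridge_sum x z (indicator A) \<partial>lborel)) =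
      ennreal (exp (- rate)) * (1 * (emeasure (bridge (x, x)) A * indicator B (x, x)) +
       (\<integral>\<^sup>+z. (emeasure (bridge (x, x + z)) A * indicator B (x, x + z)) * bridge_sum x z (\<lambda>\<omega>. 1) \<partial>lborel))"
      by (simp only: 1 2)
  qed
  also have "\<dots> = (\<integral>\<^sup>+\<omega>. 1 * (emeasure (bridge (\<omega> 0, \<omega> 1)) A * indicator B (\<omega> 0, \<omega> 1)) \<partial>P)"
    unfolding P_eq by (rule nn_integral_poisson_law[OF \<mu>, symmetric]) measurable
  also have "\<dots> = (\<integral>\<^sup>+p. emeasure (bridge p) A * indicator B p \<partial>distr P (borel \<Otimes>\<^sub>M borel) (\<lambda>\<omega>. (\<omega> 0, \<omega> 1)))"
  proof (subst nn_integral_distr, goal_cases)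
    case 1
    show ?case by measurable
  next
    case 2
    have "(\<lambda>p. emeasure (bridge p) A * indicator B p) \<in> borel_measurable (borel \<Otimes>\<^sub>M borel)" by measurable
    then show ?case by simp
  qed simp
  finally show "emeasure P {\<omega> \<in> A. (\<omega> 0, \<omega> 1) \<in> B} = (\<integral>\<^sup>+p\<in>B. emeasure (bridge p) A \<partial>distr P (borel \<Otimes>\<^sub>M borel) (\<lambda>\<omega>. (\<omega> 0, \<omega> 1)))" .
qed

text \<open>For one cylinder the two kernels are densities with the same integrals over all endpoint
  sets, so they agree almost everywhere. Countably many cylinders share one null set and determine
  the measures.\<close>

lemma bridge_family_unique:
  assumes K: "bridge_family jump_measure K" and K': "bridge_family jump_measure K'" and P: "levy_law jump_measure P"
  shows "AE \<omega> in P. K' (\<omega> 0, \<omega> 1) = K (\<omega> 0, \<omega> 1)"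
proof -
  have s: "sets P = sets path_space" and p: "prob_space P"
    using P by (auto simp: levy_law_def space_prob_algebra)
  note [measurable_cong] = s
  interpret P: prob_space P by (rule p)
  have [measurable]: "(\<lambda>\<omega>. \<omega> 0) \<in> borel_measurable path_space" "(\<lambda>\<omega>. \<omega> 1) \<in> borel_measurable path_space"
    by (intro measurable_path_eval measurable_ident; simp)+
  let ?D = "distr P (borel \<Otimes>\<^sub>M borel) (\<lambda>\<omega>. (\<omega> 0, \<omega> 1))"
  interpret D: prob_space ?D by (rule P.prob_space_distr) measurable
  have m: "K \<in> borel \<Otimes>\<^sub>M borel \<rightarrow>\<^sub>M prob_algebra path_space" "K' \<in> borel \<Otimes>\<^sub>M borel \<rightarrow>\<^sub>M prob_algebra path_space"
    using K K' by (auto simp: bridge_family_def)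
  have prob: "prob_space (K q)" "sets (K q) = sets path_space" "sets (K' q) = sets path_space" for q
    using m[THEN measurable_space, of q] by (auto simp: space_prob_algebra space_pair_measure)
  have c: "cylinder l \<in> sets path_space" for l by (auto simp: sets_path_space_cylinder)
  have "AE q in ?D. emeasure (K' q) (cylinder l) = emeasure (K q) (cylinder l)" for l
  proof (rule D.density_unique_finite_measure)
    show "(\<lambda>q. emeasure (K' q) (cylinder l)) \<in> borel_measurable ?D" "(\<lambda>q. emeasure (K q) (cylinder l)) \<in> borel_measurable ?D"
      using m[THEN measurable_prob_algebraD, THEN measurable_compose, OF measurable_emeasure_subprob_algebra[OF c]] by simp_all
    fix B assume "B \<in> sets ?D"
    then have B: "B \<in> sets (borel \<Otimes>\<^sub>M borel)" by simp
    show "(\<integral>\<^sup>+q. emeasure (K' q) (cylinder l) * indicator B q \<partial>?D) = (\<integral>\<^sup>+q. emeasure (K q) (cylinder l) * indicator B q \<partial>?D)"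
    proof -
      have "emeasure P {\<omega> \<in> cylinder l. (\<omega> 0, \<omega> 1) \<in> B} = (\<integral>\<^sup>+q\<in>B. emeasure (k q) (cylinder l) \<partial>?D)" if "bridge_family jump_measure k" for k
        using that P B c[of l] unfolding bridge_family_def by simp
      from this[OF K] this[OF K'] show ?thesis by simp
    qed
  qed simp_all
  then have "AE q in ?D. \<forall>l. emeasure (K' q) (cylinder l) = emeasure (K q) (cylinder l)"
    by (simp add: AE_all_countable)
  then have "AE q in ?D. K' q = K q"
  proof (rule AE_mp, intro AE_I2 impI)
    fix q assume eq: "\<forall>l. emeasure (K' q) (cylinder l) = emeasure (K q) (cylinder l)"
    interpret Kq: prob_space "K q" by (rule prob)
    have "K q = K' q"
      by (rule path_measure_eqI) (use eq prob in \<open>auto intro: Kq.finite_measure_axioms\<close>)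
    then show "K' q = K q" ..
  qed
  then show ?thesis by (rule AE_distrD[rotated]) measurable
qed

end

section \<open>Conditioning on a null event\<close>

lemma uniform_measure_null:
  assumes "AE \<omega> in Q. \<omega> \<notin> J"
  shows "uniform_measure Q J = measure_of (space Q) (sets Q) (\<lambda>_. 0)"
  unfolding uniform_measure_def density_def
proof (rule measure_of_eq[OF sets.space_closed])
  fix A
  have "(\<integral>\<^sup>+x. indicator J x / emeasure Q J * indicator A x \<partial>Q) = (\<integral>\<^sup>+x. 0 \<partial>Q)"
    by (rule nn_integral_cong_AE) (use assms in eventually_elim, simp)
  then show "(\<integral>\<^sup>+x. indicator J x / emeasure Q J * indicator A x \<partial>Q) = 0" by simp
qed

text \<open>Measurability of the intersection is not assumed: on a non-measurable set
  \<open>emeasure\<close> is 0 by convention.\<close>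

lemma emeasure_Int_null:
  assumes "AE \<omega> in Q. \<omega> \<notin> J"
  shows "emeasure Q (A \<inter> J) = 0"
proof (cases "A \<inter> J \<in> sets Q")
  case True
  have "emeasure Q (A \<inter> J) = (\<integral>\<^sup>+\<omega>. indicator (A \<inter> J) \<omega> \<partial>Q)" using True by simp
  also have "\<dots> = (\<integral>\<^sup>+\<omega>. 0 \<partial>Q)" by (rule nn_integral_cong_AE) (use assms in eventually_elim, simp)
  finally show ?thesis by simp
qed (rule emeasure_notin_sets)

text \<open>A regular version of the conditional laws is determined only up to null sets of
  endpoints, whereas (a), (b) and (c) concern all endpoints. Hence one version with these properties
  is exhibited, and every other version agrees with it almost surely under each Levy law.\<close>

theorem theorem3p5:
  fixes \<nu> :: "real measure" and f :: "real \<Rightarrow> real"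
  assumes "finite_measure \<nu>"
    and "f \<in> borel_measurable borel" and "\<And>x. f x > 0"
    and "\<nu> = density lborel (\<lambda>x. ennreal (f x))"
  shows "\<exists>\<kappa>. bridge_family \<nu> \<kappa> \<and>
    (\<forall>\<kappa>'. bridge_family \<nu> \<kappa>' \<longrightarrow>
       (\<forall>P. levy_law \<nu> P \<longrightarrow> (AE \<omega> in P. \<kappa>' (\<omega> 0, \<omega> 1) = \<kappa> (\<omega> 0, \<omega> 1)))) \<and>
    (\<forall>x y. splitting_identity f (\<kappa> (x, y))) \<and>
    (\<forall>x y Q. x \<noteq> y \<longrightarrow> pinned_pure_jump Q x y \<longrightarrow> splitting_identity f Q \<longrightarrow> Q = \<kappa> (x, y)) \<and>
    (\<forall>x Q. pinned_pure_jump Q x x \<longrightarrow> splitting_identity f Q \<longrightarrow>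
       uniform_measure Q jumping_paths = uniform_measure (\<kappa> (x, x)) jumping_paths \<and>
       (\<forall>A\<in>sets path_space. emeasure Q (A \<inter> jumping_paths) = emeasure (\<kappa> (x, x)) (A \<inter> jumping_paths)))"
proof -
  interpret jump_density f
  proof
    show "(\<integral>\<^sup>+x. ennreal (f x) \<partial>lborel) < \<infinity>"
      using finite_measure.emeasure_finite[OF assms(1), of UNIV] assms(2,4)
      by (simp add: emeasure_density less_top)
  qed (fact assms)+
  \<comment> \<open>Neither \<open>Q\<close> nor the bridge charges jumping paths, so the
    conditioned laws in (c) both degenerate to the zero measure under the convention of
    \<open>uniform_measure\<close>; the equality of the restrictions is stated in addition.\<close>
  have loop: "uniform_measure Q jumping_paths = uniform_measure (bridge (x, x)) jumping_paths \<and>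
       (\<forall>A\<in>sets path_space. emeasure Q (A \<inter> jumping_paths) = emeasure (bridge (x, x)) (A \<inter> jumping_paths))"
    if Q: "pinned_pure_jump Q x x" "splitting_identity f Q" for x Q
  proof -
    have Qn: "AE \<omega> in Q. \<omega> \<notin> jumping_paths"
      using loop_constant[OF Q] by eventually_elim (simp add: jumping_paths_def)
    have eq: "bridge (x, x) = return path_space (const_path x)" by (rule bridge_eq_return) simp
    have Bn: "AE \<omega> in bridge (x, x). \<omega> \<notin> jumping_paths"
    proof -
      have "AE \<omega> in return path_space (const_path x). num_jumps \<omega> = of_nat 0"
        by (subst AE_return) (simp_all add: num_jumps_def)
      then show ?thesis unfolding eq
        by eventually_elim (auto simp: num_jumps_eq_of_nat jumping_paths_def simp del: of_nat_0)
    qed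
    have "sets Q = sets path_space" using pinned_pure_jumpD(1)[OF Q(1)] .
    moreover from this have "space Q = space (bridge (x, x))" using sets_eq_imp_space_eq[of Q "bridge (x, x)"] by simp
    ultimately show ?thesis
      using uniform_measure_null[OF Qn] uniform_measure_null[OF Bn] emeasure_Int_null[OF Qn] emeasure_Int_null[OF Bn] by simp
  qed
  show ?thesis
    unfolding assms(4)
    using bridge_family_bridge bridge_family_unique[OF bridge_family_bridge] splitting_identity_bridge pinned_unique loop
    by (intro exI[of _ bridge]) blast
qed

end
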